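(* Let $T:=[T_1,\ldots,T_n]$, $T_i\in B(\mathcal H)$, be a commutative row contraction (i.e. $T_iT_j=T_jT_i$ for all $i,j$) with $\mathrm{rank}\,\Delta_T<\infty$, and let $K(T)$ and $\chi(T)$ denote Arveson's curvature and Euler characteristic, respectively. Then $$K(T)=\int_{\partial\mathbb B_n}\lim_{r\to1}\mathrm{trace}\,[I-\Theta_{J_c,T}(r\xi)\Theta_{J_c,T}(r\xi)^*]\,d\sigma(\xi)$$ $$=\mathrm{rank}\,\Delta_T-(n-1)!\lim_{m\to\infty}\frac{\mathrm{trace}\,[\Theta_{J_c,T}\Theta_{J_c,T}^*(Q_m\otimes I_{\mathcal D_T})]}{m^{n-1}},$$ where $Q_m$ is the projection of $H^2$ onto the subspace of homogeneous polynomials of degree $m$, and $$\chi(T)=n!\lim_{m\to\infty}\frac{\mathrm{rank}\left[(I-\Theta_{J_c,T}\Theta_{J_c,T}^* )(Q_{\le m}\otimes I_{\mathcal D_T})\right]}{m^n},$$ where $Q_{\le m}$ is the projection of $H^2$ onto the subspace of all polynomials of degree $\le m$.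
   Context: $\mathbb B_n$ is the open unit ball of $\mathbb C^n$, $\sigma$ the rotation-invariant probability measure on the sphere $\partial\mathbb B_n$. $H^2$ (Arveson's space, identified with the symmetric Fock space) is the reproducing kernel Hilbert space of analytic functions on $\mathbb B_n$ with kernel $K_n(z,w)=\frac1{1-\langle z,w\rangle}$. $T$, viewed as an operator $\mathcal H^{(n)}\to\mathcal H$ ($\mathcal H^{(n)}$ the direct sum of $n$ copies of $\mathcal H$), is a row contraction if $TT^*=\sum_iT_iT_i^*\le I$. $\Delta_T=(I-TT^* )^{1/2}$, $\Delta_{T^*}=(I-T^*T)^{1/2}\in B(\mathcal H^{(n)})$, $\mathcal D_T=\overline{\Delta_T\mathcal H}$, $\mathcal D_{T^*}=\overline{\Delta_{T^*}\mathcal H^{(n)}}$. The constrained characteristic function of the commutative row contraction $T$ is the multiplication operator $\Theta_{J_c,T}:H^2\otimes\mathcal D_{T^*}\to H^2\otimes\mathcal D_T$ whose symbol, denoted by the same letter, is the bounded $B(\mathcal D_{T^*},\mathcal D_T)$-valued analytic function $$\Theta_{J_c,T}(z)=-T+\Delta_T(I-z_1T_1^*-\cdots-z_nT_n^* )^{-1}[z_1I_{\mathcal H},\dots,z_nI_{\mathcal H}]\Delta_{T^*},\quad z\in\mathbb B_n.$$ In the first formula, $I=I_{\mathcal D_T}$ and the trace is that of operators on the finite-dimensional space $\mathcal D_T$. Arveson's curvature is $$K(T)=\int_{\partial\mathbb B_n}\lim_{r\to1}(1-r^2)\,\mathrm{trace}\Big[\Delta_T\Big(I-\sum_ir\xi_iT_i^*\Big)^{-1}\Big(I-\sum_ir\bar\xi_iT_i\Big)^{-1}\Delta_T\Big|_{\mathcal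 D_T}\Big]d\sigma(\xi),$$ the limit existing for $\sigma$-almost every $\xi$. Arveson's Euler characteristic $\chi(T)$ is the Euler characteristic $\sum_{k\ge1}(-1)^{k+1}\mathrm{rank}F_k$ of the finitely generated $\mathbb C[z_1,\dots,z_n]$-module $\mathrm{span}\{p(T_1,\dots,T_n)\Delta_Th:\ p\in\mathbb C[z_1,\dots,z_n],\,h\in\mathcal H\}$, computed from a finite free resolution $0\to F_N\to\cdots\to F_1\to M\to0$ of it; Arveson proved that, with $\Phi_T(X)=\sum_iT_iXT_i^*$, it is given by $\chi(T)=n!\lim_{m\to\infty}\mathrm{rank}[I-\Phi_T^{m+1}(I)]/m^n$. *)

theory Defs
  imports "HOL-Analysis.Analysis" "HOL-Library.Poly_Mapping"
begin

section \<open>Complex Hilbert spaces\<close>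

text \<open>The inner product is linear in the first argument. The real inner product space structure
  inherited from \<open>real_inner\<close> is that of the underlying real space.\<close>

class complex_inner = real_inner +
  fixes scaleC :: "complex \<Rightarrow> 'a \<Rightarrow> 'a"  (infixr \<open>*\<^sub>C\<close> 75)
    and cinner :: "'a \<Rightarrow> 'a \<Rightarrow> complex"
  assumes scaleC_add_right: "a *\<^sub>C (x + y) = a *\<^sub>C x + a *\<^sub>C y"
    and scaleC_add_left: "(a + b) *\<^sub>C x = a *\<^sub>C x + b *\<^sub>C x"
    and scaleC_scaleC: "a *\<^sub>C (b *\<^sub>C x) = (a * b) *\<^sub>C x"
    and scaleC_one: "1 *\<^sub>C x = x"
    and scaleR_scaleC: "r *\<^sub>R x = complex_of_real r *\<^sub>C x"
    and cinner_commute: "cinner x y = cnj (cinner y x)"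
    and cinner_add_left: "cinner (x + y) z = cinner x z + cinner y z"
    and cinner_scaleC_left: "cinner (a *\<^sub>C x) y = a * cinner x y"
    and inner_cinner: "inner x y = Re (cinner x y)"

class chilbert_space = complex_inner + complete_space

subclass (in chilbert_space) banach ..

global_interpretation complex_vector: vector_space "scaleC :: complex \<Rightarrow> 'a \<Rightarrow> 'a::complex_inner"
  by unfold_locales (simp_all add: scaleC_add_right scaleC_add_left scaleC_scaleC scaleC_one)

lemma cinner_add_right: "cinner x (y + z) = cinner x y + cinner x z"
  by (metis cinner_add_left cinner_commute complex_cnj_add)

lemma cinner_scaleC_right: "cinner x (a *\<^sub>C y) = cnj a * cinner x y"
  by (metis cinner_scaleC_left cinner_commute complex_cnj_mult)

lemma cinner_same: "cinner x x = complex_of_real ((norm x)\<^sup>2)"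
proof -
  have "Im (cinner x x) = 0"
    by (metis cinner_commute complex_cnj Im_complex_of_real complex_is_Real_iff
        Reals_cnj_iff)
  moreover have "Re (cinner x x) = (norm x)\<^sup>2"
    by (metis inner_cinner power2_norm_eq_inner)
  ultimately show ?thesis by (simp add: complex_eq_iff)
qed

lemma norm_scaleC: "norm (a *\<^sub>C x) = cmod a * norm x"
proof -
  have "complex_of_real ((norm (a *\<^sub>C x))\<^sup>2) = a * cnj a * cinner x x"
    by (simp only: cinner_same[symmetric] cinner_scaleC_left cinner_scaleC_right mult_ac)
  also have "\<dots> = complex_of_real ((cmod a * norm x)\<^sup>2)"
    by (simp add: cinner_same complex_norm_square[symmetric] power_mult_distrib)
  finally have "(norm (a *\<^sub>C x))\<^sup>2 = (cmod a * norm x)\<^sup>2"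
    using of_real_eq_iff by blast
  then show ?thesis
    by (simp add: power2_eq_iff_nonneg)
qed

lemma cinner_Cauchy_Schwarz: "cmod (cinner x y) \<le> norm x * norm y"
proof -
  define c where "c = cnj (sgn (cinner x y))"
  have "cinner (c *\<^sub>C x) y = complex_of_real (cmod (cinner x y))"
    unfolding c_def cinner_scaleC_left
    by (cases "cinner x y = 0")
       (simp_all add: sgn_div_norm scaleR_conv_of_real field_simps power2_eq_square
          complex_norm_square[symmetric] mult.commute flip: of_real_mult)
  then have "cmod (cinner x y) = inner (c *\<^sub>C x) y"
    by (simp add: inner_cinner)
  also have "\<dots> \<le> norm (c *\<^sub>C x) * norm y"
    by (rule norm_cauchy_schwarz)
  also have "\<dots> \<le> norm x * norm y"
    unfolding norm_scaleC c_def
    by (intro mult_right_mono) (auto simp: norm_sgn mult_left_le_one_le)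
  finally show ?thesis .
qed

instantiation complex :: chilbert_space
begin
definition "scaleC_complex = ((*) :: complex \<Rightarrow> complex \<Rightarrow> complex)"
definition "cinner_complex x y = x * cnj y" for x y :: complex
instance
  by standard
     (simp_all add: scaleC_complex_def cinner_complex_def algebra_simps scaleR_conv_of_real
        inner_complex_def)
end

instantiation vec :: (complex_inner, finite) complex_inner
begin
definition "scaleC_vec c x = (\<chi> i. c *\<^sub>C (x $ i))" for x :: "'a ^ 'b"
definition "cinner_vec x y = (\<Sum>i\<in>UNIV. cinner (x $ i) (y $ i))" for x y :: "'a ^ 'b"
instance
proof
  fix a b :: complex and r :: real and x y z :: "'a ^ 'b"
  show "a *\<^sub>C (x + y) = a *\<^sub>C x + a *\<^sub>C y" "(a + b) *\<^sub>C x = a *\<^sub>C x + b *\<^sub>C x"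
    "a *\<^sub>C (b *\<^sub>C x) = (a * b) *\<^sub>C x" "1 *\<^sub>C x = x" "r *\<^sub>R x = complex_of_real r *\<^sub>C x"
    by (simp_all add: vec_eq_iff scaleC_vec_def scaleC_add_right scaleC_add_left scaleC_scaleC
        scaleC_one scaleR_scaleC)
  show "cinner x y = cnj (cinner y x)"
    by (simp add: cinner_vec_def flip: cinner_commute)
  show "cinner (x + y) z = cinner x z + cinner y z" "cinner (a *\<^sub>C x) y = a * cinner x y"
    by (simp_all add: cinner_vec_def scaleC_vec_def cinner_add_left cinner_scaleC_left
        sum.distrib sum_distrib_left)
  show "inner x y = Re (cinner x y)"
    by (simp add: cinner_vec_def inner_vec_def inner_cinner)
qed
end

instance vec :: (chilbert_space, finite) chilbert_space ..


section \<open>Operators\<close>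

definition bounded_clinear :: "('a::complex_inner \<Rightarrow> 'b::complex_inner) \<Rightarrow> bool" where
  "bounded_clinear A \<longleftrightarrow> bounded_linear A \<and> (\<forall>c x. A (c *\<^sub>C x) = c *\<^sub>C A x)"

text \<open>Adjoint of \<open>A : V \<rightarrow> W\<close>, for a closed subspace \<open>V\<close> of the ambient space; applied only to
  elements of \<open>W\<close>, so that \<open>W\<close> need not be mentioned.\<close>

definition adjoint_on ::
    "'a::complex_inner set \<Rightarrow> ('a \<Rightarrow> 'b::complex_inner) \<Rightarrow> 'b \<Rightarrow> 'a" where
  "adjoint_on V A y = (THE x. x \<in> V \<and> (\<forall>v\<in>V. cinner (A v) y = cinner v x))"

abbreviation cadjoint :: "('a::complex_inner \<Rightarrow> 'b::complex_inner) \<Rightarrow> 'b \<Rightarrow> 'a" where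
  "cadjoint \<equiv> adjoint_on UNIV"

definition positive_op :: "('a::complex_inner \<Rightarrow> 'a) \<Rightarrow> bool" where
  "positive_op A \<longleftrightarrow> bounded_clinear A \<and> (\<forall>x. cinner (A x) x \<in> \<real> \<and> 0 \<le> Re (cinner (A x) x))"

definition sqrt_op :: "('a::complex_inner \<Rightarrow> 'a) \<Rightarrow> 'a \<Rightarrow> 'a" where
  "sqrt_op A = (THE B. positive_op B \<and> B \<circ> B = A)"

definition orthonormal_basis_of :: "'a::complex_inner set \<Rightarrow> 'a set \<Rightarrow> bool" where
  "orthonormal_basis_of V B \<longleftrightarrow>
     B \<subseteq> V \<and> (\<forall>b\<in>B. \<forall>c\<in>B. cinner b c = (if b = c then 1 else 0)) \<and>
     V \<subseteq> closure (complex_vector.span B)"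

definition trace_on :: "'a::complex_inner set \<Rightarrow> ('a \<Rightarrow> 'a) \<Rightarrow> complex" where
  "trace_on V A = (\<Sum>\<^sub>\<infinity>e\<in>(SOME B. orthonormal_basis_of V B). cinner (A e) e)"

definition finite_dim :: "'a::complex_inner set \<Rightarrow> bool" where
  "finite_dim V \<longleftrightarrow> (\<exists>B. finite B \<and> V \<subseteq> complex_vector.span B)"

text \<open>Only meaningful when \<open>A ` V\<close> is finite-dimensional.\<close>

definition rank_on :: "'a::complex_inner set \<Rightarrow> ('a \<Rightarrow> 'b::complex_inner) \<Rightarrow> nat" where
  "rank_on V A = complex_vector.dim (A ` V)"

definition orth_proj :: "'a::complex_inner set \<Rightarrow> 'a \<Rightarrow> 'a" where
  "orth_proj V x = (THE p. p \<in> V \<and> (\<forall>v\<in>V. cinner (x - p) v = 0))"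


section \<open>Arveson's space with values in a Hilbert space\<close>

type_synonym 'n multi_index = "'n \<Rightarrow>\<^sub>0 nat"

definition mdeg :: "'n::finite multi_index \<Rightarrow> nat" where
  "mdeg \<alpha> = (\<Sum>i\<in>UNIV. Poly_Mapping.lookup \<alpha> i)"

definition mpow :: "complex ^ 'n::finite \<Rightarrow> 'n multi_index \<Rightarrow> complex" where
  "mpow z \<alpha> = (\<Prod>i\<in>UNIV. (z $ i) ^ Poly_Mapping.lookup \<alpha> i)"

text \<open>The squared norm of the monomial \<open>z\<^sup>\<alpha>\<close> in the symmetric Fock space.\<close>

definition mweight :: "'n::finite multi_index \<Rightarrow> real" where
  "mweight \<alpha> = (\<Prod>i\<in>UNIV. fact (Poly_Mapping.lookup \<alpha> i)) / fact (mdeg \<alpha>)"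

lemma mweight_pos: "mweight \<alpha> > 0"
  unfolding mweight_def by (intro divide_pos_pos prod_pos) auto

text \<open>The space \<open>H\<^sup>2 \<otimes> E\<close>, an element being given by its Taylor coefficients in \<open>E\<close>.
  By \<open>arv_kernel_reproducing\<close> and \<open>arv_eval_kernel\<close> below (and since a power series is determined
  by its sum), \<open>arv_eval\<close> identifies it with the
  reproducing kernel Hilbert space of \<open>E\<close>-valued functions on the unit ball with kernel
  \<open>1 / (1 - \<langle>z, w\<rangle>) I\<^sub>E\<close>.\<close>

typedef (overloaded) ('n::finite, 'e::complex_inner) arveson =
  "{f :: 'n multi_index \<Rightarrow> 'e. (\<lambda>\<alpha>. mweight \<alpha> * (norm (f \<alpha>))\<^sup>2) summable_on UNIV}"
  morphisms coeff_arv Abs_arv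
  by (rule exI[of _ "\<lambda>_. 0"]) auto

setup_lifting type_definition_arveson

lemma coeff_arv_summable: "(\<lambda>\<alpha>. mweight \<alpha> * (norm (coeff_arv f \<alpha>))\<^sup>2) summable_on UNIV"
  using coeff_arv by blast

lemma mweight_summable_add:
  fixes f g :: "'n::finite multi_index \<Rightarrow> 'e::complex_inner"
  assumes "(\<lambda>\<alpha>. mweight \<alpha> * (norm (f \<alpha>))\<^sup>2) summable_on UNIV"
    and "(\<lambda>\<alpha>. mweight \<alpha> * (norm (g \<alpha>))\<^sup>2) summable_on UNIV"
  shows "(\<lambda>\<alpha>. mweight \<alpha> * (norm (f \<alpha> + g \<alpha>))\<^sup>2) summable_on UNIV"
proof (rule summable_on_comparison_test)
  show "(\<lambda>\<alpha>. 2 * (mweight \<alpha> * (norm (f \<alpha>))\<^sup>2 + mweight \<alpha> * (norm (g \<alpha>))\<^sup>2)) summable_on UNIV"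
    by (intro summable_on_cmult_right summable_on_add assms)
  fix \<alpha> :: "'n multi_index"
  have "(norm (f \<alpha> + g \<alpha>))\<^sup>2 \<le> (norm (f \<alpha>) + norm (g \<alpha>))\<^sup>2"
    by (intro power_mono norm_triangle_ineq) auto
  also have "\<dots> \<le> 2 * ((norm (f \<alpha>))\<^sup>2 + (norm (g \<alpha>))\<^sup>2)"
    using sum_squares_bound[of "norm (f \<alpha>)" "norm (g \<alpha>)"] by (simp add: power2_sum)
  finally show "mweight \<alpha> * (norm (f \<alpha> + g \<alpha>))\<^sup>2
      \<le> 2 * (mweight \<alpha> * (norm (f \<alpha>))\<^sup>2 + mweight \<alpha> * (norm (g \<alpha>))\<^sup>2)"
    using mult_left_mono[OF _ less_imp_le[OF mweight_pos[of \<alpha>]]]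
    by (metis (no_types, lifting) distrib_left mult.left_commute)
qed (simp add: less_imp_le[OF mweight_pos])

lemma mweight_summable_scaleC:
  assumes "(\<lambda>\<alpha>. mweight \<alpha> * (norm (f \<alpha>))\<^sup>2) summable_on UNIV"
  shows "(\<lambda>\<alpha>. mweight \<alpha> * (norm (c *\<^sub>C f \<alpha>))\<^sup>2) summable_on UNIV"
  using summable_on_cmult_right[OF assms, of "(cmod c)\<^sup>2"]
  by (simp add: norm_scaleC power_mult_distrib mult_ac)

lemma mweight_cinner_summable:
  fixes f g :: "('n::finite, 'e::complex_inner) arveson"
  shows "(\<lambda>\<alpha>. of_real (mweight \<alpha>) * cinner (coeff_arv f \<alpha>) (coeff_arv g \<alpha>)) summable_on UNIV"
proof (rule Infinite_Sum.abs_summable_summable, rule Infinite_Sum.abs_summable_on_comparison_test')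
  show "(\<lambda>\<alpha>. mweight \<alpha> * (norm (coeff_arv f \<alpha>))\<^sup>2 + mweight \<alpha> * (norm (coeff_arv g \<alpha>))\<^sup>2)
      summable_on UNIV"
    by (intro summable_on_add coeff_arv_summable)
  fix \<alpha> :: "'n multi_index"
  let ?a = "norm (coeff_arv f \<alpha>)" and ?b = "norm (coeff_arv g \<alpha>)"
  have "cmod (cinner (coeff_arv f \<alpha>) (coeff_arv g \<alpha>)) \<le> ?a * ?b"
    by (rule cinner_Cauchy_Schwarz)
  also have "\<dots> \<le> ?a\<^sup>2 + ?b\<^sup>2"
  proof -
    have "2 * (?a * ?b) \<le> ?a\<^sup>2 + ?b\<^sup>2"
      using sum_squares_bound[of ?a ?b] by (simp add: mult.assoc)
    moreover have "0 \<le> ?a * ?b" by simp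
    ultimately show ?thesis by linarith
  qed
  finally show "cmod (of_real (mweight \<alpha>) * cinner (coeff_arv f \<alpha>) (coeff_arv g \<alpha>))
      \<le> mweight \<alpha> * ?a\<^sup>2 + mweight \<alpha> * ?b\<^sup>2"
    using mweight_pos[of \<alpha>] by (simp add: norm_mult flip: distrib_left)
qed

instantiation arveson :: (finite, complex_inner) complex_inner
begin

lift_definition zero_arveson :: "('a, 'b) arveson" is "\<lambda>_. 0" by simp
lift_definition plus_arveson :: "('a, 'b) arveson \<Rightarrow> ('a, 'b) arveson \<Rightarrow> ('a, 'b) arveson"
  is "\<lambda>f g \<alpha>. f \<alpha> + g \<alpha>" by (rule mweight_summable_add)
lift_definition uminus_arveson :: "('a, 'b) arveson \<Rightarrow> ('a, 'b) arveson"
  is "\<lambda>f \<alpha>. - f \<alpha>" by simp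
definition minus_arveson :: "('a, 'b) arveson \<Rightarrow> ('a, 'b) arveson \<Rightarrow> ('a, 'b) arveson" where
  "minus_arveson f g = f + (- g)"
lift_definition scaleC_arveson :: "complex \<Rightarrow> ('a, 'b) arveson \<Rightarrow> ('a, 'b) arveson"
  is "\<lambda>c f \<alpha>. c *\<^sub>C f \<alpha>" by (rule mweight_summable_scaleC)
definition scaleR_arveson :: "real \<Rightarrow> ('a, 'b) arveson \<Rightarrow> ('a, 'b) arveson" where
  "scaleR_arveson r f = complex_of_real r *\<^sub>C f"
definition cinner_arveson :: "('a, 'b) arveson \<Rightarrow> ('a, 'b) arveson \<Rightarrow> complex" where
  "cinner_arveson f g =
     (\<Sum>\<^sub>\<infinity>\<alpha>. of_real (mweight \<alpha>) * cinner (coeff_arv f \<alpha>) (coeff_arv g \<alpha>))"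
definition inner_arveson :: "('a, 'b) arveson \<Rightarrow> ('a, 'b) arveson \<Rightarrow> real" where
  "inner_arveson f g = Re (cinner f g)"
definition norm_arveson :: "('a, 'b) arveson \<Rightarrow> real" where
  "norm_arveson f = sqrt (inner f f)"
definition sgn_arveson :: "('a, 'b) arveson \<Rightarrow> ('a, 'b) arveson" where
  "sgn_arveson f = inverse (norm f) *\<^sub>R f"
definition dist_arveson :: "('a, 'b) arveson \<Rightarrow> ('a, 'b) arveson \<Rightarrow> real" where
  "dist_arveson f g = norm (f - g)"
definition uniformity_arveson :: "(('a, 'b) arveson \<times> ('a, 'b) arveson) filter" where
  "uniformity_arveson = (INF e\<in>{0<..}. principal {(x, y). dist x y < e})"
definition open_arveson :: "('a, 'b) arveson set \<Rightarrow> bool" where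
  "open_arveson U \<longleftrightarrow> (\<forall>x\<in>U. \<forall>\<^sub>F (x', y) in uniformity. x' = x \<longrightarrow> y \<in> U)"

lemma inner_arveson_same:
  "inner f f = (\<Sum>\<^sub>\<infinity>\<alpha>. mweight \<alpha> * (norm (coeff_arv f \<alpha>))\<^sup>2)" for f :: "('a, 'b) arveson"
proof -
  have "inner f f = (\<Sum>\<^sub>\<infinity>\<alpha>. Re (of_real (mweight \<alpha>) * cinner (coeff_arv f \<alpha>) (coeff_arv f \<alpha>)))"
    unfolding inner_arveson_def cinner_arveson_def
    by (rule infsum_Re[symmetric]) (rule mweight_cinner_summable)
  also have "\<dots> = (\<Sum>\<^sub>\<infinity>\<alpha>. mweight \<alpha> * (norm (coeff_arv f \<alpha>))\<^sup>2)"
    unfolding cinner_same of_real_mult[symmetric] Re_complex_of_real ..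
  finally show ?thesis .
qed

instance
proof
  fix a b :: complex and r s :: real and x y z :: "('a, 'b) arveson"
  show "x + y + z = x + (y + z)" "x + y = y + x" "0 + x = x" "- x + x = 0"
    by (transfer; simp add: fun_eq_iff algebra_simps)+
  show "x - y = x + - y" by (simp add: minus_arveson_def)
  show C: "a *\<^sub>C (x + y) = a *\<^sub>C x + a *\<^sub>C y" "(a + b) *\<^sub>C x = a *\<^sub>C x + b *\<^sub>C x"
     "a *\<^sub>C (b *\<^sub>C x) = (a * b) *\<^sub>C x" "1 *\<^sub>C x = x" for a b and x y :: "('a, 'b) arveson"
    by (transfer; simp add: fun_eq_iff scaleC_add_right scaleC_add_left scaleC_scaleC scaleC_one)+
  show "r *\<^sub>R (x + y) = r *\<^sub>R x + r *\<^sub>R y" "(r + s) *\<^sub>R x = r *\<^sub>R x + s *\<^sub>R x"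
     "r *\<^sub>R s *\<^sub>R x = (r * s) *\<^sub>R x" "1 *\<^sub>R x = x" "r *\<^sub>R x = complex_of_real r *\<^sub>C x"
    by (simp_all add: scaleR_arveson_def C)
  show cc: "cinner x y = cnj (cinner y x)" for x y :: "('a, 'b) arveson"
    unfolding cinner_arveson_def infsum_cnj[symmetric]
    by (rule infsum_cong) (simp flip: cinner_commute)
  show cadd: "cinner (x + y) z = cinner x z + cinner y z"
    unfolding cinner_arveson_def
    by (subst infsum_add[symmetric])
       (auto intro!: infsum_cong mweight_cinner_summable
         simp: plus_arveson.rep_eq cinner_add_left distrib_left)
  show csc: "cinner (a *\<^sub>C x) y = a * cinner x y" for a
    unfolding cinner_arveson_def
    by (subst infsum_cmult_right'[symmetric])
       (auto intro!: infsum_cong simp: scaleC_arveson.rep_eq cinner_scaleC_left)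
  show "inner x y = Re (cinner x y)" by (simp add: inner_arveson_def)
  show "inner x y = inner y x"
    unfolding inner_arveson_def by (subst cc) simp
  show "inner (x + y) z = inner x z + inner y z" by (simp add: inner_arveson_def cadd)
  show "inner (r *\<^sub>R x) y = r * inner x y"
    by (simp add: inner_arveson_def scaleR_arveson_def csc)
  show "0 \<le> inner x x"
    unfolding inner_arveson_same
    by (intro infsum_nonneg) (simp add: less_imp_le[OF mweight_pos])
  show "inner x x = 0 \<longleftrightarrow> x = 0"
  proof
    assume *: "inner x x = 0"
    have "coeff_arv x \<alpha> = 0" for \<alpha>
    proof -
      have "mweight \<alpha> * (norm (coeff_arv x \<alpha>))\<^sup>2 = 0"
        by (rule nonneg_infsum_le_0D[of _ UNIV])
           (use * in \<open>auto simp: inner_arveson_same coeff_arv_summable less_imp_le[OF mweight_pos]\<close>)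
      then show ?thesis
        using mweight_pos[of \<alpha>] by simp
    qed
    then show "x = 0" by (simp add: coeff_arv_inject[symmetric] zero_arveson.rep_eq fun_eq_iff)
  qed (simp add: inner_arveson_same zero_arveson.rep_eq)
  show "norm x = sqrt (inner x x)" by (rule norm_arveson_def)
  show "sgn x = inverse (norm x) *\<^sub>R x" by (rule sgn_arveson_def)
  show "dist x y = norm (x - y)" by (rule dist_arveson_def)
  show "uniformity = (INF e\<in>{0<..}. principal {(x :: ('a, 'b) arveson, y). dist x y < e})"
    by (rule uniformity_arveson_def)
  show "open U \<longleftrightarrow> (\<forall>x\<in>U. \<forall>\<^sub>F (x', y) in uniformity. x' = x \<longrightarrow> y \<in> U)"
    for U :: "('a, 'b) arveson set"
    by (rule open_arveson_def)
qed

end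

lemma norm_arveson_square:
  "(norm f)\<^sup>2 = (\<Sum>\<^sub>\<infinity>\<alpha>. mweight \<alpha> * (norm (coeff_arv f \<alpha>))\<^sup>2)"
  by (simp add: power2_norm_eq_inner inner_arveson_same)

lemma coeff_arv_diff: "coeff_arv (f - g) \<alpha> = coeff_arv f \<alpha> - coeff_arv g \<alpha>"
  unfolding minus_arveson_def plus_arveson.rep_eq uminus_arveson.rep_eq by simp

lemma sum_le_norm_arveson:
  assumes "finite F"
  shows "(\<Sum>\<alpha>\<in>F. mweight \<alpha> * (norm (coeff_arv f \<alpha>))\<^sup>2) \<le> (norm f)\<^sup>2"
  unfolding norm_arveson_square using assms
  by (intro finite_sum_le_infsum) (auto simp: coeff_arv_summable less_imp_le[OF mweight_pos])

instance arveson :: (finite, chilbert_space) chilbert_space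
proof
  fix X :: "nat \<Rightarrow> ('a, 'b) arveson"
  assume X: "Cauchy X"
  have "Cauchy (\<lambda>k. coeff_arv (X k) \<alpha>)" for \<alpha>
  proof (rule metric_CauchyI)
    fix e :: real assume e: "e > 0"
    define w where "w = sqrt (mweight \<alpha>)"
    have w: "w > 0" by (simp add: w_def mweight_pos)
    from e w have "e * w > 0" by simp
    then obtain N where N: "\<And>m n. m \<ge> N \<Longrightarrow> n \<ge> N \<Longrightarrow> dist (X m) (X n) < e * w"
      using metric_CauchyD[OF X, of "e * w"] by auto
    have "dist (coeff_arv (X m) \<alpha>) (coeff_arv (X n) \<alpha>) < e" if "m \<ge> N" "n \<ge> N" for m n
    proof -
      have "(w * norm (coeff_arv (X m - X n) \<alpha>))\<^sup>2 \<le> (norm (X m - X n))\<^sup>2"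
        using sum_le_norm_arveson[of "{\<alpha>}" "X m - X n"] mweight_pos[of \<alpha>]
        by (simp add: w_def power_mult_distrib)
      then have "w * norm (coeff_arv (X m - X n) \<alpha>) \<le> norm (X m - X n)"
        by (rule power2_le_imp_le) simp
      also have "\<dots> < e * w" using N[OF that] by (simp add: dist_norm)
      finally show ?thesis using w by (simp add: dist_norm coeff_arv_diff mult.commute)
    qed
    then show "\<exists>M. \<forall>m\<ge>M. \<forall>n\<ge>M. dist (coeff_arv (X m) \<alpha>) (coeff_arv (X n) \<alpha>) < e" by blast
  qed
  then have "convergent (\<lambda>k. coeff_arv (X k) \<alpha>)" for \<alpha>
    by (simp add: Cauchy_convergent_iff)
  moreover define a where "a \<alpha> = lim (\<lambda>k. coeff_arv (X k) \<alpha>)" for \<alpha>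
  ultimately have a: "(\<lambda>k. coeff_arv (X k) \<alpha>) \<longlonglongrightarrow> a \<alpha>" for \<alpha>
    by (simp add: convergent_LIMSEQ_iff)
  have bound: "(\<Sum>\<alpha>\<in>F. mweight \<alpha> * (norm (coeff_arv (X m) \<alpha> - a \<alpha>))\<^sup>2) \<le> e\<^sup>2"
    if "finite F" and N: "\<And>n. n \<ge> N \<Longrightarrow> dist (X m) (X n) < e" for F m N e
  proof (rule LIMSEQ_le_const2)
    show "(\<lambda>n. \<Sum>\<alpha>\<in>F. mweight \<alpha> * (norm (coeff_arv (X m) \<alpha> - coeff_arv (X n) \<alpha>))\<^sup>2)
        \<longlonglongrightarrow> (\<Sum>\<alpha>\<in>F. mweight \<alpha> * (norm (coeff_arv (X m) \<alpha> - a \<alpha>))\<^sup>2)"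
      by (intro tendsto_intros a)
    have "(\<Sum>\<alpha>\<in>F. mweight \<alpha> * (norm (coeff_arv (X m) \<alpha> - coeff_arv (X n) \<alpha>))\<^sup>2) \<le> e\<^sup>2"
      if "n \<ge> N" for n
    proof -
      have "(\<Sum>\<alpha>\<in>F. mweight \<alpha> * (norm (coeff_arv (X m) \<alpha> - coeff_arv (X n) \<alpha>))\<^sup>2)
          \<le> (norm (X m - X n))\<^sup>2"
        using sum_le_norm_arveson[OF \<open>finite F\<close>, of "X m - X n"] by (simp add: coeff_arv_diff)
      also have "\<dots> \<le> e\<^sup>2"
        using N[OF that] by (intro power_mono) (auto simp: dist_norm)
      finally show ?thesis .
    qed
    then show "\<exists>N. \<forall>n\<ge>N.
        (\<Sum>\<alpha>\<in>F. mweight \<alpha> * (norm (coeff_arv (X m) \<alpha> - coeff_arv (X n) \<alpha>))\<^sup>2) \<le> e\<^sup>2"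
      by blast
  qed
  have summ: "(\<lambda>\<alpha>. mweight \<alpha> * (norm (coeff_arv (X m) \<alpha> - a \<alpha>))\<^sup>2) summable_on UNIV"
    if N: "\<And>n. n \<ge> N \<Longrightarrow> dist (X m) (X n) < e" for m N e
  proof (rule nonneg_bdd_above_summable_on)
    show "0 \<le> mweight \<alpha> * (norm (coeff_arv (X m) \<alpha> - a \<alpha>))\<^sup>2" for \<alpha>
      by (simp add: less_imp_le[OF mweight_pos])
    show "bdd_above (sum (\<lambda>\<alpha>. mweight \<alpha> * (norm (coeff_arv (X m) \<alpha> - a \<alpha>))\<^sup>2) `
        {F. F \<subseteq> UNIV \<and> finite F})"
      by (rule bdd_aboveI2[where M = "e\<^sup>2"], rule bound[OF _ N]) simp_all
  qed
  obtain N1 where N1: "\<And>m n. m \<ge> N1 \<Longrightarrow> n \<ge> N1 \<Longrightarrow> dist (X m) (X n) < 1"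
    using metric_CauchyD[OF X, of 1] by auto
  have "(\<lambda>\<alpha>. mweight \<alpha> * (norm (coeff_arv (X N1) \<alpha> + - (coeff_arv (X N1) \<alpha> - a \<alpha>)))\<^sup>2)
      summable_on UNIV"
    by (rule mweight_summable_add[OF coeff_arv_summable])
       (use summ[of N1 N1 1, OF N1] in \<open>simp add: norm_minus_commute\<close>)
  then have "a \<in> {f. (\<lambda>\<alpha>. mweight \<alpha> * (norm (f \<alpha>))\<^sup>2) summable_on UNIV}" by simp
  then have A: "coeff_arv (Abs_arv a) = a" by (rule Abs_arv_inverse)
  have "X \<longlonglongrightarrow> Abs_arv a"
  proof (rule metric_LIMSEQ_I)
    fix e :: real assume "e > 0"
    then obtain N where N: "\<And>m n. m \<ge> N \<Longrightarrow> n \<ge> N \<Longrightarrow> dist (X m) (X n) < e / 2"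
      using metric_CauchyD[OF X, of "e / 2"] by auto
    have "dist (X m) (Abs_arv a) < e" if "m \<ge> N" for m
    proof -
      have "(norm (X m - Abs_arv a))\<^sup>2 \<le> (e / 2)\<^sup>2"
        unfolding norm_arveson_square coeff_arv_diff A
        by (rule infsum_le_finite_sums[OF summ[OF N[OF that]] bound[OF _ N[OF that]]])
      then have "norm (X m - Abs_arv a) \<le> e / 2"
        by (rule power2_le_imp_le) (use \<open>e > 0\<close> in simp)
      then show ?thesis using \<open>e > 0\<close> by (simp add: dist_norm)
    qed
    then show "\<exists>N. \<forall>m\<ge>N. dist (X m) (Abs_arv a) < e" by blast
  qed
  then show "convergent X" by (rule convergentI)
qed

definition arv_eval :: "('n::finite, 'e::complex_inner) arveson \<Rightarrow> complex ^ 'n \<Rightarrow> 'e" where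
  "arv_eval f z = (\<Sum>\<^sub>\<infinity>\<alpha>. mpow z \<alpha> *\<^sub>C coeff_arv f \<alpha>)"

lemma finite_mdeg: "finite {\<alpha> :: 'n::finite multi_index. mdeg \<alpha> = k}"
proof (rule finite_imageD)
  have "Poly_Mapping.lookup ` {\<alpha> :: 'n multi_index. mdeg \<alpha> = k} \<subseteq> PiE UNIV (\<lambda>_. {..k})"
    by (auto simp: mdeg_def intro!: member_le_sum)
  then show "finite (Poly_Mapping.lookup ` {\<alpha> :: 'n multi_index. mdeg \<alpha> = k})"
    by (rule finite_subset) (simp add: finite_PiE)
qed (auto simp: inj_on_def poly_mapping_eqI)

lemma mdeg_add_single:
  "mdeg (\<alpha> + Poly_Mapping.single i (Suc 0)) = Suc (mdeg \<alpha>)" for \<alpha> :: "'n::finite multi_index"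
  by (simp add: mdeg_def lookup_add sum.distrib lookup_single when_def)

lemma mpow_add_single:
  "mpow z (\<alpha> + Poly_Mapping.single i (Suc 0)) = mpow z \<alpha> * z $ i"
proof -
  have "(z $ j) ^ Poly_Mapping.lookup (\<alpha> + Poly_Mapping.single i (Suc 0)) j
      = (z $ j) ^ Poly_Mapping.lookup \<alpha> j * (if j = i then z $ i else 1)" for j
    by (simp add: lookup_add lookup_single when_def)
  then show ?thesis
    by (simp only: mpow_def prod.distrib) simp
qed

lemma mweight_add_single:
  fixes \<alpha> :: "'n::finite multi_index"
  shows "mweight (\<alpha> + Poly_Mapping.single i (Suc 0)) * Suc (mdeg \<alpha>)
    = mweight \<alpha> * Suc (Poly_Mapping.lookup \<alpha> i)"
proof -
  have "fact (Poly_Mapping.lookup (\<alpha> + Poly_Mapping.single i (Suc 0)) j)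
      = (fact (Poly_Mapping.lookup \<alpha> j)
         * (if j = i then real (Suc (Poly_Mapping.lookup \<alpha> i)) else 1) :: real)" for j
    by (simp add: lookup_add lookup_single when_def)
  then have "(\<Prod>j\<in>UNIV. fact (Poly_Mapping.lookup (\<alpha> + Poly_Mapping.single i (Suc 0)) j))
      = (\<Prod>j\<in>UNIV. fact (Poly_Mapping.lookup \<alpha> j)) * real (Suc (Poly_Mapping.lookup \<alpha> i))"
    by (simp only: prod.distrib) simp
  then show ?thesis
    by (simp add: mweight_def mdeg_add_single field_simps del: of_nat_Suc)
qed

lemma multinomial:
  fixes z :: "complex ^ 'n::finite"
  shows "(\<Sum>\<alpha> | mdeg \<alpha> = k. mpow z \<alpha> / of_real (mweight \<alpha>)) = (\<Sum>i\<in>UNIV. z $ i) ^ k"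
proof (induction k)
  case 0
  have "{\<alpha> :: 'n multi_index. mdeg \<alpha> = 0} = {0}"
    by (auto simp: mdeg_def intro: poly_mapping_eqI)
  then show ?case by (simp add: mpow_def mweight_def mdeg_def)
next
  case (Suc k)
  define g where "g i \<beta> = of_nat (Poly_Mapping.lookup \<beta> i) / of_nat (Suc k)
    * (mpow z \<beta> / of_real (mweight \<beta>))" for i and \<beta> :: "'n multi_index"
  let ?e = "\<lambda>i::'n. Poly_Mapping.single i (Suc 0)"
  have g: "z $ i * (mpow z \<alpha> / of_real (mweight \<alpha>)) = g i (\<alpha> + ?e i)" if "mdeg \<alpha> = k" for i \<alpha>
  proof -
    have "of_real (mweight (\<alpha> + ?e i)) * of_nat (Suc k)
        = (of_real (mweight \<alpha>) * of_nat (Suc (Poly_Mapping.lookup \<alpha> i)) :: complex)"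
      using arg_cong[OF mweight_add_single[of \<alpha> i], of complex_of_real] that
      by (simp only: of_real_mult of_real_of_nat_eq)
    moreover have "complex_of_real (mweight \<alpha>) \<noteq> 0" "complex_of_real (mweight (\<alpha> + ?e i)) \<noteq> 0"
      using mweight_pos by (metis less_irrefl of_real_eq_0_iff)+
    ultimately show ?thesis
      by (simp add: g_def mpow_add_single lookup_add lookup_single field_simps
          del: of_nat_Suc)
  qed
  have inner: "(\<Sum>\<alpha> | mdeg \<alpha> = k. g i (\<alpha> + ?e i)) = (\<Sum>\<beta> | mdeg \<beta> = Suc k. g i \<beta>)" for i
  proof -
    have "(\<Sum>\<alpha> | mdeg \<alpha> = k. g i (\<alpha> + ?e i))
        = (\<Sum>\<beta> | mdeg \<beta> = Suc k \<and> Poly_Mapping.lookup \<beta> i \<noteq> 0. g i \<beta>)"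
    proof (rule sum.reindex_bij_witness[where i = "\<lambda>\<beta>. \<beta> - ?e i" and j = "\<lambda>\<alpha>. \<alpha> + ?e i"])
      fix \<beta> :: "'n multi_index"
      assume *: "\<beta> \<in> {\<beta>. mdeg \<beta> = Suc k \<and> Poly_Mapping.lookup \<beta> i \<noteq> 0}"
      show b: "\<beta> - ?e i + ?e i = \<beta>"
        using * by (intro poly_mapping_eqI) (auto simp: lookup_add lookup_minus lookup_single when_def)
      show "\<beta> - ?e i \<in> {\<alpha>. mdeg \<alpha> = k}"
        using * mdeg_add_single[of "\<beta> - ?e i" i] unfolding b by simp
    qed (simp_all add: mdeg_add_single lookup_add lookup_single)
    also have "\<dots> = (\<Sum>\<beta> | mdeg \<beta> = Suc k. g i \<beta>)"
      by (rule sum.mono_neutral_left) (auto simp: finite_mdeg g_def)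
    finally show ?thesis .
  qed
  have "(\<Sum>i\<in>UNIV. z $ i) ^ Suc k
      = (\<Sum>i\<in>UNIV. \<Sum>\<alpha> | mdeg \<alpha> = k. z $ i * (mpow z \<alpha> / of_real (mweight \<alpha>)))"
    by (simp only: Suc.IH[symmetric] power_Suc sum_product)
  also have "\<dots> = (\<Sum>i\<in>UNIV. \<Sum>\<beta> | mdeg \<beta> = Suc k. g i \<beta>)"
    by (simp only: inner[symmetric]) (intro sum.cong refl, use g in auto)
  also have "\<dots> = (\<Sum>\<beta> | mdeg \<beta> = Suc k. \<Sum>i\<in>UNIV. g i \<beta>)"
    by (rule sum.swap)
  also have "\<dots> = (\<Sum>\<beta> | mdeg \<beta> = Suc k. mpow z \<beta> / of_real (mweight \<beta>))"
  proof (intro sum.cong refl)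
    fix \<beta> :: "'n multi_index" assume "\<beta> \<in> {\<beta>. mdeg \<beta> = Suc k}"
    then have "(\<Sum>i\<in>UNIV. of_nat (Poly_Mapping.lookup \<beta> i)) = (of_nat (Suc k) :: complex)"
      by (simp only: mdeg_def mem_Collect_eq of_nat_sum[symmetric])
    then show "(\<Sum>i\<in>UNIV. g i \<beta>) = mpow z \<beta> / of_real (mweight \<beta>)"
      by (simp only: g_def sum_distrib_right[symmetric] sum_divide_distrib[symmetric])
         (simp del: of_nat_Suc)
  qed
  finally show ?case by simp
qed

lemma mpow_of_real_norm: "mpow (\<chi> i. of_real (cmod (z $ i))) \<alpha> = of_real (cmod (mpow z \<alpha>))"
  by (simp add: mpow_def prod_norm[symmetric] norm_power flip: of_real_power)

lemma geometric_mpow_summable: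
  fixes z :: "complex ^ 'n::finite"
  assumes "(\<Sum>i\<in>UNIV. cmod (z $ i)) < 1"
  shows "(\<lambda>\<alpha>. cmod (mpow z \<alpha> / of_real (mweight \<alpha>))) summable_on UNIV"
proof -
  let ?S = "\<lambda>k. {\<alpha> :: 'n multi_index. mdeg \<alpha> = k}"
  have bij: "bij_betw (\<lambda>\<alpha>. (mdeg \<alpha>, \<alpha>)) UNIV (Sigma UNIV ?S)"
    by (auto simp: bij_betw_def inj_on_def)
  have s: "(\<Sum>\<alpha>\<in>?S k. cmod (mpow z \<alpha> / of_real (mweight \<alpha>))) = (\<Sum>i\<in>UNIV. cmod (z $ i)) ^ k" for k
  proof -
    have "complex_of_real (\<Sum>\<alpha>\<in>?S k. cmod (mpow z \<alpha> / of_real (mweight \<alpha>)))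
        = complex_of_real ((\<Sum>i\<in>UNIV. cmod (z $ i)) ^ k)"
      using multinomial[of "\<chi> i. of_real (cmod (z $ i))" k]
      by (simp add: mpow_of_real_norm norm_divide abs_of_pos[OF mweight_pos])
    then show ?thesis using of_real_eq_iff by blast
  qed
  have "(\<lambda>(k, \<alpha>). cmod (mpow z \<alpha> / of_real (mweight \<alpha>))) summable_on Sigma UNIV ?S"
  proof (rule summable_on_SigmaI)
    show "((\<lambda>\<alpha>. case (k, \<alpha>) of (k, \<alpha>) \<Rightarrow> cmod (mpow z \<alpha> / of_real (mweight \<alpha>)))
        has_sum (\<Sum>i\<in>UNIV. cmod (z $ i)) ^ k) (?S k)" for k
      unfolding s[symmetric] by (simp only: prod.case) (rule has_sum_finite[OF finite_mdeg])
    show "(\<lambda>k. (\<Sum>i\<in>UNIV. cmod (z $ i)) ^ k) summable_on UNIV"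
      using assms by (intro summable_nonneg_imp_summable_on summable_geometric)
        (auto simp: sum_nonneg)
  qed auto
  then show ?thesis
    using summable_on_reindex_bij_betw[OF bij, of "\<lambda>(k, \<alpha>). cmod (mpow z \<alpha> / of_real (mweight \<alpha>))"]
    by simp
qed

lemma geometric_mpow_has_sum:
  fixes z :: "complex ^ 'n::finite"
  assumes "(\<Sum>i\<in>UNIV. cmod (z $ i)) < 1"
  shows "((\<lambda>\<alpha>. mpow z \<alpha> / of_real (mweight \<alpha>)) has_sum 1 / (1 - (\<Sum>i\<in>UNIV. z $ i))) UNIV"
proof -
  let ?S = "\<lambda>k. {\<alpha> :: 'n multi_index. mdeg \<alpha> = k}" and ?s = "\<Sum>i\<in>UNIV. z $ i"
  have bij: "bij_betw (\<lambda>\<alpha>. (mdeg \<alpha>, \<alpha>)) UNIV (Sigma UNIV ?S)"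
    by (auto simp: bij_betw_def inj_on_def)
  have lt: "cmod ?s < 1"
    using norm_sum[of "\<lambda>i. z $ i" UNIV] assms by linarith
  have "((\<lambda>(k, \<alpha>). mpow z \<alpha> / of_real (mweight \<alpha>)) has_sum 1 / (1 - ?s)) (Sigma UNIV ?S)"
  proof (rule has_sum_SigmaI)
    show "((\<lambda>\<alpha>. case (k, \<alpha>) of (k, \<alpha>) \<Rightarrow> mpow z \<alpha> / of_real (mweight \<alpha>)) has_sum ?s ^ k) (?S k)" for k
      unfolding multinomial[symmetric] by (simp only: prod.case) (rule has_sum_finite[OF finite_mdeg])
    show "((\<lambda>k. ?s ^ k) has_sum 1 / (1 - ?s)) UNIV"
      using lt by (intro norm_summable_imp_has_sum geometric_sums)
        (auto simp: norm_power intro: summable_geometric)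
    have "(\<lambda>\<alpha>. mpow z \<alpha> / of_real (mweight \<alpha>)) summable_on UNIV"
      by (rule Infinite_Sum.abs_summable_summable) (rule geometric_mpow_summable[OF assms])
    then show "(\<lambda>(k, \<alpha>). mpow z \<alpha> / of_real (mweight \<alpha>)) summable_on Sigma UNIV ?S"
      using summable_on_reindex_bij_betw[OF bij, of "\<lambda>(k, \<alpha>). mpow z \<alpha> / of_real (mweight \<alpha>)"]
      by simp
  qed
  then show ?thesis
    using has_sum_reindex_bij_betw[OF bij, of "\<lambda>(k, \<alpha>). mpow z \<alpha> / of_real (mweight \<alpha>)"]
    by simp
qed

lemma ball_sum_norm_mult:
  fixes z w :: "complex ^ 'n::finite"
  assumes "z \<in> ball 0 1" "w \<in> ball 0 1"
  shows "(\<Sum>i\<in>UNIV. cmod ((\<chi> i. z $ i * cnj (w $ i)) $ i)) < 1"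
proof -
  have "(\<Sum>i\<in>UNIV. cmod (z $ i) * cmod (w $ i)) \<le> norm z * norm w"
    using L2_set_mult_ineq[where f = "\<lambda>i. cmod (z $ i)" and g = "\<lambda>i. cmod (w $ i)" and A = UNIV]
    by (simp add: norm_vec_def)
  also have "\<dots> < 1 * 1"
    using assms by (intro mult_strict_mono') auto
  finally show ?thesis by (simp add: norm_mult)
qed

lift_definition arv_kernel :: "complex ^ 'n::finite \<Rightarrow> 'e::complex_inner \<Rightarrow> ('n, 'e) arveson" is
  "\<lambda>w e \<alpha>. if w \<in> ball 0 1 then (cnj (mpow w \<alpha>) / of_real (mweight \<alpha>)) *\<^sub>C e else 0"
proof -
  fix w :: "complex ^ 'n" and e :: 'e
  show "(\<lambda>\<alpha>. mweight \<alpha> *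
      (norm (if w \<in> ball 0 1 then (cnj (mpow w \<alpha>) / of_real (mweight \<alpha>)) *\<^sub>C e else 0))\<^sup>2)
      summable_on UNIV"
  proof (cases "w \<in> ball 0 1")
    case True
    let ?v = "\<chi> i. w $ i * cnj (w $ i)"
    have *: "mpow ?v \<alpha> = mpow w \<alpha> * cnj (mpow w \<alpha>)" for \<alpha>
      by (simp add: mpow_def power_mult_distrib prod.distrib)
    have "(\<lambda>\<alpha>. (norm e)\<^sup>2 * cmod (mpow ?v \<alpha> / of_real (mweight \<alpha>))) summable_on UNIV"
      by (intro summable_on_cmult_right geometric_mpow_summable ball_sum_norm_mult True)
    also have "(\<lambda>\<alpha>. (norm e)\<^sup>2 * cmod (mpow ?v \<alpha> / of_real (mweight \<alpha>)))
      = (\<lambda>\<alpha>. mweight \<alpha> * (norm ((cnj (mpow w \<alpha>) / of_real (mweight \<alpha>)) *\<^sub>C e))\<^sup>2)"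
    proof
      fix \<alpha> :: "'n multi_index"
      show "(norm e)\<^sup>2 * cmod (mpow ?v \<alpha> / of_real (mweight \<alpha>))
        = mweight \<alpha> * (norm ((cnj (mpow w \<alpha>) / of_real (mweight \<alpha>)) *\<^sub>C e))\<^sup>2"
        using mweight_pos[of \<alpha>]
        unfolding * by (simp add: norm_scaleC norm_mult norm_divide field_simps power2_eq_square)
    qed
    finally show ?thesis using True by simp
  qed simp
qed

lemma arv_eval_kernel:
  fixes z w :: "complex ^ 'n::finite" and e :: "'e::complex_inner"
  assumes "z \<in> ball 0 1" "w \<in> ball 0 1"
  shows "arv_eval (arv_kernel w e) z = (1 / (1 - cinner z w)) *\<^sub>C e"
proof -
  let ?v = "\<chi> i. z $ i * cnj (w $ i)"
  have *: "mpow ?v \<alpha> = mpow z \<alpha> * cnj (mpow w \<alpha>)" for \<alpha>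
    by (simp add: mpow_def power_mult_distrib prod.distrib)
  have bl: "bounded_linear (\<lambda>c. c *\<^sub>C e)"
  proof (rule bounded_linear_intro[where K = "norm e"])
    show "(r *\<^sub>R c) *\<^sub>C e = r *\<^sub>R (c *\<^sub>C e)" for r c
      by (simp only: scaleR_scaleC[of r "c *\<^sub>C e"] scaleR_conv_of_real[of r c] scaleC_scaleC)
  qed (simp_all add: scaleC_add_left norm_scaleC)
  have "((\<lambda>\<alpha>. (mpow ?v \<alpha> / of_real (mweight \<alpha>)) *\<^sub>C e) has_sum
      (1 / (1 - (\<Sum>i\<in>UNIV. ?v $ i))) *\<^sub>C e) UNIV"
    by (intro has_sum_bounded_linear[OF bl] geometric_mpow_has_sum ball_sum_norm_mult assms)
  then show ?thesis
    unfolding arv_eval_def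
    by (intro infsumI)
       (use assms in \<open>simp add: * arv_kernel.rep_eq scaleC_scaleC cinner_vec_def cinner_complex_def\<close>)
qed

lemma arv_kernel_reproducing:
  fixes f :: "('n::finite, 'e::chilbert_space) arveson"
  assumes z: "z \<in> ball 0 1"
  shows "cinner f (arv_kernel z e) = cinner (arv_eval f z) e"
proof -
  let ?v = "\<chi> i. z $ i * cnj (z $ i)"
  have v: "cmod (mpow ?v \<alpha>) = (cmod (mpow z \<alpha>))\<^sup>2" for \<alpha>
    by (simp add: mpow_def prod_norm[symmetric] norm_power norm_mult power_mult_distrib prod.distrib
        power2_eq_square)
  have "(\<lambda>\<alpha>. norm (mpow z \<alpha> *\<^sub>C coeff_arv f \<alpha>)) summable_on UNIV"
  proof (rule Infinite_Sum.abs_summable_on_comparison_test')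
    show "(\<lambda>\<alpha>. cmod (mpow ?v \<alpha> / of_real (mweight \<alpha>)) + mweight \<alpha> * (norm (coeff_arv f \<alpha>))\<^sup>2)
        summable_on UNIV"
      by (intro summable_on_add geometric_mpow_summable ball_sum_norm_mult z coeff_arv_summable)
    fix \<alpha> :: "'n multi_index"
    define p q w where "p = cmod (mpow z \<alpha>)" and "q = norm (coeff_arv f \<alpha>)" and "w = mweight \<alpha>"
    have w: "w > 0" by (simp add: w_def mweight_pos)
    have "0 \<le> (p - w * q)\<^sup>2" "0 \<le> p * (w * q)" using w by (simp_all add: p_def q_def)
    then have "p * (w * q) \<le> p\<^sup>2 + (w * q)\<^sup>2"
      unfolding power2_diff by linarith
    then have "p * q \<le> p\<^sup>2 / w + w * q\<^sup>2"
      using w by (simp add: field_simps power2_eq_square)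
    then show "norm (mpow z \<alpha> *\<^sub>C coeff_arv f \<alpha>)
        \<le> cmod (mpow ?v \<alpha> / of_real (mweight \<alpha>)) + mweight \<alpha> * (norm (coeff_arv f \<alpha>))\<^sup>2"
      using w by (simp add: norm_scaleC norm_divide v p_def q_def w_def)
  qed
  then have summ: "(\<lambda>\<alpha>. mpow z \<alpha> *\<^sub>C coeff_arv f \<alpha>) summable_on UNIV"
    by (rule Infinite_Sum.abs_summable_summable)
  have bl: "bounded_linear (\<lambda>x. cinner x e)"
    by (rule bounded_linear_intro[where K = "norm e"])
       (simp_all add: cinner_add_left scaleR_scaleC cinner_scaleC_left cinner_Cauchy_Schwarz
          scaleC_complex_def)
  have "cinner (arv_eval f z) e = (\<Sum>\<^sub>\<infinity>\<alpha>. cinner (mpow z \<alpha> *\<^sub>C coeff_arv f \<alpha>) e)"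
    unfolding arv_eval_def
    by (rule infsumI[symmetric]) (intro has_sum_bounded_linear[OF bl] has_sum_infsum summ)
  also have "\<dots> = cinner f (arv_kernel z e)"
    unfolding cinner_arveson_def arv_kernel.rep_eq
  proof (rule infsum_cong)
    fix \<alpha> :: "'n multi_index"
    show "cinner (mpow z \<alpha> *\<^sub>C coeff_arv f \<alpha>) e = of_real (mweight \<alpha>) * cinner (coeff_arv f \<alpha>)
        (if z \<in> ball 0 1 then (cnj (mpow z \<alpha>) / of_real (mweight \<alpha>)) *\<^sub>C e else 0)"
      using z mweight_pos[of \<alpha>] by (simp add: cinner_scaleC_left cinner_scaleC_right)
  qed
  finally show ?thesis by simp
qed

text \<open>\<open>H\<^sup>2 \<otimes> D\<close>, as a subspace of \<open>H\<^sup>2 \<otimes> E\<close>, for a closed subspace \<open>D\<close> of \<open>E\<close>.\<close>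

definition arv_sub :: "'e::complex_inner set \<Rightarrow> ('n::finite, 'e) arveson set" where
  "arv_sub D = {f. \<forall>\<alpha>. coeff_arv f \<alpha> \<in> D}"

text \<open>The operators \<open>Q\<^sub>m \<otimes> I\<close> and \<open>Q\<^bsub>\<le>m\<^esub> \<otimes> I\<close> on \<open>H\<^sup>2 \<otimes> D\<close>: the orthogonal projections onto the
  \<open>D\<close>-valued homogeneous polynomials of degree \<open>m\<close>, and polynomials of degree at most \<open>m\<close>.\<close>

definition Q_hom :: "'e::complex_inner set \<Rightarrow> nat \<Rightarrow> ('n::finite, 'e) arveson \<Rightarrow> ('n, 'e) arveson" where
  "Q_hom D m = orth_proj {f \<in> arv_sub D. \<forall>\<alpha>. mdeg \<alpha> \<noteq> m \<longrightarrow> coeff_arv f \<alpha> = 0}"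

definition Q_le :: "'e::complex_inner set \<Rightarrow> nat \<Rightarrow> ('n::finite, 'e) arveson \<Rightarrow> ('n, 'e) arveson" where
  "Q_le D m = orth_proj {f \<in> arv_sub D. \<forall>\<alpha>. mdeg \<alpha> > m \<longrightarrow> coeff_arv f \<alpha> = 0}"


section \<open>Row contractions and the constrained characteristic function\<close>

definition row_op :: "('n::finite \<Rightarrow> 'h \<Rightarrow> 'h::complex_inner) \<Rightarrow> 'h ^ 'n \<Rightarrow> 'h" where
  "row_op T v = (\<Sum>i\<in>UNIV. T i (v $ i))"

definition commutative_row_contraction :: "('n::finite \<Rightarrow> 'h \<Rightarrow> 'h::chilbert_space) \<Rightarrow> bool" where
  "commutative_row_contraction T \<longleftrightarrow>
     (\<forall>i. bounded_clinear (T i)) \<and> (\<forall>i j. T i \<circ> T j = T j \<circ> T i) \<and>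
     positive_op (\<lambda>h. h - row_op T (cadjoint (row_op T) h))"

definition defect :: "('n::finite \<Rightarrow> 'h \<Rightarrow> 'h::chilbert_space) \<Rightarrow> 'h \<Rightarrow> 'h" where
  "defect T = sqrt_op (\<lambda>h. h - row_op T (cadjoint (row_op T) h))"

definition defect_star :: "('n::finite \<Rightarrow> 'h \<Rightarrow> 'h::chilbert_space) \<Rightarrow> 'h ^ 'n \<Rightarrow> 'h ^ 'n" where
  "defect_star T = sqrt_op (\<lambda>v. v - cadjoint (row_op T) (row_op T v))"

definition defect_space :: "('n::finite \<Rightarrow> 'h \<Rightarrow> 'h::chilbert_space) \<Rightarrow> 'h set" where
  "defect_space T = closure (range (defect T))"

definition defect_star_space :: "('n::finite \<Rightarrow> 'h \<Rightarrow> 'h::chilbert_space) \<Rightarrow> ('h ^ 'n) set" where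
  "defect_star_space T = closure (range (defect_star T))"

definition char_symbol ::
    "('n::finite \<Rightarrow> 'h \<Rightarrow> 'h::chilbert_space) \<Rightarrow> complex ^ 'n \<Rightarrow> 'h ^ 'n \<Rightarrow> 'h" where
  "char_symbol T z v = - row_op T v +
     defect T (inv (\<lambda>h. h - (\<Sum>i\<in>UNIV. (z $ i) *\<^sub>C cadjoint (T i) h))
       (\<Sum>i\<in>UNIV. (z $ i) *\<^sub>C (defect_star T v $ i)))"

text \<open>\<open>\<Theta>(z)\<^sup>*\<close>, the symbol being regarded as an operator on the space \<open>defect_star_space T\<close>.\<close>

definition char_symbol_adj ::
    "('n::finite \<Rightarrow> 'h \<Rightarrow> 'h::chilbert_space) \<Rightarrow> complex ^ 'n \<Rightarrow> 'h \<Rightarrow> 'h ^ 'n" where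
  "char_symbol_adj T z = adjoint_on (defect_star_space T) (char_symbol T z)"

text \<open>The multiplication operator; only applied to elements of \<open>arv_sub (defect_star_space T)\<close>.\<close>

definition char_op ::
    "('n::finite \<Rightarrow> 'h \<Rightarrow> 'h::chilbert_space) \<Rightarrow> ('n, 'h ^ 'n) arveson \<Rightarrow> ('n, 'h) arveson" where
  "char_op T f = (THE g. \<forall>z\<in>ball 0 1. arv_eval g z = char_symbol T z (arv_eval f z))"

definition char_op_adj ::
    "('n::finite \<Rightarrow> 'h \<Rightarrow> 'h::chilbert_space) \<Rightarrow> ('n, 'h) arveson \<Rightarrow> ('n, 'h ^ 'n) arveson" where
  "char_op_adj T = adjoint_on (arv_sub (defect_star_space T)) (char_op T)"


section \<open>Curvature\<close>

definition sphere_prob :: "'a::euclidean_space measure" where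
  "sphere_prob = restrict_space (distr (uniform_measure lborel (ball 0 1)) borel sgn) (sphere 0 1)"

lemma emeasure_lborel_unit_ball:
  "emeasure lborel (ball (0::'a::euclidean_space) 1) \<noteq> 0"
  "emeasure lborel (ball (0::'a) 1) \<noteq> \<infinity>"
proof -
  have "emeasure lborel (ball (0::'a) 1) = ennreal (measure lborel (ball (0::'a) 1))"
    using emeasure_lborel_ball_finite[of "0::'a" 1] by (intro emeasure_eq_ennreal_measure) auto
  then show "emeasure lborel (ball (0::'a) 1) \<noteq> 0" "emeasure lborel (ball (0::'a) 1) \<noteq> \<infinity>"
    using content_ball_pos[of 1 "0::'a"] by auto
qed

lemma sgn_vimage_borel: "A \<in> sets borel \<Longrightarrow> sgn -` A \<in> sets (borel :: 'a::euclidean_space measure)"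
proof -
  assume A: "A \<in> sets borel"
  have "sgn \<in> borel_measurable (borel :: 'a measure)" by simp
  from measurable_sets[OF this A] show ?thesis by simp
qed

lemma emeasure_sphere_prob:
  fixes A :: "'a::euclidean_space set"
  assumes "A \<subseteq> sphere 0 1" and "A \<in> sets borel"
  shows "emeasure sphere_prob A = emeasure lborel (ball 0 1 \<inter> sgn -` A) / emeasure lborel (ball (0::'a) 1)"
  unfolding sphere_prob_def using assms sgn_vimage_borel[OF assms(2)]
  by (subst emeasure_restrict_space) (auto simp: emeasure_distr)

lemma emeasure_sphere_prob_space:
  "emeasure sphere_prob (space (sphere_prob :: 'a::euclidean_space measure)) = 1"
proof -
  have "ball (0::'a) 1 \<inter> sgn -` sphere 0 1 = ball 0 1 - {0}"
    by (auto simp: norm_sgn)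
  moreover have "emeasure lborel (ball (0::'a) 1 - {0}) = emeasure lborel (ball (0::'a) 1)"
    by (rule emeasure_Diff_null_set) auto
  ultimately have "emeasure sphere_prob (sphere (0::'a) 1)
      = emeasure lborel (ball (0::'a) 1) / emeasure lborel (ball (0::'a) 1)"
    by (subst emeasure_sphere_prob) simp_all
  also have "\<dots> = 1"
    using emeasure_lborel_unit_ball[where ?'a = 'a]
    by (intro ennreal_divide_self) (simp_all only: infinity_ennreal_def less_top not_False_eq_True)
  finally have "emeasure sphere_prob (sphere (0::'a) 1) = 1" .
  then show ?thesis by (simp add: sphere_prob_def space_restrict_space)
qed

lemma distr_lborel_orthogonal:
  fixes f :: "'a::euclidean_space \<Rightarrow> 'a"
  assumes "orthogonal_transformation f"
  shows "distr lborel borel f = lborel"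
proof -
  let ?\<nu> = "distr lborel borel f" and ?B = "ball (0::'a) 1"
  have lin: "linear f" and n: "norm (f x) = norm x" for x
    using assms by (auto simp: orthogonal_transformation)
  have bij: "bij f" by (rule orthogonal_transformation_bij[OF assms])
  have meas [measurable]: "f \<in> borel_measurable borel"
    using lin by (intro borel_measurable_continuous_onI linear_continuous_on linear_conv_bounded_linear[THEN iffD1])
  have lin': "linear (inv f)"
    using orthogonal_transformation_inv[OF assms] by (rule orthogonal_transformation_linear)
  have meas' [measurable]: "inv f \<in> borel_measurable borel"
    using lin' by (intro borel_measurable_continuous_onI linear_continuous_on linear_conv_bounded_linear[THEN iffD1])
  have sf: "sigma_finite_measure ?\<nu>"
  proof (rule sigma_finite_measure_distr)
    have "distr ?\<nu> borel (inv f) = distr lborel borel (\<lambda>x. x)"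
      using bij by (subst distr_distr) (auto intro!: distr_cong simp: o_def bij_is_inj)
    also have "\<dots> = lborel" by (rule distr_id2) simp
    finally show "sigma_finite_measure (distr ?\<nu> borel (inv f))"
      by (simp add: lborel.sigma_finite_measure_axioms)
  qed simp
  interpret \<nu>: sigma_finite_measure ?\<nu> by (rule sf)
  interpret P: pair_sigma_finite ?\<nu> lborel ..
  have trans: "distr ?\<nu> borel ((+) y) = ?\<nu>" for y
  proof -
    have "distr ?\<nu> borel ((+) y) = distr lborel borel (f \<circ> (+) (inv f y))"
      using bij by (subst distr_distr)
        (auto intro!: distr_cong simp: o_def linear_add[OF lin] bij_is_surj surj_f_inv_f)
    also have "\<dots> = distr (distr lborel borel ((+) (inv f y))) borel f"
      by (subst distr_distr) auto
    finally show ?thesis by (simp add: lborel_distr_plus)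
  qed
  have shift: "(\<integral>\<^sup>+y. h (c + y) \<partial>lborel) = (\<integral>\<^sup>+y. h y \<partial>lborel)"
    if [measurable]: "h \<in> borel_measurable borel" for h and c :: 'a
  proof -
    have "(\<integral>\<^sup>+y. h y \<partial>lborel) = (\<integral>\<^sup>+y. h y \<partial>distr lborel borel ((+) c))"
      by (simp only: lborel_distr_plus)
    then show ?thesis by (subst (asm) nn_integral_distr) auto
  qed
  have shift': "(\<integral>\<^sup>+y. h (c + y) \<partial>?\<nu>) = (\<integral>\<^sup>+y. h y \<partial>?\<nu>)"
    if [measurable]: "h \<in> borel_measurable borel" for h and c :: 'a
  proof -
    have "(\<integral>\<^sup>+y. h y \<partial>?\<nu>) = (\<integral>\<^sup>+y. h y \<partial>distr ?\<nu> borel ((+) c))"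
      by (simp only: trans)
    then show ?thesis by (subst (asm) nn_integral_distr) auto
  qed
  have \<nu>B: "emeasure ?\<nu> ?B = emeasure lborel ?B"
  proof -
    have "f -` ?B = ?B" by (auto simp: n)
    then show ?thesis by (simp add: emeasure_distr)
  qed
  note pos = emeasure_lborel_unit_ball(1)[where ?'a = 'a] and fin = emeasure_lborel_unit_ball(2)[where ?'a = 'a]
  have eq: "emeasure ?\<nu> A = emeasure lborel A" if [measurable]: "A \<in> sets borel" for A
  proof -
    let ?A = "indicator A :: 'a \<Rightarrow> ennreal" and ?I = "indicator ?B :: 'a \<Rightarrow> ennreal"
    have [measurable]: "?A \<in> borel_measurable borel" "?I \<in> borel_measurable borel"
      by (auto intro: borel_measurable_indicator)
    have cong: "?A (y + x) * ?I (- (y + x) + y) = ?A (x + y) * ?I x" for x y :: 'a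
      by (simp add: indicator_def add.commute)
    have "emeasure ?\<nu> A * emeasure lborel ?B = (\<integral>\<^sup>+x. ?A x * (\<integral>\<^sup>+y. ?I y \<partial>lborel) \<partial>?\<nu>)"
      by (simp add: nn_integral_multc)
    also have "\<dots> = (\<integral>\<^sup>+x. ?A x * (\<integral>\<^sup>+y. ?I (- x + y) \<partial>lborel) \<partial>?\<nu>)"
      by (intro nn_integral_cong arg_cong2[where f = "(*)"] refl shift[symmetric]) measurable
    also have "\<dots> = (\<integral>\<^sup>+x. \<integral>\<^sup>+y. ?A x * ?I (- x + y) \<partial>lborel \<partial>?\<nu>)"
      by (intro nn_integral_cong nn_integral_cmult[symmetric]) measurable
    also have "\<dots> = (\<integral>\<^sup>+y. \<integral>\<^sup>+x. ?A x * ?I (- x + y) \<partial>?\<nu> \<partial>lborel)"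
      by (rule P.Fubini'[symmetric]) measurable
    also have "\<dots> = (\<integral>\<^sup>+y. \<integral>\<^sup>+x. ?A (y + x) * ?I (- (y + x) + y) \<partial>?\<nu> \<partial>lborel)"
      by (intro nn_integral_cong shift'[symmetric]) measurable
    also have "\<dots> = (\<integral>\<^sup>+y. \<integral>\<^sup>+x. ?A (x + y) * ?I x \<partial>?\<nu> \<partial>lborel)"
      by (simp only: cong)
    also have "\<dots> = (\<integral>\<^sup>+x. \<integral>\<^sup>+y. ?A (x + y) * ?I x \<partial>lborel \<partial>?\<nu>)"
      by (rule P.Fubini') measurable
    also have "\<dots> = (\<integral>\<^sup>+x. (\<integral>\<^sup>+y. ?A (x + y) \<partial>lborel) * ?I x \<partial>?\<nu>)"
      by (intro nn_integral_cong nn_integral_multc) measurable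
    also have "\<dots> = (\<integral>\<^sup>+x. (\<integral>\<^sup>+y. ?A y \<partial>lborel) * ?I x \<partial>?\<nu>)"
      by (intro nn_integral_cong arg_cong2[where f = "(*)"] refl shift) measurable
    also have "\<dots> = emeasure lborel A * emeasure ?\<nu> ?B"
      by (simp add: nn_integral_cmult del: emeasure_distr)
    also note \<nu>B
    finally show ?thesis
      using pos fin by (simp add: mult.commute[of _ "emeasure lborel ?B"] ennreal_mult_cancel_left)
  qed
  show ?thesis
    by (rule measure_eqI) (use eq in auto)
qed

lemma sphere_prob_rotation_invariant:
  fixes f :: "'a::euclidean_space \<Rightarrow> 'a"
  assumes f: "orthogonal_transformation f"
  shows "distr sphere_prob sphere_prob f = sphere_prob"
proof -
  let ?B = "ball (0::'a) 1" and ?S = "sphere (0::'a) 1"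
  have lin: "linear f" and n: "norm (f x) = norm x" for x
    using f by (auto simp: orthogonal_transformation)
  have meas [measurable]: "f \<in> borel_measurable borel"
    using lin by (intro borel_measurable_continuous_onI linear_continuous_on linear_conv_bounded_linear[THEN iffD1])
  have sgn_f: "sgn (f x) = f (sgn x)" for x
    by (simp add: sgn_div_norm n linear_scale[OF lin])
  have sets: "A \<in> sets (sphere_prob :: 'a measure) \<longleftrightarrow> A \<subseteq> ?S \<and> A \<in> sets borel" for A
    unfolding sphere_prob_def by (subst sets_restrict_space_iff) auto
  have space: "space (sphere_prob :: 'a measure) = ?S"
    by (simp add: sphere_prob_def space_restrict_space)
  have mf: "f \<in> measurable sphere_prob sphere_prob"
  proof (rule measurableI)
    fix x :: 'a assume "x \<in> space sphere_prob" then show "f x \<in> space sphere_prob"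
      by (simp add: space n)
  next
    fix A :: "'a set" assume "A \<in> sets sphere_prob"
    then have "A \<in> sets borel" by (simp add: sets)
    from measurable_sets[OF meas this] show "f -` A \<inter> space sphere_prob \<in> sets sphere_prob"
      by (auto simp: sets space)
  qed
  show ?thesis
  proof (rule measure_eqI)
    fix A assume "A \<in> sets (distr sphere_prob sphere_prob f)"
    then have A: "A \<subseteq> ?S" "A \<in> sets borel" by (simp_all add: sets)
    have fA: "f -` A \<in> sets borel" "f -` A \<subseteq> ?S"
      using measurable_sets[OF meas A(2)] A(1) n by (auto simp: subset_iff)
    have sA: "?B \<inter> sgn -` A \<in> sets borel"
      using sgn_vimage_borel[OF A(2)] by simp
    have "emeasure (distr sphere_prob sphere_prob f) A = emeasure sphere_prob (f -` A)"
      using fA(2) A by (subst emeasure_distr[OF mf]) (auto simp: sets space Int_absorb2)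
    also have "\<dots> = emeasure lborel (?B \<inter> sgn -` f -` A) / emeasure lborel ?B"
      by (rule emeasure_sphere_prob[OF fA(2,1)])
    also have "?B \<inter> sgn -` f -` A = f -` (?B \<inter> sgn -` A)"
      by (auto simp: sgn_f n)
    also have "emeasure lborel (f -` (?B \<inter> sgn -` A)) = emeasure (distr lborel borel f) (?B \<inter> sgn -` A)"
      by (subst emeasure_distr) (use sA in auto)
    also have "\<dots> = emeasure lborel (?B \<inter> sgn -` A)"
      by (simp only: distr_lborel_orthogonal[OF f])
    finally show "emeasure (distr sphere_prob sphere_prob f) A = emeasure sphere_prob A"
      by (simp only: emeasure_sphere_prob[OF A])
  qed simp
qed

definition curvature :: "('n::finite \<Rightarrow> 'h \<Rightarrow> 'h::chilbert_space) \<Rightarrow> complex" where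
  "curvature T = (LINT \<xi>|sphere_prob. Lim (at_left 1) (\<lambda>r::real.
     of_real (1 - r\<^sup>2) * trace_on (defect_space T) (\<lambda>h.
       defect T
         (inv (\<lambda>x. x - (\<Sum>i\<in>UNIV. (of_real r * \<xi> $ i) *\<^sub>C cadjoint (T i) x))
           (inv (\<lambda>x. x - (\<Sum>i\<in>UNIV. (of_real r * cnj (\<xi> $ i)) *\<^sub>C T i x))
             (defect T h))))))"


section \<open>Euler characteristic\<close>

type_synonym 'n polynomial = "'n multi_index \<Rightarrow>\<^sub>0 complex"

text \<open>\<open>T\<^sup>\<alpha>\<close>; the order of composition is irrelevant for commuting operators.\<close>

definition op_monomial :: "('n::finite \<Rightarrow> 'h \<Rightarrow> 'h::complex_inner) \<Rightarrow> 'n multi_index \<Rightarrow> 'h \<Rightarrow> 'h" where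
  "op_monomial T \<alpha> = Finite_Set.fold (\<lambda>i A. (T i ^^ Poly_Mapping.lookup \<alpha> i) \<circ> A) id UNIV"

definition op_poly :: "('n::finite \<Rightarrow> 'h \<Rightarrow> 'h::complex_inner) \<Rightarrow> 'n polynomial \<Rightarrow> 'h \<Rightarrow> 'h" where
  "op_poly T p h = (\<Sum>\<alpha>\<in>Poly_Mapping.keys p. Poly_Mapping.lookup p \<alpha> *\<^sub>C op_monomial T \<alpha> h)"

definition arveson_module :: "('n::finite \<Rightarrow> 'h \<Rightarrow> 'h::chilbert_space) \<Rightarrow> 'h set" where
  "arveson_module T = complex_vector.span {op_poly T p (defect T h) | p h. True}"

text \<open>The free module of rank \<open>r\<close>.\<close>

definition free_mod :: "nat \<Rightarrow> (nat \<Rightarrow> 'r::comm_ring_1) set" where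
  "free_mod r = {u. \<forall>i\<ge>r. u i = 0}"

text \<open>A finite free resolution \<open>0 \<rightarrow> F\<^sub>N \<rightarrow> \<dots> \<rightarrow> F\<^sub>1 \<rightarrow> M \<rightarrow> 0\<close> of a submodule \<open>M\<close> of an
  abelian group on which the ring acts by \<open>act\<close>, where \<open>F\<^sub>k\<close> has rank \<open>r k\<close>, the map \<open>F\<^sub>1 \<rightarrow> M\<close>
  is \<open>\<epsilon>\<close>, and the map \<open>F\<^bsub>k+1\<^esub> \<rightarrow> F\<^sub>k\<close> is \<open>d k\<close>; \<open>F\<^sub>k = 0\<close> for \<open>k > N\<close>.\<close>

definition finite_free_resolution ::
    "('r::comm_ring_1 \<Rightarrow> 'm::ab_group_add \<Rightarrow> 'm) \<Rightarrow> 'm set \<Rightarrow> nat \<Rightarrow> (nat \<Rightarrow> nat) \<Rightarrow>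
     ((nat \<Rightarrow> 'r) \<Rightarrow> 'm) \<Rightarrow> (nat \<Rightarrow> (nat \<Rightarrow> 'r) \<Rightarrow> (nat \<Rightarrow> 'r)) \<Rightarrow> bool" where
  "finite_free_resolution act M N r \<epsilon> d \<longleftrightarrow>
     (\<forall>k>N. r k = 0) \<and>
     (\<forall>u\<in>free_mod (r 1). \<forall>v\<in>free_mod (r 1). \<epsilon> (\<lambda>i. u i + v i) = \<epsilon> u + \<epsilon> v) \<and>
     (\<forall>p. \<forall>u\<in>free_mod (r 1). \<epsilon> (\<lambda>i. p * u i) = act p (\<epsilon> u)) \<and>
     (\<forall>k\<ge>1. \<forall>u\<in>free_mod (r (k + 1)). \<forall>v\<in>free_mod (r (k + 1)).
        d k (\<lambda>i. u i + v i) = (\<lambda>i. d k u i + d k v i)) \<and>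
     (\<forall>k\<ge>1. \<forall>p. \<forall>u\<in>free_mod (r (k + 1)). d k (\<lambda>i. p * u i) = (\<lambda>i. p * d k u i)) \<and>
     \<epsilon> ` free_mod (r 1) = M \<and>
     d 1 ` free_mod (r 2) = {u \<in> free_mod (r 1). \<epsilon> u = 0} \<and>
     (\<forall>k\<ge>1. d (k + 1) ` free_mod (r (k + 2)) = {u \<in> free_mod (r (k + 1)). d k u = (\<lambda>_. 0)})"

definition euler_characteristic :: "('n::finite \<Rightarrow> 'h \<Rightarrow> 'h::chilbert_space) \<Rightarrow> int" where
  "euler_characteristic T = (THE c. \<exists>N r \<epsilon> d.
     finite_free_resolution (op_poly T) (arveson_module T) N r \<epsilon> d \<and>
     c = (\<Sum>k=1..N. (-1) ^ (k + 1) * int (r k)))"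

end

theory Submission
  imports Defs "HOL-Library.Function_Algebras" "HOL-Complex_Analysis.Complex_Analysis"
begin

text \<open>The operator \<open>M\<close> of multiplication by \<open>\<Theta>\<close> satisfies \<open>1 - M M\<^sup>* = K K\<^sup>*\<close> for the Poisson kernel
  \<open>K h = \<Sum> z\<^sup>\<alpha> \<Delta> T\<^sup>*\<^sup>\<alpha> h\<close> (up to weights), because \<open>\<Theta>\<close> is the transfer function of the unitary Julia
  colligation of \<open>T\<close>. Hence the traces and ranks in question are those of \<open>\<Phi>\<^sup>m(\<Delta>\<^sup>2)\<close> and of the span of
  the vectors \<open>T\<^sup>\<alpha> \<Delta> h\<close>, \<open>|\<alpha>| \<le> m\<close>. For the curvature, the Taylor coefficients of \<open>\<Theta>(r \<xi>)\<close> along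
  almost every slice are square summable, so radial limits exist by Fatou's theorem, and
  the mean over the sphere is an Abel limit of the traces. For the Euler
  characteristic, a finite free resolution (Hilbert's syzygy theorem) determines the leading
  coefficient of the growth of the filtration by degree.\<close>

section \<open>Finite free resolutions over polynomial rings\<close>

text \<open>\<open>euler_characteristic\<close> is a definite description. Its value is reached only
  through the existence of a resolution and a quantity that every resolution determines but that
  does not refer to it: the growth of the dimensions of \<open>filt (range (defect T)) m\<close>,
  which is also the rank in the formula. In the curvature the limit stands under the integral. The
  trace inside is bounded by the rank of \<Delta>, so dominated convergence works once limits exist
  almost everywhere; the trace is that rank minus squared norms of functions of class H^2 on every
  circle e^{it} \<xi>. These take values in a Hilbert space of arbitrary dimension, and their radial
  limits are obtained from a Cauchy criterion, without constructing a boundary function. The two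
  expressions for the curvature meet in the means over the sphere of the squared norms of
  \<open>(S \<xi> ^^ m) (\<Delta> e)\<close>: these decrease in \<open>m\<close>, since
  \<open>S \<xi>\<close> is a contraction for unit vectors, and unitary invariance turns their sum
  over \<open>e\<close> into the trace of \<Phi>^m(\<Delta>^2) divided by the number of monomials of
  degree \<open>m\<close>. Monotonicity makes both limits exist and agree.\<close>

abbreviation "csubspace \<equiv> complex_vector.subspace"
abbreviation "cspan \<equiv> complex_vector.span"
abbreviation "cdim \<equiv> complex_vector.dim"
abbreviation "lookup \<equiv> Poly_Mapping.lookup"
abbreviation "single \<equiv> Poly_Mapping.single"
abbreviation "keys \<equiv> Poly_Mapping.keys"

lemma sum_fun_apply: "(\<Sum>i\<in>A. f i) k = (\<Sum>i\<in>A. f i k)" by (induction A rule: infinite_finite_induct) auto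

section \<open>Modules over a subring and their finite free resolutions\<close>

definition rsc :: "'r::comm_ring_1 \<Rightarrow> (nat \<Rightarrow> 'r) \<Rightarrow> nat \<Rightarrow> 'r" where
  "rsc p u = (\<lambda>k. p * u k)"

definition lin :: "nat \<Rightarrow> (nat \<Rightarrow> nat \<Rightarrow> 'r::comm_ring_1) \<Rightarrow> (nat \<Rightarrow> 'r) \<Rightarrow> nat \<Rightarrow> 'r" where
  "lin r g u = (\<lambda>k. \<Sum>i<r. u i * g i k)"

text \<open>Free modules of all finite ranks live in one space of sequences, so that maps between
  them share a single type.\<close>

definition frees :: "'r::comm_ring_1 set \<Rightarrow> nat \<Rightarrow> (nat \<Rightarrow> 'r) set" where
  "frees A r = {u. (\<forall>i. u i \<in> A) \<and> (\<forall>i\<ge>r. u i = 0)}"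

definition subring :: "'r::comm_ring_1 set \<Rightarrow> bool" where
  "subring A \<longleftrightarrow> 0 \<in> A \<and> 1 \<in> A \<and> (\<forall>a\<in>A. - a \<in> A) \<and> (\<forall>a\<in>A. \<forall>b\<in>A. a + b \<in> A \<and> a * b \<in> A)"

definition submod :: "'r::comm_ring_1 set \<Rightarrow> (nat \<Rightarrow> 'r) set \<Rightarrow> bool" where
  "submod A K \<longleftrightarrow> 0 \<in> K \<and> (\<forall>u\<in>K. \<forall>v\<in>K. u + v \<in> K) \<and> (\<forall>a\<in>A. \<forall>u\<in>K. rsc a u \<in> K)"

text \<open>The ring is a set \<open>A\<close> inside a fixed type because the syzygy theorem
  inducts over polynomial rings in growing sets of variables. Finiteness of the resolution is that
  of the inductive derivation, so no length has to be carried along.\<close>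

inductive ffr :: "'r::comm_ring_1 set \<Rightarrow> (nat \<Rightarrow> 'r) set \<Rightarrow> bool" for A where
  zero: "ffr A {0}"
| step: "ffr A {u \<in> frees A r. lin r g u = 0} \<Longrightarrow> ffr A (lin r g ` frees A r)"

lemma rsc_simps:
  "rsc p (u + v) = rsc p u + rsc p v" "rsc p (u - v) = rsc p u - rsc p v"
  "rsc (p + q) u = rsc p u + rsc q u" "rsc p (rsc q u) = rsc (p * q) u"
  "rsc p 0 = 0" "rsc 0 u = 0" "rsc 1 u = u" "rsc p (- u) = - rsc p u" by (auto simp: rsc_def fun_eq_iff algebra_simps)

lemma lin_add: "lin r g (u + v) = lin r g u + lin r g v"
  and lin_minus: "lin r g (- u) = - lin r g u"
  and lin_diff: "lin r g (u - v) = lin r g u - lin r g v"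
  and lin_rsc: "lin r g (rsc p u) = rsc p (lin r g u)"
  and lin_zero [simp]: "lin r g 0 = 0"
  by (auto simp: lin_def rsc_def fun_eq_iff algebra_simps sum.distrib sum_negf sum_subtractf sum_distrib_left)

lemma lin_sum: "lin r g (\<Sum>i\<in>I. f i) = (\<Sum>i\<in>I. lin r g (f i))"
  by (auto simp: lin_def fun_eq_iff sum_fun_apply sum_distrib_right intro: sum.swap)

lemma lin_lin: "lin r g (lin t y c) = lin t (\<lambda>i. lin r g (y i)) c"
  unfolding lin_def by (auto simp: fun_eq_iff sum_distrib_left sum_distrib_right mult.assoc intro: sum.swap)

lemma lin_cong: "(\<And>i. i < r \<Longrightarrow> g i = g' i) \<Longrightarrow> lin r g u = lin r g' u"
  by (auto simp: lin_def fun_eq_iff intro!: sum.cong)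

lemma lin_unit: "i < r \<Longrightarrow> lin r g (\<lambda>j. if j = i then 1 else 0) = g i"
  by (auto simp: lin_def fun_eq_iff sum.delta if_distrib[of "\<lambda>x. x * _"] cong: if_cong)

lemma subringD:
  assumes "subring A"
  shows "0 \<in> A" "1 \<in> A" "a \<in> A \<Longrightarrow> - a \<in> A" "a \<in> A \<Longrightarrow> b \<in> A \<Longrightarrow> a + b \<in> A"
    "a \<in> A \<Longrightarrow> b \<in> A \<Longrightarrow> a * b \<in> A" "a \<in> A \<Longrightarrow> b \<in> A \<Longrightarrow> a - b \<in> A"
proof -
  show "a - b \<in> A" if "a \<in> A" "b \<in> A" using assms that unfolding subring_def by (metis diff_conv_add_uminus)
qed (use assms in \<open>auto simp: subring_def\<close>)

lemma subring_power: "subring A \<Longrightarrow> a \<in> A \<Longrightarrow> a ^ l \<in> A"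
  by (induction l) (auto intro: subringD)

lemma unit_frees: "subring A \<Longrightarrow> i < r \<Longrightarrow> (\<lambda>j. if j = i then 1 else 0) \<in> frees A r"
  by (auto simp: frees_def intro: subringD)

lemma frees_0: "subring A \<Longrightarrow> frees A 0 = {0}" by (auto simp: frees_def fun_eq_iff intro: subringD)

lemma frees_closed:
  assumes "subring A"
  shows "0 \<in> frees A r" "u \<in> frees A r \<Longrightarrow> v \<in> frees A r \<Longrightarrow> u + v \<in> frees A r"
    "u \<in> frees A r \<Longrightarrow> v \<in> frees A r \<Longrightarrow> u - v \<in> frees A r"
    "u \<in> frees A r \<Longrightarrow> - u \<in> frees A r"
    "a \<in> A \<Longrightarrow> u \<in> frees A r \<Longrightarrow> rsc a u \<in> frees A r"
  using subringD[OF assms] by (auto simp: frees_def rsc_def)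

lemma submod_minus:
  assumes "subring A" "submod A K" "u \<in> K" shows "- u \<in> K"
proof -
  have "rsc (- 1) u \<in> K" using assms subringD[OF assms(1)] by (auto simp: submod_def)
  moreover have "rsc (- 1) u = - u" by (simp add: rsc_def fun_eq_iff)
  ultimately show ?thesis by simp
qed

lemma submod_diff: "subring A \<Longrightarrow> submod A K \<Longrightarrow> u \<in> K \<Longrightarrow> v \<in> K \<Longrightarrow> u - v \<in> K"
  using submod_minus[of A K v] by (auto simp: submod_def dest: bspec[of _ _ "- v"] simp flip: diff_conv_add_uminus)

lemma submodD:
  assumes "submod A K"
  shows "0 \<in> K" "u \<in> K \<Longrightarrow> v \<in> K \<Longrightarrow> u + v \<in> K" "a \<in> A \<Longrightarrow> u \<in> K \<Longrightarrow> rsc a u \<in> K"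
  using assms by (auto simp: submod_def)

lemma submod_sum: "submod A K \<Longrightarrow> (\<And>i. i \<in> I \<Longrightarrow> f i \<in> K) \<Longrightarrow> sum f I \<in> K"
  by (induction I rule: infinite_finite_induct) (auto intro: submodD)

lemma lin_eq_sum: "lin r g u = (\<Sum>i<r. rsc (u i) (g i))" by (auto simp: lin_def rsc_def fun_eq_iff sum_fun_apply)

lemma lin_in_submod: "submod A K \<Longrightarrow> (\<And>i. i < r \<Longrightarrow> g i \<in> K) \<Longrightarrow> u \<in> frees A r \<Longrightarrow> lin r g u \<in> K"
  unfolding lin_eq_sum by (intro submod_sum) (auto simp: frees_def intro: submodD)

lemma frees_submod: "subring A \<Longrightarrow> submod A (frees A r)" by (auto simp: submod_def intro: frees_closed)

lemma frees_mono: "A \<subseteq> B \<Longrightarrow> frees A r \<subseteq> frees B r" by (auto simp: frees_def)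

lemma lin_image_submod: "subring A \<Longrightarrow> submod A (lin r g ` frees A r)"
  unfolding submod_def by (auto simp: lin_add[symmetric] lin_rsc[symmetric] intro!: imageI frees_closed image_eqI[of 0 _ 0])

lemma generator_in: "subring A \<Longrightarrow> i < r \<Longrightarrow> g i \<in> lin r g ` frees A r"
  using unit_frees lin_unit by (metis image_eqI)

text \<open>Unifies the two constructors: the zero module is presented with rank 0.\<close>

lemma ffr_presentation:
  assumes "subring A" "ffr A K"
  obtains t w where "K = lin t w ` frees A t" "ffr A {c \<in> frees A t. lin t w c = 0}" using assms(2)
proof cases
  case zero
  have "{c \<in> frees A 0. lin 0 (\<lambda>_ _. 0) c = 0} = {0}" "K = lin 0 (\<lambda>_ _. 0) ` frees A 0"
    using zero by (auto simp: frees_0[OF assms(1)])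
  then show ?thesis using that ffr.zero by metis
qed (use that in blast)

(* the horseshoe lemma *)
lemma ffr_extension:
  assumes A: "subring A" and "ffr A K" "ffr A {v \<in> frees A r. lin r z v \<in> K}"
  shows "ffr A {k + lin r z v | k v. k \<in> K \<and> v \<in> frees A r}" using assms(2,3)
proof (induction arbitrary: r z)
  case zero
  have "{k + lin r z v | k v. k \<in> {0} \<and> v \<in> frees A r} = lin r z ` frees A r" by auto
  then show ?case using zero ffr.step[of A r z] by simp
next
  case (step s h r z)
  let ?K = "{u \<in> frees A s. lin s h u = 0}"
  let ?W = "{v \<in> frees A r. lin r z v \<in> lin s h ` frees A s}"
  \<comment> \<open>\<open>?W\<close> collects the \<open>v\<close> for which
    \<open>lin r z v\<close> is already covered by \<open>h\<close>. Its generators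
    \<open>w i\<close>, with lifts \<open>u i\<close> through \<open>h\<close>, give the syzygies
    \<open>(- u i, w i)\<close> of the combined generators.\<close>
  obtain t w where W: "?W = lin t w ` frees A t" and W': "ffr A {c \<in> frees A t. lin t w c = 0}"
    by (rule ffr_presentation[OF A step.prems])
  have "\<exists>u. u \<in> frees A s \<and> lin s h u = lin r z (w i)" if "i < t" for i
    using generator_in[OF A that, of w] W[symmetric] by (auto simp: image_iff)
  then obtain u where u: "\<And>i. i < t \<Longrightarrow> u i \<in> frees A s \<and> lin s h (u i) = lin r z (w i)" by metis
  have wr: "w i \<in> frees A r" if "i < t" for i using generator_in[OF A that, of w] W[symmetric] by auto
  define hz where "hz i = (if i < s then h i else z (i - s))" for i
  define y where "y i k = (if k < s then - u i k else w i (k - s))" for i k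
  have split: "lin (s + r) hz c = lin s h c + lin r z (\<lambda>k. c (k + s))" for c
  proof -
    have "(\<Sum>i<s + r. c i * hz i k) = (\<Sum>i<s. c i * hz i k) + (\<Sum>i<r. c (i + s) * hz (i + s) k)" for k
    proof (induction r)
      case (Suc r)
      then show ?case by (simp add: add.commute add.left_commute)
    qed simp
    then show ?thesis by (auto simp: lin_def fun_eq_iff hz_def)
  qed
  have split': "lin (s + r) hz c = lin s h (\<lambda>k. if k < s then c k else 0) + lin r z (\<lambda>k. c (k + s))" for c
    unfolding split by (simp add: lin_def fun_eq_iff)
  have yf: "y i \<in> frees A (s + r)" if "i < t" for i
    using u[OF that] wr[OF that] subringD[OF A] by (auto simp: frees_def y_def)
  have y0: "lin (s + r) hz (y i) = 0" if "i < t" for i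
  proof -
    have "(\<lambda>k. if k < s then y i k else 0) = - u i" using u[OF that] by (auto simp: y_def fun_eq_iff frees_def)
    moreover have "(\<lambda>k. y i (k + s)) = w i" by (auto simp: y_def)
    ultimately show ?thesis unfolding split' by (simp add: lin_minus u[OF that])
  qed
  have hy: "lin (s + r) hz (lin t y c) = 0" for c
    unfolding lin_lin using y0 lin_cong[of t "\<lambda>i. lin (s + r) hz (y i)" "\<lambda>_. 0"]
    by (auto simp: lin_def fun_eq_iff)
  have hK: "lin (s + r) hz k = lin s h k" if "k \<in> frees A s" for k
  proof -
    have "(\<lambda>i. k (i + s)) = 0" using that by (auto simp: frees_def fun_eq_iff)
    then show ?thesis by (simp only: split lin_zero add_0_right)
  qed
  have yw: "lin t y c (k + s) = lin t w c k" for c k by (simp add: lin_def y_def)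
  have ytf: "lin t y c \<in> frees A (s + r)" if "c \<in> frees A t" for c
    by (rule lin_in_submod[OF frees_submod[OF A] yf that])
  have sr: "frees A s \<subseteq> frees A (s + r)" by (auto simp: frees_def)
  \<comment> \<open>The kernel of the combined map is again an extension: a syzygy of
    \<open>h\<close> alone plus a combination of the \<open>y i\<close>. Hence the induction keeps
    \<open>r\<close> and \<open>z\<close> arbitrary.\<close>
  have Y: "{c \<in> frees A (s + r). lin (s + r) hz c = 0} = {k + lin t y c | k c. k \<in> ?K \<and> c \<in> frees A t}"
  proof (intro equalityI subsetI)
    fix c assume "c \<in> {c \<in> frees A (s + r). lin (s + r) hz c = 0}"
    then have c: "c \<in> frees A (s + r)" "lin (s + r) hz c = 0" by auto
    let ?c2 = "\<lambda>k. c (k + s)" and ?c1 = "\<lambda>k. if k < s then c k else 0"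
    have c1: "?c1 \<in> frees A s" "?c2 \<in> frees A r" using c(1) subringD[OF A] by (auto simp: frees_def)
    have "lin r z ?c2 = lin s h (- ?c1)"
      unfolding lin_minus using c(2)[unfolded split'] by (metis add.inverse_unique)
    then have "?c2 \<in> ?W" using c1 frees_closed(4)[OF A c1(1)] by blast
    then obtain e where e: "e \<in> frees A t" "?c2 = lin t w e" unfolding W by auto
    have k: "c - lin t y e \<in> frees A (s + r)" using c ytf[OF e(1)] frees_closed[OF A] by blast
    have "c k = lin t y e k" if "k \<ge> s" for k using yw[of e "k - s"] fun_cong[OF e(2), of "k - s"] that by simp
    then have k': "c - lin t y e \<in> frees A s" using k by (auto simp: frees_def)
    then have "lin s h (c - lin t y e) = 0" using hK[OF k'] c(2) hy[of e] by (simp add: lin_diff)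
    then have "c - lin t y e \<in> ?K" using k' by auto
    moreover have "c = (c - lin t y e) + lin t y e" by simp
    ultimately show "c \<in> {k + lin t y c | k c. k \<in> ?K \<and> c \<in> frees A t}" using e(1) by blast
  next
    fix c assume "c \<in> {k + lin t y c | k c. k \<in> ?K \<and> c \<in> frees A t}"
    then show "c \<in> {c \<in> frees A (s + r). lin (s + r) hz c = 0}"
      using sr by (auto simp: lin_add hK hy intro!: frees_closed[OF A] ytf)
  qed
  \<comment> \<open>A combination of the \<open>y i\<close> is a syzygy of \<open>h\<close> alone
    exactly if its second block vanishes, that is, if it comes from a relation among the
    \<open>w i\<close>; those are resolved by \<open>W'\<close>.\<close>
  have "{c \<in> frees A t. lin t y c \<in> ?K} = {c \<in> frees A t. lin t w c = 0}"
  proof (intro Collect_cong conj_cong refl iffI)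
    fix c assume "lin t y c \<in> ?K"
    then show "lin t w c = 0" by (auto simp: yw[symmetric] fun_eq_iff frees_def)
  next
    fix c assume c: "c \<in> frees A t" and 0: "lin t w c = 0"
    have "lin t y c k = 0" if "k \<ge> s" for k using yw[of c "k - s"] that 0 by simp
    then have "lin t y c \<in> frees A s" using ytf[OF c] by (auto simp: frees_def)
    then show "lin t y c \<in> ?K" using hy[of c] hK by auto
  qed
  then have "ffr A {c \<in> frees A (s + r). lin (s + r) hz c = 0}"
    unfolding Y by (intro step.IH) (simp add: W')
  then have "ffr A (lin (s + r) hz ` frees A (s + r))" by (rule ffr.step)
  also have "lin (s + r) hz ` frees A (s + r) = {k + lin r z v | k v. k \<in> lin s h ` frees A s \<and> v \<in> frees A r}"
  proof (intro equalityI subsetI)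
    fix x assume "x \<in> lin (s + r) hz ` frees A (s + r)"
    then obtain c where c: "c \<in> frees A (s + r)" "x = lin (s + r) hz c" by auto
    have "(\<lambda>k. if k < s then c k else 0) \<in> frees A s" "(\<lambda>k. c (k + s)) \<in> frees A r"
      using c(1) subringD[OF A] by (auto simp: frees_def)
    then show "x \<in> {k + lin r z v | k v. k \<in> lin s h ` frees A s \<and> v \<in> frees A r}"
      unfolding c(2) split' by blast
  next
    fix x assume "x \<in> {k + lin r z v | k v. k \<in> lin s h ` frees A s \<and> v \<in> frees A r}"
    then obtain a v where av: "x = lin s h a + lin r z v" "a \<in> frees A s" "v \<in> frees A r" by auto
    define c where "c k = (if k < s then a k else v (k - s))" for k
    have "c \<in> frees A (s + r)" using av by (auto simp: frees_def c_def)
    moreover have "(\<lambda>k. if k < s then c k else 0) = a" "(\<lambda>k. c (k + s)) = v"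
      using av by (auto simp: c_def frees_def fun_eq_iff)
    ultimately have "c \<in> frees A (s + r)" "x = lin (s + r) hz c" using av(1) split'[of c] by simp_all
    then show "x \<in> lin (s + r) hz ` frees A (s + r)" by blast
  qed
  finally show ?case .
qed

section \<open>Adjoining one variable: B = A[x] described by coefficient functions\<close>

locale poly_ext =
  fixes A B :: "'r::comm_ring_1 set" and x :: 'r and cx :: "nat \<Rightarrow> 'r \<Rightarrow> 'r"
  assumes A: "subring A" and B: "subring B" and AB: "A \<subseteq> B" and xB: "x \<in> B"
    and cx_add: "cx l (p + q) = cx l p + cx l q"
    and cx_mult: "a \<in> A \<Longrightarrow> cx l (a * p) = a * cx l p"
    and cx_one: "cx l 1 = (if l = 0 then 1 else 0)"
    and cx_x: "cx l (x * p) = (case l of 0 \<Rightarrow> 0 | Suc l' \<Rightarrow> cx l' p)"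
    and cx_in: "p \<in> B \<Longrightarrow> cx l p \<in> A"
    and cx_fin: "p \<in> B \<Longrightarrow> \<exists>N. \<forall>l\<ge>N. cx l p = 0"
    and cx_exp: "p \<in> B \<Longrightarrow> (\<forall>l\<ge>N. cx l p = 0) \<Longrightarrow> p = (\<Sum>l<N. x ^ l * cx l p)"
begin

definition vcx :: "nat \<Rightarrow> (nat \<Rightarrow> 'r) \<Rightarrow> nat \<Rightarrow> 'r" where
  "vcx l u = (\<lambda>k. cx l (u k))"

lemma cx_0 [simp]: "cx l 0 = 0" using cx_add[of l 0 0] by simp

lemma cx_minus: "cx l (- p) = - cx l p" using cx_add[of l p "- p"] by (simp add: eq_neg_iff_add_eq_0 add.commute)

lemma cx_sum: "cx l (sum f I) = (\<Sum>i\<in>I. cx l (f i))"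
  by (induction I rule: infinite_finite_induct) (auto simp: cx_add)

lemma cx_A: "a \<in> A \<Longrightarrow> cx l a = (if l = 0 then a else 0)" using cx_mult[of a l 1] by (simp add: cx_one)

lemma cx_xpow: "cx l (x ^ m * p) = (if m \<le> l then cx (l - m) p else 0)"
  by (induction m arbitrary: l) (auto simp: cx_x mult.assoc split: nat.split)

lemma vcx_add: "vcx l (u + v) = vcx l u + vcx l v"
  and vcx_minus: "vcx l (- u) = - vcx l u"
  and vcx_0 [simp]: "vcx l 0 = 0"
  and vcx_rsc: "a \<in> A \<Longrightarrow> vcx l (rsc a u) = rsc a (vcx l u)"
  and vcx_x: "vcx l (rsc x u) = (case l of 0 \<Rightarrow> 0 | Suc l' \<Rightarrow> vcx l' u)"
  and vcx_xpow: "vcx l (rsc (x ^ m) u) = (if m \<le> l then vcx (l - m) u else 0)"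
  by (auto simp: vcx_def fun_eq_iff cx_add cx_minus rsc_def cx_mult cx_x cx_xpow split: nat.split)

lemma vcx_diff: "vcx l (u - v) = vcx l u - vcx l v" using vcx_add[of l u "- v"] by (simp add: vcx_minus)

lemma vcx_sum: "vcx l (sum f I) = (\<Sum>i\<in>I. vcx l (f i))" by (auto simp: vcx_def fun_eq_iff sum_fun_apply cx_sum)

lemma vcx_in: "u \<in> frees B r \<Longrightarrow> vcx l u \<in> frees A r" by (auto simp: frees_def vcx_def cx_in)

lemma vcx_A: "u \<in> frees A r \<Longrightarrow> vcx l u = (if l = 0 then u else 0)"
  by (auto simp: frees_def vcx_def cx_A fun_eq_iff)

lemma vcx_fin:
  assumes "u \<in> frees B r" shows "\<exists>N. \<forall>l\<ge>N. vcx l u = 0"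
proof -
  have "\<forall>k. \<exists>N. \<forall>l\<ge>N. cx l (u k) = 0" using cx_fin assms by (auto simp: frees_def)
  then obtain N where N: "\<And>k l. l \<ge> N k \<Longrightarrow> cx l (u k) = 0" by metis
  have "vcx l u = 0" if "l \<ge> Max (N ` {..r})" for l
  proof (rule ext)
    fix k show "vcx l u k = 0 k"
    proof (cases "k < r")
      case True
      then have "N k \<le> Max (N ` {..r})" by (intro Max_ge) auto
      then show ?thesis using N[of k l] that by (simp add: vcx_def)
    qed (use assms in \<open>auto simp: frees_def vcx_def\<close>)
  qed
  then show ?thesis by blast
qed

lemma vcx_exp:
  assumes "u \<in> frees B r" "\<And>l. l \<ge> N \<Longrightarrow> vcx l u = 0"
  shows "u = (\<Sum>l<N. rsc (x ^ l) (vcx l u))"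
proof
  fix k
  have "\<forall>l\<ge>N. cx l (u k) = 0" using assms(2) by (auto simp: vcx_def fun_eq_iff)
  then have "u k = (\<Sum>l<N. x ^ l * cx l (u k))" using assms(1) cx_exp by (auto simp: frees_def)
  then show "u k = (\<Sum>l<N. rsc (x ^ l) (vcx l u)) k" by (simp add: sum_fun_apply rsc_def vcx_def)
qed

lemma vcx_eq_0: "u \<in> frees B r \<Longrightarrow> (\<And>l. vcx l u = 0) \<Longrightarrow> u = 0"
  using vcx_exp[of u r 0] by simp

lemma x_inj: "u \<in> frees B r \<Longrightarrow> rsc x u = 0 \<Longrightarrow> u = 0"
proof (rule vcx_eq_0)
  fix l assume "rsc x u = 0"
  then show "vcx l u = 0" using vcx_x[of "Suc l" u] by simp
qed

lemma vcx_lin: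
  assumes "\<And>i k. i < r \<Longrightarrow> g i k \<in> A"
  shows "vcx l (lin r g v) = lin r g (vcx l v)"
proof
  fix k
  have "cx l (\<Sum>i<r. v i * g i k) = (\<Sum>i<r. g i k * cx l (v i))"
    unfolding cx_sum by (intro sum.cong refl, subst mult.commute) (use assms cx_mult in auto)
  then show "vcx l (lin r g v) k = lin r g (vcx l v) k" by (simp add: vcx_def lin_def mult.commute)
qed

text \<open>This is K[x], the base change of \<open>K\<close> from \<open>A\<close> to
  \<open>A[x]\<close>, realised inside the free module over \<open>B\<close>.\<close>

definition scext :: "nat \<Rightarrow> (nat \<Rightarrow> 'r) set \<Rightarrow> (nat \<Rightarrow> 'r) set" where
  "scext r K = {u \<in> frees B r. \<forall>l. vcx l u \<in> K}"

lemma frees_AB: "u \<in> frees A r \<Longrightarrow> u \<in> frees B r" using frees_mono[OF AB] by blast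

lemma xpow_B: "x ^ l \<in> B" using subring_power[OF B xB] .

text \<open>Base change to \<open>A[x]\<close> is exact: maps with entries in \<open>A\<close>
  commute with \<open>vcx\<close>, so images and kernels can be computed coefficient by coefficient,
  with the same generators.\<close>

lemma ffr_scext:
  assumes "ffr A K" "K \<subseteq> frees A r"
  shows "ffr B (scext r K)" using assms
proof (induction arbitrary: r)
  case zero
  have "scext r {0} = {0}" using vcx_eq_0 by (auto simp: scext_def intro: frees_closed[OF B])
  then show ?case using ffr.zero by simp
next
  case (step s h r)
  have hr: "h i \<in> frees A r" if "i < s" for i using generator_in[OF A that, of h] step.prems by auto
  have hA: "h i k \<in> A" if "i < s" for i k using hr[OF that] by (auto simp: frees_def)
  have "scext r (lin s h ` frees A s) = lin s h ` frees B s"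
  proof (intro equalityI subsetI)
    fix u assume u: "u \<in> scext r (lin s h ` frees A s)"
    then have uB: "u \<in> frees B r" and "\<forall>l. \<exists>v. v \<in> frees A s \<and> vcx l u = lin s h v"
      by (auto simp: scext_def image_iff Bex_def)
    then obtain v where v: "\<And>l. v l \<in> frees A s \<and> vcx l u = lin s h (v l)" by metis
    obtain N where N: "\<forall>l\<ge>N. vcx l u = 0" using vcx_fin[OF uB] by blast
    define w where "w = (\<Sum>l<N. rsc (x ^ l) (v l))"
    have "u = (\<Sum>l<N. rsc (x ^ l) (vcx l u))" by (rule vcx_exp[OF uB]) (use N in blast)
    also have "\<dots> = lin s h w"
      unfolding w_def lin_sum lin_rsc by (intro sum.cong refl arg_cong2[where f = rsc]) (use v in blast)
    finally have "u = lin s h w" .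
    moreover have "w \<in> frees B s"
      unfolding w_def using v by (intro submod_sum[OF frees_submod[OF B]] frees_closed(5)[OF B] xpow_B frees_AB) blast
    ultimately show "u \<in> lin s h ` frees B s" by blast
  next
    fix u assume "u \<in> lin s h ` frees B s"
    then obtain v where v: "v \<in> frees B s" "u = lin s h v" by auto
    have "u \<in> frees B r" unfolding v(2) by (rule lin_in_submod[OF frees_submod[OF B] _ v(1)]) (use hr frees_AB in blast)
    moreover have "vcx l u \<in> lin s h ` frees A s" for l
      unfolding v(2) using vcx_in[OF v(1), of l] by (subst vcx_lin) (use hA in auto)
    ultimately show "u \<in> scext r (lin s h ` frees A s)" by (auto simp: scext_def)
  qed
  moreover have "{v \<in> frees B s. lin s h v = 0} = scext s {v \<in> frees A s. lin s h v = 0}"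
  proof (intro equalityI subsetI)
    fix v assume "v \<in> {v \<in> frees B s. lin s h v = 0}"
    then show "v \<in> scext s {v \<in> frees A s. lin s h v = 0}"
      using vcx_lin[of s h _ v] hA by (auto simp: scext_def vcx_in)
  next
    fix v assume "v \<in> scext s {v \<in> frees A s. lin s h v = 0}"
    then have v: "v \<in> frees B s" "\<And>l. lin s h (vcx l v) = 0" by (simp_all add: scext_def)
    have "lin s h v = 0"
    proof (rule vcx_eq_0)
      show "lin s h v \<in> frees B r" by (rule lin_in_submod[OF frees_submod[OF B] _ v(1)]) (rule frees_AB[OF hr])
      show "vcx l (lin s h v) = 0" for l using vcx_lin[of s h l v] hA v(2) by simp
    qed
    with v(1) show "v \<in> {v \<in> frees B s. lin s h v = 0}" by simp
  qed
  moreover have "ffr B (scext s {v \<in> frees A s. lin s h v = 0})" by (rule step.IH) blast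
  ultimately show ?case using ffr.step[of B s h] by simp
qed

end

section \<open>Submodules over A[x] from submodules over A\<close>

context poly_ext
begin

context
  fixes K :: "(nat \<Rightarrow> 'r) set" and q :: nat
  assumes IH: "\<And>q K. submod A K \<Longrightarrow> K \<subseteq> frees A q \<Longrightarrow> ffr A K"
    and K: "submod B K" "K \<subseteq> frees B q"
begin

text \<open>The degree in \<open>x\<close> is below \<open>j\<close>, not at most \<open>j\<close>,
  so that \<open>degl 0\<close> is the zero module and the induction on \<open>j\<close> starts at
  the constructor \<open>zero\<close>.\<close>

definition "degl j = {u \<in> K. \<forall>l\<ge>j. vcx l u = 0}"

lemma degl_submod: "submod A (degl j)"
  unfolding submod_def degl_def using submodD[OF K(1)] AB by (auto simp: vcx_add vcx_rsc rsc_simps)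

lemma degl_0: "degl 0 = {0}"
proof -
  have "u = 0" if "u \<in> degl 0" for u by (rule vcx_eq_0[of u q]) (use that K(2) in \<open>auto simp: degl_def\<close>)
  moreover have "0 \<in> degl 0" using submodD(1)[OF K(1)] by (simp add: degl_def)
  ultimately show ?thesis by blast
qed

lemma degl_Suc: "u \<in> degl j \<longleftrightarrow> u \<in> degl (Suc j) \<and> vcx j u = 0"
  unfolding degl_def using le_eq_less_or_eq[of j] by (auto simp: Suc_le_eq)

text \<open>Since \<open>degl (Suc j)\<close> admits degrees up to \<open>j\<close>, this is the
  quotient of \<open>degl (Suc j)\<close> by \<open>degl j\<close>, embedded in a free module over
  \<open>A\<close>.\<close>

definition "lead j = vcx j ` degl (Suc j)"

lemma lead_submod: "submod A (lead j)"
  unfolding submod_def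
proof (intro conjI ballI)
  show "0 \<in> lead j"
    unfolding lead_def using submodD(1)[OF degl_submod] by (metis imageI vcx_0)
  show "u + v \<in> lead j" if "u \<in> lead j" "v \<in> lead j" for u v
    using that submodD(2)[OF degl_submod] unfolding lead_def by (auto simp: vcx_add[symmetric])
  show "rsc a u \<in> lead j" if "a \<in> A" "u \<in> lead j" for a u
    using that submodD(3)[OF degl_submod] unfolding lead_def by (auto simp: vcx_rsc[symmetric])
qed

lemma lead_sub: "lead j \<subseteq> frees A q" using K(2) vcx_in by (auto simp: lead_def degl_def)

text \<open>Here \<open>degl j\<close> is resolved as a module over \<open>A\<close>, although its
  coordinates lie in \<open>B\<close>. The extension lemma climbs along
  \<open>degl j \<subseteq> degl (Suc j)\<close>, whose quotient \<open>lead j\<close> is resolvable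
  by \<open>IH\<close>.\<close>

lemma ffr_degl: "ffr A (degl j)"
proof (induction j)
  case 0
  show ?case unfolding degl_0 by (rule ffr.zero)
next
  case (Suc j)
  obtain s h where h: "lead j = lin s h ` frees A s" and h': "ffr A {c \<in> frees A s. lin s h c = 0}"
    by (rule ffr_presentation[OF A IH[OF lead_submod lead_sub]])
  have "\<forall>i. i < s \<longrightarrow> (\<exists>z. z \<in> degl (Suc j) \<and> vcx j z = h i)"
  proof (intro allI impI)
    fix i assume "i < s"
    then have "h i \<in> lead j" using generator_in[OF A, of i s h] h by blast
    then obtain z where "h i = vcx j z" "z \<in> degl (Suc j)" unfolding lead_def by (rule imageE)
    then show "\<exists>z. z \<in> degl (Suc j) \<and> vcx j z = h i" by metis
  qed
  then obtain z where z: "\<And>i. i < s \<Longrightarrow> z i \<in> degl (Suc j)" "\<And>i. i < s \<Longrightarrow> vcx j (z i) = h i"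
    by metis
  have vz: "vcx l (lin s z v) = lin s (\<lambda>i. vcx l (z i)) v" if "v \<in> frees A s" for l v
    unfolding lin_eq_sum vcx_sum by (intro sum.cong refl vcx_rsc) (use that in \<open>auto simp: frees_def\<close>)
  have vzj: "vcx j (lin s z v) = lin s h v" if "v \<in> frees A s" for v
    unfolding vz[OF that] by (rule lin_cong) (rule z)
  have zs: "lin s z v \<in> degl (Suc j)" if "v \<in> frees A s" for v by (rule lin_in_submod[OF degl_submod z(1) that])
  note dS = degl_Suc[of _ j]
  have "{v \<in> frees A s. lin s z v \<in> degl j} = {v \<in> frees A s. lin s h v = 0}"
    unfolding dS using zs vzj by auto
  with h' have "ffr A {v \<in> frees A s. lin s z v \<in> degl j}" by simp
  from ffr_extension[OF A Suc this]
  have "ffr A {k + lin s z v |k v. k \<in> degl j \<and> v \<in> frees A s}" .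
  also have "{k + lin s z v |k v. k \<in> degl j \<and> v \<in> frees A s} = degl (Suc j)"
  proof (intro equalityI subsetI)
    fix u assume "u \<in> {k + lin s z v |k v. k \<in> degl j \<and> v \<in> frees A s}"
    then show "u \<in> degl (Suc j)" using zs dS submodD(2)[OF degl_submod] by blast
  next
    fix u assume u: "u \<in> degl (Suc j)"
    then have "vcx j u \<in> lin s h ` frees A s" unfolding h[symmetric] lead_def by blast
    then obtain v where v: "v \<in> frees A s" "vcx j u = lin s h v" by blast
    have "u - lin s z v \<in> degl j"
      unfolding dS using v vzj[OF v(1)] submod_diff[OF A degl_submod u zs[OF v(1)]] by (simp add: vcx_diff)
    moreover have "u = (u - lin s z v) + lin s z v" by simp
    ultimately show "u \<in> {k + lin s z v |k v. k \<in> degl j \<and> v \<in> frees A s}" using v(1) by blast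
  qed
  finally show ?case .
qed

lemma degl_mono: "j \<le> j' \<Longrightarrow> degl j \<subseteq> degl j'" by (auto simp: degl_def)

lemma degl_x: "u \<in> degl j \<Longrightarrow> rsc x u \<in> degl (Suc j)"
  using submodD(3)[OF K(1) xB] by (auto simp: degl_def vcx_x split: nat.split)

text \<open>Multiplication by \<open>x\<close> raises the degree and keeps the leading
  coefficient.\<close>

lemma lead_mono: "j \<le> j' \<Longrightarrow> lead j \<subseteq> lead j'"
proof (rule lift_Suc_mono_le[of lead])
  fix j show "lead j \<subseteq> lead (Suc j)"
  proof
    fix c assume "c \<in> lead j"
    then obtain u where u: "u \<in> degl (Suc j)" "c = vcx j u" by (auto simp: lead_def)
    then have "c = vcx (Suc j) (rsc x u)" by (simp add: vcx_x)
    then show "c \<in> lead (Suc j)" using degl_x[OF u(1)] by (auto simp: lead_def)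
  qed
qed

text \<open>The Noetherian step of Hilbert's basis theorem: the union of the increasing modules is
  finitely generated by \<open>IH\<close>, and its generators all occur at one stage.\<close>

lemma lead_stable: "\<exists>J. \<forall>j. lead j \<subseteq> lead J"
proof -
  have "submod A (\<Union>j. lead j)"
    unfolding submod_def
  proof (intro conjI ballI)
    show "0 \<in> (\<Union>j. lead j)" using submodD(1)[OF lead_submod] by blast
    show "rsc a u \<in> (\<Union>j. lead j)" if "a \<in> A" "u \<in> (\<Union>j. lead j)" for a u
      using that submodD(3)[OF lead_submod] by blast
    fix u v assume "u \<in> (\<Union>j. lead j)" "v \<in> (\<Union>j. lead j)"
    then obtain i j where "u \<in> lead i" "v \<in> lead j" by blast
    then have "u \<in> lead (max i j)" "v \<in> lead (max i j)"
      using lead_mono[of i "max i j"] lead_mono[of j "max i j"] by auto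
    then show "u + v \<in> (\<Union>j. lead j)" using submodD(2)[OF lead_submod] by blast
  qed
  moreover have "(\<Union>j. lead j) \<subseteq> frees A q" using lead_sub by blast
  ultimately obtain s h where h: "(\<Union>j. lead j) = lin s h ` frees A s" using ffr_presentation[OF A IH] by metis
  have "\<forall>i. i < s \<longrightarrow> (\<exists>j. h i \<in> lead j)" using generator_in[OF A, of _ s h] h[symmetric] by blast
  then obtain j where j: "\<And>i. i < s \<Longrightarrow> h i \<in> lead (j i)" by metis
  define J where "J = Max (j ` {..<s})"
  have "h i \<in> lead J" if "i < s" for i
  proof -
    have "j i \<le> J" unfolding J_def using that by (intro Max_ge) auto
    then show ?thesis using j[OF that] lead_mono by blast
  qed
  then have "lin s h ` frees A s \<subseteq> lead J" using lin_in_submod[OF lead_submod, of s h] by blast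
  then show ?thesis using h by blast
qed

text \<open>With \<open>J\<close> from \<open>lead_stable\<close>, the sequence \<open>0 -> B
  \<otimes> degl J -> B \<otimes> degl (Suc J) -> K -> 0\<close> is exact, the first map sending
  \<open>1 \<otimes> m\<close> to \<open>x \<otimes> m - 1 \<otimes> x m\<close>. Presentations over
  \<open>A\<close> of the two modules on the left turn it into an extension of the kind treated by
  \<open>ffr_extension\<close>.\<close>

lemma ffr_B: "ffr B K"
proof -
  obtain J where J: "\<And>j. lead j \<subseteq> lead J" using lead_stable by blast
  obtain r g where g: "degl (Suc J) = lin r g ` frees A r" and g': "ffr A {c \<in> frees A r. lin r g c = 0}"
    by (rule ffr_presentation[OF A ffr_degl])
  obtain r' f where f: "degl J = lin r' f ` frees A r'" and f': "ffr A {c \<in> frees A r'. lin r' f c = 0}"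
    by (rule ffr_presentation[OF A ffr_degl])
  let ?K1 = "{c \<in> frees A r. lin r g c = 0}" and ?K2 = "{c \<in> frees A r'. lin r' f c = 0}"
  have gK: "g i \<in> degl (Suc J)" if "i < r" for i using generator_in[OF A that] g by blast
  have gB: "g i \<in> K" if "i < r" for i using gK[OF that] by (simp add: degl_def)
  have fJ: "f i \<in> degl J" if "i < r'" for i using generator_in[OF A that] f by blast
  \<comment> \<open>The leading coefficient of \<open>u\<close> already occurs in degree
    \<open>J\<close>; subtracting a power of \<open>x\<close> times an element of
    \<open>degl (Suc J)\<close> lowers the degree.\<close>
  have gen: "u \<in> lin r g ` frees B r" if "u \<in> degl (Suc J + d)" for u d using that
  proof (induction d arbitrary: u)
    case 0
    then have "u \<in> lin r g ` frees A r" using g by simp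
    then show ?case using frees_mono[OF AB] by blast
  next
    case (Suc d)
    have "vcx (Suc (J + d)) u \<in> lead J" using J[of "Suc (J + d)"] Suc.prems unfolding lead_def by auto
    then obtain u' where u': "u' \<in> degl (Suc J)" "vcx J u' = vcx (Suc (J + d)) u" by (auto simp: lead_def)
    have uK: "u \<in> K" "u' \<in> K" "rsc (x ^ Suc d) u' \<in> K"
      using Suc.prems u' submodD(3)[OF K(1) xpow_B, of _ "Suc d"] by (auto simp: degl_def simp del: power_Suc)
    have "u - rsc (x ^ Suc d) u' \<in> degl (Suc J + d)"
      unfolding degl_def
    proof (intro CollectI conjI allI impI)
      show "u - rsc (x ^ Suc d) u' \<in> K" by (rule submod_diff[OF B K(1) uK(1,3)])
      fix l assume l: "Suc J + d \<le> l"
      show "vcx l (u - rsc (x ^ Suc d) u') = 0"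
      proof (cases "l = Suc J + d")
        case True
        then show ?thesis using u'(2) by (simp add: vcx_diff vcx_xpow del: power_Suc)
      next
        case False
        then have "vcx l u = 0" "vcx (l - Suc d) u' = 0" using l Suc.prems u' by (auto simp: degl_def)
        then show ?thesis by (simp add: vcx_diff vcx_xpow del: power_Suc)
      qed
    qed
    from Suc.IH[OF this] have 1: "u - rsc (x ^ Suc d) u' \<in> lin r g ` frees B r" .
    have "u' \<in> lin r g ` frees B r" using u'(1) g frees_mono[OF AB] by blast
    then have "rsc (x ^ Suc d) u' \<in> lin r g ` frees B r" using submodD(3)[OF lin_image_submod[OF B] xpow_B] by blast
    from submodD(2)[OF lin_image_submod[OF B] 1 this] show ?case by simp
  qed
  have Kg: "K = lin r g ` frees B r"
  proof (intro equalityI subsetI)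
    fix u assume u: "u \<in> K"
    obtain N where N: "\<forall>l\<ge>N. vcx l u = 0" using vcx_fin K(2) u by blast
    then have "u \<in> degl (Suc J + N)" using u by (auto simp: degl_def)
    then show "u \<in> lin r g ` frees B r" by (rule gen)
  next
    fix u assume "u \<in> lin r g ` frees B r"
    then show "u \<in> K" using lin_in_submod[OF K(1), of r g] gB by blast
  qed
  have "\<forall>i. i < r' \<longrightarrow> (\<exists>a. a \<in> frees A r \<and> f i = lin r g a)"
    using fJ degl_mono[OF le_SucI[OF order_refl], of J] unfolding g by blast
  then obtain a where a: "\<And>i. i < r' \<Longrightarrow> a i \<in> frees A r" "\<And>i. i < r' \<Longrightarrow> lin r g (a i) = f i" by metis
  have "\<forall>i. i < r' \<longrightarrow> (\<exists>a. a \<in> frees A r \<and> rsc x (f i) = lin r g a)"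
    using fJ degl_x g by blast
  then obtain b where b: "\<And>i. i < r' \<Longrightarrow> b i \<in> frees A r" "\<And>i. i < r' \<Longrightarrow> lin r g (b i) = rsc x (f i)" by metis
  have aA: "\<And>i k. i < r' \<Longrightarrow> a i k \<in> A" and bA: "\<And>i k. i < r' \<Longrightarrow> b i k \<in> A"
    using a(1) b(1) by (auto simp: frees_def)
  have lga: "lin r g (lin r' a v) = lin r' f v" for v
    unfolding lin_lin by (rule lin_cong) (rule a(2))
  have lgb: "lin r g (lin r' b v) = rsc x (lin r' f v)" for v
  proof -
    have "lin r' (\<lambda>i. rsc x (f i)) v = rsc x (lin r' f v)"
      by (simp add: lin_def rsc_def sum_distrib_left mult.left_commute)
    then show ?thesis unfolding lin_lin using lin_cong[of r' "\<lambda>i. lin r g (b i)", OF b(2)] by simp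
  qed
  \<comment> \<open>\<open>a i\<close> and \<open>b i\<close> lift \<open>f i\<close> and
    \<open>x\<close> times \<open>f i\<close> to \<open>frees A r\<close>. So \<open>z i\<close>
    represents the image of the generator \<open>f i\<close> under
    \<open>m -> x \<otimes> m - 1 \<otimes> x m\<close>; these are the relations over
    \<open>B\<close> that do not come from \<open>A\<close>.\<close>
  define z where "z i = rsc x (a i) - b i" for i
  have lz: "lin r' z v = rsc x (lin r' a v) - lin r' b v" for v
    by (simp add: lin_def z_def rsc_def fun_eq_iff sum_distrib_left sum_subtractf right_diff_distrib mult.left_commute)
  have lgz: "lin r g (lin r' z v) = 0" for v
    unfolding lz lin_diff lin_rsc lga lgb by simp
  have laF: "lin r' a v \<in> frees A r" if "v \<in> frees A r'" for v
    by (rule lin_in_submod[OF frees_submod[OF A] a(1) that])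
  have lbF: "lin r' b v \<in> frees A r" if "v \<in> frees A r'" for v
    by (rule lin_in_submod[OF frees_submod[OF A] b(1) that])
  have laB: "lin r' a v \<in> frees B r" if "v \<in> frees B r'" for v
    by (rule lin_in_submod[OF frees_submod[OF B] frees_AB[OF a(1)] that])
  have lbB: "lin r' b v \<in> frees B r" if "v \<in> frees B r'" for v
    by (rule lin_in_submod[OF frees_submod[OF B] frees_AB[OF b(1)] that])
  have lzB: "lin r' z v \<in> frees B r" if "v \<in> frees B r'" for v
    unfolding lz by (intro frees_closed(3)[OF B] frees_closed(5)[OF B] xB laB lbB that)
  have expand: "lin r g u = (\<Sum>l<N. rsc (x ^ l) (lin r g (vcx l u)))"
    if "u \<in> frees B r" "\<And>l. l \<ge> N \<Longrightarrow> vcx l u = 0" for u N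
  proof -
    have "lin r g u = lin r g (\<Sum>l<N. rsc (x ^ l) (vcx l u))" using vcx_exp[OF that] by simp
    then show ?thesis by (simp only: lin_sum lin_rsc)
  qed
  have extK1: "lin r g k = 0" if "k \<in> scext r ?K1" for k
  proof -
    have k: "k \<in> frees B r" "\<And>l. lin r g (vcx l k) = 0" using that by (auto simp: scext_def)
    obtain N where "\<forall>l\<ge>N. vcx l k = 0" using vcx_fin[OF k(1)] by blast
    then have "lin r g k = (\<Sum>l<N. rsc (x ^ l) (lin r g (vcx l k)))" using expand[OF k(1)] by blast
    also have "\<dots> = 0" unfolding k(2) rsc_simps by (rule sum.neutral) simp
    finally show ?thesis .
  qed
  have scext_add: "u + v \<in> scext r ?K1" if "u \<in> scext r ?K1" "v \<in> scext r ?K1" for u v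
    using that frees_closed(2)[OF A] frees_closed(2)[OF B] by (auto simp: scext_def vcx_add lin_add)
  let ?Z = "{u \<in> frees B r. lin r g u = 0}"
  have dec: "\<exists>k v. k \<in> scext r ?K1 \<and> v \<in> frees B r' \<and> u = k + lin r' z v"
    if "u \<in> ?Z" "\<forall>l>N. vcx l u = 0" for u N using that
  proof (induction N arbitrary: u)
    case 0
    then have u: "u \<in> frees B r" "lin r g u = 0" by auto
    have "u = (\<Sum>l<1. rsc (x ^ l) (vcx l u))" by (rule vcx_exp[OF u(1)]) (use 0 in auto)
    then have u0: "u = vcx 0 u" by (simp add: rsc_simps)
    then have uA: "u \<in> frees A r" using vcx_in[OF u(1), of 0] by simp
    have "u \<in> scext r ?K1"
      unfolding scext_def using u uA frees_closed(1)[OF A] by (auto simp: vcx_A)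
    moreover have "u = u + lin r' z 0" by simp
    ultimately show ?case using frees_closed(1)[OF B] by blast
  next
    case (Suc N)
    have u: "u \<in> frees B r" "lin r g u = 0" using Suc.prems by auto
    define m where "m l = lin r g (vcx l u)" for l
    have mD: "m l \<in> degl (Suc J)" for l unfolding m_def g using vcx_in[OF u(1)] by blast
    \<comment> \<open>The coefficient of \<open>x ^ (Suc J + N)\<close> is read off. Each
      \<open>m l\<close> has degree at most \<open>J\<close>, so only \<open>l = Suc N\<close>
      contributes; its coefficient at \<open>J\<close> must vanish, which puts
      \<open>m (Suc N)\<close> into \<open>degl J\<close>.\<close>
    have "(\<Sum>l<Suc (Suc N). rsc (x ^ l) (m l)) = 0"
      unfolding m_def u(2)[symmetric] by (rule expand[OF u(1), symmetric]) (use Suc.prems(2) Suc_le_lessD in blast)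
    then have "0 = vcx (Suc J + N) (\<Sum>l<Suc (Suc N). rsc (x ^ l) (m l))" by simp
    also have "\<dots> = (\<Sum>l<Suc (Suc N). if l \<le> Suc J + N then vcx (Suc J + N - l) (m l) else 0)"
      unfolding vcx_sum vcx_xpow ..
    also have "\<dots> = (\<Sum>l<Suc (Suc N). if l = Suc N then vcx J (m l) else 0)"
    proof (intro sum.cong refl)
      fix l assume "l \<in> {..<Suc (Suc N)}"
      moreover have "vcx (Suc J + N - l) (m l) = 0" if "l < Suc N" using mD[of l] that by (auto simp: degl_def)
      ultimately show "(if l \<le> Suc J + N then vcx (Suc J + N - l) (m l) else 0) = (if l = Suc N then vcx J (m l) else 0)"
        by (cases "l = Suc N") auto
    qed
    also have "\<dots> = vcx J (m (Suc N))" by (subst sum.delta) auto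
    finally have "m (Suc N) \<in> degl J" using mD[of "Suc N"] degl_Suc by metis
    then obtain v0 where v0: "v0 \<in> frees A r'" "m (Suc N) = lin r' f v0" unfolding f by blast
    \<comment> \<open>The top coefficient of \<open>u\<close> equals \<open>lin r' a v0\<close> up
      to a relation \<kappa> over \<open>A\<close>, and \<open>x ^ N\<close> times
      \<open>lin r' z v0\<close> has leading term \<open>x ^ Suc N\<close> times
      \<open>lin r' a v0\<close>. Removing both lowers the degree.\<close>
    define \<kappa> where "\<kappa> = vcx (Suc N) u - lin r' a v0"
    define u' where "u' = u - rsc (x ^ N) (lin r' z v0) - rsc (x ^ Suc N) \<kappa>"
    have \<kappa>: "\<kappa> \<in> ?K1"
      unfolding \<kappa>_def using v0 vcx_in[OF u(1)] laF[OF v0(1)]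
      by (auto simp: lin_diff lga m_def[symmetric] intro!: frees_closed(3)[OF A])
    have \<kappa>B: "rsc (x ^ Suc N) \<kappa> \<in> scext r ?K1"
      unfolding scext_def
    proof (intro CollectI conjI allI)
      show "rsc (x ^ Suc N) \<kappa> \<in> frees B r" using \<kappa> frees_closed(5)[OF B xpow_B frees_AB] by blast
      fix l
      have "\<kappa> \<in> frees A r" "lin r g \<kappa> = 0" using \<kappa> by auto
      then show "vcx l (rsc (x ^ Suc N) \<kappa>) \<in> frees A r" "lin r g (vcx l (rsc (x ^ Suc N) \<kappa>)) = 0"
        using frees_closed(1)[OF A] by (simp_all add: vcx_xpow vcx_A del: power_Suc)
    qed
    have u'Z: "u' \<in> ?Z"
    proof (intro CollectI conjI)
      show "u' \<in> frees B r"
      proof -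
        have "rsc (x ^ Suc N) \<kappa> \<in> frees B r" using \<kappa>B unfolding scext_def by blast
        then show ?thesis
          unfolding u'_def using u(1)
          by (intro frees_closed(3)[OF B] frees_closed(5)[OF B xpow_B, of _ r N] lzB frees_AB[OF v0(1)])
      qed
      show "lin r g u' = 0"
        unfolding u'_def lin_diff extK1[OF \<kappa>B] u(2) lin_rsc[of r g "x ^ N"] lgz rsc_simps by simp
    qed
    have "u' = u - rsc (x ^ Suc N) (vcx (Suc N) u) + rsc (x ^ N) (lin r' b v0)"
      unfolding u'_def \<kappa>_def lz by (simp add: rsc_simps mult.commute)
    then have vu': "vcx l u' = vcx l u - vcx l (rsc (x ^ Suc N) (vcx (Suc N) u)) + vcx l (rsc (x ^ N) (lin r' b v0))" for l
      by (simp add: vcx_add vcx_diff)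
    have "vcx l u' = 0" if "l > N" for l
    proof (cases "l = Suc N")
      case True
      then show ?thesis unfolding vu' vcx_xpow by (simp add: vcx_A[OF vcx_in[OF u(1)]] vcx_A[OF lbF[OF v0(1)]])
    next
      case False
      then have "l > Suc N" using that by simp
      then have "vcx l u = 0" using Suc.prems(2) by blast
      then show ?thesis using False that unfolding vu' vcx_xpow
        by (simp add: vcx_A[OF vcx_in[OF u(1)]] vcx_A[OF lbF[OF v0(1)]])
    qed
    from Suc.IH[OF u'Z] this obtain k v where kv: "k \<in> scext r ?K1" "v \<in> frees B r'" "u' = k + lin r' z v" by blast
    have "u = (k + rsc (x ^ Suc N) \<kappa>) + lin r' z (v + rsc (x ^ N) v0)"
      using kv(3) unfolding u'_def lin_add lin_rsc by (simp add: algebra_simps)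
    moreover have "v + rsc (x ^ N) v0 \<in> frees B r'"
      by (intro frees_closed(2)[OF B] kv(2) frees_closed(5)[OF B xpow_B] frees_AB[OF v0(1)])
    ultimately show ?case using scext_add[OF kv(1) \<kappa>B] by blast
  qed
  have Z: "?Z = {k + lin r' z v | k v. k \<in> scext r ?K1 \<and> v \<in> frees B r'}"
  proof (intro equalityI subsetI)
    fix u assume u: "u \<in> ?Z"
    then obtain N where "\<forall>l\<ge>N. vcx l u = 0" using vcx_fin by blast
    then have "\<forall>l>N. vcx l u = 0" by auto
    from dec[OF u this] show "u \<in> {k + lin r' z v | k v. k \<in> scext r ?K1 \<and> v \<in> frees B r'}" by blast
  next
    fix u assume "u \<in> {k + lin r' z v | k v. k \<in> scext r ?K1 \<and> v \<in> frees B r'}"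
    then obtain k v where kv: "k \<in> scext r ?K1" "v \<in> frees B r'" "u = k + lin r' z v" by blast
    have "k \<in> frees B r" using kv(1) by (simp add: scext_def)
    then show "u \<in> ?Z"
      unfolding kv(3) using frees_closed(2)[OF B _ lzB[OF kv(2)]] extK1[OF kv(1)] lgz by (simp add: lin_add)
  qed
  \<comment> \<open>Under \<open>lin r g\<close> the coefficient of \<open>lin r' z v\<close> at
    \<open>l\<close> becomes \<open>lin r' f\<close> of coefficient \<open>l - 1\<close> of
    \<open>v\<close> minus \<open>x\<close> times \<open>lin r' f\<close> of coefficient
    \<open>l\<close>. If all of these vanish, injectivity of \<open>x\<close> kills
    \<open>lin r' f\<close> of each coefficient, beginning with \<open>l = 0\<close>.\<close>
  have W: "{v \<in> frees B r'. lin r' z v \<in> scext r ?K1} = scext r' ?K2"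
  proof -
    have vz: "vcx l (lin r' z v) = (case l of 0 \<Rightarrow> 0 | Suc l' \<Rightarrow> lin r' a (vcx l' v)) - lin r' b (vcx l v)" for l v
      unfolding lz vcx_diff vcx_x using vcx_lin[of r' a _ v] vcx_lin[of r' b _ v] aA bA by (cases l) auto
    have lgvz: "lin r g (vcx l (lin r' z v)) = (case l of 0 \<Rightarrow> 0 | Suc l' \<Rightarrow> lin r' f (vcx l' v)) - rsc x (lin r' f (vcx l v))" for l v
      unfolding vz by (cases l) (simp_all add: lin_diff lgb lga lin_minus)
    have xi: "lin r' f (vcx l v) = 0" if "v \<in> frees B r'" "rsc x (lin r' f (vcx l v)) = 0" for l v
    proof (rule x_inj[OF _ that(2)])
      have "lin r' f (vcx l v) \<in> degl J" unfolding f using vcx_in[OF that(1)] by blast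
      then show "lin r' f (vcx l v) \<in> frees B q" using K(2) by (auto simp: degl_def)
    qed
    show ?thesis
    proof (intro equalityI subsetI)
      fix v assume "v \<in> {v \<in> frees B r'. lin r' z v \<in> scext r ?K1}"
      then have v: "v \<in> frees B r'" "\<And>l. lin r g (vcx l (lin r' z v)) = 0" by (auto simp: scext_def)
      have "lin r' f (vcx l v) = 0" for l
      proof (induction l)
        case 0
        then show ?case using v(2)[of 0] unfolding lgvz by (intro xi[OF v(1)]) simp
      next
        case (Suc l)
        then show ?case using v(2)[of "Suc l"] unfolding lgvz
          by (intro xi[OF v(1)]) (simp only: nat.case diff_0 neg_equal_0_iff_equal)
      qed
      then show "v \<in> scext r' ?K2" using v(1) vcx_in[OF v(1)] by (simp add: scext_def)
    next
      fix v assume "v \<in> scext r' ?K2"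
      then have v: "v \<in> frees B r'" "\<And>l. lin r' f (vcx l v) = 0" by (auto simp: scext_def)
      have "lin r g (vcx l (lin r' z v)) = 0" for l
        unfolding lgvz v(2) by (cases l) (simp_all add: rsc_simps)
      then show "v \<in> {v \<in> frees B r'. lin r' z v \<in> scext r ?K1}"
        using v(1) lzB[OF v(1)] vcx_in[OF lzB[OF v(1)]] by (simp add: scext_def)
    qed
  qed
  have "ffr B ?Z"
    unfolding Z
  proof (rule ffr_extension[OF B])
    show "ffr B (scext r ?K1)" by (rule ffr_scext[OF g']) blast
    show "ffr B {v \<in> frees B r'. lin r' z v \<in> scext r ?K1}"
      unfolding W by (rule ffr_scext[OF f']) blast
  qed
  then show ?thesis unfolding Kg by (rule ffr.step)
qed

end

end

section \<open>Polynomial rings in a subset of the variables\<close>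

lemma poly_mapping_sum_singles:
  fixes p :: "'a \<Rightarrow>\<^sub>0 'b::comm_monoid_add"
  shows "p = (\<Sum>\<alpha>\<in>keys p. single \<alpha> (lookup p \<alpha>))" by (rule poly_mapping_eqI)
     (auto simp: lookup_sum lookup_single when_def sum.delta' in_keys_iff)

lemma poly_mapping_induct_single [case_names single add]:
  fixes p :: "'a \<Rightarrow>\<^sub>0 'b::comm_monoid_add"
  assumes "\<And>\<alpha> c. P (single \<alpha> c)" and add: "\<And>p q. P p \<Longrightarrow> P q \<Longrightarrow> P (p + q)"
  shows "P p"
proof -
  have "P (\<Sum>\<alpha>\<in>F. single \<alpha> (lookup p \<alpha>))" for F using assms(1)[of undefined 0]
    by (induction F rule: infinite_finite_induct) (auto intro: assms)
  then show ?thesis using poly_mapping_sum_singles[of p] by metis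
qed

lemma keys_nonempty: "p \<noteq> 0 \<Longrightarrow> \<exists>\<alpha>. \<alpha> \<in> keys p"
  by (metis in_keys_iff lookup_zero poly_mapping_eqI)

text \<open>The coefficient of the \<open>l\<close>-th power of variable \<open>i\<close>. Only
  exponents without \<open>i\<close> are kept, so the value is a polynomial in the other
  variables.\<close>

lift_definition pcoeff :: "'n \<Rightarrow> nat \<Rightarrow> 'n::finite polynomial \<Rightarrow> 'n polynomial" is
  "\<lambda>i l p \<alpha>. if lookup \<alpha> i = 0 then p (\<alpha> + single i l) else 0"
proof -
  fix i :: 'n and l and p :: "'n multi_index \<Rightarrow> complex"
  assume *: "finite {\<alpha>. p \<alpha> \<noteq> 0}"
  have "\<alpha> \<in> (\<lambda>\<beta>. \<beta> - single i l) ` {\<alpha>. p \<alpha> \<noteq> 0}"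
    if "p (\<alpha> + single i l) \<noteq> 0" for \<alpha>
    using that by (intro image_eqI[of _ _ "\<alpha> + single i l"]) auto
  then have "{\<alpha>. (if lookup \<alpha> i = 0 then p (\<alpha> + single i l) else 0) \<noteq> 0}
      \<subseteq> (\<lambda>\<beta>. \<beta> - single i l) ` {\<alpha>. p \<alpha> \<noteq> 0}" by (auto split: if_splits)
  then show "finite {\<alpha>. (if lookup \<alpha> i = 0 then p (\<alpha> + single i l) else 0) \<noteq> 0}"
    by (rule finite_subset) (use * in simp)
qed

lemma pcoeff_add: "pcoeff i l (p + q) = pcoeff i l p + pcoeff i l q"
  by (rule poly_mapping_eqI) (simp add: pcoeff.rep_eq lookup_add)

lemma pcoeff_0 [simp]: "pcoeff i l 0 = 0" by (rule poly_mapping_eqI) (simp add: pcoeff.rep_eq)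

lemma pcoeff_sum: "pcoeff i l (sum f I) = (\<Sum>j\<in>I. pcoeff i l (f j))"
  by (induction I rule: infinite_finite_induct) (auto simp: pcoeff_add)

lemma pcoeff_single:
  "pcoeff i l (single \<beta> c) =
     (if lookup \<beta> i = l then single (\<beta> - single i l) c else 0)"
proof (rule poly_mapping_eqI)
  fix \<alpha>
  have "(lookup \<alpha> i = 0 \<and> \<beta> = \<alpha> + single i l)
      \<longleftrightarrow> (lookup \<beta> i = l \<and> \<beta> - single i l = \<alpha>)"
  proof
    assume "lookup \<alpha> i = 0 \<and> \<beta> = \<alpha> + single i l"
    then show "lookup \<beta> i = l \<and> \<beta> - single i l = \<alpha>" by (auto simp: lookup_add)
  next
    assume "lookup \<beta> i = l \<and> \<beta> - single i l = \<alpha>"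
    then show "lookup \<alpha> i = 0 \<and> \<beta> = \<alpha> + single i l"
      by (auto simp: lookup_add lookup_minus lookup_single when_def intro!: poly_mapping_eqI)
  qed
  then show "lookup (pcoeff i l (single \<beta> c)) \<alpha> = lookup
     (if lookup \<beta> i = l then single (\<beta> - single i l) c else 0) \<alpha>"
    by (auto simp: pcoeff.rep_eq lookup_single when_def)
qed

definition pvars :: "'n::finite set \<Rightarrow> 'n polynomial set" where
  "pvars S = {p. \<forall>\<alpha>\<in>keys p. \<forall>i. i \<notin> S \<longrightarrow> lookup \<alpha> i = 0}"

definition pX :: "'n::finite \<Rightarrow> 'n polynomial" where
  "pX i = single (single i 1) 1"

lemma pX_power: "pX i ^ l = single (single i l) 1" by (induction l) (auto simp: pX_def mult_single single_add[symmetric])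

lemma subring_pvars: "subring (pvars S)"
proof -
  have "a * b \<in> pvars S" if "a \<in> pvars S" "b \<in> pvars S" for a b
    unfolding pvars_def
  proof (intro CollectI ballI allI impI)
    fix \<alpha> i assume "\<alpha> \<in> keys (a * b)" "i \<notin> S"
    moreover obtain \<beta> \<gamma> where "\<alpha> = \<beta> + \<gamma>" "\<beta> \<in> keys a" "\<gamma> \<in> keys b"
      using keys_mult[of a b] calculation(1) by blast
    ultimately show "lookup \<alpha> i = 0" using that by (auto simp: pvars_def lookup_add)
  qed
  moreover have "a + b \<in> pvars S" if "a \<in> pvars S" "b \<in> pvars S" for a b
    unfolding pvars_def
  proof (intro CollectI ballI allI impI)
    fix \<alpha> i assume "\<alpha> \<in> keys (a + b)" "i \<notin> S"
    moreover have "\<alpha> \<in> keys a \<or> \<alpha> \<in> keys b" using keys_add[of a b] calculation(1) by auto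
    ultimately show "lookup \<alpha> i = 0" using that by (auto simp: pvars_def)
  qed
  moreover have "- a \<in> pvars S" if "a \<in> pvars S" for a using that by (auto simp: pvars_def in_keys_iff)
  moreover have "0 \<in> pvars S" "1 \<in> pvars S" by (auto simp: pvars_def)
  ultimately show ?thesis unfolding subring_def by blast
qed

lemma pcoeff_mult:
  assumes "a \<in> pvars S" "i \<notin> S"
  shows "pcoeff i l (a * p) = a * pcoeff i l p"
proof (induction p rule: poly_mapping_induct_single)
  case (single \<beta> c)
  have 1: "pcoeff i l (single \<alpha> d * single \<beta> c)
      = single \<alpha> d * pcoeff i l (single \<beta> c)"
    if "\<alpha> \<in> keys a" for \<alpha> d
  proof -
    have "lookup \<alpha> i = 0" using that assms by (auto simp: pvars_def)
    moreover from this have "\<alpha> + \<beta> - single i (lookup \<beta> i) = \<alpha> + (\<beta> - single i (lookup \<beta> i))"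
      by (intro poly_mapping_eqI) (auto simp: lookup_add lookup_minus lookup_single when_def)
    ultimately show ?thesis by (auto simp: mult_single pcoeff_single lookup_add)
  qed
  have "pcoeff i l ((\<Sum>\<alpha>\<in>keys a. single \<alpha> (lookup a \<alpha>)) * single \<beta> c)
      = (\<Sum>\<alpha>\<in>keys a. single \<alpha> (lookup a \<alpha>)) * pcoeff i l (single \<beta> c)"
    unfolding sum_distrib_right pcoeff_sum by (intro sum.cong refl 1)
  then show ?case by (simp only: poly_mapping_sum_singles[symmetric])
qed (simp add: distrib_left pcoeff_add)

lemma pcoeff_expansion: "\<exists>N. (\<forall>l\<ge>N. pcoeff i l p = 0) \<and> p = (\<Sum>l<N. pX i ^ l * pcoeff i l p)"
proof (induction p rule: poly_mapping_induct_single)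
  case (single \<beta> c)
  let ?m = "lookup \<beta> i" and ?p = "single \<beta> c"
  have b: "single i ?m + (\<beta> - single i ?m) = \<beta>"
    by (rule poly_mapping_eqI) (auto simp: lookup_add lookup_minus lookup_single when_def)
  have "(\<Sum>l<Suc ?m. pX i ^ l * pcoeff i l ?p) = (\<Sum>l<Suc ?m. if l = ?m then ?p else 0)"
    by (intro sum.cong refl) (auto simp: pcoeff_single pX_power mult_single b)
  also have "\<dots> = ?p" by (subst sum.delta) auto
  finally show ?case by (intro exI[of _ "Suc ?m"]) (auto simp: pcoeff_single)
next
  case (add p q)
  then obtain M N where M: "\<forall>l\<ge>M. pcoeff i l p = 0" "p = (\<Sum>l<M. pX i ^ l * pcoeff i l p)"
    and N: "\<forall>l\<ge>N. pcoeff i l q = 0" "q = (\<Sum>l<N. pX i ^ l * pcoeff i l q)" by blast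
  have "p = (\<Sum>l<max M N. pX i ^ l * pcoeff i l p)" by (subst M(2), rule sum.mono_neutral_left) (use M(1) in auto)
  moreover have "q = (\<Sum>l<max M N. pX i ^ l * pcoeff i l q)"
    by (subst N(2), rule sum.mono_neutral_left) (use N(1) in auto)
  ultimately have "p + q = (\<Sum>l<max M N. pX i ^ l * pcoeff i l (p + q))"
    by (simp add: pcoeff_add distrib_left sum.distrib)
  moreover have "\<forall>l\<ge>max M N. pcoeff i l (p + q) = 0" using M(1) N(1) by (simp add: pcoeff_add)
  ultimately show ?case by blast
qed

lemma pcoeff_pvars: "p \<in> pvars (insert i S) \<Longrightarrow> pcoeff i l p \<in> pvars S"
proof -
  assume p: "p \<in> pvars (insert i S)"
  show "pcoeff i l p \<in> pvars S"
    unfolding pvars_def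
  proof (intro CollectI ballI allI impI)
    fix \<alpha> j assume a: "\<alpha> \<in> keys (pcoeff i l p)" and j: "j \<notin> S"
    then have 1: "lookup \<alpha> i = 0" "\<alpha> + single i l \<in> keys p"
      by (auto simp: in_keys_iff pcoeff.rep_eq split: if_splits)
    show "lookup \<alpha> j = 0"
    proof (cases "j = i")
      case False
      then have "lookup (\<alpha> + single i l) j = 0" using p 1(2) j by (auto simp: pvars_def)
      then show ?thesis by (simp add: lookup_add)
    qed (use 1 in simp)
  qed
qed

lemma poly_ext_pvars:
  assumes "i \<notin> S"
  shows "poly_ext (pvars S) (pvars (insert i S)) (pX i) (pcoeff i)"
proof
  show "pvars S \<subseteq> pvars (insert i S)" by (auto simp: pvars_def)
  show "pX i \<in> pvars (insert i S)" by (auto simp: pvars_def pX_def lookup_single when_def)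
  show "pcoeff i l (a * p) = a * pcoeff i l p" if "a \<in> pvars S" for a l p by (rule pcoeff_mult[OF that assms])
  show "pcoeff i l 1 = (if l = 0 then 1 else 0)" for l by (simp add: pcoeff_single flip: single_one)
  show "pcoeff i l (pX i * p) = (case l of 0 \<Rightarrow> 0 | Suc l' \<Rightarrow> pcoeff i l' p)" for l p
  proof (induction p rule: poly_mapping_induct_single)
    case (single \<beta> c)
    have "single i 1 + \<beta> - single i (Suc m) = \<beta> - single i m" for m
      by (rule poly_mapping_eqI) (auto simp: lookup_add lookup_minus lookup_single when_def)
    then show ?case by (auto simp: pX_def mult_single pcoeff_single lookup_add split: nat.split)
  qed (auto simp: distrib_left pcoeff_add split: nat.split)
  show "\<exists>N. \<forall>l\<ge>N. pcoeff i l p = 0" for p using pcoeff_expansion by blast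
  show "p = (\<Sum>l<N. pX i ^ l * pcoeff i l p)" if N: "\<forall>l\<ge>N. pcoeff i l p = 0" for p N
  proof -
    obtain M where M: "\<forall>l\<ge>M. pcoeff i l p = 0" "p = (\<Sum>l<M. pX i ^ l * pcoeff i l p)"
      using pcoeff_expansion by blast
    have "p = (\<Sum>l<max M N. pX i ^ l * pcoeff i l p)" by (subst M(2), rule sum.mono_neutral_left) (use M(1) in auto)
    also have "\<dots> = (\<Sum>l<N. pX i ^ l * pcoeff i l p)" by (rule sum.mono_neutral_right) (use N in auto)
    finally show ?thesis .
  qed
qed (auto simp: subring_pvars pcoeff_add pcoeff_pvars)

text \<open>Elimination of the last coordinate: an element of \<open>K\<close> that is nonzero there
  can be normalised and spans a free complement of rank 1 to the elements that vanish there.\<close>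

lemma ffr_field:
  assumes A: "subring A" and unit: "\<And>a. a \<in> A \<Longrightarrow> a \<noteq> 0 \<Longrightarrow> \<exists>b\<in>A. b * a = 1"
    and "submod A K" "K \<subseteq> frees A q"
  shows "ffr A K" using assms(3,4)
proof (induction q arbitrary: K)
  case 0
  then have "K = {0}" using submodD(1)[OF 0(1)] by (auto simp: frees_0[OF A])
  then show ?case using ffr.zero by simp
next
  case (Suc q)
  define K' where "K' = {u \<in> K. u q = 0}"
  have "submod A K'"
    unfolding submod_def
  proof (intro conjI ballI)
    show "0 \<in> K'" using submodD(1)[OF Suc.prems(1)] by (simp add: K'_def)
    show "u + v \<in> K'" if "u \<in> K'" "v \<in> K'" for u v using submodD(2)[OF Suc.prems(1)] that by (simp add: K'_def)
    show "rsc a u \<in> K'" if "a \<in> A" "u \<in> K'" for a u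
      using submodD(3)[OF Suc.prems(1)] that by (simp add: K'_def) (simp add: rsc_def)
  qed
  moreover have "K' \<subseteq> frees A q"
  proof
    fix u assume u: "u \<in> K'"
    then have "u \<in> frees A (Suc q)" "u q = 0" using Suc.prems(2) by (auto simp: K'_def)
    then show "u \<in> frees A q" using le_eq_less_or_eq[of q] by (auto simp: frees_def Suc_le_eq)
  qed
  ultimately have K': "ffr A K'" by (rule Suc.IH)
  show ?case
  proof (cases "K' = K")
    case False
    then obtain u where u: "u \<in> K" "u q \<noteq> 0" by (auto simp: K'_def)
    then have "u q \<in> A" using Suc.prems(2) by (auto simp: frees_def)
    then obtain b where b: "b \<in> A" "b * u q = 1" using unit u by blast
    define z where "z = (\<lambda>_::nat. rsc b u)"
    have zK: "rsc b u \<in> K" using submodD(3)[OF Suc.prems(1)] b u by blast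
    have lz: "lin 1 z v = rsc (v 0) (rsc b u)" for v by (simp add: lin_def rsc_def z_def)
    have lzq: "lin 1 z v q = v 0" for v unfolding lz by (simp add: rsc_def b mult.assoc)
    have 0: "0 \<in> frees A 1" by (rule frees_closed[OF A])
    have "{v \<in> frees A 1. lin 1 z v \<in> K'} = {0}"
    proof (intro equalityI subsetI)
      fix v assume v: "v \<in> {v \<in> frees A 1. lin 1 z v \<in> K'}"
      then have "v 0 = 0" using lzq[of v] by (simp add: K'_def)
      then have "v k = 0" for k using v by (cases k) (auto simp: frees_def)
      then show "v \<in> {0}" by (auto simp: fun_eq_iff)
    next
      fix v :: "nat \<Rightarrow> 'a" assume "v \<in> {0}"
      then show "v \<in> {v \<in> frees A 1. lin 1 z v \<in> K'}" using 0 submodD(1)[OF Suc.prems(1)] by (auto simp: K'_def)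
    qed
    then have "ffr A {v \<in> frees A 1. lin 1 z v \<in> K'}" using ffr.zero by simp
    from ffr_extension[OF A K' this] have "ffr A {k + lin 1 z v |k v. k \<in> K' \<and> v \<in> frees A 1}" .
    also have "{k + lin 1 z v |k v. k \<in> K' \<and> v \<in> frees A 1} = K"
    proof (intro equalityI subsetI)
      fix w assume "w \<in> {k + lin 1 z v |k v. k \<in> K' \<and> v \<in> frees A 1}"
      then obtain k v where w: "w = k + lin 1 z v" "k \<in> K" "v 0 \<in> A" by (auto simp: K'_def frees_def)
      then show "w \<in> K" unfolding w lz using submodD(2,3)[OF Suc.prems(1)] zK by blast
    next
      fix w assume w: "w \<in> K"
      define v where "v k = (if k = 0 then w q else 0)" for k :: nat
      have v: "v \<in> frees A 1" using w Suc.prems(2) subringD[OF A] by (auto simp: v_def frees_def)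
      have "lin 1 z v \<in> K" unfolding lz using v zK submodD(3)[OF Suc.prems(1)] by (auto simp: frees_def)
      then have "w - lin 1 z v \<in> K'" using submod_diff[OF A Suc.prems(1) w] lzq[of v] by (simp add: K'_def v_def)
      moreover have "w = (w - lin 1 z v) + lin 1 z v" by simp
      ultimately show "w \<in> {k + lin 1 z v |k v. k \<in> K' \<and> v \<in> frees A 1}" using v by blast
    qed
    finally show ?thesis .
  qed (use K' in simp)
qed

text \<open>Induction on the set of variables, starting from the constants, which form a field. The
  claim is made for all submodules of all free modules of finite rank, so each stage also provides
  the finite generation that the next one uses.\<close>

theorem hilbert_syzygy:
  fixes K :: "(nat \<Rightarrow> 'n::finite polynomial) set"
  assumes "submod UNIV K" "K \<subseteq> frees UNIV q"
  shows "ffr UNIV K"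
proof -
  have "finite S \<Longrightarrow> submod (pvars S) K \<Longrightarrow> K \<subseteq> frees (pvars S) q \<Longrightarrow> ffr (pvars S) K"
    for S :: "'n set" and K q
  proof (induction S arbitrary: K q rule: finite_induct)
    case empty
    have "\<exists>b\<in>pvars {}. b * a = 1" if "a \<in> pvars {}" "a \<noteq> 0" for a :: "'n polynomial"
    proof -
      have "\<alpha> = 0" if "\<alpha> \<in> keys a" for \<alpha>
        using \<open>a \<in> pvars {}\<close> that by (intro poly_mapping_eqI) (auto simp: pvars_def)
      then have k: "keys a = {0}" using keys_nonempty[OF \<open>a \<noteq> 0\<close>] by auto
      define c where "c = lookup a 0"
      have "c \<noteq> 0" using k by (auto simp: c_def simp flip: in_keys_iff)
      moreover have "a = single 0 c" using poly_mapping_sum_singles[of a] k by (simp add: c_def)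
      ultimately have "single 0 (inverse c) * a = 1" by (simp add: mult_single)
      moreover have "single 0 (inverse c) \<in> pvars {}" by (auto simp: pvars_def)
      ultimately show ?thesis by blast
    qed
    then show ?case using ffr_field[OF subring_pvars _ empty] by blast
  next
    case (insert i S)
    interpret poly_ext "pvars S" "pvars (insert i S)" "pX i" "pcoeff i" by (rule poly_ext_pvars) fact
    show ?case by (rule ffr_B[OF insert.IH insert.prems])
  qed
  from this[of UNIV K q] have "submod (pvars UNIV) K \<Longrightarrow> K \<subseteq> frees (pvars UNIV) q \<Longrightarrow> ffr (pvars UNIV) K"
    by simp
  moreover have "pvars UNIV = (UNIV :: 'n polynomial set)" by (auto simp: pvars_def)
  ultimately show ?thesis using assms by simp
qed

text \<open>Unrolls the derivation into sequences of ranks and matrices, padded by zero modules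
  beyond its end.\<close>

lemma ffr_resolution:
  assumes "ffr UNIV K"
  shows "\<exists>N r g. (\<forall>k>N. r k = 0) \<and> lin (r 0) (g 0) ` frees UNIV (r 0) = K \<and>
     (\<forall>k. lin (r (Suc k)) (g (Suc k)) ` frees UNIV (r (Suc k)) = {u \<in> frees UNIV (r k). lin (r k) (g k) u = 0})"
  using assms
proof induction
  case zero
  have U: "subring (UNIV :: 'a set)" by (simp add: subring_def)
  show ?case
  proof (rule exI[of _ 0], rule exI[of _ "\<lambda>_. 0"], rule exI[of _ "\<lambda>_ _ _. 0"], intro conjI allI impI)
    have l: "lin 0 (\<lambda>_ _. 0) u = (0 :: nat \<Rightarrow> 'a)" for u by (simp add: lin_def fun_eq_iff)
    show "lin 0 (\<lambda>_ _. 0) ` frees UNIV 0 = {0 :: nat \<Rightarrow> 'a}" unfolding frees_0[OF U] l by simp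
    show "lin 0 (\<lambda>_ _. 0) ` frees UNIV 0 = {u \<in> frees UNIV 0. lin 0 (\<lambda>_ _. 0) u = (0 :: nat \<Rightarrow> 'a)}"
      unfolding frees_0[OF U] l by simp
  qed simp
next
  case (step s h)
  then obtain N r g where *: "\<forall>k>N. r k = (0::nat)" "lin (r 0) (g 0) ` frees UNIV (r 0) = {u \<in> frees UNIV s. lin s h u = 0}"
     "\<And>k. lin (r (Suc k)) (g (Suc k)) ` frees UNIV (r (Suc k)) = {u \<in> frees UNIV (r k). lin (r k) (g k) u = 0}"
    by blast
  show ?case
  proof (rule exI[of _ "Suc N"], rule exI[of _ "case_nat s r"], rule exI[of _ "case_nat h g"], intro conjI allI impI)
    fix k assume "k > Suc N" then show "case_nat s r k = 0" using *(1) by (cases k) auto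
  next
    fix k show "lin (case_nat s r (Suc k)) (case_nat h g (Suc k)) ` frees UNIV (case_nat s r (Suc k))
      = {u \<in> frees UNIV (case_nat s r k). lin (case_nat s r k) (case_nat h g k) u = 0}" using * by (cases k) auto
  qed simp
qed

section \<open>Independence of monomials and absence of zero divisors\<close>

definition plin :: "('n::finite multi_index \<Rightarrow> 'v::complex_inner) \<Rightarrow> 'n polynomial \<Rightarrow> 'v" where
  "plin \<phi> p = (\<Sum>\<alpha>\<in>keys p. lookup p \<alpha> *\<^sub>C \<phi> \<alpha>)"

lemma plin_superset:
  "finite S \<Longrightarrow> keys p \<subseteq> S \<Longrightarrow> plin \<phi> p = (\<Sum>\<alpha>\<in>S. lookup p \<alpha> *\<^sub>C \<phi> \<alpha>)"
  unfolding plin_def by (rule sum.mono_neutral_left) (auto simp: in_keys_iff)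

lemma plin_add: "plin \<phi> (p + q) = plin \<phi> p + plin \<phi> q"
proof -
  let ?S = "keys p \<union> keys q"
  have "plin \<phi> (p + q) = (\<Sum>\<alpha>\<in>?S. lookup (p + q) \<alpha> *\<^sub>C \<phi> \<alpha>)"
    using keys_add[of p q] by (intro plin_superset) auto
  moreover have "plin \<phi> p = (\<Sum>\<alpha>\<in>?S. lookup p \<alpha> *\<^sub>C \<phi> \<alpha>)"
    "plin \<phi> q = (\<Sum>\<alpha>\<in>?S. lookup q \<alpha> *\<^sub>C \<phi> \<alpha>)" by (intro plin_superset; auto)+
  ultimately show ?thesis by (simp add: lookup_add scaleC_add_left sum.distrib)
qed

lemma plin_single: "plin \<phi> (single \<alpha> c) = c *\<^sub>C \<phi> \<alpha>"
  by (subst plin_superset[of "{\<alpha>}"]) auto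

lemma plin_zero [simp]: "plin \<phi> 0 = 0" by (simp add: plin_def)

definition pev :: "complex ^ 'n::finite \<Rightarrow> 'n polynomial \<Rightarrow> complex" where
  "pev z = plin (mpow z)"

lemma mpow_add: "mpow z (\<alpha> + \<beta>) = mpow z \<alpha> * mpow z \<beta>"
  by (simp add: mpow_def lookup_add power_add prod.distrib)

lemma pev_mult: "pev z (p * q) = pev z p * pev z q"
proof (induction p rule: poly_mapping_induct_single)
  case (single \<alpha> c)
  show ?case
  proof (induction q rule: poly_mapping_induct_single)
    case (single \<beta> d)
    show ?case by (simp add: pev_def mult_single plin_single mpow_add scaleC_complex_def)
  qed (simp add: distrib_left pev_def plin_add)
qed (simp add: distrib_right pev_def plin_add)

text \<open>The values \<open>f i\<close> are digits in base \<open>N\<close>, and the weights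
  \<open>e\<close> are the powers of \<open>N\<close>.\<close>

lemma digits_inj:
  fixes V :: "'n set"
  assumes "finite V"
  shows "\<exists>e::'n \<Rightarrow> nat. inj_on (\<lambda>f. \<Sum>i\<in>V. f i * e i) {f. (\<forall>i\<in>V. f i < N) \<and> (\<forall>i. i \<notin> V \<longrightarrow> f i = (0::nat))}"
  using assms
proof induction
  case empty
  show ?case by (auto simp: inj_on_def fun_eq_iff)
next
  case (insert v V)
  then obtain e :: "'n \<Rightarrow> nat" where e: "inj_on (\<lambda>f. \<Sum>i\<in>V. f i * e i) {f. (\<forall>i\<in>V. f i < N) \<and> (\<forall>i. i \<notin> V \<longrightarrow> f i = (0::nat))}"
    by blast
  define e' where "e' i = (if i = v then 1 else N * e i)" for i
  have s: "(\<Sum>i\<in>insert v V. f i * e' i) = f v + N * (\<Sum>i\<in>V. f i * e i)" for f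
  proof -
    have "(\<Sum>i\<in>V. f i * e' i) = N * (\<Sum>i\<in>V. f i * e i)"
      unfolding sum_distrib_left by (intro sum.cong refl) (use insert(2) in \<open>auto simp: e'_def\<close>)
    then show ?thesis using insert(1,2) by (simp add: e'_def)
  qed
  show ?case
  proof (intro exI[of _ e'] inj_onI)
    fix f g :: "'n \<Rightarrow> nat"
    assume f: "f \<in> {f. (\<forall>i\<in>insert v V. f i < N) \<and> (\<forall>i. i \<notin> insert v V \<longrightarrow> f i = 0)}"
      and g: "g \<in> {f. (\<forall>i\<in>insert v V. f i < N) \<and> (\<forall>i. i \<notin> insert v V \<longrightarrow> f i = 0)}"
      and eq: "(\<Sum>i\<in>insert v V. f i * e' i) = (\<Sum>i\<in>insert v V. g i * e' i)"
    have N: "f v < N" "g v < N" using f g by auto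
    have "(f v + N * (\<Sum>i\<in>V. f i * e i)) mod N = (g v + N * (\<Sum>i\<in>V. g i * e i)) mod N"
      using eq unfolding s by simp
    then have v: "f v = g v" using N by simp
    then have "(\<Sum>i\<in>V. f i * e i) = (\<Sum>i\<in>V. g i * e i)" using eq N unfolding s by simp
    moreover have "(\<Sum>i\<in>V. h i * e i) = (\<Sum>i\<in>V. (h(v := 0)) i * e i)" for h
      by (intro sum.cong refl) (use insert(2) in auto)
    ultimately have "(\<Sum>i\<in>V. (f(v := 0)) i * e i) = (\<Sum>i\<in>V. (g(v := 0)) i * e i)" by simp
    then have fg: "f(v := 0) = g(v := 0)" by (rule inj_onD[OF e]) (use f g insert(2) in auto)
    have "f i = g i" for i using fun_cong[OF fg, of i] v by (cases "i = v") auto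
    then show "f = g" by (rule ext)
  qed
qed

text \<open>Prepares Kronecker's substitution: with \<open>t ^ e i\<close> for variable
  \<open>i\<close>, the monomials in \<open>S\<close> become distinct powers of
  \<open>t\<close>.\<close>

lemma multi_index_weights:
  assumes "finite S"
  shows "\<exists>e::'n::finite \<Rightarrow> nat. inj_on (\<lambda>\<alpha>. \<Sum>i\<in>UNIV. lookup \<alpha> i * e i) S"
proof -
  define N where "N = Suc (Max (mdeg ` S))"
  have l: "lookup \<alpha> i < N" if "\<alpha> \<in> S" for \<alpha> :: "'n multi_index" and i
  proof -
    have "lookup \<alpha> i \<le> mdeg \<alpha>" unfolding mdeg_def by (rule member_le_sum) auto
    also have "\<dots> \<le> Max (mdeg ` S)" using that assms by (intro Max_ge) auto
    finally show ?thesis by (simp add: N_def)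
  qed
  obtain e where e: "inj_on (\<lambda>f. \<Sum>i\<in>UNIV. f i * e i) {f::'n \<Rightarrow> nat. (\<forall>i\<in>UNIV. f i < N) \<and> (\<forall>i. i \<notin> UNIV \<longrightarrow> f i = 0)}"
    by (rule exE[OF digits_inj[of "UNIV :: 'n set" N, OF finite]])
  have "inj_on (\<lambda>\<alpha>. \<Sum>i\<in>UNIV. lookup \<alpha> i * e i) S"
  proof (rule inj_onI)
    fix \<alpha> \<beta> :: "'n multi_index"
    assume "\<alpha> \<in> S" "\<beta> \<in> S" "(\<Sum>i\<in>UNIV. lookup \<alpha> i * e i) = (\<Sum>i\<in>UNIV. lookup \<beta> i * e i)"
    then have "(\<lambda>f. \<Sum>i\<in>UNIV. f i * e i) (lookup \<alpha>) = (\<lambda>f. \<Sum>i\<in>UNIV. f i * e i) (lookup \<beta>)"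
      by blast
    moreover have L: "lookup \<gamma> \<in> {f. (\<forall>i\<in>UNIV. f i < N) \<and> (\<forall>i. i \<notin> UNIV \<longrightarrow> f i = 0)}"
      if "\<gamma> \<in> S" for \<gamma> using l[OF that] by simp
    ultimately have "lookup \<alpha> = lookup \<beta>"
      by (intro inj_onD[OF e _ L[OF \<open>\<alpha> \<in> S\<close>] L[OF \<open>\<beta> \<in> S\<close>]])
    then show "\<alpha> = \<beta>" unfolding poly_mapping_eq_iff .
  qed
  then show ?thesis by blast
qed

lemma poly_sum_monom_nonzero:
  fixes c :: "'a \<Rightarrow> complex"
  assumes "finite S" "inj_on \<omega> S" "\<alpha> \<in> S" "c \<alpha> \<noteq> 0"
  shows "(\<Sum>\<alpha>\<in>S. monom (c \<alpha>) (\<omega> \<alpha>)) \<noteq> 0"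
proof
  assume "(\<Sum>\<alpha>\<in>S. monom (c \<alpha>) (\<omega> \<alpha>)) = 0"
  then have "0 = coeff (\<Sum>\<alpha>\<in>S. monom (c \<alpha>) (\<omega> \<alpha>)) (\<omega> \<alpha>)" by simp
  also have "\<dots> = (\<Sum>\<beta>\<in>S. if \<beta> = \<alpha> then c \<beta> else 0)"
    unfolding coeff_sum
  proof (intro sum.cong refl)
    fix \<beta> assume "\<beta> \<in> S"
    then have "\<omega> \<beta> = \<omega> \<alpha> \<longleftrightarrow> \<beta> = \<alpha>" using inj_on_eq_iff[OF assms(2)] assms(3) by blast
    then show "coeff (monom (c \<beta>) (\<omega> \<beta>)) (\<omega> \<alpha>) = (if \<beta> = \<alpha> then c \<beta> else 0)" by simp
  qed
  also have "\<dots> = c \<alpha>" using assms by simp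
  finally show False using assms by simp
qed

lemma mpow_power_curve:
  "mpow (\<chi> i. t ^ e i) \<alpha> = t ^ (\<Sum>i\<in>UNIV. lookup \<alpha> i * e i)"
  by (simp add: mpow_def power_mult[symmetric] power_sum mult.commute)

lemma poly_curve:
  "poly (\<Sum>\<alpha>\<in>S. monom (c \<alpha>) (\<Sum>i\<in>UNIV. lookup \<alpha> i * e i)) t = (\<Sum>\<alpha>\<in>S. c \<alpha> * mpow (\<chi> i. t ^ e i) \<alpha>)"
  by (simp add: poly_sum poly_monom mpow_power_curve)

text \<open>Points with positive coordinates suffice as test points, because the curve with
  coordinates \<open>t ^ e i\<close>, \<open>t > 0\<close>, already gives a polynomial in
  \<open>t\<close> infinitely many roots. In this form the lemma applies to the squares that occur
  in the integrals over the sphere.\<close>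

lemma mpow_independent:
  fixes c :: "'n::finite multi_index \<Rightarrow> complex"
  assumes "finite S" "\<And>z. (\<And>i. \<exists>x>0. z $ i = complex_of_real x) \<Longrightarrow> (\<Sum>\<alpha>\<in>S. c \<alpha> * mpow z \<alpha>) = 0" "\<alpha> \<in> S"
  shows "c \<alpha> = 0"
proof (rule ccontr)
  assume "c \<alpha> \<noteq> 0"
  obtain e :: "'n \<Rightarrow> nat" where e: "inj_on (\<lambda>\<alpha>. \<Sum>i\<in>UNIV. lookup \<alpha> i * e i) S"
    using multi_index_weights[OF assms(1)] by blast
  let ?P = "\<Sum>\<alpha>\<in>S. monom (c \<alpha>) (\<Sum>i\<in>UNIV. lookup \<alpha> i * e i)"
  have "?P \<noteq> 0" by (rule poly_sum_monom_nonzero[OF assms(1) e assms(3)]) fact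
  then have "finite {t. poly ?P t = 0}" by (rule poly_roots_finite)
  moreover have "complex_of_real ` {0<..} \<subseteq> {t. poly ?P t = 0}"
    unfolding poly_curve by (auto intro!: assms(2) exI[of _ "_ ^ _"])
  ultimately have "finite (complex_of_real ` {0<..})" by (rule finite_subset[rotated])
  then have "finite ({0<..} :: real set)" by (rule finite_imageD) (auto simp: inj_on_def)
  then show False using infinite_Ioi by blast
qed

text \<open>Evaluation on the curve of Kronecker's substitution is multiplicative and reduces the
  claim to one variable.\<close>

lemma polynomial_no_zero_divisors:
  fixes p q :: "'n::finite polynomial"
  assumes "p * q = 0" "p \<noteq> 0"
  shows "q = 0"
proof (rule ccontr)
  assume q: "q \<noteq> 0"
  let ?S = "keys p \<union> keys q"
  obtain e :: "'n \<Rightarrow> nat" where e: "inj_on (\<lambda>\<alpha>. \<Sum>i\<in>UNIV. lookup \<alpha> i * e i) ?S"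
    using multi_index_weights[of ?S] by auto
  let ?P = "\<lambda>p. \<Sum>\<alpha>\<in>?S. monom (lookup p \<alpha>) (\<Sum>i\<in>UNIV. lookup \<alpha> i * e i)"
  obtain \<alpha> \<beta> where "\<alpha> \<in> keys p" "\<beta> \<in> keys q" using assms(2) q keys_nonempty by metis
  then have "?P p \<noteq> 0" "?P q \<noteq> 0"
    by (intro poly_sum_monom_nonzero[OF _ e, of \<alpha>] poly_sum_monom_nonzero[OF _ e, of \<beta>]; auto simp: in_keys_iff)+
  then have "?P p * ?P q \<noteq> 0" by simp
  moreover have "poly (?P p * ?P q) t = 0" for t
  proof -
    have "poly (?P f) t = pev (\<chi> i. t ^ e i) f" if "keys f \<subseteq> ?S" for f
      unfolding poly_curve pev_def by (subst plin_superset[OF _ that]) (auto simp: scaleC_complex_def)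
    then have "poly (?P p * ?P q) t = pev (\<chi> i. t ^ e i) (p * q)" by (simp add: pev_mult)
    then show ?thesis by (simp add: assms(1) pev_def)
  qed
  ultimately show False using poly_all_0_iff_0 by blast
qed

section \<open>Growth of finitely generated modules\<close>

text \<open>Stars and bars, through the lists of exponents along an enumeration of the
  variables.\<close>

lemma card_mdeg: "card {\<alpha> :: 'n::finite multi_index. mdeg \<alpha> = m} = (m + CARD('n) - 1) choose m"
proof -
  obtain xs :: "'n list" where xs: "set xs = UNIV" "distinct xs" using finite_distinct_list[of "UNIV :: 'n set"] by auto
  have len: "length xs = CARD('n)" using distinct_card[OF xs(2)] xs(1) by simp
  have md: "mdeg \<alpha> = sum_list (map (lookup \<alpha>) xs)" for \<alpha> :: "'n multi_index"
    by (simp add: mdeg_def sum_list_distinct_conv_sum_set[OF xs(2)] xs(1))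
  have "bij_betw (\<lambda>\<alpha>. map (lookup \<alpha>) xs) {\<alpha> :: 'n multi_index. mdeg \<alpha> = m}
      {l :: nat list. length l = CARD('n) \<and> sum_list l = m}"
    unfolding bij_betw_def
  proof
    show "inj_on (\<lambda>\<alpha>. map (lookup \<alpha>) xs) {\<alpha> :: 'n multi_index. mdeg \<alpha> = m}"
      using xs(1) by (auto simp: inj_on_def intro!: poly_mapping_eqI)
    show "(\<lambda>\<alpha>. map (lookup \<alpha>) xs) ` {\<alpha> :: 'n multi_index. mdeg \<alpha> = m}
        = {l. length l = CARD('n) \<and> sum_list l = m}"
    proof (intro equalityI subsetI)
      fix l :: "nat list" assume l: "l \<in> {l. length l = CARD('n) \<and> sum_list l = m}"
      define \<alpha> :: "'n multi_index" where "\<alpha> = Abs_poly_mapping (\<lambda>i. the (map_of (zip xs l) i))"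
      have la: "lookup \<alpha> = (\<lambda>i. the (map_of (zip xs l) i))"
        unfolding \<alpha>_def by (rule lookup_Abs_poly_mapping) simp
      have "map (lookup \<alpha>) xs = l"
        unfolding la using l xs(2) len by (intro nth_equalityI) (auto simp: map_of_zip_nth)
      then show "l \<in> (\<lambda>\<alpha>. map (lookup \<alpha>) xs) ` {\<alpha> :: 'n multi_index. mdeg \<alpha> = m}"
        using l md by (intro image_eqI[of _ _ \<alpha>]) auto
    qed (use md len in auto)
  qed
  then have "card {\<alpha> :: 'n multi_index. mdeg \<alpha> = m} = card {l :: nat list. length l = CARD('n) \<and> sum_list l = m}"
    by (rule bij_betw_same_card)
  then show ?thesis by (simp add: card_length_sum_list)
qed

lemma finite_mdeg_le: "finite {\<alpha> :: 'n::finite multi_index. mdeg \<alpha> \<le> m}"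
proof -
  have "{\<alpha> :: 'n multi_index. mdeg \<alpha> \<le> m} = (\<Union>k\<le>m. {\<alpha>. mdeg \<alpha> = k})" by auto
  then show ?thesis by (simp add: finite_mdeg)
qed

lemma card_mdeg_le: "card {\<alpha> :: 'n::finite multi_index. mdeg \<alpha> \<le> m} = (m + CARD('n)) choose m"
proof -
  have "{\<alpha> :: 'n multi_index. mdeg \<alpha> \<le> m} = (\<Union>k\<le>m. {\<alpha>. mdeg \<alpha> = k})" by auto
  then have "card {\<alpha> :: 'n multi_index. mdeg \<alpha> \<le> m} = (\<Sum>k\<le>m. card {\<alpha> :: 'n multi_index. mdeg \<alpha> = k})"
    by (simp add: card_UN_disjoint finite_mdeg disjoint_iff)
  also have "\<dots> = (\<Sum>k\<le>m. ((CARD('n) - 1) + k) choose k)"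
    unfolding card_mdeg by (intro sum.cong refl) (simp add: add.commute)
  also have "\<dots> = (m + CARD('n)) choose m"
    unfolding sum_choose_lower by (simp add: add.commute)
  finally show ?thesis .
qed

section \<open>Dimension bounds in the presence of a finite spanning set\<close>

context vector_space
begin

text \<open>In infinite dimension \<open>dim\<close> is the cardinality of an infinite set, that is
  0; the finite spanning set \<open>W\<close> excludes this.\<close>

lemma dim_mono_finite:
  assumes "U \<subseteq> V" "V \<subseteq> span W" "finite W"
  shows "dim U \<le> dim V"
proof -
  obtain B where B: "B \<subseteq> U" "independent B" "U \<subseteq> span B" "card B = dim U" by (rule basis_exists)
  obtain C where C: "C \<subseteq> V" "independent C" "V \<subseteq> span C" "card C = dim V" by (rule basis_exists)
  have "finite C" using independent_span_bound[OF assms(3) C(2)] C(1) assms(2) by blast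
  then have "card B \<le> card C" using independent_span_bound[OF _ B(2), of C] B(1) C(3) assms(1) by blast
  then show ?thesis using B C by simp
qed

lemma finite_basis_exists:
  assumes "V \<subseteq> span W" "finite W"
  obtains B where "finite B" "B \<subseteq> V" "independent B" "V \<subseteq> span B" "card B = dim V"
proof -
  obtain C where C: "C \<subseteq> V" "independent C" "V \<subseteq> span C" "card C = dim V" by (rule basis_exists)
  have "finite C" using independent_span_bound[OF assms(2) C(2)] C(1) assms(1) by blast
  then show ?thesis using C that by blast
qed

end

context vector_space_pair
begin

lemma dim_image_ge_inj:
  assumes f: "Vector_Spaces.linear s1 s2 f" and U: "vs1.subspace U" and inj: "\<And>x. x \<in> U \<Longrightarrow> f x = 0 \<Longrightarrow> x = 0"
    and V: "f ` U \<subseteq> V" "V \<subseteq> vs2.span W" "finite W"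
  shows "vs1.dim U \<le> vs2.dim V"
proof -
  obtain B where B: "B \<subseteq> U" "vs1.independent B" "U \<subseteq> vs1.span B" "card B = vs1.dim U" by (rule vs1.basis_exists)
  have sp: "vs1.span B \<subseteq> U" using vs1.span_minimal[OF B(1) U] .
  have "inj_on f (vs1.span B)"
  proof (rule inj_onI)
    fix x y assume xy: "x \<in> vs1.span B" "y \<in> vs1.span B" "f x = f y"
    have "f (x - y) = 0" using linear_diff[OF f] xy(3) by simp
    moreover have "x - y \<in> U" using vs1.subspace_diff[OF U] xy sp by blast
    ultimately show "x = y" using inj by fastforce
  qed
  then have i: "vs2.independent (f ` B)" and inj: "inj_on f B"
    using linear_independent_injective_image[OF f B(2)] inj_on_subset vs1.span_superset by blast+
  obtain C where C: "finite C" "C \<subseteq> V" "vs2.independent C" "V \<subseteq> vs2.span C" "card C = vs2.dim V"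
    by (rule vs2.finite_basis_exists[OF V(2,3)])
  have "f ` B \<subseteq> vs2.span C" using B(1) C(4) V(1) by blast
  then have "card (f ` B) \<le> card C" using vs2.independent_span_bound[OF C(1) i] by blast
  then show ?thesis using B(4) C(5) card_image[OF inj] by simp
qed

text \<open>One half of rank and nullity, for a part \<open>Z\<close> of the kernel whose growth is
  known instead of the whole kernel.\<close>

lemma dim_image_add_kernel_le:
  assumes f: "Vector_Spaces.linear s1 s2 f" and "Z \<subseteq> U" "\<And>z. z \<in> Z \<Longrightarrow> f z = 0"
    and W: "U \<subseteq> vs1.span W" "finite W"
  shows "vs2.dim (f ` U) + vs1.dim Z \<le> vs1.dim U"
proof -
  have "Z \<subseteq> vs1.span W" using assms by blast
  then obtain B0 where B0: "finite B0" "B0 \<subseteq> Z" "vs1.independent B0" "Z \<subseteq> vs1.span B0" "card B0 = vs1.dim Z"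
    using vs1.finite_basis_exists[OF _ W(2)] by blast
  obtain B where B: "B0 \<subseteq> B" "B \<subseteq> U" "vs1.independent B" "U \<subseteq> vs1.span B"
    by (rule vs1.maximal_independent_subset_extend[of B0 U]) (use B0 assms(2) in auto)
  have fB: "finite B" using vs1.independent_span_bound[OF W(2) B(3)] B(2) W(1) by blast
  have "f ` U \<subseteq> vs2.span (f ` (B - B0))"
  proof -
    have "f ` B \<subseteq> vs2.span (f ` (B - B0))"
    proof
      fix y assume "y \<in> f ` B"
      then obtain b where b: "b \<in> B" "y = f b" by blast
      show "y \<in> vs2.span (f ` (B - B0))"
      proof (cases "b \<in> B0")
        case True
        then have "y = 0" using b assms(3) B0(2) by blast
        then show ?thesis by (simp add: vs2.span_zero)
      next
        case False
        then show ?thesis using b by (intro vs2.span_base) blast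
      qed
    qed
    then have "vs2.span (f ` B) \<subseteq> vs2.span (f ` (B - B0))" by (intro vs2.span_minimal) auto
    moreover have "f ` U \<subseteq> vs2.span (f ` B)"
      unfolding linear_span_image[OF f] using B(4) by blast
    ultimately show ?thesis by blast
  qed
  then have "vs2.dim (f ` U) \<le> card (f ` (B - B0))" using fB by (intro vs2.dim_le_card) auto
  also have "\<dots> \<le> card (B - B0)" using fB by (intro card_image_le) auto
  also have "\<dots> = card B - card B0" using B0(1) B(1) by (rule card_Diff_subset)
  finally show ?thesis using B0(5) vs1.basis_card_eq_dim[OF B(2,4,3)] card_mono[OF fB B(1)] by simp
qed

end

section \<open>Tuples of polynomials filtered by degree\<close>

definition const_poly :: "complex \<Rightarrow> 'n::finite polynomial" where
  "const_poly c = single 0 c"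

definition csc :: "complex \<Rightarrow> (nat \<Rightarrow> 'n::finite polynomial) \<Rightarrow> nat \<Rightarrow> 'n polynomial" where
  "csc c = rsc (const_poly c)"

lemma const_poly_simps:
  "const_poly (a + b) = const_poly a + const_poly b" "const_poly (a * b) = const_poly a * const_poly b"
  "const_poly 1 = 1" "const_poly 0 = 0" by (simp_all add: const_poly_def single_add mult_single)

lemma module_rsc: "module (rsc :: 'r::comm_ring_1 \<Rightarrow> _)" by unfold_locales (simp_all add: rsc_simps)

definition pdeg_le :: "nat \<Rightarrow> 'n::finite polynomial set" where
  "pdeg_le m = {p. \<forall>\<alpha>\<in>keys p. mdeg \<alpha> \<le> m}"

lemma mdeg_add: "mdeg (\<alpha> + \<beta>) = mdeg \<alpha> + mdeg \<beta>" by (simp add: mdeg_def lookup_add sum.distrib)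

lemma pdeg_le_add: "p \<in> pdeg_le m \<Longrightarrow> q \<in> pdeg_le m \<Longrightarrow> p + q \<in> pdeg_le m"
proof -
  assume pq: "p \<in> pdeg_le m" "q \<in> pdeg_le m"
  show "p + q \<in> pdeg_le m"
    unfolding pdeg_le_def
  proof (intro CollectI ballI)
    fix \<alpha> assume "\<alpha> \<in> keys (p + q)"
    then have "\<alpha> \<in> keys p \<or> \<alpha> \<in> keys q" using keys_add[of p q] by auto
    then show "mdeg \<alpha> \<le> m" using pq unfolding pdeg_le_def by blast
  qed
qed

lemma pdeg_le_0: "0 \<in> pdeg_le m" by (simp add: pdeg_le_def)

lemma pdeg_le_mult: "p \<in> pdeg_le m \<Longrightarrow> q \<in> pdeg_le k \<Longrightarrow> p * q \<in> pdeg_le (m + k)"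
proof -
  assume pq: "p \<in> pdeg_le m" "q \<in> pdeg_le k"
  show "p * q \<in> pdeg_le (m + k)"
    unfolding pdeg_le_def
  proof (intro CollectI ballI)
    fix \<alpha> assume "\<alpha> \<in> keys (p * q)"
    then obtain \<beta> \<gamma> where *: "\<alpha> = \<beta> + \<gamma>" "\<beta> \<in> keys p" "\<gamma> \<in> keys q"
      using keys_mult[of p q] by blast
    then have "mdeg \<beta> \<le> m" "mdeg \<gamma> \<le> k" using pq unfolding pdeg_le_def by blast+
    then show "mdeg \<alpha> \<le> m + k" by (simp add: * mdeg_add)
  qed
qed

lemma pdeg_le_mono: "m \<le> k \<Longrightarrow> pdeg_le m \<subseteq> pdeg_le k"
  unfolding pdeg_le_def using le_trans by blast

lemma pdeg_le_single: "mdeg \<alpha> \<le> m \<Longrightarrow> single \<alpha> c \<in> pdeg_le m" by (simp add: pdeg_le_def)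

lemma pdeg_le_ex: "\<exists>m. p \<in> pdeg_le m"
proof
  show "p \<in> pdeg_le (Max (mdeg ` keys p))"
    unfolding pdeg_le_def by (intro CollectI ballI Max_ge) auto
qed

lemma pdeg_le_ex_finite:
  assumes "finite I" shows "\<exists>m. \<forall>i\<in>I. f i \<in> pdeg_le m"
proof -
  have "\<forall>i. \<exists>m. f i \<in> pdeg_le m" using pdeg_le_ex by blast
  then obtain k where k: "\<And>i. f i \<in> pdeg_le (k i)" by metis
  have "f i \<in> pdeg_le (Max (k ` I))" if "i \<in> I" for i
    using k[of i] pdeg_le_mono[of "k i" "Max (k ` I)"] assms that by auto
  then show ?thesis by blast
qed

text \<open>The support is an arbitrary set of coordinates because ranks will be counted on subsets
  of the coordinates.\<close>

definition FL :: "nat set \<Rightarrow> nat \<Rightarrow> (nat \<Rightarrow> 'n::finite polynomial) set" where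
  "FL I m = {u. (\<forall>i. i \<notin> I \<longrightarrow> u i = 0) \<and> (\<forall>i. u i \<in> pdeg_le m)}"

global_interpretation fv: vector_space "csc :: complex \<Rightarrow> _ \<Rightarrow> nat \<Rightarrow> 'n::finite polynomial"
  by unfold_locales (simp_all add: csc_def rsc_simps const_poly_simps)

lemma csc_apply: "csc c u i = const_poly c * u i" by (simp add: csc_def rsc_def)

lemma pdeg_le_const_mult: "p \<in> pdeg_le m \<Longrightarrow> const_poly c * p \<in> pdeg_le m"
  using pdeg_le_mult[of "const_poly c" 0 p m] pdeg_le_single[of 0 0 c] by (simp add: const_poly_def mdeg_def)

lemma FL_subspace: "fv.subspace (FL I m)"
  unfolding fv.subspace_def by (auto simp: FL_def pdeg_le_0 pdeg_le_add csc_apply pdeg_le_const_mult)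

lemma FL_mono: "I \<subseteq> J \<Longrightarrow> m \<le> k \<Longrightarrow> FL I m \<subseteq> FL J k"
  unfolding FL_def using pdeg_le_mono[of m k] by blast

definition munit :: "nat \<times> 'n::finite multi_index \<Rightarrow> nat \<Rightarrow> 'n polynomial" where
  "munit = (\<lambda>(i, \<alpha>) k. if k = i then single \<alpha> 1 else 0)"

definition FLidx :: "nat set \<Rightarrow> nat \<Rightarrow> (nat \<times> 'n::finite multi_index) set" where
  "FLidx I m = I \<times> {\<alpha>. mdeg \<alpha> \<le> m}"

lemma lookup_sum_munit:
  assumes "finite S" "(i, \<alpha>) \<in> S"
  shows "lookup ((\<Sum>x\<in>S. csc (f x) (munit x)) i) \<alpha> = f (i, \<alpha>)"
proof -
  have "lookup ((\<Sum>x\<in>S. csc (f x) (munit x)) i) \<alpha>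
      = (\<Sum>x\<in>S. if x = (i, \<alpha>) then f x else 0)"
    unfolding sum_fun_apply lookup_sum by (intro sum.cong refl)
       (auto simp: munit_def csc_apply const_poly_def mult_single lookup_single when_def split: prod.split)
  then show ?thesis using assms by simp
qed

lemma inj_munit: "inj munit"
proof (rule injI)
  fix x y :: "nat \<times> 'a multi_index" assume eq: "munit x = munit y"
  obtain i \<alpha> j \<beta> where xy: "x = (i, \<alpha>)" "y = (j, \<beta>)" by (cases x, cases y)
  have "lookup (munit x i) \<alpha> = lookup (munit y i) \<alpha>" by (simp add: eq)
  then show "x = y" by (auto simp: xy munit_def lookup_single when_def split: if_splits)
qed

lemma finite_FLidx: "finite I \<Longrightarrow> finite (FLidx I m)" by (simp add: FLidx_def finite_mdeg_le)

lemma independent_munit: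
  assumes "finite S" shows "fv.independent (munit ` S)"
proof (rule fv.independent_if_scalars_zero)
  fix f x assume 0: "(\<Sum>x\<in>munit ` S. csc (f x) x) = 0" and x: "x \<in> munit ` S"
  then obtain i \<alpha> where i: "(i, \<alpha>) \<in> S" "x = munit (i, \<alpha>)" by auto
  have "(\<Sum>x\<in>S. csc ((f \<circ> munit) x) (munit x)) = 0"
    using 0 by (subst (asm) sum.reindex) (auto simp: inj_on_subset[OF inj_munit])
  then have "lookup ((0 :: nat \<Rightarrow> 'a polynomial) i) \<alpha> = (f \<circ> munit) (i, \<alpha>)"
    using lookup_sum_munit[OF assms i(1), of "f \<circ> munit"] by metis
  then show "f x = 0" by (simp add: i)
qed (use assms in simp)

lemma FL_expansion:
  assumes "finite I" "u \<in> FL I m"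
  shows "u = (\<Sum>x\<in>FLidx I m. csc (lookup (u (fst x)) (snd x)) (munit x))"
proof (rule ext, rule poly_mapping_eqI)
  fix i \<alpha>
  show "lookup (u i) \<alpha> = lookup ((\<Sum>x\<in>FLidx I m. csc (lookup (u (fst x)) (snd x)) (munit x)) i) \<alpha>"
  proof (cases "(i, \<alpha>) \<in> FLidx I m")
    case True
    then show ?thesis by (subst lookup_sum_munit) (auto simp: finite_FLidx assms)
  next
    case False
    have "lookup ((\<Sum>x\<in>FLidx I m. csc (lookup (u (fst x)) (snd x)) (munit x)) i) \<alpha> = 0"
      unfolding sum_fun_apply lookup_sum using False by (intro sum.neutral)
         (auto simp: munit_def csc_apply const_poly_def mult_single lookup_single when_def split: prod.split)
    moreover have "lookup (u i) \<alpha> = 0"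
    proof (cases "i \<in> I")
      case True
      then have "\<not> mdeg \<alpha> \<le> m" using False by (simp add: FLidx_def)
      then have "\<alpha> \<notin> keys (u i)" using assms(2) unfolding FL_def pdeg_le_def by blast
      then show ?thesis by (simp add: in_keys_iff)
    qed (use assms(2) in \<open>simp add: FL_def\<close>)
    ultimately show ?thesis by simp
  qed
qed

lemma munit_FL: "x \<in> FLidx I m \<Longrightarrow> munit x \<in> FL I m"
  by (auto simp: FLidx_def FL_def munit_def pdeg_le_single pdeg_le_0)

lemma FL_span:
  assumes "finite I" shows "FL I m \<subseteq> fv.span (munit ` FLidx I m)"
proof
  fix u :: "nat \<Rightarrow> 'a polynomial" assume "u \<in> FL I m"
  then have u: "u = (\<Sum>x\<in>FLidx I m. csc (lookup (u (fst x)) (snd x)) (munit x))" by (rule FL_expansion[OF assms])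
  show "u \<in> fv.span (munit ` FLidx I m)" by (subst u) (intro fv.span_sum fv.span_scale fv.span_base imageI)
qed

text \<open>The dimension of the polynomials of degree at most \<open>m\<close>: the growth of a
  free module of rank 1, against which all growth is measured.\<close>

definition ccount :: "'n::finite itself \<Rightarrow> nat \<Rightarrow> nat" where
  "ccount _ m = (m + CARD('n)) choose m"

lemma FL_dim:
  assumes "finite I" shows "fv.dim (FL I m :: (nat \<Rightarrow> 'n::finite polynomial) set) = card I * ccount TYPE('n) m"
proof -
  have "fv.dim (FL I m :: (nat \<Rightarrow> 'n polynomial) set) = card (munit ` FLidx I m :: (nat \<Rightarrow> 'n polynomial) set)"
    by (rule fv.basis_card_eq_dim[symmetric])
       (use munit_FL in \<open>auto intro!: independent_munit FL_span finite_FLidx assms\<close>)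
  also have "\<dots> = card (FLidx I m :: (nat \<times> 'n multi_index) set)"
    by (rule card_image) (rule inj_on_subset[OF inj_munit], simp)
  finally show ?thesis by (simp add: FLidx_def card_cartesian_product card_mdeg_le ccount_def)
qed

section \<open>Asymptotic comparison with the number of monomials\<close>

lemma binomial_asymp: "(\<lambda>m. real ((m + n) choose m) / real m ^ n) \<longlonglongrightarrow> 1 / fact n"
proof -
  have "real ((m + n) choose m) = (\<Prod>i\<in>{1..n}. (real m + real i)) / fact n" for m
  proof -
    have "(m + n) choose m = (m + n) choose n" using binomial_symmetric[of m "m + n"] by simp
    then have "real ((m + n) choose m) = real ((m + n) choose n)" by simp
    also have "\<dots> = (\<Prod>i<n. real (m + n) - real i) / fact n"
      by (simp add: binomial_gbinomial gbinomial_prod_rev atLeast0LessThan)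
    also have "(\<Prod>i<n. real (m + n) - real i) = (\<Prod>i\<in>{1..n}. (real m + real i))"
      by (rule prod.reindex_bij_witness[where i = "\<lambda>i. n - i" and j = "\<lambda>i. n - i"]) auto
    finally show ?thesis .
  qed
  then have eq: "real ((m + n) choose m) / real m ^ n = (\<Prod>i\<in>{1..n}. (real m + real i) / real m) / fact n" for m
    by (simp add: prod_dividef)
  have "(\<lambda>m. (\<Prod>i\<in>{1..n}. (real m + real i) / real m) / fact n) \<longlonglongrightarrow> (\<Prod>i\<in>{1..n}. 1) / fact n"
  proof (intro tendsto_divide tendsto_prod tendsto_const)
    fix i
    have "(\<lambda>m. 1 + real i / real m) \<longlonglongrightarrow> 1 + 0"
      by (intro tendsto_add tendsto_const lim_const_over_n)
    moreover have "\<forall>\<^sub>F m in sequentially. 1 + real i / real m = (real m + real i) / real m"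
      using eventually_gt_at_top[of 0] by eventually_elim (simp add: field_simps)
    ultimately show "(\<lambda>m. (real m + real i) / real m) \<longlonglongrightarrow> 1" by (simp add: tendsto_cong)
  qed simp
  then show ?thesis unfolding eq by simp
qed

lemma ccount_asymp: "(\<lambda>m. real (ccount TYPE('n::finite) m) / real m ^ CARD('n)) \<longlonglongrightarrow> 1 / fact CARD('n)"
  unfolding ccount_def by (rule binomial_asymp)

lemma ccount_pos: "ccount TYPE('n::finite) m > 0" by (simp add: ccount_def)

abbreviation growth_rate :: "'n::finite itself \<Rightarrow> (nat \<Rightarrow> nat) \<Rightarrow> real \<Rightarrow> bool"
  where "growth_rate N a K \<equiv> (\<lambda>m. real (a m) / real (ccount N m)) \<longlonglongrightarrow> K"

text \<open>Constant shifts of the degree do not affect the leading growth. Such shifts are all that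
  a change of generators can cause.\<close>

lemma ccount_shift: "(\<lambda>m. real (ccount TYPE('n::finite) (m + k)) / real (ccount TYPE('n) m)) \<longlonglongrightarrow> 1"
proof -
  let ?n = "CARD('n)" and ?c = "\<lambda>m. real (ccount TYPE('n::finite) m)"
  have 1: "(\<lambda>m. ?c (m + k) / real (m + k) ^ ?n) \<longlonglongrightarrow> 1 / fact ?n"
    using ccount_asymp[where ?'n = 'n] by (rule LIMSEQ_ignore_initial_segment)
  have "(\<lambda>m. (1 + real k / real m) ^ ?n) \<longlonglongrightarrow> (1 + 0) ^ ?n"
    by (intro tendsto_power tendsto_add tendsto_const lim_const_over_n)
  then have "(\<lambda>m. (?c (m + k) / real (m + k) ^ ?n) * (1 + real k / real m) ^ ?n / (?c m / real m ^ ?n)) \<longlonglongrightarrow> (1 / fact ?n) * (1 + 0) ^ ?n / (1 / fact ?n)"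
    by (intro tendsto_intros 1 ccount_asymp) auto
  moreover have "\<forall>\<^sub>F m in sequentially. (?c (m + k) / real (m + k) ^ ?n) * (1 + real k / real m) ^ ?n / (?c m / real m ^ ?n) = ?c (m + k) / ?c m"
    using eventually_gt_at_top[of 0]
  proof eventually_elim
    case (elim m)
    have "(1 + real k / real m) ^ ?n = real (m + k) ^ ?n / real m ^ ?n"
    proof -
      have "1 + real k / real m = real (m + k) / real m" using elim by (simp add: add_divide_distrib)
      then show ?thesis by (simp only: power_divide)
    qed
    moreover have "real (m + k) ^ ?n \<noteq> 0" "real m ^ ?n \<noteq> 0" using elim by auto
    ultimately show ?case by simp
  qed
  ultimately show ?thesis by (simp add: tendsto_cong)
qed

lemma ccount_squeeze:
  fixes a :: "nat \<Rightarrow> nat"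
  assumes "\<And>m. a m \<le> K * ccount TYPE('n::finite) (m + k)" "\<And>m. K * ccount TYPE('n) m \<le> a (m + l)"
  shows "growth_rate TYPE('n) a (real K)"
proof -
  let ?c = "\<lambda>m. real (ccount TYPE('n) m)"
  have pos: "?c m > 0" for m using ccount_pos[where ?'n = 'n] by simp
  have s: "(\<lambda>m. ?c (m + k) / ?c m) \<longlonglongrightarrow> 1" by (rule ccount_shift)
  have "(\<lambda>m. real (a (m + l)) / ?c (m + l)) \<longlonglongrightarrow> real K"
  proof (rule tendsto_sandwich)
    have "(\<lambda>m. real K / (?c (m + l) / ?c m)) \<longlonglongrightarrow> real K / 1"
      by (intro tendsto_intros ccount_shift) auto
    then show "(\<lambda>m. real K / (?c (m + l) / ?c m)) \<longlonglongrightarrow> real K" by simp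
    have "(\<lambda>m. real K * (?c ((m + l) + k) / ?c (m + l))) \<longlonglongrightarrow> real K * 1"
      by (intro tendsto_mult tendsto_const LIMSEQ_ignore_initial_segment[OF s, of l])
    then show "(\<lambda>m. real K * (?c ((m + l) + k) / ?c (m + l))) \<longlonglongrightarrow> real K" by simp
    show "\<forall>\<^sub>F m in sequentially. real K / (?c (m + l) / ?c m) \<le> real (a (m + l)) / ?c (m + l)"
    proof (rule always_eventually, rule allI)
      fix m have "real K * ?c m \<le> real (a (m + l))" using assms(2)[of m] by (metis of_nat_le_iff of_nat_mult)
      then show "real K / (?c (m + l) / ?c m) \<le> real (a (m + l)) / ?c (m + l)"
        using pos[of "m + l"] by (simp add: divide_right_mono)
    qed
    show "\<forall>\<^sub>F m in sequentially. real (a (m + l)) / ?c (m + l) \<le> real K * (?c ((m + l) + k) / ?c (m + l))"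
    proof (rule always_eventually, rule allI)
      fix m have "real (a (m + l)) \<le> real K * ?c ((m + l) + k)" using assms(1)[of "m + l"] by (metis of_nat_le_iff of_nat_mult)
      then show "real (a (m + l)) / ?c (m + l) \<le> real K * (?c ((m + l) + k) / ?c (m + l))"
        using pos[of "m + l"] by (simp add: divide_right_mono)
    qed
  qed
  then show ?thesis by (rule LIMSEQ_offset)
qed

text \<open>For situations where the upper bound is indirect: \<open>a\<close> together with a
  disjoint piece of growth \<open>K'\<close> fits into a free module of rank
  \<open>K + K'\<close>.\<close>

lemma ccount_ratio_limit:
  fixes a :: "nat \<Rightarrow> nat"
  assumes "\<And>m. K * ccount TYPE('n::finite) m \<le> a m"
    and "\<And>m. a (m + k) + K' * ccount TYPE('n) m \<le> (K + K') * ccount TYPE('n) (m + k)"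
  shows "growth_rate TYPE('n) a (real K)"
proof -
  let ?c = "\<lambda>m. real (ccount TYPE('n) m)"
  have pos: "?c m > 0" for m using ccount_pos[where ?'n = 'n] by simp
  have "(\<lambda>m. real (a (m + k)) / ?c (m + k)) \<longlonglongrightarrow> real K"
  proof (rule tendsto_sandwich)
    show "(\<lambda>m. real K) \<longlonglongrightarrow> real K" by simp
    have "(\<lambda>m. real (K + K') - real K' / (?c (m + k) / ?c m)) \<longlonglongrightarrow> real (K + K') - real K' / 1"
      by (intro tendsto_intros ccount_shift) auto
    then show "(\<lambda>m. real (K + K') - real K' / (?c (m + k) / ?c m)) \<longlonglongrightarrow> real K" by simp
    show "\<forall>\<^sub>F m in sequentially. real K \<le> real (a (m + k)) / ?c (m + k)"
    proof (rule always_eventually, rule allI)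
      fix m have "real K * ?c (m + k) \<le> real (a (m + k))" using assms(1)[of "m + k"] by (metis of_nat_le_iff of_nat_mult)
      then show "real K \<le> real (a (m + k)) / ?c (m + k)" using pos[of "m + k"] by (simp add: le_divide_eq)
    qed
    show "\<forall>\<^sub>F m in sequentially. real (a (m + k)) / ?c (m + k) \<le> real (K + K') - real K' / (?c (m + k) / ?c m)"
    proof (rule always_eventually, rule allI)
      fix m
      have "real (a (m + k)) + real K' * ?c m \<le> real (K + K') * ?c (m + k)"
        using assms(2)[of m] by (metis of_nat_le_iff of_nat_mult of_nat_add)
      then have "real (a (m + k)) \<le> real (K + K') * ?c (m + k) - real K' * ?c m" by simp
      then have "real (a (m + k)) / ?c (m + k) \<le> (real (K + K') * ?c (m + k) - real K' * ?c m) / ?c (m + k)"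
        by (rule divide_right_mono) simp
      also have "\<dots> = real (K + K') - real K' / (?c (m + k) / ?c m)"
        using pos[of "m + k"] by (simp add: diff_divide_distrib)
      finally show "real (a (m + k)) / ?c (m + k) \<le> real (K + K') - real K' / (?c (m + k) / ?c m)" .
    qed
  qed
  then show ?thesis by (rule LIMSEQ_offset)
qed

text \<open>Two filtrations that contain each other up to a shift grow alike.\<close>

lemma ccount_limit_transfer:
  fixes a b :: "nat \<Rightarrow> nat"
  assumes b: "(\<lambda>m. real (b m) / real (ccount TYPE('n::finite) m)) \<longlonglongrightarrow> K"
    and "\<And>m. b m \<le> a (m + k)" "\<And>m. a m \<le> b (m + l)"
  shows "growth_rate TYPE('n) a K"
proof -
  let ?c = "\<lambda>m. real (ccount TYPE('n) m)"
  have pos: "?c m > 0" for m using ccount_pos[where ?'n = 'n] by simp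
  have s: "(\<lambda>m. ?c (m + l) / ?c m) \<longlonglongrightarrow> 1" by (rule ccount_shift)
  have "(\<lambda>m. real (a (m + k)) / ?c (m + k)) \<longlonglongrightarrow> K"
  proof (rule tendsto_sandwich)
    have "(\<lambda>m. (real (b m) / ?c m) / (?c (m + k) / ?c m)) \<longlonglongrightarrow> K / 1"
      by (intro tendsto_intros ccount_shift b) auto
    then show "(\<lambda>m. (real (b m) / ?c m) / (?c (m + k) / ?c m)) \<longlonglongrightarrow> K" by simp
    have "(\<lambda>m. (real (b (m + k + l)) / ?c (m + k + l)) * (?c (m + k + l) / ?c (m + k))) \<longlonglongrightarrow> K * 1"
      by (intro tendsto_mult LIMSEQ_ignore_initial_segment[OF s, of k]
          LIMSEQ_ignore_initial_segment[OF LIMSEQ_ignore_initial_segment[OF b, of l], of k])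
    then show "(\<lambda>m. (real (b (m + k + l)) / ?c (m + k + l)) * (?c (m + k + l) / ?c (m + k))) \<longlonglongrightarrow> K" by simp
    show "\<forall>\<^sub>F m in sequentially. (real (b m) / ?c m) / (?c (m + k) / ?c m) \<le> real (a (m + k)) / ?c (m + k)"
      using pos assms(2) by (intro always_eventually allI) (simp add: divide_right_mono less_imp_neq[THEN not_sym])
    show "\<forall>\<^sub>F m in sequentially. real (a (m + k)) / ?c (m + k) \<le> (real (b (m + k + l)) / ?c (m + k + l)) * (?c (m + k + l) / ?c (m + k))"
      using pos assms(3) by (intro always_eventually allI) (simp add: divide_right_mono less_imp_neq[THEN not_sym])
  qed
  then show ?thesis by (rule LIMSEQ_offset)
qed

lemma frees_UNIV_FL: "u \<in> frees UNIV r \<Longrightarrow> \<exists>m. u \<in> FL {..<r} m"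
proof -
  assume u: "u \<in> frees UNIV r"
  obtain m where m: "\<forall>i\<in>{..<r}. u i \<in> pdeg_le m" using pdeg_le_ex_finite[of "{..<r}" u] by auto
  have "u i \<in> pdeg_le m" for i using m u pdeg_le_0 by (cases "i < r") (auto simp: frees_def)
  then have "u \<in> FL {..<r} m" using u by (auto simp: FL_def frees_def)
  then show ?thesis ..
qed

lemma FL_frees: "FL {..<r} m \<subseteq> frees UNIV r" by (auto simp: FL_def frees_def)

lemma FL_rsc: "p \<in> pdeg_le m \<Longrightarrow> u \<in> FL I k \<Longrightarrow> rsc p u \<in> FL I (m + k)"
  by (auto simp: FL_def rsc_def intro: pdeg_le_mult)

lemma linear_lin: "Vector_Spaces.linear csc csc (lin r g)"
  unfolding module_hom_iff_linear[symmetric]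
  by unfold_locales (simp_all add: fv.module_axioms[unfolded module_def] lin_add csc_def lin_rsc rsc_simps const_poly_simps)

global_interpretation fvp: vector_space_pair "csc :: complex \<Rightarrow> _ \<Rightarrow> nat \<Rightarrow> 'n::finite polynomial" "csc :: complex \<Rightarrow> _ \<Rightarrow> nat \<Rightarrow> 'n polynomial"
  by unfold_locales

section \<open>Rank and growth of finitely generated modules\<close>

locale poly_module = module act for act :: "'n::finite polynomial \<Rightarrow> 'm::ab_group_add \<Rightarrow> 'm"
begin

definition cs :: "complex \<Rightarrow> 'm \<Rightarrow> 'm" where "cs c = act (const_poly c)"

sublocale cvs: vector_space cs
  by unfold_locales (simp_all add: cs_def const_poly_simps scale_left_distrib scale_right_distrib)

sublocale cvp: vector_space_pair "csc :: complex \<Rightarrow> _ \<Rightarrow> nat \<Rightarrow> 'n polynomial" cs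
  by unfold_locales

definition L :: "nat \<Rightarrow> (nat \<Rightarrow> 'm) \<Rightarrow> (nat \<Rightarrow> 'n polynomial) \<Rightarrow> 'm" where
  "L r g u = (\<Sum>i<r. act (u i) (g i))"

lemma L_add: "L r g (u + v) = L r g u + L r g v"
  and L_rsc: "L r g (rsc p u) = act p (L r g u)"
  and L_diff: "L r g (u - v) = L r g u - L r g v"
  by (simp_all add: L_def scale_left_distrib sum.distrib rsc_def scale_sum_right scale_left_diff_distrib sum_subtractf)

lemma L_0 [simp]: "L r g 0 = 0" by (simp add: L_def)

lemma linear_L: "Vector_Spaces.linear csc cs (L r g)"
  unfolding module_hom_iff_linear[symmetric]
  by (rule module_hom.intro[OF fv.module_axioms cvs.module_axioms], unfold_locales)
     (simp_all add: L_add csc_def L_rsc cs_def)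

lemma L_unit: "i < r \<Longrightarrow> L r g (\<lambda>j. if j = i then 1 else 0) = g i"
proof -
  assume "i < r"
  have "act (if j = i then 1 else 0) (g j) = (if j = i then g i else 0)" for j by simp
  then show ?thesis using \<open>i < r\<close> by (simp add: L_def)
qed

lemma L_kernel_submod: "submod UNIV {u \<in> frees UNIV r. L r g u = 0}"
proof -
  have UR: "subring (UNIV :: 'n polynomial set)" by (simp add: subring_def)
  show ?thesis
    unfolding submod_def
  proof (intro conjI ballI CollectI)
    show "(0 :: nat \<Rightarrow> 'n polynomial) \<in> frees UNIV r" by (rule frees_closed(1)[OF UR])
    show "L r g 0 = 0" by (rule L_0)
  next
    fix u v assume "u \<in> {u \<in> frees UNIV r. L r g u = 0}" "v \<in> {u \<in> frees UNIV r. L r g u = 0}"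
    then show "u + v \<in> frees UNIV r" "L r g (u + v) = 0" using frees_closed(2)[OF UR, of u r v] L_add[of r g u v] by auto
  next
    fix a u assume "u \<in> {u \<in> frees UNIV r. L r g u = 0}"
    then show "rsc a u \<in> frees UNIV r" "L r g (rsc a u) = 0"
      using frees_closed(5)[OF UR UNIV_I, of u r a] L_rsc[of r g a u] by auto
  qed
qed

text \<open>\<open>k\<close> is the rank of the module generated by the \<open>g i\<close>, obtained
  as the largest size of a set \<open>I\<close> of coordinates that supports no nonzero relation.
  The last conclusion allows an arbitrary presentation of the module of relations; this is what
  passes the growth from one map of a resolution to the next.\<close>

lemma rank_growth:
  fixes g :: "nat \<Rightarrow> 'm" and r :: nat
  obtains k where "k \<le> r"
    "growth_rate TYPE('n) (\<lambda>m. cvs.dim (L r g ` FL {..<r} m)) (real k)"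
    "\<And>s h. lin s h ` frees UNIV s = {u \<in> frees UNIV r. L r g u = 0} \<Longrightarrow>
      growth_rate TYPE('n) (\<lambda>m. fv.dim (lin s h ` FL {..<s} m)) (real (r - k))"
proof -
  define N where "N = {u \<in> frees UNIV r. L r g u = 0}"
  have NF: "N \<subseteq> frees UNIV r" by (auto simp: N_def)
  define P where "P I \<longleftrightarrow> I \<subseteq> {..<r} \<and> (\<forall>u\<in>N. (\<forall>i. i \<notin> I \<longrightarrow> u i = 0) \<longrightarrow> u = 0)" for I
  have P0: "P {}" by (auto simp: P_def fun_eq_iff)
  have "card I \<le> r" if "P I" for I using card_mono[of "{..<r}" I] that by (auto simp: P_def)
  then have "\<exists>I. P I \<and> (\<forall>J. P J \<longrightarrow> card J \<le> card I)"
    using ex_has_greatest_nat[of P "{}" card "Suc r"] P0 by (simp add: le_imp_less_Suc)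
  then obtain I where I: "P I" and Imax: "\<And>J. P J \<Longrightarrow> card J \<le> card I" by blast
  define J where "J = {..<r} - I"
  define k where "k = card I"
  have Isub: "I \<subseteq> {..<r}" and fin: "finite I" "finite J"
    using I finite_subset[of I "{..<r}"] by (auto simp: P_def J_def)
  have IN: "u = 0" if "u \<in> N" "\<And>i. i \<notin> I \<Longrightarrow> u i = 0" for u using I that by (auto simp: P_def)
  have k: "k \<le> r" "card J = r - k"
    using card_mono[OF _ Isub] card_Diff_subset[OF fin(1) Isub] by (auto simp: k_def J_def)
  \<comment> \<open>Maximality of \<open>I\<close>: each further coordinate \<open>j\<close> admits
    a relation \<open>y j\<close> that involves \<open>j\<close> and otherwise only
    \<open>I\<close>. Restricted to the coordinates \<open>J\<close>, the \<open>y j\<close> form a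
    diagonal matrix with nonzero entries.\<close>
  have "\<forall>j. j \<in> J \<longrightarrow> (\<exists>y. y \<in> N \<and> y j \<noteq> 0 \<and> (\<forall>i. i \<notin> insert j I \<longrightarrow> y i = 0))"
  proof (intro allI impI)
    fix j assume j: "j \<in> J"
    then have "\<not> P (insert j I)" using Imax[of "insert j I"] fin by (auto simp: J_def)
    then obtain y where y: "y \<in> N" "\<forall>i. i \<notin> insert j I \<longrightarrow> y i = 0" "y \<noteq> 0"
      using j Isub by (auto simp: P_def J_def)
    have "y j \<noteq> 0"
    proof
      assume "y j = 0"
      then have "y i = 0" if "i \<notin> I" for i using y(2) that by (cases "i = j") auto
      then show False using IN[OF y(1)] y(3) by blast
    qed
    then show "\<exists>y. y \<in> N \<and> y j \<noteq> 0 \<and> (\<forall>i. i \<notin> insert j I \<longrightarrow> y i = 0)" using y by blast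
  qed
  then obtain y where y: "\<And>j. j \<in> J \<Longrightarrow> y j \<in> N" "\<And>j. j \<in> J \<Longrightarrow> y j j \<noteq> 0"
    "\<And>j i. j \<in> J \<Longrightarrow> i \<notin> insert j I \<Longrightarrow> y j i = 0" by metis
  define Y where "Y u = (\<Sum>j\<in>J. rsc (u j) (y j))" for u :: "nat \<Rightarrow> 'n polynomial"
  have Ylin: "Vector_Spaces.linear csc csc Y"
  proof -
    have "Y (u + v) = Y u + Y v" for u v
      unfolding Y_def sum.distrib[symmetric] by (intro sum.cong refl) (simp add: rsc_def fun_eq_iff distrib_right)
    moreover have "Y (csc c u) = csc c (Y u)" for c u
      unfolding Y_def fv.scale_sum_right by (intro sum.cong refl) (simp add: rsc_def fun_eq_iff csc_apply mult.assoc)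
    ultimately show ?thesis
      unfolding module_hom_iff_linear[symmetric]
      by (intro module_hom.intro[OF fv.module_axioms fv.module_axioms], unfold_locales)
  qed
  have Yj: "Y u j = u j * y j j" if "j \<in> J" for u j
  proof -
    have "Y u j = (\<Sum>j'\<in>J. if j' = j then u j * y j j else 0)"
      unfolding Y_def sum_fun_apply
    proof (intro sum.cong refl)
      fix j' assume "j' \<in> J"
      then show "rsc (u j') (y j') j = (if j' = j then u j * y j j else 0)"
        using y(3)[of j' j] that by (auto simp: rsc_def J_def)
    qed
    then show ?thesis using that fin by simp
  qed
  have Yinj: "u = 0" if "u \<in> FL J m" "Y u = 0" for u m
  proof
    fix j show "u j = 0 j"
    proof (cases "j \<in> J")
      case True
      then have "u j * y j j = 0" using Yj[OF True, of u] that(2) by simp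
      then show ?thesis using polynomial_no_zero_divisors[of "y j j" "u j"] y(2)[OF True] by (simp add: mult.commute)
    qed (use that(1) in \<open>simp add: FL_def\<close>)
  qed
  have submodN: "submod UNIV N"
    unfolding N_def by (rule L_kernel_submod)
  have YN: "Y u \<in> N" for u
    unfolding Y_def by (intro submod_sum[OF submodN] submodD(3)[OF submodN] y(1)) auto
  obtain k0 where k0: "\<And>j. j \<in> J \<Longrightarrow> y j \<in> FL {..<r} k0"
  proof -
    have "\<forall>j. j \<in> J \<longrightarrow> (\<exists>m. y j \<in> FL {..<r} m)" using frees_UNIV_FL y(1) NF by blast
    then obtain m where m: "\<And>j. j \<in> J \<Longrightarrow> y j \<in> FL {..<r} (m j)" by metis
    have "y j \<in> FL {..<r} (Max (m ` J))" if "j \<in> J" for j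
      using m[OF that] FL_mono[of "{..<r}" "{..<r}" "m j" "Max (m ` J)"] fin(2) that by auto
    then show ?thesis by (rule that)
  qed
  have YFL: "Y u \<in> FL {..<r} (m + k0)" if "u \<in> FL J m" for u m
    unfolding Y_def by (intro fv.subspace_sum[OF FL_subspace] FL_rsc k0) (use that in \<open>auto simp: FL_def\<close>)
  have dimY: "(r - k) * ccount TYPE('n) m = fv.dim (FL J m :: (nat \<Rightarrow> 'n polynomial) set)" for m
    using FL_dim[OF fin(2)] k(2) by metis
  note spans = FL_span[of "{..<r}"] finite_imageI[OF finite_FLidx[of "{..<r}"]]
  show ?thesis
  proof (rule that[OF k(1)])
    show "growth_rate TYPE('n) (\<lambda>m. cvs.dim (L r g ` FL {..<r} m)) (real k)"
    proof (rule ccount_ratio_limit)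
      fix m
      have "k * ccount TYPE('n) m = fv.dim (FL I m :: (nat \<Rightarrow> 'n polynomial) set)"
        by (simp add: k_def FL_dim[OF fin(1)])
      also have "\<dots> \<le> cvs.dim (L r g ` FL {..<r} m)"
      proof (rule cvp.dim_image_ge_inj[OF linear_L FL_subspace])
        fix u assume u: "u \<in> FL I m" "L r g u = 0"
        then have "u \<in> N" using Isub by (auto simp: N_def FL_def frees_def)
        then show "u = 0" by (rule IN) (use u in \<open>simp add: FL_def\<close>)
      next
        show "L r g ` FL I m \<subseteq> L r g ` FL {..<r} m" using FL_mono[OF Isub] by blast
        show "L r g ` FL {..<r} m \<subseteq> cvs.span (L r g ` munit ` FLidx {..<r} m)"
          unfolding cvp.linear_span_image[OF linear_L] using spans(1) by blast
        show "finite (L r g ` munit ` FLidx {..<r} m)" by (intro finite_imageI finite_FLidx) simp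
      qed
      finally show "k * ccount TYPE('n) m \<le> cvs.dim (L r g ` FL {..<r} m)" .
    next
      fix m
      \<comment> \<open>The combinations \<open>Y u\<close> are relations of growth
        \<open>r - k\<close>, which bounds the growth of the image from above.\<close>
      have "(r - k) * ccount TYPE('n) m \<le> fv.dim (Y ` FL J m)"
        unfolding dimY
      proof (rule fvp.dim_image_ge_inj[OF Ylin FL_subspace _ order_refl])
        show "u = 0" if "u \<in> FL J m" "Y u = 0" for u using Yinj that by blast
        show "Y ` FL J m \<subseteq> fv.span (munit ` FLidx {..<r} (m + k0))" using YFL spans(1)[OF finite_lessThan] by blast
        show "finite (munit ` FLidx {..<r} (m + k0) :: (nat \<Rightarrow> 'n polynomial) set)"
          by (intro finite_imageI finite_FLidx) simp
      qed
      moreover have "cvs.dim (L r g ` FL {..<r} (m + k0)) + fv.dim (Y ` FL J m) \<le> fv.dim (FL {..<r} (m + k0) :: (nat \<Rightarrow> 'n polynomial) set)"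
      proof (rule cvp.dim_image_add_kernel_le[OF linear_L])
        show "Y ` FL J m \<subseteq> FL {..<r} (m + k0)" using YFL by blast
        show "L r g z = 0" if "z \<in> Y ` FL J m" for z using that YN by (auto simp: N_def)
        show "FL {..<r} (m + k0) \<subseteq> fv.span (munit ` FLidx {..<r} (m + k0))" by (rule FL_span) simp
        show "finite (munit ` FLidx {..<r} (m + k0) :: (nat \<Rightarrow> 'n polynomial) set)"
          by (intro finite_imageI finite_FLidx) simp
      qed
      ultimately show "cvs.dim (L r g ` FL {..<r} (m + k0)) + (r - k) * ccount TYPE('n) m \<le> (k + (r - k)) * ccount TYPE('n) (m + k0)"
        using k(1) by (simp add: FL_dim)
    qed
  next
    fix s h assume sh: "lin s h ` frees UNIV s = {u \<in> frees UNIV r. L r g u = 0}"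
    then have im: "lin s h ` frees UNIV s = N" by (simp add: N_def)
    have UR: "subring (UNIV :: 'n polynomial set)" by (simp add: subring_def)
    have hN: "h i \<in> N" if "i < s" for i using generator_in[OF UR that] im by blast
    obtain k1 where k1: "\<And>i. i < s \<Longrightarrow> h i \<in> FL {..<r} k1"
    proof -
      have "\<forall>i. i < s \<longrightarrow> (\<exists>m. h i \<in> FL {..<r} m)" using frees_UNIV_FL hN NF by blast
      then obtain m where m: "\<And>i. i < s \<Longrightarrow> h i \<in> FL {..<r} (m i)" by metis
      have "h i \<in> FL {..<r} (Max (m ` {..<s}))" if "i < s" for i
        using m[OF that] FL_mono[of "{..<r}" "{..<r}" "m i" "Max (m ` {..<s})"] that by auto
      then show ?thesis by (rule that)
    qed
    have shFL: "lin s h u \<in> FL {..<r} (m + k1)" if "u \<in> FL {..<s} m" for u m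
      unfolding lin_eq_sum
      by (intro fv.subspace_sum[OF FL_subspace] FL_rsc k1) (use that in \<open>auto simp: FL_def\<close>)
    obtain w where w: "\<And>j. j \<in> J \<Longrightarrow> w j \<in> frees UNIV s" "\<And>j. j \<in> J \<Longrightarrow> y j = lin s h (w j)"
    proof -
      have "\<forall>j. j \<in> J \<longrightarrow> (\<exists>w. w \<in> frees UNIV s \<and> y j = lin s h w)" using y(1) im by blast
      then show ?thesis using that by metis
    qed
    obtain k2 where k2: "\<And>j. j \<in> J \<Longrightarrow> w j \<in> FL {..<s} k2"
    proof -
      have "\<forall>j. j \<in> J \<longrightarrow> (\<exists>m. w j \<in> FL {..<s} m)" using frees_UNIV_FL w(1) by blast
      then obtain m where m: "\<And>j. j \<in> J \<Longrightarrow> w j \<in> FL {..<s} (m j)" by metis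
      have "w j \<in> FL {..<s} (Max (m ` J))" if "j \<in> J" for j
        using m[OF that] FL_mono[of "{..<s}" "{..<s}" "m j" "Max (m ` J)"] fin(2) that by auto
      then show ?thesis by (rule that)
    qed
    show "growth_rate TYPE('n) (\<lambda>m. fv.dim (lin s h ` FL {..<s} m)) (real (r - k))"
    proof (rule ccount_squeeze)
      fix m
      \<comment> \<open>Forgetting the coordinates in \<open>I\<close> is injective on relations, by
        the choice of \<open>I\<close>.\<close>
      define \<pi> where "\<pi> u i = (if i \<in> J then u i else 0)" for u :: "nat \<Rightarrow> 'n polynomial" and i
      have pilin: "Vector_Spaces.linear csc csc \<pi>"
        unfolding module_hom_iff_linear[symmetric]
        by (intro module_hom.intro[OF fv.module_axioms fv.module_axioms], unfold_locales)
           (auto simp: \<pi>_def fun_eq_iff csc_apply)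
      have "fv.dim (lin s h ` FL {..<s} m) \<le> fv.dim (FL J (m + k1) :: (nat \<Rightarrow> 'n polynomial) set)"
      proof (rule fvp.dim_image_ge_inj[OF pilin])
        show "fv.subspace (lin s h ` FL {..<s} m)" by (rule fvp.linear_subspace_image[OF linear_lin FL_subspace])
        show "u = 0" if u: "u \<in> lin s h ` FL {..<s} m" "\<pi> u = 0" for u
        proof (rule IN)
          show uN: "u \<in> N" using u(1) im FL_frees by blast
          fix i assume "i \<notin> I"
          show "u i = 0"
          proof (cases "i < r")
            case True
            then show ?thesis using fun_cong[OF u(2), of i] \<open>i \<notin> I\<close> by (simp add: \<pi>_def J_def)
          qed (use uN NF in \<open>auto simp: frees_def\<close>)
        qed
        have "\<pi> u \<in> FL J (m + k1)" if "u \<in> FL {..<r} (m + k1)" for u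
          using that by (simp add: FL_def \<pi>_def pdeg_le_0)
        then show "\<pi> ` lin s h ` FL {..<s} m \<subseteq> FL J (m + k1)" using shFL by blast
      next
        show "FL J (m + k1) \<subseteq> fv.span (munit ` FLidx J (m + k1))" by (rule FL_span[OF fin(2)])
        show "finite (munit ` FLidx J (m + k1) :: (nat \<Rightarrow> 'n polynomial) set)"
          by (intro finite_imageI finite_FLidx fin)
      qed
      then show "fv.dim (lin s h ` FL {..<s} m) \<le> (r - k) * ccount TYPE('n) (m + k1)" by (simp only: dimY)
    next
      fix m
      have Yl: "Y u = lin s h (\<Sum>j\<in>J. rsc (u j) (w j))" for u
        unfolding Y_def lin_sum lin_rsc by (intro sum.cong refl) (simp only: w(2))
      have "fv.dim (FL J m :: (nat \<Rightarrow> 'n polynomial) set) \<le> fv.dim (lin s h ` FL {..<s} (m + k2))"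
      proof (rule fvp.dim_image_ge_inj[OF Ylin FL_subspace])
        show "u = 0" if "u \<in> FL J m" "Y u = 0" for u using Yinj that by blast
        show "Y ` FL J m \<subseteq> lin s h ` FL {..<s} (m + k2)"
        proof
          fix v assume "v \<in> Y ` FL J m"
          then obtain u where u: "u \<in> FL J m" "v = Y u" by blast
          have "(\<Sum>j\<in>J. rsc (u j) (w j)) \<in> FL {..<s} (m + k2)"
            by (intro fv.subspace_sum[OF FL_subspace] FL_rsc k2) (use u in \<open>auto simp: FL_def\<close>)
          then show "v \<in> lin s h ` FL {..<s} (m + k2)" unfolding u(2) Yl by blast
        qed
        show "lin s h ` FL {..<s} (m + k2) \<subseteq> fv.span (munit ` FLidx {..<r} (m + k2 + k1))"
          using shFL FL_span[of "{..<r}"] by blast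
        show "finite (munit ` FLidx {..<r} (m + k2 + k1) :: (nat \<Rightarrow> 'n polynomial) set)"
          by (intro finite_imageI finite_FLidx) simp
      qed
      then show "(r - k) * ccount TYPE('n) m \<le> fv.dim (lin s h ` FL {..<s} (m + k2))" by (simp only: dimY)
    qed
  qed
qed

text \<open>The maps of a \<open>finite_free_resolution\<close> are homomorphisms specified only on
  the free modules; this replaces them by matrices.\<close>

lemma hom_on_free:
  assumes "\<And>u v. u \<in> frees UNIV r \<Longrightarrow> v \<in> frees UNIV r \<Longrightarrow> f (u + v) = f u + f v"
    and "\<And>p u. u \<in> frees UNIV r \<Longrightarrow> f (rsc p u) = act p (f u)"
    and u: "u \<in> frees UNIV r"
  shows "f u = L r (\<lambda>i. f (\<lambda>j. if j = i then 1 else 0)) u"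
proof -
  let ?e = "\<lambda>i j. if j = i then 1 else 0 :: 'n polynomial"
  have UR: "subring (UNIV :: 'n polynomial set)" by (simp add: subring_def)
  have e: "?e i \<in> frees UNIV r" if "i < r" for i by (rule unit_frees[OF UR that])
  have *: "(\<Sum>i<t. rsc (u i) (?e i)) \<in> frees UNIV r \<and> f (\<Sum>i<t. rsc (u i) (?e i)) = (\<Sum>i<t. act (u i) (f (?e i)))"
    if "t \<le> r" for t using that
  proof (induction t)
    case 0
    have z: "(0 :: nat \<Rightarrow> 'n polynomial) \<in> frees UNIV r" by (rule frees_closed[OF UR])
    have "f 0 = 0" using assms(1)[OF z z] by simp
    then show ?case using z by (simp only: lessThan_0 sum.empty)
  next
    case (Suc t)
    then have t: "t < r" and IH: "(\<Sum>i<t. rsc (u i) (?e i)) \<in> frees UNIV r"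
      "f (\<Sum>i<t. rsc (u i) (?e i)) = (\<Sum>i<t. act (u i) (f (?e i)))" by auto
    have r: "rsc (u t) (?e t) \<in> frees UNIV r" using frees_closed(5)[OF UR _ e[OF t]] by blast
    show ?case
      unfolding sum.lessThan_Suc assms(1)[OF IH(1) r] IH(2) assms(2)[OF e[OF t]]
      using frees_closed(2)[OF UR IH(1) r] by blast
  qed
  have "(\<Sum>i<r. rsc (u i) (?e i)) = u"
  proof
    fix k
    have "(\<Sum>i<r. rsc (u i) (?e i)) k = (\<Sum>i<r. if i = k then u i else 0)"
      unfolding sum_fun_apply rsc_def by (intro sum.cong refl) auto
    then show "(\<Sum>i<r. rsc (u i) (?e i)) k = u k" using u by (auto simp: frees_def)
  qed
  then show ?thesis using *[of r] by (simp add: L_def)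
qed

end

section \<open>Alternating sums of ranks along a resolution\<close>

global_interpretation rs: poly_module "rsc :: 'n::finite polynomial \<Rightarrow> (nat \<Rightarrow> 'n polynomial) \<Rightarrow> _"
  by (rule poly_module.intro) (rule module_rsc)

lemma rs_L: "rs.L r g = lin r g" by (rule ext) (simp add: rs.L_def lin_eq_sum)

lemma rs_cs: "rs.cs = csc" by (rule ext) (simp add: rs.cs_def csc_def)

lemma frees_free_mod: "frees UNIV r = free_mod r" by (simp add: frees_def free_mod_def)

context poly_module
begin

text \<open>Exactness makes the image of each map the relations of the previous one. Comparing the
  two growth rates of the same dimensions gives
  \<open>\<kappa> j = r (j + 1) - \<kappa> (j + 1)\<close> for the growth of the image of
  \<open>d j\<close>, and these identities telescope.\<close>

lemma resolution_growth:
  assumes res: "finite_free_resolution act M N r \<epsilon> d"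
  obtains g k where "L (r 1) g ` frees UNIV (r 1) = M"
    "growth_rate TYPE('n) (\<lambda>m. cvs.dim (L (r 1) g ` FL {..<r 1} m)) (real k)"
    "int k = (\<Sum>j=1..N. (-1) ^ (j + 1) * int (r j))"
proof -
  let ?e = "\<lambda>i j. if j = i then 1 else 0 :: 'n polynomial"
  define g where "g i = \<epsilon> (?e i)" for i
  define h where "h j i = d j (?e i)" for j i
  note R = res[unfolded finite_free_resolution_def, folded frees_free_mod]
  have eps: "\<epsilon> u = L (r 1) g u" if "u \<in> frees UNIV (r 1)" for u
    unfolding g_def by (rule hom_on_free[OF _ _ that]) (use R in \<open>simp_all add: plus_fun_def rsc_def\<close>)
  have dl: "d j u = lin (r (j + 1)) (h j) u" if "j \<ge> 1" "u \<in> frees UNIV (r (j + 1))" for j u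
    unfolding h_def rs_L[symmetric]
    by (rule rs.hom_on_free[OF _ _ that(2)]) (use R that(1) in \<open>simp_all add: plus_fun_def rsc_def\<close>)
  have "\<epsilon> ` frees UNIV (r 1) = L (r 1) g ` frees UNIV (r 1)" by (rule image_cong[OF refl eps])
  then have M: "L (r 1) g ` frees UNIV (r 1) = M" using R by simp
  obtain k1 where k1: "k1 \<le> r 1"
    "growth_rate TYPE('n) (\<lambda>m. cvs.dim (L (r 1) g ` FL {..<r 1} m)) (real k1)"
    "\<And>s h. lin s h ` frees UNIV s = {u \<in> frees UNIV (r 1). L (r 1) g u = 0} \<Longrightarrow>
      growth_rate TYPE('n) (\<lambda>m. fv.dim (lin s h ` FL {..<s} m)) (real (r 1 - k1))"
    by (rule rank_growth[of "r 1" g]) blast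
  define Q where "Q j k \<longleftrightarrow> k \<le> r (j + 1) \<and>
      growth_rate TYPE('n) (\<lambda>m. fv.dim (lin (r (j + 1)) (h j) ` FL {..<r (j + 1)} m)) (real k) \<and>
      (\<forall>s h'. lin s h' ` frees UNIV s = {u \<in> frees UNIV (r (j + 1)). lin (r (j + 1)) (h j) u = 0} \<longrightarrow>
      growth_rate TYPE('n) (\<lambda>m. fv.dim (lin s h' ` FL {..<s} m)) (real (r (j + 1) - k)))" for j k
  have "\<exists>k. Q j k" for j
    unfolding Q_def by (rule rs.rank_growth[of "r (j + 1)" "h j", unfolded rs_L rs_cs]) blast
  then obtain \<kappa> where Q: "\<And>j. Q j (\<kappa> j)" by metis
  have \<kappa>: "\<kappa> j \<le> r (j + 1)"
    "growth_rate TYPE('n) (\<lambda>m. fv.dim (lin (r (j + 1)) (h j) ` FL {..<r (j + 1)} m)) (real (\<kappa> j))"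
    "lin s h' ` frees UNIV s = {u \<in> frees UNIV (r (j + 1)). lin (r (j + 1)) (h j) u = 0} \<Longrightarrow>
      growth_rate TYPE('n) (\<lambda>m. fv.dim (lin s h' ` FL {..<s} m)) (real (r (j + 1) - \<kappa> j))" for j s h'
    using Q[of j] unfolding Q_def by blast+
  have im: "lin (r (j + 1)) (h j) ` frees UNIV (r (j + 1)) = d j ` frees UNIV (r (j + 1))" if "j \<ge> 1" for j
    by (rule image_cong[OF refl]) (rule dl[OF that, symmetric])
  have "lin (r (1 + 1)) (h 1) ` frees UNIV (r (1 + 1)) = {u \<in> frees UNIV (r 1). L (r 1) g u = 0}"
    unfolding im[OF order_refl] using R eps by (auto simp: numeral_2_eq_2)
  from LIMSEQ_unique[OF k1(3)[OF this] \<kappa>(2)[of 1]] have s1: "int k1 = int (r 1) - int (\<kappa> 1)"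
    using k1(1) by simp
  have s: "int (\<kappa> j) = int (r (j + 1)) - int (\<kappa> (j + 1))" if "j \<ge> 1" for j
  proof -
    have j1: "j + 1 \<ge> 1" by simp
    have "lin (r (j + 1 + 1)) (h (j + 1)) ` frees UNIV (r (j + 1 + 1)) = {u \<in> frees UNIV (r (j + 1)). lin (r (j + 1)) (h j) u = 0}"
    proof -
      have "d (j + 1) ` frees UNIV (r (j + 2)) = {u \<in> frees UNIV (r (j + 1)). d j u = (\<lambda>_. 0)}"
        using R that by blast
      also have "\<dots> = {u \<in> frees UNIV (r (j + 1)). lin (r (j + 1)) (h j) u = 0}"
        using dl[OF that] by (auto simp: zero_fun_def)
      finally show ?thesis unfolding im[OF j1] by simp
    qed
    from LIMSEQ_unique[OF \<kappa>(3)[OF this] \<kappa>(2)[of "j + 1"]] show ?thesis using \<kappa>(1)[of j] by simp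
  qed
  have "int k1 = (\<Sum>j=1..Suc i. (-1) ^ (j + 1) * int (r j)) + (-1) ^ Suc i * int (\<kappa> (Suc i))" for i
  proof (induction i)
    case 0
    show ?case using s1 by simp
  next
    case (Suc i)
    have "int (\<kappa> (Suc i)) = int (r (Suc (Suc i))) - int (\<kappa> (Suc (Suc i)))" using s[of "Suc i"] by simp
    then show ?case unfolding Suc.IH by (simp add: right_diff_distrib)
  qed
  \<comment> \<open>Beyond the end of the resolution the ranks vanish, and the remainder vanishes
    with them, since \<open>\<kappa> (Suc N) \<le> r (Suc N + 1)\<close>.\<close>
  from this[of N] have "int k1 = (\<Sum>j=1..Suc N. (-1) ^ (j + 1) * int (r j))" using \<kappa>(1)[of "Suc N"] R by simp
  also have "\<dots> = (\<Sum>j=1..N. (-1) ^ (j + 1) * int (r j))" using R by simp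
  finally show ?thesis using that[OF M k1(2)] by blast
qed

text \<open>The syzygy theorem resolves the relations among the generators. Index 1 belongs to the
  generators, so the ranks of that resolution, indexed from 0, move up by two.\<close>

lemma resolution_exists:
  assumes "L p g ` frees UNIV p = M"
  shows "\<exists>N r \<epsilon> d. finite_free_resolution act M N r \<epsilon> d"
proof -
  have "submod UNIV {u \<in> frees UNIV p. L p g u = 0}" by (rule L_kernel_submod)
  then have "ffr UNIV {u \<in> frees UNIV p. L p g u = 0}" by (rule hilbert_syzygy) blast
  from ffr_resolution[OF this] obtain N r h where N: "\<forall>k>N. r k = (0::nat)"
    and h0: "lin (r 0) (h 0) ` frees UNIV (r 0) = {u \<in> frees UNIV p. L p g u = 0}"
    and hS: "\<And>k. lin (r (Suc k)) (h (Suc k)) ` frees UNIV (r (Suc k)) = {u \<in> frees UNIV (r k). lin (r k) (h k) u = 0}"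
    by blast
  define r' where "r' j = (if j \<le> 1 then p else r (j - 2))" for j :: nat
  define d where "d j = lin (r (j - 1)) (h (j - 1))" for j
  have r'1: "r' 1 = p" and r'2: "r' (j + 2) = r j" for j by (simp_all add: r'_def)
  have dd: "d (j + 1) = lin (r j) (h j)" for j by (simp add: d_def)
  have "finite_free_resolution act M (Suc (Suc N)) r' (L p g) d"
    unfolding finite_free_resolution_def frees_free_mod[symmetric] r'1
  proof (intro conjI allI impI ballI)
    show "r' k = 0" if "Suc (Suc N) < k" for k using that N by (simp add: r'_def)
    show "L p g (\<lambda>i. u i + v i) = L p g u + L p g v" for u v using L_add[of p g u v] by (simp add: plus_fun_def)
    show "L p g (\<lambda>i. q * u i) = act q (L p g u)" for q u using L_rsc[of p g q u] by (simp add: rsc_def)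
    show "d k (\<lambda>i. u i + v i) = (\<lambda>i. d k u i + d k v i)" for k u v
      unfolding d_def using lin_add[of _ _ u v] by (simp add: plus_fun_def)
    show "d k (\<lambda>i. q * u i) = (\<lambda>i. q * d k u i)" for k q u
      unfolding d_def using lin_rsc[of _ _ q u] by (simp add: rsc_def)
    show "L p g ` frees UNIV p = M" by fact
    show "d 1 ` frees UNIV (r' 2) = {u \<in> frees UNIV p. L p g u = 0}"
      using h0 r'2[of 0] by (simp add: d_def numeral_2_eq_2)
    show "d (k + 1) ` frees UNIV (r' (k + 2)) = {u \<in> frees UNIV (r' (k + 1)). d k u = (\<lambda>_. 0)}" if k: "1 \<le> k" for k
    proof -
      obtain j where j: "k = Suc j" using k by (cases k) auto
      show ?thesis using hS[of j] r'2[of j] r'2[of "Suc j"] by (simp add: j d_def zero_fun_def)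
    qed
  qed
  then show ?thesis by blast
qed

end

section \<open>The Euler characteristic of commuting operators\<close>

lemma bounded_clinearD:
  assumes "bounded_clinear A"
  shows "bounded_linear A" "A (c *\<^sub>C x) = c *\<^sub>C A x" "A (x + y) = A x + A y" "A 0 = 0" "A (- x) = - A x"
    "A (x - y) = A x - A y"
proof -
  show b: "bounded_linear A" using assms by (simp add: bounded_clinear_def)
  show "A (c *\<^sub>C x) = c *\<^sub>C A x" using assms by (simp add: bounded_clinear_def)
  show "A (x + y) = A x + A y" "A 0 = 0" "A (- x) = - A x" "A (x - y) = A x - A y"
    using b by (auto simp: bounded_linear.linear linear_add linear_0 linear_neg linear_diff)
qed

lemma funpow_commute:
  assumes "f \<circ> g = g \<circ> f"
  shows "(f ^^ a) \<circ> (g ^^ b) = (g ^^ b) \<circ> (f ^^ a)"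
proof -
  have 1: "f \<circ> (g ^^ b) = (g ^^ b) \<circ> f" for b
  proof (induction b)
    case (Suc b)
    have "f \<circ> (g ^^ Suc b) = (f \<circ> g) \<circ> (g ^^ b)" by (simp add: comp_assoc)
    also have "\<dots> = g \<circ> (f \<circ> (g ^^ b))" by (simp add: assms comp_assoc)
    finally show ?case by (simp only: Suc.IH comp_assoc funpow.simps)
  qed simp
  show ?thesis
  proof (induction a)
    case (Suc a)
    have "(f ^^ Suc a) \<circ> (g ^^ b) = f \<circ> ((f ^^ a) \<circ> (g ^^ b))" by (simp add: comp_assoc)
    also have "\<dots> = (f \<circ> (g ^^ b)) \<circ> (f ^^ a)" by (simp only: Suc.IH comp_assoc)
    finally show ?case by (simp only: 1 comp_assoc funpow.simps)
  qed simp
qed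

locale commuting_ops =
  fixes T :: "'n::finite \<Rightarrow> 'h::complex_inner \<Rightarrow> 'h"
  assumes T_clinear: "bounded_clinear (T i)"
    and T_commute: "T i \<circ> T j = T j \<circ> T i"
begin

text \<open>\<open>op_monomial\<close> folds over all variables at once; folding over subsets makes
  induction possible. Commutativity of the operators makes the fold independent of the
  order.\<close>

definition mon :: "'n set \<Rightarrow> 'n multi_index \<Rightarrow> 'h \<Rightarrow> 'h" where
  "mon A \<alpha> = Finite_Set.fold (\<lambda>i A. (T i ^^ lookup \<alpha> i) \<circ> A) id A"

lemma mon_empty: "mon {} \<alpha> = id" by (simp add: mon_def)

lemma mon_insert:
  assumes "i \<notin> A"
  shows "mon (insert i A) \<alpha> = (T i ^^ lookup \<alpha> i) \<circ> mon A \<alpha>"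
proof -
  interpret comp_fun_commute "\<lambda>i A. (T i ^^ lookup \<alpha> i) \<circ> A"
  proof
    fix x y
    show "(\<lambda>A. (T y ^^ lookup \<alpha> y) \<circ> A) \<circ> (\<lambda>A. (T x ^^ lookup \<alpha> x) \<circ> A)
        = (\<lambda>A. (T x ^^ lookup \<alpha> x) \<circ> A) \<circ> (\<lambda>A. (T y ^^ lookup \<alpha> y) \<circ> A)"
      by (rule ext) (simp add: comp_assoc[symmetric] funpow_commute[OF T_commute[of y x]])
  qed
  show ?thesis unfolding mon_def by (rule fold_insert) (use assms in auto)
qed

lemma op_monomial_mon: "op_monomial T \<alpha> = mon UNIV \<alpha>" by (simp add: op_monomial_def mon_def)

lemma mon_funpow_commute: "mon A \<alpha> \<circ> (T j ^^ b) = (T j ^^ b) \<circ> mon A \<alpha>" using finite[of A]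
proof (induction A rule: finite_induct)
  case (insert i A)
  have "mon (insert i A) \<alpha> \<circ> (T j ^^ b) = (T i ^^ lookup \<alpha> i) \<circ> (mon A \<alpha> \<circ> (T j ^^ b))"
    by (simp add: mon_insert[OF insert(2)] comp_assoc)
  also have "\<dots> = ((T i ^^ lookup \<alpha> i) \<circ> (T j ^^ b)) \<circ> mon A \<alpha>"
    by (simp only: insert.IH comp_assoc)
  also have "\<dots> = (T j ^^ b) \<circ> mon (insert i A) \<alpha>"
    by (simp only: funpow_commute[OF T_commute[of i j]] mon_insert[OF insert(2)] comp_assoc)
  finally show ?case .
qed (simp add: mon_empty)

lemma mon_add: "mon A (\<alpha> + \<beta>) = mon A \<alpha> \<circ> mon A \<beta>" using finite[of A]
proof (induction A rule: finite_induct)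
  case (insert i A)
  let ?a = "T i ^^ lookup \<alpha> i" and ?b = "T i ^^ lookup \<beta> i"
  have "mon (insert i A) (\<alpha> + \<beta>) = ?a \<circ> (?b \<circ> mon A \<alpha>) \<circ> mon A \<beta>"
    by (simp only: mon_insert[OF insert(2)] lookup_add funpow_add insert.IH comp_assoc)
  also have "?b \<circ> mon A \<alpha> = mon A \<alpha> \<circ> ?b" by (rule mon_funpow_commute[symmetric])
  finally show ?case by (simp only: mon_insert[OF insert(2)] comp_assoc)
qed (simp add: mon_empty)

lemma op_monomial_add: "op_monomial T (\<alpha> + \<beta>) h = op_monomial T \<alpha> (op_monomial T \<beta> h)"
  by (simp add: op_monomial_mon mon_add)

lemma op_monomial_zero: "op_monomial T 0 h = h"
proof -
  have "mon A 0 = id" for A using finite[of A] by (induction A rule: finite_induct) (simp_all add: mon_empty mon_insert)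
  then show ?thesis by (simp add: op_monomial_mon)
qed

lemma op_monomial_single: "op_monomial T (single i (Suc 0)) h = T i h"
proof -
  have "mon A (single i (Suc 0)) = (if i \<in> A then T i else id)" for A using finite[of A]
    by (induction A rule: finite_induct) (auto simp: mon_empty mon_insert lookup_single when_def)
  then show ?thesis by (simp add: op_monomial_mon)
qed

lemma op_monomial_Suc: "op_monomial T (\<alpha> + single i (Suc 0)) h = op_monomial T \<alpha> (T i h)"
  "op_monomial T (\<alpha> + single i (Suc 0)) h = T i (op_monomial T \<alpha> h)"
  by (simp add: op_monomial_add op_monomial_single)
     (simp add: add.commute[of \<alpha>] op_monomial_add op_monomial_single)

lemma funpow_clinear: "bounded_clinear (T i ^^ a)"
proof (induction a)
  case 0
  show ?case by (simp add: bounded_clinear_def bounded_linear_ident id_def)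
next
  case (Suc a)
  show ?case using Suc T_clinear[of i] bounded_linear_compose[of "T i" "T i ^^ a"]
    by (auto simp: bounded_clinear_def comp_def)
qed

lemma op_monomial_clinear: "bounded_clinear (op_monomial T \<alpha>)"
proof -
  have "bounded_clinear (mon A \<alpha>)" for A using finite[of A]
  proof (induction A rule: finite_induct)
    case empty
    show ?case by (simp add: mon_empty bounded_clinear_def bounded_linear_ident id_def)
  next
    case (insert i A)
    show ?case using insert.IH funpow_clinear[where i = i and a = "lookup \<alpha> i"]
        bounded_linear_compose[of "T i ^^ lookup \<alpha> i" "mon A \<alpha>"]
      by (auto simp: mon_insert[OF insert(2)] bounded_clinear_def comp_def)
  qed
  then show ?thesis by (simp add: op_monomial_mon)
qed

lemmas op_monomial_linear = bounded_clinearD[OF op_monomial_clinear]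

lemma op_poly_plin: "op_poly T p h = plin (\<lambda>\<alpha>. op_monomial T \<alpha> h) p"
  by (simp add: op_poly_def plin_def)

lemma op_poly_single: "op_poly T (single \<alpha> c) h = c *\<^sub>C op_monomial T \<alpha> h"
  by (simp add: op_poly_plin plin_single)

lemma op_poly_add: "op_poly T (p + q) h = op_poly T p h + op_poly T q h" by (simp add: op_poly_plin plin_add)

lemma op_poly_add_right: "op_poly T p (x + y) = op_poly T p x + op_poly T p y"
  by (simp add: op_poly_def op_monomial_linear scaleC_add_right sum.distrib)

lemma op_poly_scaleC: "op_poly T p (c *\<^sub>C x) = c *\<^sub>C op_poly T p x"
  unfolding op_poly_def complex_vector.scale_sum_right
  by (intro sum.cong refl) (simp add: op_monomial_linear scaleC_scaleC mult.commute)

lemma op_poly_mult: "op_poly T (p * q) h = op_poly T p (op_poly T q h)"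
proof (induction p rule: poly_mapping_induct_single)
  case (single \<alpha> c)
  show ?case
  proof (induction q rule: poly_mapping_induct_single)
    case (single \<beta> d)
    show ?case by (simp add: mult_single op_poly_single op_monomial_add op_monomial_linear scaleC_scaleC)
  next
    case (add p q)
    then show ?case by (simp add: distrib_left op_poly_add op_poly_add_right)
  qed
next
  case (add p q)
  then show ?case by (simp add: distrib_right op_poly_add)
qed

sublocale pm: poly_module "op_poly T"
proof
  show "op_poly T 1 x = x" for x using op_poly_single[of 0 1 x] by (simp add: op_monomial_zero scaleC_one)
qed (simp_all add: op_poly_add op_poly_add_right op_poly_mult)

lemma pm_cs: "pm.cs = scaleC" by (intro ext) (simp add: pm.cs_def const_poly_def op_poly_single op_monomial_zero)

text \<open>For \<open>V = range (defect T)\<close> this is the filtration of Arveson's module by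
  degree, and its dimension will turn out to be the rank in the formula for the Euler
  characteristic.\<close>

definition filt :: "'h set \<Rightarrow> nat \<Rightarrow> 'h set" where
  "filt V m = cspan {op_monomial T \<alpha> v | \<alpha> v. v \<in> V \<and> mdeg \<alpha> \<le> m}"

lemma filt_mono: "m \<le> k \<Longrightarrow> filt V m \<subseteq> filt V k"
  unfolding filt_def by (rule complex_vector.span_mono) (use le_trans in blast)

lemma filt_subspace: "csubspace (filt V m)" by (simp add: filt_def)

lemma op_poly_filt: "p \<in> pdeg_le k \<Longrightarrow> x \<in> filt V m \<Longrightarrow> op_poly T p x \<in> filt V (k + m)"
proof -
  assume p: "p \<in> pdeg_le k" and x: "x \<in> filt V m"
  have mono: "op_monomial T \<alpha> x \<in> filt V (k + m)" if \<alpha>: "mdeg \<alpha> \<le> k" for \<alpha>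
    using x unfolding filt_def
  proof (induction rule: complex_vector.span_induct_alt)
    case base
    show ?case by (simp add: op_monomial_linear complex_vector.span_zero)
  next
    case (step c y z)
    then obtain \<beta> v where y: "y = op_monomial T \<beta> v" "v \<in> V" "mdeg \<beta> \<le> m" by blast
    then have "op_monomial T \<alpha> y \<in> {op_monomial T \<alpha> v | \<alpha> v. v \<in> V \<and> mdeg \<alpha> \<le> k + m}"
      using \<alpha> by (auto simp: op_monomial_add[symmetric] mdeg_add intro!: exI[of _ "\<alpha> + \<beta>"] exI[of _ v])
    then show ?case
      unfolding op_monomial_linear
      by (intro complex_vector.span_add complex_vector.span_scale complex_vector.span_base step.IH)
  qed
  show ?thesis
    unfolding op_poly_def
    by (intro complex_vector.subspace_sum[OF filt_subspace] complex_vector.subspace_scale[OF filt_subspace] mono)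
       (use p in \<open>simp add: pdeg_le_def\<close>)
qed

lemma module_filt:
  assumes "x \<in> cspan {op_poly T p v | p v. v \<in> V}"
  shows "\<exists>m. x \<in> filt V m" using assms
proof (induction rule: complex_vector.span_induct_alt)
  case base
  show ?case using complex_vector.subspace_0[OF filt_subspace] by blast
next
  case (step c y z)
  then obtain p v where y: "y = op_poly T p v" "v \<in> V" by blast
  obtain m where m: "z \<in> filt V m" using step.IH by blast
  obtain k where k: "p \<in> pdeg_le k" using pdeg_le_ex by blast
  have "v \<in> filt V 0"
    unfolding filt_def by (rule complex_vector.span_base)
       (use y(2) op_monomial_zero[of v] in \<open>auto simp: mdeg_def intro!: exI[of _ 0] exI[of _ v]\<close>)
  then have "y \<in> filt V k" using op_poly_filt[OF k, of v V 0] y by simp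
  then have "c *\<^sub>C y + z \<in> filt V (max k m)" using m filt_mono[of k "max k m" V] filt_mono[of m "max k m" V]
    by (intro complex_vector.subspace_add[OF filt_subspace] complex_vector.subspace_scale[OF filt_subspace]) auto
  then show ?case by blast
qed

lemma finite_gens_filt:
  assumes "\<And>i. i < (r::nat) \<Longrightarrow> \<exists>m. x i \<in> filt V m"
  shows "\<exists>m. \<forall>i<r. x i \<in> filt V m"
proof -
  obtain m where m: "\<And>i. i < r \<Longrightarrow> x i \<in> filt V (m i)" using assms by metis
  have "x i \<in> filt V (Max (m ` {..<r}))" if "i < r" for i
    using m[OF that] filt_mono[of "m i" "Max (m ` {..<r})" V] that by auto
  then show ?thesis by blast
qed

text \<open>The generators provided by a resolution need not lie in \<open>V\<close>. They do lie in
  some \<open>filt V m1\<close>, and conversely they produce a basis of \<open>V\<close> with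
  coefficients of degree at most \<open>m2\<close>, so the two filtrations agree up to a
  shift.\<close>

lemma euler_growth_aux:
  assumes V: "V \<subseteq> cspan W" "finite W"
    and M: "M = cspan {op_poly T p v | p v. v \<in> V}"
  shows "\<exists>N r \<epsilon> d. finite_free_resolution (op_poly T) M N r \<epsilon> d"
    and "finite_free_resolution (op_poly T) M N r \<epsilon> d \<Longrightarrow>
      growth_rate TYPE('n) (\<lambda>m. cdim (filt V m)) (real_of_int (\<Sum>j=1..N. (-1) ^ (j + 1) * int (r j)))"
proof -
  obtain B where B: "finite B" "B \<subseteq> V" "V \<subseteq> cspan B"
    using complex_vector.finite_basis_exists[OF V] by metis
  obtain gl where gl: "set gl = B" using finite_list[OF B(1)] by blast
  define p where "p = length gl"
  define g where "g i = gl ! i" for i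
  have gB: "B = g ` {..<p}" unfolding gl[symmetric] g_def p_def by (auto simp: set_conv_nth)
  have vspan: "\<exists>w. w \<in> FL {..<p} 0 \<and> v = pm.L p g w" if "v \<in> V" for v
  proof -
    have "v \<in> cspan B" using that B by blast
    also have "cspan B \<subseteq> pm.L p g ` FL {..<p} 0"
    proof (rule complex_vector.span_minimal)
      show "B \<subseteq> pm.L p g ` FL {..<p} 0"
      proof
        fix b assume "b \<in> B"
        then obtain i where i: "i < p" "b = g i" using gB by auto
        have "(1 :: 'n polynomial) \<in> pdeg_le 0" using pdeg_le_single[of 0 0 1] by (simp add: mdeg_def)
        then have "(\<lambda>j. if j = i then 1 else 0 :: 'n polynomial) \<in> FL {..<p} 0"
          using i by (auto simp: FL_def pdeg_le_0)
        then show "b \<in> pm.L p g ` FL {..<p} 0" using pm.L_unit[OF i(1)] i(2) by (metis imageI)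
      qed
      show "csubspace (pm.L p g ` FL {..<p} 0)"
        using pm.cvp.linear_subspace_image[OF pm.linear_L FL_subspace] unfolding pm_cs .
    qed
    finally show ?thesis by blast
  qed
  have LM: "pm.L q h u \<in> M" if "\<And>i. i < q \<Longrightarrow> h i \<in> M" for q h u
  proof -
    have "op_poly T f x \<in> M" if "x \<in> M" for f x using that unfolding M
    proof (induction rule: complex_vector.span_induct_alt)
      case base
      show ?case using pm.scale_zero_right complex_vector.span_zero by simp
    next
      case (step c y z)
      then obtain q v where "y = op_poly T q v" "v \<in> V" by blast
      then have "op_poly T f y \<in> {op_poly T p v | p v. v \<in> V}" by (auto simp: op_poly_mult[symmetric])
      then show ?case
        unfolding op_poly_add_right op_poly_scaleC
        by (intro complex_vector.span_add complex_vector.span_scale complex_vector.span_base step.IH)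
    qed
    then show ?thesis
      unfolding pm.L_def M by (intro complex_vector.subspace_sum[OF complex_vector.subspace_span]) (use that M in auto)
  qed
  have gM: "g i \<in> M" if "i < p" for i
  proof -
    have "g i \<in> V" using gB B(2) that by blast
    then have "op_poly T 1 (g i) \<in> {op_poly T p v | p v. v \<in> V}" by blast
    then have "g i \<in> {op_poly T p v | p v. v \<in> V}" unfolding pm.scale_one .
    then show ?thesis unfolding M by (rule complex_vector.span_base)
  qed
  have Lsub: "csubspace (pm.L p g ` frees UNIV p)"
  proof -
    have "fv.subspace (frees UNIV p :: (nat \<Rightarrow> 'n polynomial) set)"
      by (auto simp: fv.subspace_def frees_def csc_apply)
    from pm.cvp.linear_subspace_image[OF pm.linear_L this] show ?thesis unfolding pm_cs .
  qed
  have im: "pm.L p g ` frees UNIV p = M"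
  proof (intro equalityI)
    show "pm.L p g ` frees UNIV p \<subseteq> M" using LM gM by blast
    show "M \<subseteq> pm.L p g ` frees UNIV p"
      unfolding M
    proof (rule complex_vector.span_minimal[OF _ Lsub], rule subsetI)
      fix x assume "x \<in> {op_poly T p v | p v. v \<in> V}"
      then obtain f v where x: "x = op_poly T f v" "v \<in> V" by blast
      obtain w where w: "w \<in> FL {..<p} 0" "v = pm.L p g w" using vspan[OF x(2)] by blast
      have "rsc f w \<in> frees UNIV p" using w(1) by (auto simp: FL_def frees_def rsc_def)
      moreover have "x = pm.L p g (rsc f w)" by (simp add: x w pm.L_rsc)
      ultimately show "x \<in> pm.L p g ` frees UNIV p" by blast
    qed
  qed
  show "\<exists>N r \<epsilon> d. finite_free_resolution (op_poly T) M N r \<epsilon> d"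
    by (rule pm.resolution_exists[OF im])
  assume "finite_free_resolution (op_poly T) M N r \<epsilon> d"
  then obtain h k where h: "pm.L (r 1) h ` frees UNIV (r 1) = M"
    "growth_rate TYPE('n) (\<lambda>m. cdim (pm.L (r 1) h ` FL {..<r 1} m)) (real k)"
    "int k = (\<Sum>j=1..N. (-1) ^ (j + 1) * int (r j))" using pm.resolution_growth unfolding pm_cs by blast
  have UR: "subring (UNIV :: 'n polynomial set)" by (simp add: subring_def)
  have hM: "h i \<in> M" if "i < r 1" for i
  proof -
    have "(\<lambda>j. if j = i then 1 else 0) \<in> frees (UNIV :: 'n polynomial set) (r 1)" by (rule unit_frees[OF UR that])
    then show ?thesis using pm.L_unit[OF that, of h] h(1) by (metis imageI)
  qed
  obtain m1 where m1: "\<And>i. i < r 1 \<Longrightarrow> h i \<in> filt V m1"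
    using finite_gens_filt[of "r 1" h V] module_filt hM unfolding M by blast
  have 1: "pm.L (r 1) h ` FL {..<r 1} m \<subseteq> filt V (m + m1)" for m
    unfolding pm.L_def by (auto intro!: complex_vector.subspace_sum[OF filt_subspace] op_poly_filt m1 simp: FL_def)
  have "\<exists>w m. w \<in> FL {..<r 1} m \<and> g i = pm.L (r 1) h w" if "i < p" for i
    using gM[OF that] h(1) frees_UNIV_FL by blast
  then obtain w m where w: "\<And>i. i < p \<Longrightarrow> w i \<in> FL {..<r 1} (m i)" "\<And>i. i < p \<Longrightarrow> g i = pm.L (r 1) h (w i)"
    by metis
  define m2 where "m2 = Max (m ` {..<p})"
  have w2: "w i \<in> FL {..<r 1} m2" if "i < p" for i
    using w(1)[OF that] FL_mono[OF order_refl, of "m i" m2 "{..<r 1}"] that by (auto simp: m2_def)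
  have Lsub2: "csubspace (pm.L (r 1) h ` FL {..<r 1} m)" for m
    using pm.cvp.linear_subspace_image[OF pm.linear_L FL_subspace] unfolding pm_cs .
  have Lv: "v \<in> pm.L (r 1) h ` FL {..<r 1} m2" if "v \<in> V" for v
  proof -
    have "cspan B \<subseteq> pm.L (r 1) h ` FL {..<r 1} m2"
      by (rule complex_vector.span_minimal[OF _ Lsub2]) (use gB w(2) w2 in blast)
    then show ?thesis using that B by blast
  qed
  have 2: "filt V m \<subseteq> pm.L (r 1) h ` FL {..<r 1} (m + m2)" for m
    unfolding filt_def
  proof (rule complex_vector.span_minimal[OF _ Lsub2], rule subsetI)
    fix x assume "x \<in> {op_monomial T \<alpha> v | \<alpha> v. v \<in> V \<and> mdeg \<alpha> \<le> m}"
    then obtain \<alpha> v where x: "x = op_monomial T \<alpha> v" "v \<in> V" "mdeg \<alpha> \<le> m" by blast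
    obtain u where u: "u \<in> FL {..<r 1} m2" "v = pm.L (r 1) h u" using Lv[OF x(2)] by blast
    have "x = pm.L (r 1) h (rsc (single \<alpha> 1) u)" by (simp add: x u pm.L_rsc op_poly_single scaleC_one)
    moreover have "rsc (single \<alpha> 1) u \<in> FL {..<r 1} (m + m2)" by (intro FL_rsc pdeg_le_single x(3) u(1))
    ultimately show "x \<in> pm.L (r 1) h ` FL {..<r 1} (m + m2)" by blast
  qed
  have fs: "pm.L (r 1) h ` FL {..<r 1} m \<subseteq> cspan (pm.L (r 1) h ` munit ` FLidx {..<r 1} m)" for m
  proof -
    have "FL {..<r 1} m \<subseteq> fv.span (munit ` FLidx {..<r 1} m :: (nat \<Rightarrow> 'n polynomial) set)" by (rule FL_span) simp
    then show ?thesis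
      using pm.cvp.linear_span_image[OF pm.linear_L, of "r 1" h "munit ` FLidx {..<r 1} m"] unfolding pm_cs by blast
  qed
  have ff: "finite (pm.L (r 1) h ` munit ` FLidx {..<r 1} m)" for m by (intro finite_imageI finite_FLidx) simp
  have "growth_rate TYPE('n) (\<lambda>m. cdim (filt V m)) (real k)"
  proof (rule ccount_limit_transfer[OF h(2)])
    show "cdim (pm.L (r 1) h ` FL {..<r 1} m) \<le> cdim (filt V (m + m1))" for m
      by (rule complex_vector.dim_mono_finite[OF 1 subset_trans[OF 2 fs] ff])
    show "cdim (filt V m) \<le> cdim (pm.L (r 1) h ` FL {..<r 1} (m + m2))" for m
      by (rule complex_vector.dim_mono_finite[OF 2 fs ff])
  qed
  also have "real k = real_of_int (\<Sum>j=1..N. (-1) ^ (j + 1) * int (r j))"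
    unfolding h(3)[symmetric] by simp
  finally show "growth_rate TYPE('n) (\<lambda>m. cdim (filt V m)) (real_of_int (\<Sum>j=1..N. (-1) ^ (j + 1) * int (r j)))" .
qed

end

text \<open>Any two resolutions yield the same growth rate and therefore the same alternating sum,
  so the description in \<open>euler_characteristic\<close> is satisfied by exactly one
  integer.\<close>

theorem euler_characteristic_growth:
  fixes T :: "'n::finite \<Rightarrow> 'h::chilbert_space \<Rightarrow> 'h"
  assumes "commuting_ops T" "finite_dim (range (defect T))"
  shows "(\<lambda>m. real (cdim (commuting_ops.filt T (range (defect T)) m)) / real m ^ CARD('n))
    \<longlonglongrightarrow> real_of_int (euler_characteristic T) / fact CARD('n)"
proof -
  interpret commuting_ops T by fact
  obtain W where W: "finite W" "range (defect T) \<subseteq> cspan W" using assms(2) by (auto simp: finite_dim_def)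
  have M: "arveson_module T = cspan {op_poly T p v | p v. v \<in> range (defect T)}"
    unfolding arveson_module_def by (rule arg_cong[of _ _ complex_vector.span]) blast
  note E = euler_growth_aux[OF W(2,1) M]
  let ?P = "\<lambda>c. \<exists>N r \<epsilon> d. finite_free_resolution (op_poly T) (arveson_module T) N r \<epsilon> d \<and>
     c = (\<Sum>k=1..N. (-1) ^ (k + 1) * int (r k))"
  have lim: "growth_rate TYPE('n) (\<lambda>m. cdim (filt (range (defect T)) m)) (real_of_int c)"
    if "?P c" for c using that E(2) by blast
  have "\<exists>!c. ?P c"
  proof (rule ex_ex1I)
    show "\<exists>c. ?P c" using E(1) by blast
    show "c = c'" if "?P c" "?P c'" for c c' using LIMSEQ_unique[OF lim[OF that(1)] lim[OF that(2)]] by simp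
  qed
  from theI'[OF this] have "?P (euler_characteristic T)" unfolding euler_characteristic_def .
  from tendsto_mult[OF lim[OF this] ccount_asymp[where ?'n = 'n]]
  show ?thesis by (simp add: less_imp_neq[OF ccount_pos, THEN not_sym])
qed

section \<open>Closed subspaces and adjoints\<close>

lemma cinner_simps [simp]:
  "cinner 0 y = 0" "cinner x 0 = 0" "cinner (- x) y = - cinner x y" "cinner x (- y) = - cinner x y"
  and cinner_diff: "cinner (x - z) y = cinner x y - cinner z y" "cinner x (y - z) = cinner x y - cinner x z"
proof -
  have z: "cinner 0 y = 0" for y :: 'a using cinner_add_left[of 0 0 y] by simp
  have m: "cinner (- x) y = - cinner x y" for x y :: 'a
    using cinner_add_left[of x "- x" y] z[of y] by (simp add: eq_neg_iff_add_eq_0 add.commute)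
  have z': "cinner x 0 = 0" for x :: 'a using cinner_commute[of x 0] z by simp
  have m': "cinner x (- y) = - cinner x y" for x y :: 'a using cinner_commute[of x "- y"] cinner_commute[of x y] m by simp
  show "cinner 0 y = 0" "cinner x 0 = 0" "cinner (- x) y = - cinner x y" "cinner x (- y) = - cinner x y" by (fact z z' m m')+
  show "cinner (x - z) y = cinner x y - cinner z y" "cinner x (y - z) = cinner x y - cinner x z"
    using cinner_add_left[of x "- z" y] cinner_add_right[of x y "- z"] m m' by simp_all
qed

lemma cinner_sum_left: "cinner (\<Sum>i\<in>I. f i) y = (\<Sum>i\<in>I. cinner (f i) y)"
  by (induction I rule: infinite_finite_induct) (simp_all add: cinner_add_left)

lemma cinner_sum_right: "cinner y (\<Sum>i\<in>I. f i) = (\<Sum>i\<in>I. cinner y (f i))"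
  by (induction I rule: infinite_finite_induct) (simp_all add: cinner_add_right)

lemma cinner_eq_0_iff: "cinner x x = 0 \<longleftrightarrow> x = 0" by (simp add: cinner_same)

lemma cinner_ext: "(\<And>v. cinner x v = cinner y v) \<Longrightarrow> x = y"
  using cinner_eq_0_iff[of "x - y"] by (simp add: cinner_diff)

lemma scaleC_simps [simp]:
  "0 *\<^sub>C x = 0" "c *\<^sub>C 0 = 0" "1 *\<^sub>C x = x" "(- c) *\<^sub>C x = - (c *\<^sub>C x)" "c *\<^sub>C (- x) = - (c *\<^sub>C x)"
  by (simp_all add: scaleC_one)

lemma scaleC_sum_right: "c *\<^sub>C (\<Sum>i\<in>I. f i) = (\<Sum>i\<in>I. c *\<^sub>C f i)"
  by (rule complex_vector.scale_sum_right)

lemma scaleC_diff_right: "c *\<^sub>C (x - y) = c *\<^sub>C x - c *\<^sub>C y"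
  by (rule complex_vector.scale_right_diff_distrib)

lemma bounded_clinearI:
  assumes "\<And>x y. A (x + y) = A x + A y" "\<And>c x. A (c *\<^sub>C x) = c *\<^sub>C A x" "\<And>x. norm (A x) \<le> K * norm x"
  shows "bounded_clinear A"
  unfolding bounded_clinear_def
  using assms by (auto intro!: bounded_linear_intro[where K = K] simp: scaleR_scaleC mult.commute)

lemma bounded_clinear_sum: "bounded_clinear A \<Longrightarrow> A (\<Sum>i\<in>I. f i) = (\<Sum>i\<in>I. A (f i))"
  by (induction I rule: infinite_finite_induct) (simp_all add: bounded_clinearD)

lemma bounded_clinear_comp: "bounded_clinear A \<Longrightarrow> bounded_clinear B \<Longrightarrow> bounded_clinear (\<lambda>x. A (B x))"
  unfolding bounded_clinear_def by (auto intro: bounded_linear_compose)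

lemma bounded_clinear_id: "bounded_clinear (\<lambda>x. x)" by (auto simp: bounded_clinear_def bounded_linear_ident)

lemma bounded_clinear_diff: "bounded_clinear A \<Longrightarrow> bounded_clinear B \<Longrightarrow> bounded_clinear (\<lambda>x. A x - B x)"
  unfolding bounded_clinear_def by (auto intro: bounded_linear_sub simp: scaleC_diff_right)

lemma bounded_clinear_add: "bounded_clinear A \<Longrightarrow> bounded_clinear B \<Longrightarrow> bounded_clinear (\<lambda>x. A x + B x)"
  unfolding bounded_clinear_def by (auto intro: bounded_linear_add simp: scaleC_add_right)

lemma bounded_clinear_scaleC: "bounded_clinear A \<Longrightarrow> bounded_clinear (\<lambda>x. c *\<^sub>C A x)"
proof -
  assume A: "bounded_clinear A"
  have s: "bounded_clinear (\<lambda>x. c *\<^sub>C x :: 'b)"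
    by (rule bounded_clinearI[where K = "cmod c"]) (simp_all add: scaleC_add_right scaleC_scaleC norm_scaleC mult.commute)
  show ?thesis by (rule bounded_clinear_comp[OF s A])
qed

lemma bounded_clinear_zero: "bounded_clinear (\<lambda>x. 0)" by (rule bounded_clinearI[where K = 0]) simp_all

lemma bounded_clinear_sum_op: "(\<And>i. i \<in> I \<Longrightarrow> bounded_clinear (A i)) \<Longrightarrow> bounded_clinear (\<lambda>x. \<Sum>i\<in>I. A i x)"
  by (induction I rule: infinite_finite_induct) (simp_all add: bounded_clinear_add bounded_clinear_zero)

lemma bounded_linear_cinner_left: "bounded_linear (\<lambda>x. cinner x y)"
  by (rule bounded_linear_intro[where K = "norm y"])
     (simp_all add: cinner_add_left scaleR_scaleC cinner_scaleC_left cinner_Cauchy_Schwarz scaleC_complex_def)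

lemma bounded_linear_cinner_right: "bounded_linear (\<lambda>y. cinner x y)"
  by (rule bounded_linear_intro[where K = "norm x"])
     (simp_all add: cinner_add_right scaleR_scaleC cinner_scaleC_right scaleC_complex_def cinner_Cauchy_Schwarz mult.commute[of _ "norm x"])

lemmas tendsto_cinner_left = bounded_linear.tendsto[OF bounded_linear_cinner_left]
lemmas tendsto_cinner_right = bounded_linear.tendsto[OF bounded_linear_cinner_right]

lemma norm_pythagoras: "cinner x y = 0 \<Longrightarrow> (norm (x + y))\<^sup>2 = (norm x)\<^sup>2 + (norm y)\<^sup>2"
  by (simp add: power2_norm_eq_inner inner_add_left inner_add_right inner_commute[of y x]) (simp add: inner_cinner)

section \<open>Projections, Riesz representation and adjoints\<close>

lemma subspace_convex: "csubspace V \<Longrightarrow> convex V"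
  unfolding convex_def by (auto simp: scaleR_scaleC intro!: complex_vector.subspace_add complex_vector.subspace_scale)

lemma subspace_image:
  assumes A: "bounded_clinear A" and V: "csubspace V"
  shows "csubspace (A ` V)"
proof -
  note A = bounded_clinearD[OF A]
  have "A x + A y \<in> A ` V" "c *\<^sub>C A x \<in> A ` V" if "x \<in> V" "y \<in> V" for x y c
    using that V by (auto simp: A(2,3)[symmetric] complex_vector.subspace_add complex_vector.subspace_scale)
  then show ?thesis using image_eqI[of 0 A 0 V] V by (auto simp: complex_vector.subspace_def A)
qed

lemma closest_point_Hilbert:
  fixes V :: "'a::chilbert_space set"
  assumes "closed V" "convex V" "V \<noteq> {}"
  shows "\<exists>p\<in>V. \<forall>v\<in>V. dist x p \<le> dist x v"
proof -
  define d where "d = infdist x V"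
  have d0: "d \<ge> 0" by (simp add: d_def infdist_nonneg)
  have dle: "d \<le> dist x v" if "v \<in> V" for v using infdist_le[OF that] by (simp add: d_def)
  have "\<exists>v\<in>V. dist x v < d + 1 / real (Suc k)" for k
  proof (rule ccontr)
    assume "\<not> ?thesis"
    then have "d + 1 / real (Suc k) \<le> infdist x V"
      using assms(3) by (simp add: infdist_def) (intro cINF_greatest, auto simp: not_less)
    then show False by (simp add: d_def)
  qed
  then obtain s where s: "\<And>k. s k \<in> V" "\<And>k. dist x (s k) < d + 1 / real (Suc k)" by metis
  \<comment> \<open>The midpoint \<open>y\<close> lies in \<open>V\<close>, so the parallelogram law
    bounds the distance of two near-minimisers. The constant comes from
    \<open>(d + e)^2 \<le> d^2 + (2 d + 1) e\<close> for \<open>0 \<le> e \<le> 1\<close>, with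
    \<open>e = 1 / (N + 1)\<close>.\<close>
  have par: "(dist (s m) (s k))\<^sup>2 \<le> (8 * d + 4) / real (Suc N)" if "m \<ge> N" "k \<ge> N" for m k N
  proof -
    define y where "y = (1/2) *\<^sub>R s m + (1/2) *\<^sub>R s k"
    have "y \<in> V" unfolding y_def using assms(2) s(1) by (intro convexD) auto
    then have "d\<^sup>2 \<le> (norm (x - y))\<^sup>2" using dle[of y] d0 by (intro power_mono) (auto simp: dist_norm)
    moreover have "(norm (s m - s k))\<^sup>2 = 2 * (norm (x - s m))\<^sup>2 + 2 * (norm (x - s k))\<^sup>2 - 4 * (norm (x - y))\<^sup>2"
      unfolding y_def power2_norm_eq_inner by (simp add: inner_simps inner_commute algebra_simps)
    moreover have "(norm (x - s j))\<^sup>2 \<le> (d + 1 / real (Suc N))\<^sup>2" if "j \<ge> N" for j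
    proof (rule power_mono)
      have "1 / real (Suc j) \<le> 1 / real (Suc N)" using that by (simp add: frac_le)
      then show "norm (x - s j) \<le> d + 1 / real (Suc N)" using s(2)[of j] by (simp add: dist_norm)
    qed simp
    note this[OF that(1)] this[OF that(2)]
    moreover have "(d + 1 / real (Suc N))\<^sup>2 \<le> d\<^sup>2 + (2 * d + 1) / real (Suc N)"
    proof -
      have "(1 / real (Suc N))\<^sup>2 \<le> (1 / real (Suc N)) ^ 1" by (rule power_decreasing) auto
      then show ?thesis by (simp add: power2_sum add_divide_distrib)
    qed
    ultimately have "(norm (s m - s k))\<^sup>2 \<le> 4 * ((2 * d + 1) / real (Suc N))" by linarith
    then show ?thesis by (simp add: dist_norm algebra_simps)
  qed
  have "Cauchy s"
  proof (rule metric_CauchyI)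
    fix e :: real assume e: "e > 0"
    obtain N where N: "real N > (8 * d + 4) / e\<^sup>2" using reals_Archimedean2 by blast
    then have "real (Suc N) * e\<^sup>2 > 8 * d + 4" using e by (simp add: field_simps) (smt (verit) zero_le_power2)
    then have "(8 * d + 4) / real (Suc N) < e\<^sup>2" by (simp add: field_simps)
    then have "dist (s m) (s k) < e" if "m \<ge> N" "k \<ge> N" for m k
      using par[OF that] e by (intro power_less_imp_less_base[of _ 2 e]) auto
    then show "\<exists>M. \<forall>m\<ge>M. \<forall>n\<ge>M. dist (s m) (s n) < e" by blast
  qed
  then obtain p where p: "s \<longlonglongrightarrow> p" using Cauchy_convergent convergent_def by blast
  then have "p \<in> V" using assms(1) s(1) closed_sequentially by blast
  moreover have "dist x p \<le> d"
  proof (rule LIMSEQ_le)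
    show "(\<lambda>k. dist x (s k)) \<longlonglongrightarrow> dist x p" by (intro tendsto_intros p)
    show "(\<lambda>k. d + 1 / real (Suc k)) \<longlonglongrightarrow> d"
      using tendsto_add[OF tendsto_const[of d] LIMSEQ_inverse_real_of_nat] by (simp add: inverse_eq_divide)
    show "\<exists>N. \<forall>k\<ge>N. dist x (s k) \<le> d + 1 / real (Suc k)" using s(2) less_imp_le by blast
  qed
  ultimately show ?thesis using dle by force
qed

text \<open>Minimality yields a real inequality; using it for \<open>v\<close> and
  \<open>- v\<close>, and then for \<open>i v\<close>, gives complex orthogonality.\<close>

lemma projection_exists:
  fixes V :: "'a::chilbert_space set"
  assumes "closed V" "csubspace V"
  shows "\<exists>p\<in>V. \<forall>v\<in>V. cinner (x - p) v = 0"
proof -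
  have cv: "convex V" by (rule subspace_convex[OF assms(2)])
  obtain p where p: "p \<in> V" "\<And>v. v \<in> V \<Longrightarrow> dist x p \<le> dist x v"
    using closest_point_Hilbert[OF assms(1) cv] complex_vector.subspace_0[OF assms(2)] by blast
  have 1: "inner (x - p) v \<le> 0" if "v \<in> V" for v
    using any_closest_point_dot[OF cv assms(1) p(1), of "p + v" x] p complex_vector.subspace_add[OF assms(2) p(1) that] by simp
  have 2: "Re (cinner (x - p) v) = 0" if "v \<in> V" for v
    using 1[OF that] 1[OF complex_vector.subspace_neg[OF assms(2) that]] by (simp add: inner_cinner)
  have "cinner (x - p) v = 0" if "v \<in> V" for v
  proof -
    have "Im (cinner (x - p) v) = 0"
      using 2[OF complex_vector.subspace_scale[OF assms(2) that, of \<i>]] by (simp add: cinner_scaleC_right)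
    then show ?thesis using 2[OF that] by (simp add: complex_eq_iff)
  qed
  then show ?thesis using p(1) by blast
qed

lemma projection_unique:
  assumes "csubspace V" "p \<in> V" "q \<in> V" "\<And>v. v \<in> V \<Longrightarrow> cinner (x - p) v = 0" "\<And>v. v \<in> V \<Longrightarrow> cinner (x - q) v = 0"
  shows "p = q"
proof -
  have "p - q \<in> V" by (rule complex_vector.subspace_diff[OF assms(1-3)])
  then have "cinner (x - q) (p - q) - cinner (x - p) (p - q) = 0" using assms(4,5)[of "p - q"] by simp
  then have "cinner (p - q) (p - q) = 0" by (simp add: cinner_diff(1) del: eq_iff_diff_eq_0)
  then show ?thesis by (simp add: cinner_eq_0_iff)
qed

lemma orth_proj_eq:
  assumes "csubspace V" "p \<in> V" "\<And>v. v \<in> V \<Longrightarrow> cinner (x - p) v = 0"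
  shows "orth_proj V x = p"
  unfolding orth_proj_def by (rule the_equality) (use assms projection_unique[OF assms(1), of _ p x] in blast)+

lemma riesz_representation:
  fixes f :: "'a::chilbert_space \<Rightarrow> complex"
  assumes "bounded_clinear f"
  shows "\<exists>x. \<forall>v. f v = cinner v x"
proof (cases "\<forall>v. f v = 0")
  case True
  then show ?thesis by (intro exI[of _ 0]) simp
next
  case False
  then obtain u where u: "f u \<noteq> 0" by blast
  note f = bounded_clinearD[OF assms, unfolded scaleC_complex_def]
  let ?N = "f -` {0}"
  have "closed ?N" by (intro closed_vimage linear_continuous_on f(1)) auto
  moreover have "csubspace ?N" by (simp add: complex_vector.subspace_def f)
  ultimately obtain p where p: "p \<in> ?N" "\<And>v. v \<in> ?N \<Longrightarrow> cinner (u - p) v = 0"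
    using projection_exists[of ?N u] by blast
  define w where "w = u - p"
  have fw: "f w \<noteq> 0" using u p(1) by (simp add: w_def f)
  then have w0: "cinner w w \<noteq> 0" using f(4) by (auto simp: cinner_eq_0_iff)
  show ?thesis
  proof (intro exI allI)
    fix v
    have "f (v - (f v / f w) *\<^sub>C w) = 0" using fw by (simp add: f)
    then have "cinner w (v - (f v / f w) *\<^sub>C w) = 0" using p(2) unfolding w_def by blast
    then have "cinner (v - (f v / f w) *\<^sub>C w) w = 0" by (metis cinner_commute complex_cnj_zero)
    then have "cinner v w = (f v / f w) * cinner w w" by (simp add: cinner_scaleC_left cinner_diff)
    moreover have "cnj (cinner w w) = cinner w w" by (metis cinner_commute)
    ultimately show "f v = cinner v ((cnj (f w) / cinner w w) *\<^sub>C w)" using fw w0 by (simp add: cinner_scaleC_right)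
  qed
qed

text \<open>Riesz on the whole space, followed by projection to \<open>V\<close>.\<close>

lemma adjoint_on_ex1:
  fixes A :: "'a::chilbert_space \<Rightarrow> 'b::complex_inner"
  assumes "bounded_clinear A" "closed V" "csubspace V"
  shows "\<exists>!x. x \<in> V \<and> (\<forall>v\<in>V. cinner (A v) y = cinner v x)"
proof -
  obtain K where K: "\<And>x. norm (A x) \<le> norm x * K" using bounded_clinearD(1)[OF assms(1)] bounded_linear.bounded by blast
  have "bounded_clinear (\<lambda>v. cinner (A v) y)"
  proof (rule bounded_clinearI)
    fix x
    have "norm (cinner (A x) y) \<le> norm (A x) * norm y" by (rule cinner_Cauchy_Schwarz)
    also have "\<dots> \<le> norm x * K * norm y" by (intro mult_right_mono K) simp
    finally show "norm (cinner (A x) y) \<le> (K * norm y) * norm x" by (simp add: mult_ac)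
  qed (simp_all add: bounded_clinearD[OF assms(1)] cinner_add_left cinner_scaleC_left scaleC_complex_def)
  then obtain x where x: "\<And>v. cinner (A v) y = cinner v x" using riesz_representation by blast
  obtain p where p: "p \<in> V" "\<And>v. v \<in> V \<Longrightarrow> cinner (x - p) v = 0" using projection_exists[OF assms(2,3)] by blast
  have "cinner v x = cinner v p" if "v \<in> V" for v
    using p(2)[OF that] cinner_commute[of v "x - p"] by (simp add: cinner_diff)
  then have ex: "p \<in> V \<and> (\<forall>v\<in>V. cinner (A v) y = cinner v p)" using x p(1) by simp
  show ?thesis
  proof (rule ex_ex1I)
    show "\<exists>x. x \<in> V \<and> (\<forall>v\<in>V. cinner (A v) y = cinner v x)" using ex by blast
    fix p q assume *: "p \<in> V \<and> (\<forall>v\<in>V. cinner (A v) y = cinner v p)" "q \<in> V \<and> (\<forall>v\<in>V. cinner (A v) y = cinner v q)"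
    then have "p - q \<in> V" using complex_vector.subspace_diff[OF assms(3)] by blast
    then have "cinner (p - q) (p - q) = 0" using * by (simp only: cinner_diff(2)) (metis diff_self)
    then show "p = q" by (simp add: cinner_eq_0_iff)
  qed
qed

lemma adjoint_onI:
  fixes A :: "'a::chilbert_space \<Rightarrow> 'b::complex_inner"
  assumes "bounded_clinear A" "closed V" "csubspace V"
    and "x \<in> V" "\<And>v. v \<in> V \<Longrightarrow> cinner (A v) y = cinner v x"
  shows "adjoint_on V A y = x"
  unfolding adjoint_on_def by (rule the1_equality[OF adjoint_on_ex1[OF assms(1-3)]]) (use assms(4,5) in blast)

lemma adjoint_on:
  fixes A :: "'a::chilbert_space \<Rightarrow> 'b::complex_inner"
  assumes "bounded_clinear A" "closed V" "csubspace V"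
  shows "adjoint_on V A y \<in> V" "v \<in> V \<Longrightarrow> cinner (A v) y = cinner v (adjoint_on V A y)"
  using theI'[OF adjoint_on_ex1[OF assms, of y]] unfolding adjoint_on_def by blast+

lemma adjoint_on_clinear:
  fixes A :: "'a::chilbert_space \<Rightarrow> 'b::complex_inner"
  assumes A: "bounded_clinear A" "closed V" "csubspace V"
  shows "bounded_clinear (adjoint_on V A)"
proof -
  obtain K where K: "\<And>x. norm (A x) \<le> norm x * K" and K0: "K \<ge> 0"
    using bounded_clinearD(1)[OF assms(1)] bounded_linear.nonneg_bounded by blast
  show ?thesis
  proof (rule bounded_clinearI[where K = K])
    fix x y c
    show "adjoint_on V A (x + y) = adjoint_on V A x + adjoint_on V A y"
      by (rule adjoint_onI[OF A]) (simp_all add: complex_vector.subspace_add[OF A(3)] adjoint_on[OF A] cinner_add_right)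
    show "adjoint_on V A (c *\<^sub>C x) = c *\<^sub>C adjoint_on V A x"
      by (rule adjoint_onI[OF A]) (simp_all add: complex_vector.subspace_scale[OF A(3)] adjoint_on[OF A] cinner_scaleC_right)
    let ?z = "adjoint_on V A x"
    have "(norm ?z)\<^sup>2 = cmod (cinner ?z ?z)" by (simp add: cinner_same norm_power)
    also have "\<dots> = cmod (cinner (A ?z) x)" by (simp add: adjoint_on[OF A])
    also have "\<dots> \<le> norm (A ?z) * norm x" by (rule cinner_Cauchy_Schwarz)
    also have "\<dots> \<le> norm ?z * K * norm x" by (intro mult_right_mono K) simp
    finally have "norm ?z * norm ?z \<le> norm ?z * (K * norm x)" by (simp add: power2_eq_square mult_ac)
    moreover have "0 \<le> K * norm x" using K0 by simp
    ultimately show "norm ?z \<le> K * norm x" by (cases "?z = 0") auto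
  qed
qed

lemma cadjoint:
  fixes A :: "'a::chilbert_space \<Rightarrow> 'b::complex_inner"
  assumes "bounded_clinear A"
  shows "cinner (A v) y = cinner v (cadjoint A y)" "cinner y (A v) = cinner (cadjoint A y) v"
    "bounded_clinear (cadjoint A)"
proof -
  show 1: "cinner (A v) y = cinner v (cadjoint A y)" by (rule adjoint_on[OF assms]) auto
  show "cinner y (A v) = cinner (cadjoint A y) v" using 1 by (metis cinner_commute)
  show "bounded_clinear (cadjoint A)" by (rule adjoint_on_clinear[OF assms]) auto
qed

lemma cadjointI:
  fixes A :: "'a::chilbert_space \<Rightarrow> 'b::complex_inner"
  assumes "bounded_clinear A" "\<And>v. cinner (A v) y = cinner v x"
  shows "cadjoint A y = x" by (rule adjoint_onI[OF assms(1)]) (use assms(2) in auto)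

section \<open>Square roots of positive operators\<close>

lemma positive_op_selfadjoint:
  assumes "positive_op A"
  shows "cinner (A x) y = cinner x (A y)"
proof -
  have A: "bounded_clinear A" and R: "Im (cinner (A x) x) = 0" for x
    using assms by (auto simp: positive_op_def complex_is_Real_iff)
  note A' = bounded_clinearD[OF A]
  have "Im (cinner (A x) y) + Im (cinner (A y) x) = 0"
    using R[of "x + y"] R[of x] R[of y] by (simp add: A' cinner_add_left cinner_add_right)
  moreover have "Re (cinner (A x) y) = Re (cinner (A y) x)" using R[of "x + \<i> *\<^sub>C y"] R[of x] R[of y]
    by (simp add: A' cinner_add_left cinner_add_right cinner_scaleC_left cinner_scaleC_right)
  ultimately have "cinner (A x) y = cnj (cinner (A y) x)" by (simp add: complex_eq_iff)
  then show ?thesis by (metis cinner_commute)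
qed

text \<open>The quadratic form at \<open>x - t A x\<close> is nonnegative for all real
  \<open>t\<close>, and its linear term is \<open>- 2 t\<close> times the squared norm of
  \<open>A x\<close>. The value \<open>t = a / (b + 1)\<close> is small enough for a
  contradiction.\<close>

lemma positive_op_null:
  assumes "positive_op A" "Re (cinner (A x) x) = 0"
  shows "A x = 0"
proof (rule ccontr)
  assume "A x \<noteq> 0"
  note A = bounded_clinearD[of A, OF assms(1)[unfolded positive_op_def, THEN conjunct1]]
  define y where "y = A x"
  define a where "a = (norm y)\<^sup>2"
  define b where "b = Re (cinner (A y) y)"
  have b: "b \<ge> 0" using assms(1) by (simp add: positive_op_def b_def)
  have a: "a > 0" using \<open>A x \<noteq> 0\<close> by (simp add: a_def y_def)
  have "2 * t * a \<le> t\<^sup>2 * b" for t :: real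
  proof -
    let ?c = "complex_of_real t"
    have "Re (cinner (A (x - ?c *\<^sub>C y)) (x - ?c *\<^sub>C y)) \<ge> 0" using assms(1) by (simp add: positive_op_def)
    moreover have "cinner (A x) y = of_real a" "cinner (A y) x = of_real a"
      using positive_op_selfadjoint[OF assms(1), of y x] by (simp_all add: y_def a_def cinner_same)
    ultimately show ?thesis using assms(2)
      by (simp add: A cinner_diff cinner_scaleC_left cinner_scaleC_right b_def power2_eq_square algebra_simps)
  qed
  from this[of "a / (b + 1)"] have "(a / (b + 1)) * (2 * a) \<le> (a / (b + 1)) * (a / (b + 1) * b)"
    by (simp add: power2_eq_square mult_ac)
  moreover have "a / (b + 1) > 0" using a b by simp
  ultimately have "2 * a \<le> a / (b + 1) * b" by (rule mult_left_le_imp_le)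
  also have "\<dots> \<le> a" using a b by (simp add: field_simps)
  finally show False using a by simp
qed

text \<open>The coefficients of the binomial series of \<open>sqrt (1 - t)\<close>.\<close>

definition sqrt_coeff :: "nat \<Rightarrow> real" where
  "sqrt_coeff k = (-1) ^ k * ((1/2) gchoose k)"

lemma sqrt_coeff_0: "sqrt_coeff 0 = 1" by (simp add: sqrt_coeff_def)

lemma sqrt_coeff_Suc: "real (Suc k) * sqrt_coeff (Suc k) = (real k - 1/2) * sqrt_coeff k"
proof -
  have "real (Suc k) * ((1/2::real) gchoose (Suc k)) = (1/2 - real k) * ((1/2) gchoose k)"
    using gbinomial_mult_1[of "1/2 :: real" k] by (simp add: algebra_simps)
  then have "(-1) ^ Suc k * (real (Suc k) * ((1/2::real) gchoose (Suc k))) = (-1) ^ Suc k * ((1/2 - real k) * ((1/2) gchoose k))"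
    by simp
  then show ?thesis by (simp add: sqrt_coeff_def algebra_simps)
qed

text \<open>The recursion telescopes. As the next coefficient is negative, the partial sums at
  argument 1 stay nonnegative, which is the source of the absolute bound in
  \<open>sqrt_coeff_abs_sum\<close>.\<close>

lemma sqrt_coeff_sum: "(\<Sum>k\<le>N. sqrt_coeff k) = - 2 * (real (Suc N) * sqrt_coeff (Suc N))"
proof (induction N)
  case 0
  show ?case using sqrt_coeff_Suc[of 0] by (simp add: sqrt_coeff_0)
next
  case (Suc N)
  show ?case unfolding sum.atMost_Suc Suc.IH sqrt_coeff_Suc[of "Suc N"] by (simp add: algebra_simps)
qed

lemma sqrt_coeff_neg: "sqrt_coeff (Suc k) < 0"
proof (induction k)
  case 0
  show ?case using sqrt_coeff_Suc[of 0] by (simp add: sqrt_coeff_0)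
next
  case (Suc k)
  have "real (Suc (Suc k)) * sqrt_coeff (Suc (Suc k)) < 0"
    unfolding sqrt_coeff_Suc by (intro mult_pos_neg Suc.IH) simp
  then show ?case by (simp add: mult_less_0_iff)
qed

lemma sqrt_coeff_abs_sum: "(\<Sum>k<N. \<bar>sqrt_coeff (Suc k)\<bar>) \<le> 1"
proof -
  have "1 - (\<Sum>k<N. \<bar>sqrt_coeff (Suc k)\<bar>) = (\<Sum>k\<le>N. sqrt_coeff k)"
    by (simp add: sum.atMost_shift sqrt_coeff_0 abs_of_neg[OF sqrt_coeff_neg] sum_negf)
  also have "\<dots> \<ge> 0" unfolding sqrt_coeff_sum using sqrt_coeff_neg[of N] by (simp add: mult_le_0_iff)
  finally show ?thesis by simp
qed

lemma sqrt_coeff_summable: "summable (\<lambda>k. \<bar>sqrt_coeff k\<bar>)" "suminf (\<lambda>k. \<bar>sqrt_coeff (Suc k)\<bar>) \<le> 1"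
proof -
  have s: "summable (\<lambda>k. \<bar>sqrt_coeff (Suc k)\<bar>)"
    by (rule summableI_nonneg_bounded[where x = 1]) (use sqrt_coeff_abs_sum in auto)
  then show "summable (\<lambda>k. \<bar>sqrt_coeff k\<bar>)" using summable_Suc_iff[of "\<lambda>k. \<bar>sqrt_coeff k\<bar>"] by blast
  show "suminf (\<lambda>k. \<bar>sqrt_coeff (Suc k)\<bar>) \<le> 1" by (rule suminf_le_const[OF s sqrt_coeff_abs_sum])
qed

text \<open>The square of the series is \<open>1 - t\<close>, by Vandermonde's identity with
  \<open>1/2 + 1/2 = 1\<close>.\<close>

lemma sqrt_coeff_conv:
  "(\<Sum>i\<le>k. sqrt_coeff i * sqrt_coeff (k - i)) = (if k = 0 then 1 else if k = 1 then -1 else 0)"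
proof -
  have "(\<Sum>i\<le>k. sqrt_coeff i * sqrt_coeff (k - i)) = (\<Sum>i\<le>k. (-1) ^ k * (((1/2) gchoose i) * ((1/2) gchoose (k - i))))"
    by (rule sum.cong) (auto simp: sqrt_coeff_def simp flip: power_add)
  also have "\<dots> = (-1) ^ k * ((1/2 + 1/2 :: real) gchoose k)"
    unfolding sum_distrib_left[symmetric] atMost_atLeast0 gbinomial_Vandermonde ..
  also have "(1/2 + 1/2 :: real) gchoose k = of_nat (1 choose k)" by (simp add: binomial_gbinomial)
  finally have *: "(\<Sum>i\<le>k. sqrt_coeff i * sqrt_coeff (k - i)) = (-1) ^ k * of_nat (1 choose k)" .
  consider "k = 0" | "k = 1" | "1 < k" by linarith
  then show ?thesis unfolding * by cases (simp_all add: binomial_eq_0)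
qed

definition sqrt_series :: "('a::chilbert_space \<Rightarrow> 'a) \<Rightarrow> 'a \<Rightarrow> 'a" where
  "sqrt_series B x = suminf (\<lambda>k. sqrt_coeff k *\<^sub>R (B ^^ k) x)"

locale contraction =
  fixes B :: "'a::chilbert_space \<Rightarrow> 'a"
  assumes clinear: "bounded_clinear B" and norm_le: "norm (B x) \<le> norm x"
begin

lemma pow: "bounded_clinear (B ^^ k)" "norm ((B ^^ k) x) \<le> norm x"
proof -
  show "bounded_clinear (B ^^ k)"
    by (induction k) (use bounded_clinear_comp[OF clinear] in \<open>auto simp: bounded_clinear_id id_def o_def\<close>)
  show "norm ((B ^^ k) x) \<le> norm x" by (induction k) (auto intro: order_trans[OF norm_le])
qed

lemma series_abs: "norm (sqrt_coeff k *\<^sub>R (B ^^ k) x) \<le> \<bar>sqrt_coeff k\<bar> * norm x"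
  by (simp add: mult_left_mono pow)

lemma series_summable: "summable (\<lambda>k. sqrt_coeff k *\<^sub>R (B ^^ k) x)"
  by (rule summable_comparison_test'[OF summable_mult2[OF sqrt_coeff_summable(1)]]) (rule series_abs)

lemma series_sums: "(\<lambda>k. sqrt_coeff k *\<^sub>R (B ^^ k) x) sums sqrt_series B x"
  unfolding sqrt_series_def by (rule summable_sums[OF series_summable])

text \<open>With the row operator for \<open>C\<close> this relates the two defect operators; with
  \<open>C = c\<close> times the identity it gives homogeneity, and with \<open>C\<close> a second
  square root it gives uniqueness.\<close>

lemma series_intertwine:
  assumes "bounded_clinear C" "contraction B'" "\<And>x. C (B x) = B' (C x)"
  shows "C (sqrt_series B x) = sqrt_series B' (C x)"
proof -
  interpret B': contraction B' by fact
  have p: "C ((B ^^ k) x) = (B' ^^ k) (C x)" for k x by (induction k) (auto simp: assms(3))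
  have "(\<lambda>k. C (sqrt_coeff k *\<^sub>R (B ^^ k) x)) sums C (sqrt_series B x)"
    by (rule bounded_linear.sums[OF bounded_clinearD(1)[OF assms(1)] series_sums])
  then have "(\<lambda>k. sqrt_coeff k *\<^sub>R (B' ^^ k) (C x)) sums C (sqrt_series B x)"
    by (simp add: p bounded_clinearD[OF assms(1)] scaleR_scaleC)
  then show ?thesis using B'.series_sums sums_unique2 by blast
qed

lemma series_clinear: "bounded_clinear (sqrt_series B)"
proof (rule bounded_clinearI[where K = "suminf (\<lambda>k. \<bar>sqrt_coeff k\<bar>)"])
  fix x y :: 'a and c
  note p = bounded_clinearD[OF pow(1)]
  show "sqrt_series B (x + y) = sqrt_series B x + sqrt_series B y"
    using sums_unique2[OF series_sums[of "x + y"], of "sqrt_series B x + sqrt_series B y"]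
      sums_add[OF series_sums[of x] series_sums[of y]] by (simp add: p scaleR_right_distrib)
  have "bounded_clinear (\<lambda>x. c *\<^sub>C x :: 'a)" by (rule bounded_clinear_scaleC[OF bounded_clinear_id])
  from series_intertwine[OF this contraction_axioms, of x]
  show "sqrt_series B (c *\<^sub>C x) = c *\<^sub>C sqrt_series B x" by (simp add: bounded_clinearD[OF clinear])
  have s: "summable (\<lambda>k. norm (sqrt_coeff k *\<^sub>R (B ^^ k) x))"
    by (rule summable_comparison_test'[OF summable_mult2[OF sqrt_coeff_summable(1)]]) (use series_abs in auto)
  have "norm (sqrt_series B x) \<le> suminf (\<lambda>k. norm (sqrt_coeff k *\<^sub>R (B ^^ k) x))"
    unfolding sqrt_series_def by (rule summable_norm[OF s])
  also have "\<dots> \<le> suminf (\<lambda>k. \<bar>sqrt_coeff k\<bar> * norm x)"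
    by (rule suminf_le[OF series_abs s summable_mult2[OF sqrt_coeff_summable(1)]])
  also have "\<dots> = suminf (\<lambda>k. \<bar>sqrt_coeff k\<bar>) * norm x"
    by (rule suminf_mult2[OF sqrt_coeff_summable(1), symmetric])
  finally show "norm (sqrt_series B x) \<le> suminf (\<lambda>k. \<bar>sqrt_coeff k\<bar>) * norm x" .
qed

text \<open>Absolute summability over pairs permits a rearrangement along \<open>i + j = k\<close>,
  where \<open>sqrt_coeff_conv\<close> applies.\<close>

lemma series_square: "sqrt_series B (sqrt_series B x) = x - B x"
proof -
  let ?a = sqrt_coeff
  define f where "f = (\<lambda>(i, j). (?a i * ?a j) *\<^sub>R (B ^^ (i + j)) x)"
  have a: "(\<lambda>k. \<bar>?a k\<bar>) summable_on UNIV"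
    using sqrt_coeff_summable(1) by (intro summable_nonneg_imp_summable_on) auto
  have "(\<lambda>(i, j). \<bar>?a i\<bar> * \<bar>?a j\<bar>) summable_on UNIV \<times> UNIV"
  proof (rule summable_on_SigmaI)
    show "((\<lambda>j. case (i, j) of (i, j) \<Rightarrow> \<bar>?a i\<bar> * \<bar>?a j\<bar>) has_sum \<bar>?a i\<bar> * (\<Sum>\<^sub>\<infinity>k. \<bar>?a k\<bar>)) UNIV" for i
      using has_sum_cmult_right[OF has_sum_infsum[OF a]] by simp
    show "(\<lambda>i. \<bar>?a i\<bar> * (\<Sum>\<^sub>\<infinity>k. \<bar>?a k\<bar>)) summable_on UNIV" by (rule summable_on_cmult_left[OF a])
  qed auto
  then have s: "(\<lambda>p. norm (f p)) summable_on UNIV \<times> UNIV"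
  proof (rule Infinite_Sum.abs_summable_on_comparison_test'[OF summable_on_cmult_left[of _ _ "norm x"]])
    fix p :: "nat \<times> nat"
    show "norm (f p) \<le> (case p of (i, j) \<Rightarrow> \<bar>?a i\<bar> * \<bar>?a j\<bar>) * norm x"
      by (cases p) (auto simp: f_def abs_mult intro!: mult_left_mono pow)
  qed
  have hs: "((\<lambda>k. ?a k *\<^sub>R (B ^^ k) y) has_sum sqrt_series B y) UNIV" for y
    by (rule norm_summable_imp_has_sum[OF summable_comparison_test'[OF summable_mult2[OF sqrt_coeff_summable(1)]] series_sums])
       (use series_abs in auto)
  have "(\<Sum>\<^sub>\<infinity>p\<in>UNIV \<times> UNIV. f p) = (\<Sum>\<^sub>\<infinity>i. \<Sum>\<^sub>\<infinity>j. f (i, j))"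
    using infsum_Sigma_banach[OF Infinite_Sum.abs_summable_summable[OF s]] by simp
  also have "\<dots> = (\<Sum>\<^sub>\<infinity>i. ?a i *\<^sub>R (B ^^ i) (sqrt_series B x))"
  proof (rule infsum_cong)
    fix i
    have "bounded_clinear (\<lambda>y. complex_of_real (?a i) *\<^sub>C (B ^^ i) y)" by (rule bounded_clinear_scaleC[OF pow(1)])
    from has_sum_bounded_linear[OF bounded_clinearD(1)[OF this] hs[of x]]
    have "((\<lambda>j. f (i, j)) has_sum ?a i *\<^sub>R (B ^^ i) (sqrt_series B x)) UNIV"
      by (simp add: f_def scaleR_scaleC scaleC_scaleC bounded_clinearD(2)[OF pow(1)] funpow_add)
    then show "(\<Sum>\<^sub>\<infinity>j. f (i, j)) = ?a i *\<^sub>R (B ^^ i) (sqrt_series B x)" by (rule infsumI)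
  qed
  also have "\<dots> = sqrt_series B (sqrt_series B x)" by (rule infsumI[OF hs])
  finally have 1: "(\<Sum>\<^sub>\<infinity>p\<in>UNIV \<times> UNIV. f p) = sqrt_series B (sqrt_series B x)" .
  have bij: "bij_betw (\<lambda>(k, i). (i, k - i)) (Sigma UNIV (\<lambda>k::nat. {..k})) (UNIV \<times> UNIV)"
    by (rule bij_betwI[where g = "\<lambda>(i, j). (i + j, i)"]) auto
  have "(\<lambda>p. f (case p of (k, i) \<Rightarrow> (i, k - i))) summable_on Sigma UNIV (\<lambda>k::nat. {..k})"
    using summable_on_reindex_bij_betw[OF bij, of f] Infinite_Sum.abs_summable_summable[OF s] by simp
  then have "infsum (\<lambda>p. f (case p of (k, i) \<Rightarrow> (i, k - i))) (Sigma UNIV (\<lambda>k::nat. {..k})) = (\<Sum>\<^sub>\<infinity>k. \<Sum>\<^sub>\<infinity>i\<in>{..k}. f (i, k - i))"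
    by (subst infsum_Sigma_banach[symmetric]) auto
  then have 2: "(\<Sum>\<^sub>\<infinity>p\<in>UNIV \<times> UNIV. f p) = (\<Sum>\<^sub>\<infinity>k. \<Sum>i\<le>k. f (i, k - i))"
    using infsum_reindex_bij_betw[OF bij, of f] by simp
  have "(\<Sum>i\<le>k. f (i, k - i)) = (if k = 0 then x else if k = 1 then - B x else 0)" for k
  proof -
    have "(\<Sum>i\<le>k. f (i, k - i)) = (\<Sum>i\<le>k. ?a i * ?a (k - i)) *\<^sub>R (B ^^ k) x"
      unfolding scaleR_sum_left by (rule sum.cong) (auto simp: f_def)
    then show ?thesis by (simp add: sqrt_coeff_conv)
  qed
  then have "(\<Sum>\<^sub>\<infinity>k. \<Sum>i\<le>k. f (i, k - i)) = (\<Sum>\<^sub>\<infinity>k::nat. (if k = 0 then x else if k = 1 then - B x else 0))" by simp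
  also have "\<dots> = (\<Sum>\<^sub>\<infinity>k\<in>{0::nat, 1}. (if k = 0 then x else if k = 1 then - B x else 0))"
    by (rule infsum_cong_neutral) auto
  also have "\<dots> = x - B x" by simp
  finally show ?thesis using 1 2 by simp
qed

text \<open>The term \<open>k = 0\<close> contributes the squared norm of \<open>x\<close>; the
  others together are no larger in absolute value, by the bound 1 on the sum of their
  coefficients.\<close>

lemma series_positive:
  assumes self: "\<And>x y. cinner (B x) y = cinner x (B y)"
  shows "positive_op (sqrt_series B)"
  unfolding positive_op_def
proof (intro conjI allI series_clinear)
  fix x
  have p: "cinner ((B ^^ k) x) x \<in> \<real>" for k
  proof -
    have "cinner ((B ^^ k) x) y = cinner x ((B ^^ k) y)" for x y
      by (induction k arbitrary: x y) (simp_all add: self funpow_swap1)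
    then have "cinner ((B ^^ k) x) x = cnj (cinner ((B ^^ k) x) x)" by (metis cinner_commute)
    then show ?thesis by (simp add: Reals_cnj_iff)
  qed
  have "(\<lambda>k. cinner (sqrt_coeff k *\<^sub>R (B ^^ k) x) x) sums cinner (sqrt_series B x) x"
    by (rule bounded_linear.sums[OF bounded_linear_cinner_left series_sums])
  then have s: "(\<lambda>k. of_real (sqrt_coeff k) * cinner ((B ^^ k) x) x) sums cinner (sqrt_series B x) x"
    by (simp add: scaleR_scaleC cinner_scaleC_left)
  have "(\<lambda>k. Im (of_real (sqrt_coeff k) * cinner ((B ^^ k) x) x)) sums Im (cinner (sqrt_series B x) x)"
    by (rule sums_Im[OF s])
  then have "(\<lambda>k. 0) sums Im (cinner (sqrt_series B x) x)" using p by (simp add: complex_is_Real_iff)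
  then show "cinner (sqrt_series B x) x \<in> \<real>" using sums_unique2[OF sums_zero] by (auto simp: complex_is_Real_iff)
  have "(\<lambda>k. Re (of_real (sqrt_coeff k) * cinner ((B ^^ k) x) x)) sums Re (cinner (sqrt_series B x) x)"
    by (rule sums_Re[OF s])
  then have s1: "(\<lambda>k. sqrt_coeff k * Re (cinner ((B ^^ k) x) x)) sums Re (cinner (sqrt_series B x) x)" by simp
  have s2: "(\<lambda>k. sqrt_coeff (Suc k) * Re (cinner ((B ^^ Suc k) x) x)) sums (Re (cinner (sqrt_series B x) x) - (norm x)\<^sup>2)"
    using sums_Suc_imp[of "\<lambda>k. sqrt_coeff k * Re (cinner ((B ^^ k) x) x)"] s1
    by (subst sums_Suc_iff) (simp add: sqrt_coeff_0 cinner_same del: of_real_power)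
  have s3: "(\<lambda>k. - (\<bar>sqrt_coeff (Suc k)\<bar> * (norm x)\<^sup>2)) sums (- (suminf (\<lambda>k. \<bar>sqrt_coeff (Suc k)\<bar>) * (norm x)\<^sup>2))"
    by (intro sums_minus sums_mult2 summable_sums) (use sqrt_coeff_summable(1) summable_Suc_iff[of "\<lambda>k. \<bar>sqrt_coeff k\<bar>"] in blast)
  have "- (suminf (\<lambda>k. \<bar>sqrt_coeff (Suc k)\<bar>) * (norm x)\<^sup>2) \<le> Re (cinner (sqrt_series B x) x) - (norm x)\<^sup>2"
  proof (rule sums_le[OF _ s3 s2])
    fix k
    have "Re (cinner ((B ^^ Suc k) x) x) \<le> cmod (cinner ((B ^^ Suc k) x) x)" by (rule complex_Re_le_cmod)
    also have "\<dots> \<le> norm ((B ^^ Suc k) x) * norm x" by (rule cinner_Cauchy_Schwarz)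
    also have "\<dots> \<le> norm x * norm x" by (intro mult_right_mono pow) simp
    finally have "Re (cinner ((B ^^ Suc k) x) x) \<le> (norm x)\<^sup>2" by (simp add: power2_eq_square)
    then show "- (\<bar>sqrt_coeff (Suc k)\<bar> * (norm x)\<^sup>2) \<le> sqrt_coeff (Suc k) * Re (cinner ((B ^^ Suc k) x) x)"
      using sqrt_coeff_neg[of k] by (simp add: abs_of_neg mult_le_cancel_left)
  qed
  moreover have "suminf (\<lambda>k. \<bar>sqrt_coeff (Suc k)\<bar>) * (norm x)\<^sup>2 \<le> 1 * (norm x)\<^sup>2"
    by (intro mult_right_mono sqrt_coeff_summable(2)) simp
  ultimately show "0 \<le> Re (cinner (sqrt_series B x) x)" by simp
qed

text \<open>For uniqueness, a second root \<open>C\<close> commutes with \<open>B = 1 - C^2\<close>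
  and hence with the series \<open>S\<close>. Then \<open>S + C\<close> annihilates
  \<open>y = (S - C) x\<close>, and positivity forces \<open>S y = C y = 0\<close>, so
  \<open>y = 0\<close>.\<close>

lemma sqrt_op_eq:
  assumes self: "\<And>x y. cinner (B x) y = cinner x (B y)"
  shows "sqrt_op (\<lambda>x. x - B x) = sqrt_series B"
  unfolding sqrt_op_def
proof (rule the_equality)
  let ?S = "sqrt_series B"
  have S: "positive_op ?S" by (rule series_positive[OF self])
  show "positive_op ?S \<and> ?S \<circ> ?S = (\<lambda>x. x - B x)" using S by (auto simp: series_square)
  fix C assume C: "positive_op C \<and> C \<circ> C = (\<lambda>x. x - B x)"
  then have Cl: "bounded_clinear C" and CC: "C (C x) = x - B x" for x by (auto simp: positive_op_def fun_eq_iff)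
  note Cd = bounded_clinearD[OF Cl] and Sd = bounded_clinearD[OF series_clinear]
  have B: "B x = x - C (C x)" for x by (simp add: CC)
  have CB: "C (B x) = B (C x)" for x by (simp add: B Cd)
  have CS: "C (?S x) = ?S (C x)" for x by (rule series_intertwine[OF Cl contraction_axioms CB])
  show "C = ?S"
  proof
    fix x
    define y where "y = ?S x - C x"
    have "?S y + C y = 0" by (simp add: y_def Cd Sd CS CC series_square)
    then have "cinner (?S y) y + cinner (C y) y = 0" by (metis cinner_add_left cinner_simps(1))
    moreover have "Re (cinner (?S y) y) \<ge> 0" "Re (cinner (C y) y) \<ge> 0" using S C by (auto simp: positive_op_def)
    ultimately have "Re (cinner (?S y) y) = 0" "Re (cinner (C y) y) = 0"
      by (metis add_nonneg_eq_0_iff plus_complex.simps(1) zero_complex.simps(1))+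
    then have 0: "?S y = 0" "C y = 0" using positive_op_null S C by blast+
    have "cinner y y = cinner (?S x) y - cinner (C x) y" by (simp add: y_def cinner_diff)
    also have "\<dots> = cinner x (?S y) - cinner x (C y)" using positive_op_selfadjoint S C by metis
    finally have "y = 0" using 0 by (simp add: cinner_eq_0_iff)
    then show "C x = ?S x" by (simp add: y_def)
  qed
qed

end

section \<open>Orthonormal bases and traces\<close>

definition orthonormal :: "'a::complex_inner set \<Rightarrow> bool" where
  "orthonormal B \<longleftrightarrow> (\<forall>b\<in>B. \<forall>c\<in>B. cinner b c = (if b = c then 1 else 0))"

lemma orthonormal_basis_of_iff:
  "orthonormal_basis_of V B \<longleftrightarrow> B \<subseteq> V \<and> orthonormal B \<and> V \<subseteq> closure (cspan B)"
  by (simp add: orthonormal_basis_of_def orthonormal_def)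

lemma orthonormal_subset: "orthonormal B \<Longrightarrow> F \<subseteq> B \<Longrightarrow> orthonormal F"
  unfolding orthonormal_def by blast

lemma orthonormal_coeff:
  assumes "orthonormal F" "finite F" "e \<in> F"
  shows "cinner (\<Sum>b\<in>F. c b *\<^sub>C b) e = c e"
proof -
  have "cinner (\<Sum>b\<in>F. c b *\<^sub>C b) e = (\<Sum>b\<in>F. if b = e then c b else 0)"
    unfolding cinner_sum_left by (rule sum.cong) (use assms in \<open>auto simp: cinner_scaleC_left orthonormal_def\<close>)
  then show ?thesis using assms by simp
qed

lemma orthonormal_span:
  assumes "orthonormal F" "finite F" "w \<in> cspan F"
  shows "w = (\<Sum>e\<in>F. cinner w e *\<^sub>C e)"
proof -
  obtain c where c: "w = (\<Sum>e\<in>F. c e *\<^sub>C e)" using assms(3) complex_vector.span_finite[OF assms(2)] by auto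
  show ?thesis unfolding c by (rule sum.cong) (simp_all add: orthonormal_coeff[OF assms(1,2)])
qed

lemma orthonormal_residual:
  assumes "orthonormal F" "finite F" "w \<in> cspan F"
  shows "cinner (u - (\<Sum>e\<in>F. cinner u e *\<^sub>C e)) w = 0"
proof -
  have "cinner (u - (\<Sum>e\<in>F. cinner u e *\<^sub>C e)) e = 0" if "e \<in> F" for e
    using orthonormal_coeff[OF assms(1,2) that] by (simp add: cinner_diff)
  then show ?thesis by (subst orthonormal_span[OF assms]) (simp add: cinner_sum_right cinner_scaleC_right)
qed

lemma orthonormal_best:
  assumes "orthonormal F" "finite F" "w \<in> cspan F"
  shows "norm (u - (\<Sum>e\<in>F. cinner u e *\<^sub>C e)) \<le> norm (u - w)"
proof -
  let ?p = "\<Sum>e\<in>F. cinner u e *\<^sub>C e"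
  have "?p - w \<in> cspan F"
    by (intro complex_vector.span_diff complex_vector.span_sum complex_vector.span_scale complex_vector.span_base assms(3))
  then have "(norm (u - ?p + (?p - w)))\<^sup>2 = (norm (u - ?p))\<^sup>2 + (norm (?p - w))\<^sup>2"
    by (intro norm_pythagoras orthonormal_residual assms)
  then have "(norm (u - ?p))\<^sup>2 \<le> (norm (u - w))\<^sup>2" by simp
  then show ?thesis by (rule power2_le_imp_le) simp
qed

text \<open>Finite partial sums are best approximations, so they do at least as well as any
  approximant from a smaller span. The basis may be uncountable; convergence is along finite
  subsets.\<close>

lemma orthonormal_expansion:
  assumes "orthonormal_basis_of V B" "u \<in> V"
  shows "((\<lambda>e. cinner u e *\<^sub>C e) has_sum u) B"
  unfolding has_sum_def
proof (rule tendstoI)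
  fix r :: real assume "r > 0"
  have B: "orthonormal B" and "u \<in> closure (cspan B)" using assms by (auto simp: orthonormal_basis_of_iff)
  then obtain w where w: "w \<in> cspan B" "dist w u < r" using \<open>r > 0\<close> closure_approachable by blast
  obtain X c where X: "finite X" "X \<subseteq> B" and wX: "w = (\<Sum>a\<in>X. c a *\<^sub>C a)"
    using w(1) unfolding complex_vector.span_explicit[of B] by blast
  have wX: "w \<in> cspan X" unfolding wX
    by (intro complex_vector.span_sum complex_vector.span_scale complex_vector.span_base)
  show "\<forall>\<^sub>F F in finite_subsets_at_top B. dist (\<Sum>e\<in>F. cinner u e *\<^sub>C e) u < r"
    unfolding eventually_finite_subsets_at_top
  proof (intro exI conjI allI impI)
    fix Y assume Y: "finite Y \<and> X \<subseteq> Y \<and> Y \<subseteq> B"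
    then have "w \<in> cspan Y" using wX complex_vector.span_mono by blast
    from orthonormal_best[OF orthonormal_subset[OF B] _ this, of u] Y
    show "dist (\<Sum>e\<in>Y. cinner u e *\<^sub>C e) u < r" using w(2) by (simp add: dist_norm norm_minus_commute)
  qed (use X in auto)
qed

lemma parseval:
  assumes "orthonormal_basis_of V B" "u \<in> V"
  shows "((\<lambda>e. cinner v e * cinner e u) has_sum cinner v u) B"
proof -
  have "((\<lambda>e. cinner v (cinner u e *\<^sub>C e)) has_sum cinner v u) B"
    by (rule has_sum_bounded_linear[OF bounded_linear_cinner_right orthonormal_expansion[OF assms]])
  then show ?thesis by (simp add: cinner_scaleC_right mult.commute flip: cinner_commute)
qed

lemma subspace_closure:
  assumes "csubspace (V :: 'a::complex_inner set)"
  shows "csubspace (closure V)"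
  unfolding complex_vector.subspace_def
proof (intro conjI ballI allI)
  show "0 \<in> closure V" using complex_vector.subspace_0[OF assms] closure_subset by blast
  fix x assume "x \<in> closure V"
  then obtain s where s: "\<And>k. s k \<in> V" "s \<longlonglongrightarrow> x" by (auto simp: closure_sequential)
  { fix y assume "y \<in> closure V"
    then obtain t where t: "\<And>k. t k \<in> V" "t \<longlonglongrightarrow> y" by (auto simp: closure_sequential)
    have "(\<lambda>k. s k + t k) \<longlonglongrightarrow> x + y" by (intro tendsto_add s t)
    then show "x + y \<in> closure V" unfolding closure_sequential
      using complex_vector.subspace_add[OF assms s(1) t(1)] by (intro exI[of _ "\<lambda>k. s k + t k"]) simp }
  fix c
  have "(\<lambda>k. c *\<^sub>C s k) \<longlonglongrightarrow> c *\<^sub>C x"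
    by (rule bounded_linear.tendsto[OF bounded_clinearD(1)[OF bounded_clinear_scaleC[OF bounded_clinear_id]] s(2)])
  then show "c *\<^sub>C x \<in> closure V" unfolding closure_sequential
    using complex_vector.subspace_scale[OF assms s(1)] by (intro exI[of _ "\<lambda>k. c *\<^sub>C s k"]) simp
qed

lemma orthonormal_insert:
  assumes "orthonormal M" "w \<noteq> 0" "\<And>e. e \<in> M \<Longrightarrow> cinner w e = 0"
  shows "orthonormal (insert ((1 / of_real (norm w)) *\<^sub>C w) M)" "(1 / of_real (norm w)) *\<^sub>C w \<notin> M"
proof -
  let ?e = "(1 / complex_of_real (norm w)) *\<^sub>C w"
  have 1: "cinner ?e ?e = 1" using assms(2) by (simp add: cinner_same norm_scaleC norm_divide)
  have 2: "cinner ?e e = 0" "cinner e ?e = 0" if "e \<in> M" for e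
    using assms(3)[OF that] cinner_commute[of e w] by (simp_all add: cinner_scaleC_left cinner_scaleC_right)
  show 3: "?e \<notin> M" using 1 2(1)[of ?e] by auto
  show "orthonormal (insert ?e M)" using assms(1) 1 2 3 unfolding orthonormal_def by auto
qed

text \<open>\<open>trace_on\<close> selects a basis by \<open>SOME\<close>, so that existence is
  needed to compute any trace.\<close>

lemma exists_orthonormal_basis:
  fixes V :: "'a::chilbert_space set"
  assumes "closed V" "csubspace V"
  shows "\<exists>B. orthonormal_basis_of V B"
proof -
  let ?A = "{B. B \<subseteq> V \<and> orthonormal B}"
  have "\<exists>M\<in>?A. \<forall>X\<in>?A. M \<subseteq> X \<longrightarrow> X = M"
  proof (rule subset_Zorn')
    fix C assume C: "subset.chain ?A C"
    then have C1: "\<And>X. X \<in> C \<Longrightarrow> X \<subseteq> V \<and> orthonormal X" and C2: "\<And>X Y. X \<in> C \<Longrightarrow> Y \<in> C \<Longrightarrow> X \<subseteq> Y \<or> Y \<subseteq> X"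
      unfolding subset.chain_def by blast+
    have "orthonormal (\<Union>C)"
      unfolding orthonormal_def
    proof (intro ballI)
      fix b c assume "b \<in> \<Union>C" "c \<in> \<Union>C"
      then obtain X Y where XY: "X \<in> C" "b \<in> X" "Y \<in> C" "c \<in> Y" by blast
      then consider "X \<subseteq> Y" | "Y \<subseteq> X" using C2 by blast
      then show "cinner b c = (if b = c then 1 else 0)" using XY C1[of X] C1[of Y] unfolding orthonormal_def by cases blast+
    qed
    then show "\<Union>C \<in> ?A" using C1 by blast
  qed
  then obtain M where "M \<in> ?A" and M': "\<forall>X\<in>?A. M \<subseteq> X \<longrightarrow> X = M" by (rule bexE)
  then have M: "M \<subseteq> V" "orthonormal M" by simp_all
  let ?S = "closure (cspan M)"
  have S: "csubspace ?S" by (rule subspace_closure[OF complex_vector.subspace_span])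
  have SV: "?S \<subseteq> V" by (intro closure_minimal complex_vector.span_minimal M(1) assms)
  have "V \<subseteq> ?S"
  proof
    fix x assume x: "x \<in> V"
    obtain p where p: "p \<in> ?S" "\<And>v. v \<in> ?S \<Longrightarrow> cinner (x - p) v = 0" using projection_exists[OF closed_closure S] by blast
    show "x \<in> ?S"
    proof (cases "x = p")
      case False
      have "cinner (x - p) e = 0" if "e \<in> M" for e using p(2) that closure_subset complex_vector.span_base by blast
      note * = orthonormal_insert[OF M(2) _ this]
      have "x - p \<in> V" using x p(1) SV complex_vector.subspace_diff[OF assms(2)] by blast
      then have "insert ((1 / of_real (norm (x - p))) *\<^sub>C (x - p)) M \<subseteq> V"
        using M(1) complex_vector.subspace_scale[OF assms(2)] by blast
      from M'[rule_format, of "insert ((1 / of_real (norm (x - p))) *\<^sub>C (x - p)) M"] this * False show ?thesis by auto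
    qed (use p in simp)
  qed
  then show ?thesis using M by (auto simp: orthonormal_basis_of_iff)
qed

text \<open>Parseval evaluates each rank one term in whatever basis \<open>SOME\<close> selects. The
  form of \<open>A\<close> matters only on \<open>V\<close>, since the basis lies there.\<close>

lemma trace_on_finite_rank:
  fixes V :: "'a::chilbert_space set"
  assumes V: "closed V" "csubspace V" and J: "\<And>j. j \<in> J \<Longrightarrow> u j \<in> V"
    and A: "\<And>f. f \<in> V \<Longrightarrow> A f = (\<Sum>j\<in>J. cinner f (u j) *\<^sub>C v j)"
  shows "trace_on V A = (\<Sum>j\<in>J. cinner (v j) (u j))"
proof -
  define B where "B = (SOME B. orthonormal_basis_of V B)"
  have B: "orthonormal_basis_of V B" unfolding B_def by (rule someI_ex[OF exists_orthonormal_basis[OF V]])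
  have "((\<lambda>e. \<Sum>j\<in>J. cinner (v j) e * cinner e (u j)) has_sum (\<Sum>j\<in>J. cinner (v j) (u j))) B"
    using parseval[OF B J] by (induction J rule: infinite_finite_induct) (auto intro!: has_sum_add)
  moreover have "cinner (A e) e = (\<Sum>j\<in>J. cinner (v j) e * cinner e (u j))" if "e \<in> B" for e
  proof -
    have "e \<in> V" using B that by (auto simp: orthonormal_basis_of_def)
    then show ?thesis by (simp add: A cinner_sum_left cinner_scaleC_left mult.commute)
  qed
  ultimately have "((\<lambda>e. cinner (A e) e) has_sum (\<Sum>j\<in>J. cinner (v j) (u j))) B" by (subst has_sum_cong) auto
  then show ?thesis unfolding trace_on_def B_def[symmetric] by (rule infsumI)
qed

lemma orthonormal_independent:
  assumes "orthonormal E" "finite E"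
  shows "\<not> complex_vector.dependent E" by (rule complex_vector.independent_if_scalars_zero[OF assms(2)])
     (metis assms orthonormal_coeff cinner_simps(1))

lemma finite_dim_orthonormal:
  assumes "csubspace R" "finite W" "R \<subseteq> cspan W"
  shows "\<exists>E. finite E \<and> orthonormal E \<and> cspan E = R"
proof -
  let ?P = "\<lambda>E. finite E \<and> orthonormal E \<and> E \<subseteq> R"
  have "\<exists>E. ?P E \<and> (\<forall>F. ?P F \<longrightarrow> card F \<le> card E)"
  proof (rule Lattices_Big.ex_has_greatest_nat[of ?P "{}" card "Suc (card W)"])
    show "\<forall>F. ?P F \<longrightarrow> card F < Suc (card W)"
    proof (intro allI impI)
      fix F assume F: "?P F"
      then show "card F < Suc (card W)"
        using complex_vector.independent_span_bound[OF assms(2) orthonormal_independent, of F] assms(3) subset_trans[of F R] by (simp add: less_Suc_eq_le)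
    qed
  qed (simp add: orthonormal_def)
  then obtain E where E: "finite E" "orthonormal E" "E \<subseteq> R" and max: "\<And>F. ?P F \<Longrightarrow> card F \<le> card E" by blast
  have "x \<in> cspan E" if x: "x \<in> R" for x
  proof (rule ccontr)
    assume "x \<notin> cspan E"
    define p where "p = (\<Sum>e\<in>E. cinner x e *\<^sub>C e)"
    have p: "p \<in> cspan E" unfolding p_def
      by (intro complex_vector.span_sum complex_vector.span_scale complex_vector.span_base)
    then have "x - p \<noteq> 0" using \<open>x \<notin> _\<close> by auto
    note * = orthonormal_insert[OF E(2) this orthonormal_residual[OF E(2,1), of _ x, folded p_def]]
    have "p \<in> R" using p complex_vector.span_minimal[OF E(3) assms(1)] by blast
    then have "(1 / of_real (norm (x - p))) *\<^sub>C (x - p) \<in> R"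
      using x complex_vector.subspace_scale[OF assms(1)] complex_vector.subspace_diff[OF assms(1)] by blast
    then show False
      using max[of "insert ((1 / of_real (norm (x - p))) *\<^sub>C (x - p)) E"] *(1)[OF complex_vector.span_base] *(2)[OF complex_vector.span_base] E by auto
  qed
  then show ?thesis using E complex_vector.span_minimal[OF E(3) assms(1)] by blast
qed

text \<open>The span is the set of fixed points of a continuous projection. In finite rank this
  makes the defect space equal to the range of the defect operator.\<close>

lemma closed_span_orthonormal:
  fixes E :: "'a::complex_inner set"
  assumes "orthonormal E" "finite E"
  shows "closed (cspan E)"
proof -
  have "cspan E = {u. u = (\<Sum>e\<in>E. cinner u e *\<^sub>C e)}"
  proof (intro set_eqI iffI CollectI orthonormal_span[OF assms])
    fix u assume "u \<in> {u. u = (\<Sum>e\<in>E. cinner u e *\<^sub>C e)}"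
    then have *: "u = (\<Sum>e\<in>E. cinner u e *\<^sub>C e)" by simp
    show "u \<in> cspan E" by (subst *) (intro complex_vector.span_sum complex_vector.span_scale complex_vector.span_base)
  qed
  moreover have "bounded_linear (\<lambda>u. \<Sum>e\<in>E. cinner u e *\<^sub>C e)"
  proof (rule bounded_linear_sum)
    fix e :: 'a
    show "bounded_linear (\<lambda>u. cinner u e *\<^sub>C e)"
    proof (rule bounded_linear_intro[where K = "norm e * norm e"])
      fix x
      show "norm (cinner x e *\<^sub>C e) \<le> norm x * (norm e * norm e)"
        using mult_right_mono[OF cinner_Cauchy_Schwarz[of x e] norm_ge_zero[of e]] by (simp add: norm_scaleC mult.assoc)
    qed (simp_all add: cinner_add_left scaleC_add_left scaleR_scaleC cinner_scaleC_left scaleC_scaleC)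
  qed
  ultimately show ?thesis by (simp add: closed_Collect_eq linear_continuous_on)
qed

section \<open>Row contractions\<close>

text \<open>The resolvents in the definitions are written with \<open>inv\<close>; injectivity, from
  \<open>q < 1\<close>, identifies \<open>inv\<close> with the Neumann series.\<close>

lemma neumann:
  fixes C :: "'a::chilbert_space \<Rightarrow> 'a"
  defines "F \<equiv> inv (\<lambda>x. x - C x)"
  assumes C: "bounded_clinear C" and q: "\<And>x. norm (C x) \<le> q * norm x" "0 \<le> q" "q < 1"
  shows "F y - C (F y) = y" "F (y - C y) = y" "bounded_clinear F" "(\<lambda>k. (C ^^ k) y) sums F y"
    "norm (F y) \<le> norm y / (1 - q)"
proof -
  note Cd = bounded_clinearD[OF C]
  have n: "norm ((C ^^ k) y) \<le> q ^ k * norm y" for k y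
  proof (induction k)
    case (Suc k)
    have "norm (C ((C ^^ k) y)) \<le> q * (q ^ k * norm y)" by (rule order_trans[OF q(1) mult_left_mono[OF Suc q(2)]])
    then show ?case by (simp add: mult.assoc)
  qed simp
  have sq: "summable (\<lambda>k. q ^ k * norm y)" for y using q by (intro summable_mult2 summable_geometric) simp
  define s where "s y = suminf (\<lambda>k. (C ^^ k) y)" for y
  have s: "(\<lambda>k. (C ^^ k) y) sums s y" for y
    unfolding s_def by (intro summable_sums summable_comparison_test'[OF sq[of y]] n)
  have right: "s y - C (s y) = y" for y
  proof -
    have "(\<lambda>k. C ((C ^^ k) y)) sums C (s y)" by (rule bounded_linear.sums[OF Cd(1) s])
    moreover have "(\<lambda>k. (C ^^ Suc k) y) sums (s y - y)" using sums_Suc_iff[of "\<lambda>k. (C ^^ k) y" "s y - y"] s[of y] by simp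
    ultimately have "C (s y) = s y - y" by (simp add: sums_unique2)
    then show ?thesis by simp
  qed
  have inj: "inj (\<lambda>x. x - C x)"
  proof (rule injI)
    fix x y assume "x - C x = y - C y"
    then have *: "x - y = C (x - y)" by (simp add: Cd algebra_simps)
    have "norm (x - y) \<le> q * norm (x - y)" by (subst *) (rule q(1))
    then have "(1 - q) * norm (x - y) \<le> 0" by (simp add: algebra_simps)
    then show "x = y" using q(3) by (simp add: mult_le_0_iff)
  qed
  have Fs: "F y = s y" for y unfolding F_def by (rule inv_f_eq[OF inj right])
  show l: "F (y - C y) = y" for y unfolding F_def by (rule inv_f_f[OF inj])
  show r: "F y - C (F y) = y" for y unfolding Fs by (rule right)
  show "(\<lambda>k. (C ^^ k) y) sums F y" unfolding Fs by (rule s)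
  show b: "norm (F y) \<le> norm y / (1 - q)" for y
  proof -
    have "norm (F y) \<le> suminf (\<lambda>k. q ^ k * norm y)"
      unfolding Fs sums_unique[OF s[of y]] by (rule norm_suminf_le[OF n sq])
    also have "\<dots> = norm y / (1 - q)"
      using suminf_mult2[OF summable_geometric[of q], of "norm y"] suminf_geometric[of q] q by simp
    finally show ?thesis .
  qed
  show "bounded_clinear F"
  proof (rule bounded_clinearI[where K = "1 / (1 - q)"])
    fix x y c
    have "F x + F y - C (F x + F y) = (F x - C (F x)) + (F y - C (F y))" by (simp add: Cd)
    then show "F (x + y) = F x + F y" using l[of "F x + F y"] by (simp add: r)
    show "F (c *\<^sub>C x) = c *\<^sub>C F x" using l[of "c *\<^sub>C F x"] r[of x] by (simp add: Cd flip: scaleC_diff_right)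
  qed (use b in simp)
qed

lemma norm_vec_square: "(norm (x :: 'a::real_normed_vector ^ 'n::finite))\<^sup>2 = (\<Sum>i\<in>UNIV. (norm (x $ i))\<^sup>2)"
  by (simp add: norm_vec_def L2_set_def sum_nonneg)

lemma bounded_clinear_nth: "bounded_clinear (\<lambda>v :: 'a::complex_inner ^ 'n::finite. v $ i)"
  by (rule bounded_clinearI[where K = 1]) (simp_all add: scaleC_vec_def component_le_norm_cart Finite_Cartesian_Product.norm_nth_le)

text \<open>The row operator \<open>[z_1 I, ..., z_n I]\<close>; \<open>zcol z\<close> is its
  adjoint.\<close>

definition zrow :: "complex ^ 'n::finite \<Rightarrow> 'h::complex_inner ^ 'n \<Rightarrow> 'h" where
  "zrow z u = (\<Sum>i\<in>UNIV. (z $ i) *\<^sub>C (u $ i))"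

definition zcol :: "complex ^ 'n::finite \<Rightarrow> 'h::complex_inner \<Rightarrow> 'h ^ 'n" where
  "zcol z h = (\<chi> i. cnj (z $ i) *\<^sub>C h)"

lemma norm_zcol: "norm (zcol z h) = norm z * norm h"
proof -
  have "(norm (zcol z h))\<^sup>2 = (norm z * norm h)\<^sup>2"
    by (simp add: norm_vec_square zcol_def norm_scaleC power_mult_distrib sum_distrib_right)
  then show ?thesis by (simp add: power2_eq_iff_nonneg)
qed

lemma zrow_zcol_adjoint: "cinner (zrow z u) h = cinner u (zcol z h)"
  by (simp add: zrow_def zcol_def cinner_vec_def cinner_sum_left cinner_scaleC_left cinner_scaleC_right)

lemma zrow_zcol: "zrow z (zcol w h) = cinner z w *\<^sub>C h"
  by (simp add: zrow_def zcol_def cinner_vec_def cinner_complex_def complex_vector.scale_sum_left scaleC_scaleC)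

lemma zcol_clinear: "bounded_clinear (zcol z)" by (rule bounded_clinearI[where K = "norm z"])
     (simp_all add: norm_zcol, simp_all add: zcol_def vec_eq_iff scaleC_vec_def scaleC_add_right scaleC_scaleC mult.commute)

lemma zrow_clinear: "bounded_clinear (zrow z)"
  unfolding zrow_def by (intro bounded_clinear_sum_op bounded_clinear_scaleC bounded_clinear_nth)

locale row_contraction =
  fixes T :: "'n::finite \<Rightarrow> 'h::chilbert_space \<Rightarrow> 'h"
  assumes crc: "commutative_row_contraction T"
begin

lemma T_clinear: "bounded_clinear (T i)" using crc by (simp add: commutative_row_contraction_def)

sublocale commuting_ops T by unfold_locales (use crc in \<open>auto simp: commutative_row_contraction_def\<close>)

abbreviation "rw \<equiv> row_op T"
abbreviation "rowad \<equiv> cadjoint (row_op T)"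
abbreviation "\<Delta> \<equiv> defect T"
abbreviation "\<Delta>s \<equiv> defect_star T"

lemma row_clinear: "bounded_clinear rw"
  unfolding row_op_def by (intro bounded_clinear_sum_op bounded_clinear_comp[OF T_clinear] bounded_clinear_nth)

lemmas rowad = cadjoint[OF row_clinear]
lemmas row_simps = bounded_clinearD[OF row_clinear]
lemmas rowad_simps = bounded_clinearD[OF rowad(3)]

lemma rowad_nth: "rowad h $ i = cadjoint (T i) h"
proof -
  have "rowad h = (\<chi> i. cadjoint (T i) h)" by (rule cadjointI[OF row_clinear])
       (simp add: row_op_def cinner_sum_left cinner_vec_def cadjoint(1)[OF T_clinear])
  then show ?thesis by simp
qed

lemma norm_rowad: "norm (rowad h) \<le> norm h"
proof -
  have "Re (cinner (h - rw (rowad h)) h) \<ge> 0" using crc by (auto simp: commutative_row_contraction_def positive_op_def)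
  then have "(norm (rowad h))\<^sup>2 \<le> (norm h)\<^sup>2" by (simp add: cinner_diff rowad(1) cinner_same)
  then show ?thesis by (rule power2_le_imp_le) simp
qed

lemma norm_row: "norm (rw v) \<le> norm v"
proof -
  have "(norm (rw v))\<^sup>2 = cmod (cinner v (rowad (rw v)))" by (simp add: rowad(1)[symmetric] cinner_same norm_power)
  also have "\<dots> \<le> norm v * norm (rowad (rw v))" by (rule cinner_Cauchy_Schwarz)
  also have "\<dots> \<le> norm v * norm (rw v)" by (intro mult_left_mono norm_rowad) simp
  finally have "norm (rw v) * norm (rw v) \<le> norm v * norm (rw v)" by (simp add: power2_eq_square)
  then show ?thesis by (cases "rw v = 0") (auto simp: mult_le_cancel_right)
qed

lemma contraction_row: "contraction (\<lambda>h. rw (rowad h))" by unfold_locales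
     (auto intro: bounded_clinear_comp[OF row_clinear rowad(3)] order_trans[OF norm_row norm_rowad])

lemma contraction_rowad: "contraction (\<lambda>v. rowad (rw v))" by unfold_locales
     (auto intro: bounded_clinear_comp[OF rowad(3) row_clinear] order_trans[OF norm_rowad norm_row])

sublocale B: contraction "\<lambda>h. rw (rowad h)" by (rule contraction_row)
sublocale Bs: contraction "\<lambda>v. rowad (rw v)" by (rule contraction_rowad)

lemma selfadjoint:
  "cinner (rw (rowad h)) k = cinner h (rw (rowad k))" "cinner (rowad (rw v)) u = cinner v (rowad (rw u))"
  by (simp only: rowad(1,2)) (simp only: rowad(1,2)[symmetric])

lemma defect_series: "\<Delta> = sqrt_series (\<lambda>h. rw (rowad h))" "\<Delta>s = sqrt_series (\<lambda>v. rowad (rw v))"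
  unfolding defect_def defect_star_def by (rule B.sqrt_op_eq Bs.sqrt_op_eq, rule selfadjoint)+

lemma defect_clinear: "bounded_clinear \<Delta>" "bounded_clinear \<Delta>s"
  unfolding defect_series by (rule B.series_clinear Bs.series_clinear)+

lemmas defect_simps = bounded_clinearD[OF defect_clinear(1)] bounded_clinearD[OF defect_clinear(2)]

lemma defect_square: "\<Delta> (\<Delta> h) = h - rw (rowad h)" "\<Delta>s (\<Delta>s v) = v - rowad (rw v)"
  unfolding defect_series by (rule B.series_square Bs.series_square)+

lemma defect_selfadjoint: "cinner (\<Delta> h) k = cinner h (\<Delta> k)" "cinner (\<Delta>s v) u = cinner v (\<Delta>s u)"
  unfolding defect_series by (rule positive_op_selfadjoint B.series_positive Bs.series_positive selfadjoint)+

lemma intertwine: "\<Delta> (rw v) = rw (\<Delta>s v)" "\<Delta>s (rowad h) = rowad (\<Delta> h)"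
proof -
  show "\<Delta> (rw v) = rw (\<Delta>s v)" unfolding defect_series
    by (rule Bs.series_intertwine[OF row_clinear contraction_row, symmetric]) simp
  show "\<Delta>s (rowad h) = rowad (\<Delta> h)" unfolding defect_series
    by (rule B.series_intertwine[OF rowad(3) contraction_rowad, symmetric]) simp
qed

lemma norm_defect: "(norm (\<Delta> h))\<^sup>2 = (norm h)\<^sup>2 - (norm (rowad h))\<^sup>2" "(norm (\<Delta>s v))\<^sup>2 = (norm v)\<^sup>2 - (norm (rw v))\<^sup>2"
proof -
  have "cinner (\<Delta> h) (\<Delta> h) = cinner h h - cinner (rowad h) (rowad h)"
    by (simp add: defect_selfadjoint defect_square cinner_diff rowad)
  then have "complex_of_real ((norm (\<Delta> h))\<^sup>2) = complex_of_real ((norm h)\<^sup>2 - (norm (rowad h))\<^sup>2)" by (simp add: cinner_same)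
  then show "(norm (\<Delta> h))\<^sup>2 = (norm h)\<^sup>2 - (norm (rowad h))\<^sup>2" by (simp only: of_real_eq_iff)
  have "cinner (\<Delta>s v) (\<Delta>s v) = cinner v v - cinner (rw v) (rw v)"
    by (simp add: defect_selfadjoint defect_square cinner_diff rowad(1))
  then have "complex_of_real ((norm (\<Delta>s v))\<^sup>2) = complex_of_real ((norm v)\<^sup>2 - (norm (rw v))\<^sup>2)" by (simp add: cinner_same)
  then show "(norm (\<Delta>s v))\<^sup>2 = (norm v)\<^sup>2 - (norm (rw v))\<^sup>2" by (simp only: of_real_eq_iff)
qed

text \<open>The cross terms cancel: \<open>\<Delta> T = T \<Delta>\<^sub>*\<close>.\<close>

lemma julia_isometry:
  "(norm (rowad x + \<Delta>s f))\<^sup>2 + (norm (\<Delta> x - rw f))\<^sup>2 = (norm x)\<^sup>2 + (norm f)\<^sup>2"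
proof -
  have "cinner (rowad x) (\<Delta>s f) = cinner (\<Delta> x) (rw f)"
    by (simp add: defect_selfadjoint[symmetric] intertwine rowad)
  then have "inner (rowad x) (\<Delta>s f) = inner (\<Delta> x) (rw f)" by (simp add: inner_cinner)
  then show ?thesis using norm_defect(1)[of x] norm_defect(2)[of f]
    by (simp add: power2_norm_eq_inner inner_add_left inner_add_right inner_diff_left inner_diff_right inner_commute)
qed

section \<open>Resolvents and the characteristic function\<close>

definition S :: "complex ^ 'n \<Rightarrow> 'h \<Rightarrow> 'h" where "S z h = rw (zcol z h)"
definition Sad :: "complex ^ 'n \<Rightarrow> 'h \<Rightarrow> 'h" where "Sad z h = zrow z (rowad h)"

lemma S_sum: "S z h = (\<Sum>i\<in>UNIV. cnj (z $ i) *\<^sub>C T i h)" "Sad z h = (\<Sum>i\<in>UNIV. (z $ i) *\<^sub>C cadjoint (T i) h)"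
  by (simp_all add: S_def row_op_def zcol_def bounded_clinearD[OF T_clinear] Sad_def zrow_def rowad_nth)

lemma S_clinear: "bounded_clinear (S z)" "bounded_clinear (Sad z)"
  unfolding S_def Sad_def
  by (rule bounded_clinear_comp[OF row_clinear zcol_clinear] bounded_clinear_comp[OF zrow_clinear rowad(3)])+

lemma S_adjoint: "cinner (S z h) k = cinner h (Sad z k)"
proof -
  have "cinner (S z h) k = cinner (zcol z h) (rowad k)" by (simp add: S_def rowad)
  also have "\<dots> = cnj (cinner (zrow z (rowad k)) h)" unfolding zrow_zcol_adjoint by (rule cinner_commute)
  finally show ?thesis unfolding Sad_def by (simp flip: cinner_commute)
qed

lemma S_norm: "norm (S z h) \<le> norm z * norm h" "norm (Sad z h) \<le> norm z * norm h"
proof -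
  show 1: "norm (S z h) \<le> norm z * norm h" for h using norm_row[of "zcol z h"] by (simp add: S_def norm_zcol)
  have "(norm (Sad z h))\<^sup>2 = cmod (cinner (S z (Sad z h)) h)" by (simp add: S_adjoint cinner_same norm_power)
  also have "\<dots> \<le> norm (S z (Sad z h)) * norm h" by (rule cinner_Cauchy_Schwarz)
  also have "\<dots> \<le> norm z * norm (Sad z h) * norm h" by (intro mult_right_mono 1) simp
  finally have "norm (Sad z h) * norm (Sad z h) \<le> norm z * norm h * norm (Sad z h)" by (simp add: power2_eq_square mult_ac)
  then show "norm (Sad z h) \<le> norm z * norm h" by (cases "Sad z h = 0") (auto simp: mult_le_cancel_right)
qed

definition R :: "complex ^ 'n \<Rightarrow> 'h \<Rightarrow> 'h" where "R z = inv (\<lambda>x. x - S z x)"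
definition Rad :: "complex ^ 'n \<Rightarrow> 'h \<Rightarrow> 'h" where "Rad z = inv (\<lambda>x. x - Sad z x)"

lemma R_props:
  assumes "norm z < 1"
  shows "R z x - S z (R z x) = x" "R z (x - S z x) = x" "Rad z x - Sad z (Rad z x) = x" "Rad z (x - Sad z x) = x"
    "bounded_clinear (R z)" "bounded_clinear (Rad z)"
    "(\<lambda>k. (S z ^^ k) x) sums R z x" "(\<lambda>k. (Sad z ^^ k) x) sums Rad z x"
    "norm (R z x) \<le> norm x / (1 - norm z)" "norm (Rad z x) \<le> norm x / (1 - norm z)"
  unfolding R_def Rad_def
  by (rule neumann[OF S_clinear(1) S_norm(1) norm_ge_zero assms] neumann[OF S_clinear(2) S_norm(2) norm_ge_zero assms])+

lemma R_adjoint: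
  assumes "norm z < 1"
  shows "cinner (R z x) y = cinner x (Rad z y)"
proof -
  have "cinner (R z x) y = cinner (R z x) (Rad z y - Sad z (Rad z y))" by (simp add: R_props[OF assms])
  also have "\<dots> = cinner (R z x - S z (R z x)) (Rad z y)" by (simp add: cinner_diff S_adjoint)
  finally show ?thesis by (simp add: R_props[OF assms])
qed

abbreviation "\<Theta> \<equiv> char_symbol T"

text \<open>Closed form of the adjoint of \<open>\<Theta> z\<close>. On the defect space it agrees
  with \<open>char_symbol_adj\<close>, which is given by a description.\<close>

definition \<Theta>ad :: "complex ^ 'n \<Rightarrow> 'h \<Rightarrow> 'h ^ 'n" where
  "\<Theta>ad z h = \<Delta>s (zcol z (R z (\<Delta> h))) - rowad h"

lemma char_symbol_eq: "\<Theta> z v = \<Delta> (Rad z (zrow z (\<Delta>s v))) - rw v"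
  by (simp add: char_symbol_def Rad_def S_sum(2)[abs_def] zrow_def)

lemma char_symbol_clinear: "norm z < 1 \<Longrightarrow> bounded_clinear (\<Theta> z)"
  unfolding char_symbol_eq[abs_def]
  by (intro bounded_clinear_diff bounded_clinear_comp[OF defect_clinear(1)] bounded_clinear_comp[OF R_props(6)]
        bounded_clinear_comp[OF zrow_clinear] defect_clinear row_clinear)

lemma char_symbol_adjoint:
  assumes "norm z < 1"
  shows "cinner (\<Theta> z v) h = cinner v (\<Theta>ad z h)"
proof -
  have "cinner (\<Delta> (Rad z (zrow z (\<Delta>s v)))) h = cinner (zrow z (\<Delta>s v)) (R z (\<Delta> h))"
    using R_adjoint[OF assms] by (metis defect_selfadjoint(1) cinner_commute)
  also have "\<dots> = cinner v (\<Delta>s (zcol z (R z (\<Delta> h))))" by (simp add: zrow_zcol_adjoint defect_selfadjoint)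
  finally show ?thesis by (simp add: char_symbol_eq \<Theta>ad_def cinner_diff rowad)
qed

text \<open>The square of \<open>\<Delta>s\<close> and the intertwining relations remove all defect
  operators between the two resolvents, and the resolvent equations absorb the remaining factors.
  After division by \<open>1 - cinner z w\<close> this is the identity
  \<open>1 - M M^* = K K^*\<close> evaluated on kernel functions.\<close>

lemma char_symbol_kernel_identity:
  assumes "norm z < 1" "norm w < 1"
  shows "h - \<Theta> z (\<Theta>ad w h) = (1 - cinner z w) *\<^sub>C \<Delta> (Rad z (R w (\<Delta> h)))"
proof -
  define d where "d = \<Delta> h"
  define x where "x = R w d"
  have x: "S w x = x - d" using R_props(1)[OF assms(2), of d] by (simp add: x_def algebra_simps)
  note l = bounded_clinearD[OF R_props(6)[OF assms(1)]] bounded_clinearD[OF zrow_clinear] row_simps rowad_simps defect_simps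
  have RS: "Rad z (Sad z y) = Rad z y - y" for y using R_props(4)[OF assms(1), of y] by (simp add: l algebra_simps)
  have "\<Theta> z (\<Theta>ad w h) = \<Delta> (Rad z (zrow z (\<Delta>s (\<Delta>s (zcol w x)) - \<Delta>s (rowad h)))) - (rw (\<Delta>s (zcol w x)) - rw (rowad h))"
    by (simp add: char_symbol_eq \<Theta>ad_def d_def x_def l)
  also have "\<Delta>s (\<Delta>s (zcol w x)) = zcol w x - rowad (x - d)"
    unfolding defect_square using x by (simp add: S_def)
  also have "\<Delta>s (rowad h) = rowad d" by (simp add: intertwine d_def)
  also have "rw (\<Delta>s (zcol w x)) = \<Delta> (x - d)" using x by (simp add: intertwine[symmetric] S_def)
  also have "zcol w x - rowad (x - d) - rowad d = zcol w x - rowad x" by (simp add: l)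
  also have "Rad z (zrow z (zcol w x - rowad x)) = cinner z w *\<^sub>C Rad z x - Rad z x + x"
    by (simp add: l zrow_zcol RS flip: Sad_def)
  finally have "\<Theta> z (\<Theta>ad w h) = \<Delta> (cinner z w *\<^sub>C Rad z x - Rad z x) + \<Delta> d + rw (rowad h)"
    by (simp add: l)
  also have "\<Delta> d = h - rw (rowad h)" by (simp add: d_def defect_square)
  finally show ?thesis
    unfolding d_def[symmetric] x_def[symmetric] by (simp add: l complex_vector.scale_left_diff_distrib)
qed

abbreviation "D \<equiv> defect_space T"
abbreviation "Ds \<equiv> defect_star_space T"

lemma spaces: "closed D" "csubspace D" "closed Ds" "csubspace Ds"
proof -
  show "closed D" "csubspace D" "closed Ds" "csubspace Ds"
    unfolding defect_space_def defect_star_space_def by (auto intro!: subspace_closure subspace_image defect_clinear)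
qed

lemma defect_in: "\<Delta> h \<in> D" "\<Delta>s v \<in> Ds"
  unfolding defect_space_def defect_star_space_def by (rule subsetD[OF closure_subset], rule rangeI)+

lemma row_in: "v \<in> Ds \<Longrightarrow> rw v \<in> D" "h \<in> D \<Longrightarrow> rowad h \<in> Ds"
proof -
  have *: "A x \<in> closure Y" if A: "bounded_linear A" and XY: "\<And>x. x \<in> X \<Longrightarrow> A x \<in> Y" and x: "x \<in> closure X"
    for A :: "'x::real_normed_vector \<Rightarrow> 'y::real_normed_vector" and X Y x
  proof -
    obtain s where s: "\<And>k. s k \<in> X" "s \<longlonglongrightarrow> x" using x by (auto simp: closure_sequential)
    then show ?thesis unfolding closure_sequential using bounded_linear.tendsto[OF A s(2)] XY[OF s(1)] by (intro exI[of _ "\<lambda>k. A (s k)"]) simp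
  qed
  show "v \<in> Ds \<Longrightarrow> rw v \<in> D" unfolding defect_space_def defect_star_space_def
    by (rule *[OF row_simps(1)]) (auto simp flip: intertwine)
  show "h \<in> D \<Longrightarrow> rowad h \<in> Ds" unfolding defect_space_def defect_star_space_def
    by (rule *[OF rowad_simps(1)]) (auto simp flip: intertwine)
qed

lemma char_symbol_in: "v \<in> Ds \<Longrightarrow> \<Theta> z v \<in> D" "h \<in> D \<Longrightarrow> \<Theta>ad z h \<in> Ds"
  by (auto simp: char_symbol_eq \<Theta>ad_def intro!: complex_vector.subspace_diff spaces defect_in row_in)

lemma char_symbol_adj_eq:
  assumes "norm z < 1" "h \<in> D"
  shows "char_symbol_adj T z h = \<Theta>ad z h"
  unfolding char_symbol_adj_def
  by (rule adjoint_onI[OF char_symbol_clinear[OF assms(1)] spaces(3,4) char_symbol_in(2)[OF assms(2)] char_symbol_adjoint[OF assms(1)]])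

lemma defect_null: "(\<And>d. d \<in> D \<Longrightarrow> cinner h d = 0) \<Longrightarrow> \<Delta> h = 0"
proof -
  assume "\<And>d. d \<in> D \<Longrightarrow> cinner h d = 0"
  then have "cinner h (\<Delta> (\<Delta> h)) = 0" using defect_in by blast
  then have "cinner (\<Delta> h) (\<Delta> h) = 0" by (simp only: defect_selfadjoint(1))
  then show ?thesis by (simp add: cinner_eq_0_iff)
qed

end

section \<open>Evaluation in Arveson's space\<close>

lemma arv_eval_linear:
  fixes f g :: "('n::finite, 'e::chilbert_space) arveson"
  assumes "z \<in> ball 0 1"
  shows "arv_eval (f + g) z = arv_eval f z + arv_eval g z" "arv_eval (f - g) z = arv_eval f z - arv_eval g z"
    "arv_eval (c *\<^sub>C f) z = c *\<^sub>C arv_eval f z" "arv_eval (0 :: ('n, 'e) arveson) z = 0"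
  by (rule cinner_ext, simp add: arv_kernel_reproducing[OF assms, symmetric] cinner_add_left cinner_diff cinner_scaleC_left)+

lemma arv_eval_abs_summable:
  fixes f :: "('n::finite, 'e::chilbert_space) arveson"
  assumes z: "z \<in> ball 0 1"
  shows "(\<lambda>\<alpha>. norm (mpow z \<alpha> *\<^sub>C coeff_arv f \<alpha>)) summable_on UNIV"
proof (rule Infinite_Sum.abs_summable_on_comparison_test')
  let ?v = "\<chi> i. z $ i * cnj (z $ i)"
  have v: "cmod (mpow ?v \<alpha>) = (cmod (mpow z \<alpha>))\<^sup>2" for \<alpha>
    by (simp add: mpow_def prod_norm[symmetric] norm_power norm_mult power_mult_distrib prod.distrib power2_eq_square)
  show "(\<lambda>\<alpha>. cmod (mpow ?v \<alpha> / of_real (mweight \<alpha>)) + mweight \<alpha> * (norm (coeff_arv f \<alpha>))\<^sup>2) summable_on UNIV"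
    by (intro summable_on_add geometric_mpow_summable ball_sum_norm_mult z coeff_arv_summable)
  fix \<alpha> :: "'n multi_index"
  define p q w where "p = cmod (mpow z \<alpha>)" and "q = norm (coeff_arv f \<alpha>)" and "w = mweight \<alpha>"
  have w: "w > 0" by (simp add: w_def mweight_pos)
  have "0 \<le> (p - w * q)\<^sup>2" "0 \<le> p * (w * q)" using w by (simp_all add: p_def q_def)
  then have "p * (w * q) \<le> p\<^sup>2 + (w * q)\<^sup>2" unfolding power2_diff by linarith
  then have "p * q \<le> p\<^sup>2 / w + w * q\<^sup>2" using w by (simp add: field_simps power2_eq_square)
  then show "norm (mpow z \<alpha> *\<^sub>C coeff_arv f \<alpha>) \<le> cmod (mpow ?v \<alpha> / of_real (mweight \<alpha>)) + mweight \<alpha> * (norm (coeff_arv f \<alpha>))\<^sup>2"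
    using w by (simp add: norm_scaleC norm_divide v p_def q_def w_def)
qed

definition hpart :: "complex ^ 'n::finite \<Rightarrow> nat \<Rightarrow> ('n multi_index \<Rightarrow> 'e::complex_inner) \<Rightarrow> 'e" where
  "hpart z m c = (\<Sum>\<alpha> | mdeg \<alpha> = m. mpow z \<alpha> *\<^sub>C c \<alpha>)"

text \<open>Grouping by degree turns statements in several variables into statements on sequences of
  homogeneous parts, to which recursions over the degree apply.\<close>

lemma hpart_sums:
  fixes f :: "('n::finite, 'e::chilbert_space) arveson"
  assumes z: "z \<in> ball 0 1"
  shows "(\<lambda>m. hpart z m (coeff_arv f)) sums arv_eval f z" "summable (\<lambda>m. norm (hpart z m (coeff_arv f)))"
proof -
  let ?S = "\<lambda>m. {\<alpha> :: 'n multi_index. mdeg \<alpha> = m}" and ?t = "\<lambda>\<alpha>. mpow z \<alpha> *\<^sub>C coeff_arv f \<alpha>"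
  let ?F = "\<lambda>(m, \<alpha>). ?t \<alpha>"
  have bij: "bij_betw (\<lambda>\<alpha>. (mdeg \<alpha>, \<alpha>)) UNIV (Sigma UNIV ?S)"
    by (auto simp: bij_betw_def inj_on_def)
  have n: "(\<lambda>p. norm (?F p)) summable_on Sigma UNIV ?S"
    using summable_on_reindex_bij_betw[OF bij, of "\<lambda>p. norm (?F p)"] arv_eval_abs_summable[OF z, of f] by simp
  then have s: "?F summable_on Sigma UNIV ?S" by (rule Infinite_Sum.abs_summable_summable)
  have "arv_eval f z = infsum ?F (Sigma UNIV ?S)"
    unfolding arv_eval_def using infsum_reindex_bij_betw[OF bij, of ?F] by simp
  also have "\<dots> = (\<Sum>\<^sub>\<infinity>m. \<Sum>\<^sub>\<infinity>\<alpha>\<in>?S m. ?F (m, \<alpha>))" by (rule infsum_Sigma_banach[OF s, symmetric])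
  also have "\<dots> = (\<Sum>\<^sub>\<infinity>m. hpart z m (coeff_arv f))" by (simp add: hpart_def finite_mdeg)
  finally have e: "arv_eval f z = (\<Sum>\<^sub>\<infinity>m. hpart z m (coeff_arv f))" .
  have "(\<lambda>m. \<Sum>\<^sub>\<infinity>\<alpha>\<in>?S m. norm (?F (m, \<alpha>))) summable_on UNIV"
    using summable_on_Sigma_banach[of "\<lambda>m \<alpha>. norm (?t \<alpha>)" UNIV ?S] n by (simp add: case_prod_unfold)
  then have "(\<lambda>m. \<Sum>\<alpha>\<in>?S m. norm (?t \<alpha>)) summable_on UNIV" by (simp add: finite_mdeg)
  then have a: "(\<lambda>m. norm (hpart z m (coeff_arv f))) summable_on UNIV"
    by (rule Infinite_Sum.abs_summable_on_comparison_test') (simp add: hpart_def norm_sum)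
  show "(\<lambda>m. hpart z m (coeff_arv f)) sums arv_eval f z"
    unfolding e by (rule has_sum_imp_sums[OF has_sum_infsum[OF Infinite_Sum.abs_summable_summable[OF a]]])
  show "summable (\<lambda>m. norm (hpart z m (coeff_arv f)))" by (rule summable_on_imp_summable[OF a])
qed

lemma mpow_scale: "mpow (t *\<^sub>C z) \<alpha> = t ^ mdeg \<alpha> * mpow z \<alpha>"
  by (simp add: mpow_def mdeg_def scaleC_vec_def scaleC_complex_def power_mult_distrib prod.distrib power_sum)

lemma hpart_scale: "hpart (t *\<^sub>C z) m c = t ^ m *\<^sub>C hpart z m c"
  by (auto simp: hpart_def scaleC_sum_right mpow_scale scaleC_scaleC intro!: sum.cong)

lemma power_series_zero:
  fixes a :: "nat \<Rightarrow> complex"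
  assumes "\<And>t. cmod t < 1 \<Longrightarrow> (\<lambda>m. a m * t ^ m) sums 0"
  shows "a m = 0"
proof (cases "m = 0")
  case True
  then show ?thesis using sums_unique2[OF assms[of 0]] powser_sums_zero[of a] by simp
next
  case False
  show ?thesis
  proof (rule ccontr)
    assume "a m \<noteq> 0"
    have sm: "(\<lambda>n. a n * (x - 0) ^ n) sums (\<lambda>_. 0) x" if "norm (x - 0) < 1" for x using assms that by simp
    show False
    proof (rule powser_0_nonzero[OF zero_less_one sm _ \<open>a m \<noteq> 0\<close>])
      fix s :: real assume "0 < s" "\<And>z :: complex. z \<in> cball 0 s - {0} \<Longrightarrow> (0::complex) \<noteq> 0"
      from this(2)[of "complex_of_real s"] this(1) show False by simp
    qed (use False in simp_all)
  qed
qed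

text \<open>Restriction to complex lines through 0 separates the homogeneous parts, scaling carries
  their vanishing from the ball to the whole space, and independence of the monomials separates the
  coefficients.\<close>

lemma arv_eval_zero:
  fixes f :: "('n::finite, 'e::chilbert_space) arveson"
  assumes "\<And>z. z \<in> ball 0 1 \<Longrightarrow> arv_eval f z = 0"
  shows "f = 0"
proof -
  have 1: "hpart z m (coeff_arv f) = 0" if "z \<in> ball 0 1" for z m
  proof (rule cinner_ext)
    fix e
    have "(\<lambda>m. cinner (hpart z m (coeff_arv f)) e * t ^ m) sums 0" if t: "cmod t < 1" for t
    proof -
      have "norm (t *\<^sub>C z) \<le> 1 * norm z" unfolding norm_scaleC using t by (intro mult_right_mono) auto
      then have b: "t *\<^sub>C z \<in> ball 0 1" using \<open>z \<in> ball 0 1\<close> by simp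
      from bounded_linear.sums[OF bounded_linear_cinner_left hpart_sums(1)[OF b, of f], of e]
      show ?thesis by (simp add: hpart_scale cinner_scaleC_left assms[OF b] mult.commute)
    qed
    then have "cinner (hpart z m (coeff_arv f)) e = 0" by (rule power_series_zero)
    then show "cinner (hpart z m (coeff_arv f)) e = cinner 0 e" by simp
  qed
  have 2: "hpart z m (coeff_arv f) = 0" for z m
  proof -
    define t where "t = complex_of_real (1 / (norm z + 1))"
    have "norm (t *\<^sub>C z) = norm z / (norm z + 1)" by (simp add: norm_scaleC t_def norm_divide)
    also have "\<dots> < 1" by (subst divide_less_eq_1_pos) (simp_all add: add_nonneg_pos)
    finally have "t ^ m *\<^sub>C hpart z m (coeff_arv f) = 0" using 1[of "t *\<^sub>C z"] by (simp add: hpart_scale)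
    moreover have "t \<noteq> 0" unfolding t_def of_real_eq_0_iff by (simp add: add_nonneg_eq_0_iff)
    ultimately show ?thesis by (simp add: complex_vector.scale_eq_0_iff)
  qed
  have "coeff_arv f \<alpha> = 0" for \<alpha>
  proof (rule cinner_ext)
    fix e
    have "cinner (coeff_arv f \<alpha>) e = 0"
    proof (rule mpow_independent[where S = "{\<beta>. mdeg \<beta> = mdeg \<alpha>}" and c = "\<lambda>\<beta>. cinner (coeff_arv f \<beta>) e"])
      fix z
      have "cinner (hpart z (mdeg \<alpha>) (coeff_arv f)) e = 0" by (simp add: 2)
      then show "(\<Sum>\<beta> | mdeg \<beta> = mdeg \<alpha>. cinner (coeff_arv f \<beta>) e * mpow z \<beta>) = 0"
        by (simp add: hpart_def cinner_sum_left cinner_scaleC_left mult.commute)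
    qed (auto simp: finite_mdeg)
    then show "cinner (coeff_arv f \<alpha>) e = cinner 0 e" by simp
  qed
  then show ?thesis by (simp add: coeff_arv_inject[symmetric] zero_arveson.rep_eq fun_eq_iff)
qed

lemma arv_eval_inject:
  fixes f :: "('n::finite, 'e::chilbert_space) arveson"
  assumes "\<And>z. z \<in> ball 0 1 \<Longrightarrow> arv_eval f z = arv_eval g z"
  shows "f = g" using arv_eval_zero[of "f - g"] assms by (simp add: arv_eval_linear)

lemma coeff_arv_clinear: "bounded_clinear (\<lambda>f. coeff_arv f \<alpha>)"
proof (rule bounded_clinearI[where K = "1 / sqrt (mweight \<alpha>)"])
  fix f
  have "(sqrt (mweight \<alpha>) * norm (coeff_arv f \<alpha>))\<^sup>2 \<le> (norm f)\<^sup>2"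
    using sum_le_norm_arveson[of "{\<alpha>}" f] mweight_pos[of \<alpha>] by (simp add: power_mult_distrib)
  then have "sqrt (mweight \<alpha>) * norm (coeff_arv f \<alpha>) \<le> norm f" by (rule power2_le_imp_le) simp
  then show "norm (coeff_arv f \<alpha>) \<le> 1 / sqrt (mweight \<alpha>) * norm f"
    using mweight_pos[of \<alpha>] by (simp add: field_simps)
qed (simp_all add: plus_arveson.rep_eq scaleC_arveson.rep_eq)

lemma arv_sub_subspace:
  assumes "csubspace D"
  shows "csubspace (arv_sub D)"
  unfolding complex_vector.subspace_def arv_sub_def
  by (auto simp: zero_arveson.rep_eq plus_arveson.rep_eq scaleC_arveson.rep_eq
      intro: complex_vector.subspace_0 complex_vector.subspace_add complex_vector.subspace_scale assms)

lemma arv_sub_closed: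
  assumes "closed D"
  shows "closed (arv_sub D :: ('n::finite, 'e::complex_inner) arveson set)"
proof -
  have "arv_sub D = (\<Inter>\<alpha>. (\<lambda>f :: ('n, 'e) arveson. coeff_arv f \<alpha>) -` D)" by (auto simp: arv_sub_def)
  then show ?thesis
    by (auto intro!: closed_INT closed_vimage assms linear_continuous_on bounded_clinearD(1)[OF coeff_arv_clinear])
qed

text \<open>The component of the value orthogonal to \<open>D\<close> gives a kernel function
  orthogonal to \<open>f\<close>, hence pairs to zero with the value itself.\<close>

lemma arv_eval_in:
  fixes f :: "('n::finite, 'e::chilbert_space) arveson"
  assumes D: "closed D" "csubspace D" and f: "f \<in> arv_sub D" and z: "z \<in> ball 0 1"
  shows "arv_eval f z \<in> D"
proof -
  obtain p where p: "p \<in> D" "\<And>v. v \<in> D \<Longrightarrow> cinner (arv_eval f z - p) v = 0" using projection_exists[OF D] by blast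
  define e where "e = arv_eval f z - p"
  have e: "cinner v e = 0" if "v \<in> D" for v using p(2)[OF that] cinner_commute[of v e] by (simp add: e_def)
  have "cinner (arv_eval f z) e = cinner f (arv_kernel z e)" by (simp add: arv_kernel_reproducing[OF z])
  also have "\<dots> = 0"
    unfolding cinner_arveson_def arv_kernel.rep_eq using f e z by (simp add: arv_sub_def cinner_scaleC_right)
  finally have "cinner e e = 0" using e[OF p(1)] by (simp add: e_def cinner_diff(1))
  then show ?thesis using p(1) by (simp add: cinner_eq_0_iff e_def)
qed

lemma arv_kernel_in:
  assumes "csubspace D" "d \<in> D"
  shows "arv_kernel w d \<in> arv_sub D" using complex_vector.subspace_scale[OF assms] complex_vector.subspace_0[OF assms(1)]
  by (auto simp: arv_sub_def arv_kernel.rep_eq)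

lemma mdeg_eq_0: "mdeg \<alpha> = 0 \<longleftrightarrow> \<alpha> = (0 :: 'n::finite multi_index)"
  by (auto simp: mdeg_def intro: poly_mapping_eqI)

lemma multi_index_minus_single:
  fixes \<beta> :: "'n::finite multi_index"
  assumes "lookup \<beta> i \<noteq> 0"
  shows "\<beta> - single i (Suc 0) + single i (Suc 0) = \<beta>"
    "mdeg \<beta> = Suc (mdeg (\<beta> - single i (Suc 0)))"
    "mweight \<beta> * real (mdeg \<beta>) = mweight (\<beta> - single i (Suc 0)) * real (lookup \<beta> i)"
proof -
  let ?\<alpha> = "\<beta> - single i (Suc 0)"
  show b: "?\<alpha> + single i (Suc 0) = \<beta>"
    using assms by (intro poly_mapping_eqI) (auto simp: lookup_add lookup_minus lookup_single when_def)
  show d: "mdeg \<beta> = Suc (mdeg ?\<alpha>)" using mdeg_add_single[of ?\<alpha> i] unfolding b .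
  have "Suc (lookup ?\<alpha> i) = lookup \<beta> i" using assms by (simp add: lookup_minus)
  then show "mweight \<beta> * real (mdeg \<beta>) = mweight ?\<alpha> * real (lookup \<beta> i)"
    using mweight_add_single[of ?\<alpha> i] unfolding b d by simp
qed

text \<open>The pairs of an index \<beta> and a variable occurring in it correspond to arbitrary
  pairs one degree lower. All recursions over the degree below use this reindexing.\<close>

lemma multi_index_Suc_sum:
  fixes F :: "'n::finite \<Rightarrow> 'n multi_index \<Rightarrow> 'b::comm_monoid_add"
  shows "(\<Sum>\<beta> | mdeg \<beta> = Suc m. \<Sum>i | lookup \<beta> i \<noteq> 0. F i (\<beta> - single i (Suc 0)))
    = (\<Sum>\<alpha> | mdeg \<alpha> = m. \<Sum>i\<in>UNIV. F i \<alpha>)"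
proof -
  let ?e = "\<lambda>i::'n. single i (Suc 0)"
  have "(\<Sum>\<beta> | mdeg \<beta> = Suc m. \<Sum>i | lookup \<beta> i \<noteq> 0. F i (\<beta> - ?e i))
    = (\<Sum>(\<beta>, i)\<in>Sigma {\<beta>. mdeg \<beta> = Suc m} (\<lambda>\<beta>. {i. lookup \<beta> i \<noteq> 0}). F i (\<beta> - ?e i))"
    by (rule sum.Sigma) (auto simp: finite_mdeg)
  also have "\<dots> = (\<Sum>(\<alpha>, i)\<in>Sigma {\<alpha>. mdeg \<alpha> = m} (\<lambda>_. UNIV). F i \<alpha>)"
    by (rule sum.reindex_bij_witness[where i = "\<lambda>(\<alpha>, i). (\<alpha> + ?e i, i)" and j = "\<lambda>(\<beta>, i). (\<beta> - ?e i, i)"])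
       (auto simp: multi_index_minus_single mdeg_add_single lookup_add lookup_single)
  also have "\<dots> = (\<Sum>\<alpha> | mdeg \<alpha> = m. \<Sum>i\<in>UNIV. F i \<alpha>)"
    by (rule sum.Sigma[symmetric]) (auto simp: finite_mdeg)
  finally show ?thesis .
qed

lemma summable_recursion:
  fixes a b :: "nat \<Rightarrow> real"
  assumes a: "\<And>k. 0 \<le> a k" "\<And>k. a (Suc k) \<le> q * a k + b k" and q: "q < 1"
    and b: "summable b" "\<And>k. 0 \<le> b k"
  shows "summable a"
proof (rule summableI_nonneg_bounded[OF a(1)])
  fix N
  have "(\<Sum>k<N. a k) \<le> a 0 + (\<Sum>k<N. a (Suc k))"
    using sum.lessThan_Suc_shift[of a N] a(1)[of N] unfolding sum.lessThan_Suc by linarith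
  also have "(\<Sum>k<N. a (Suc k)) \<le> (\<Sum>k<N. q * a k + b k)" by (rule sum_mono[OF a(2)])
  also have "\<dots> \<le> q * (\<Sum>k<N. a k) + suminf b"
    by (simp add: sum.distrib sum_distrib_left sum_le_suminf[OF b(1)] b(2))
  finally have "(1 - q) * (\<Sum>k<N. a k) \<le> a 0 + suminf b" by (simp add: algebra_simps)
  then show "(\<Sum>k<N. a k) \<le> (a 0 + suminf b) / (1 - q)" using q by (simp add: field_simps)
qed

lemma weighted_sum_norm:
  fixes y :: "'i \<Rightarrow> 'a::real_normed_vector"
  assumes "finite I" "\<And>i. i \<in> I \<Longrightarrow> p i > 0"
  shows "(norm (\<Sum>i\<in>I. y i))\<^sup>2 \<le> (\<Sum>i\<in>I. p i) * (\<Sum>i\<in>I. (norm (y i))\<^sup>2 / p i)"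
proof -
  have "(norm (\<Sum>i\<in>I. y i))\<^sup>2 \<le> (\<Sum>i\<in>I. norm (y i))\<^sup>2" by (intro power_mono norm_sum) simp
  also have "(\<Sum>i\<in>I. norm (y i)) = (\<Sum>i\<in>I. sqrt (p i) * (norm (y i) / sqrt (p i)))"
    using assms(2) by (intro sum.cong) (auto simp: less_imp_neq[THEN not_sym])
  also have "\<dots>\<^sup>2 \<le> (\<Sum>i\<in>I. (sqrt (p i))\<^sup>2) * (\<Sum>i\<in>I. (norm (y i) / sqrt (p i))\<^sup>2)"
    by (rule Cauchy_Schwarz_ineq_sum)
  also have "\<dots> = (\<Sum>i\<in>I. p i) * (\<Sum>i\<in>I. (norm (y i))\<^sup>2 / p i)"
    using assms(2) by (intro arg_cong2[where f = "(*)"] sum.cong) (auto simp: power_divide less_imp_le)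
  finally show ?thesis .
qed

section \<open>The multiplication operator of the characteristic function\<close>

context row_contraction
begin

text \<open>With \<open>x(z) = (1 - z T\<^sup>*)\<^sup>-\<^sup>1 (h + z \<Delta>\<^sub>* f(z))\<close>, the output \<open>\<Delta> x - T f\<close> is
  \<open>\<Delta> (1 - z T\<^sup>*)\<^sup>-\<^sup>1 h + \<Theta> f\<close>; the recursion computes the Taylor coefficients of \<open>x\<close>.\<close>

primrec state :: "'h \<Rightarrow> ('n multi_index \<Rightarrow> 'h ^ 'n) \<Rightarrow> nat \<Rightarrow> 'n multi_index \<Rightarrow> 'h" where
  "state h f 0 \<beta> = h"
| "state h f (Suc m) \<beta> = (\<Sum>i | lookup \<beta> i \<noteq> 0.
     (rowad (state h f m (\<beta> - single i (Suc 0))) + \<Delta>s (f (\<beta> - single i (Suc 0)))) $ i)"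

definition outcoeff :: "'h \<Rightarrow> ('n multi_index \<Rightarrow> 'h ^ 'n) \<Rightarrow> 'n multi_index \<Rightarrow> 'h" where
  "outcoeff h f \<alpha> = \<Delta> (state h f (mdeg \<alpha>) \<alpha>) - rw (f \<alpha>)"

text \<open>Multiplication by the row of coordinate functions is contractive on Arveson's space.
  Cauchy-Schwarz is applied with the probability weights \<open>lookup \<beta> i / Suc m\<close>, by
  which the monomial weights of neighbouring degrees differ exactly.\<close>

lemma state_energy:
  "(\<Sum>\<beta> | mdeg \<beta> = Suc m. mweight \<beta> * (norm (state h f (Suc m) \<beta>))\<^sup>2)
   \<le> (\<Sum>\<alpha> | mdeg \<alpha> = m. mweight \<alpha> * (norm (rowad (state h f m \<alpha>) + \<Delta>s (f \<alpha>)))\<^sup>2)"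
proof -
  let ?y = "\<lambda>\<alpha>. rowad (state h f m \<alpha>) + \<Delta>s (f \<alpha>)" and ?e = "\<lambda>i::'n. single i (Suc 0)"
  have 1: "mweight \<beta> * (norm (state h f (Suc m) \<beta>))\<^sup>2
      \<le> (\<Sum>i | lookup \<beta> i \<noteq> 0. mweight (\<beta> - ?e i) * (norm (?y (\<beta> - ?e i) $ i))\<^sup>2)"
    if \<beta>: "mdeg \<beta> = Suc m" for \<beta>
  proof -
    let ?I = "{i. lookup \<beta> i \<noteq> 0}" and ?p = "\<lambda>i. real (lookup \<beta> i) / real (Suc m)"
    have "(norm (state h f (Suc m) \<beta>))\<^sup>2 \<le> (\<Sum>i\<in>?I. ?p i) * (\<Sum>i\<in>?I. (norm (?y (\<beta> - ?e i) $ i))\<^sup>2 / ?p i)"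
      unfolding state.simps by (rule weighted_sum_norm) auto
    also have "(\<Sum>i\<in>?I. ?p i) = (\<Sum>i\<in>UNIV. ?p i)" by (rule sum.mono_neutral_left) auto
    also have "\<dots> = 1"
      using \<beta> by (simp add: mdeg_def sum_divide_distrib[symmetric] del: of_nat_Suc flip: of_nat_sum)
    finally have "mweight \<beta> * (norm (state h f (Suc m) \<beta>))\<^sup>2 \<le> mweight \<beta> * (\<Sum>i\<in>?I. (norm (?y (\<beta> - ?e i) $ i))\<^sup>2 / ?p i)"
      using mweight_pos[of \<beta>] by (simp add: mult_left_mono)
    also have "\<dots> = (\<Sum>i\<in>?I. mweight (\<beta> - ?e i) * (norm (?y (\<beta> - ?e i) $ i))\<^sup>2)"
      unfolding sum_distrib_left
    proof (rule sum.cong[OF refl])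
      fix i assume i: "i \<in> ?I"
      then have "mweight \<beta> * real (Suc m) = mweight (\<beta> - ?e i) * real (lookup \<beta> i)"
        using multi_index_minus_single(3)[of \<beta> i] \<beta> by simp
      then have "mweight \<beta> / ?p i = mweight (\<beta> - ?e i)" using i by (simp add: field_simps del: of_nat_Suc)
      then show "mweight \<beta> * ((norm (?y (\<beta> - ?e i) $ i))\<^sup>2 / ?p i) = mweight (\<beta> - ?e i) * (norm (?y (\<beta> - ?e i) $ i))\<^sup>2"
        by (simp only: times_divide_eq_left[symmetric] times_divide_eq_right)
    qed
    finally show ?thesis .
  qed
  have "(\<Sum>\<beta> | mdeg \<beta> = Suc m. mweight \<beta> * (norm (state h f (Suc m) \<beta>))\<^sup>2)
    \<le> (\<Sum>\<beta> | mdeg \<beta> = Suc m. \<Sum>i | lookup \<beta> i \<noteq> 0. mweight (\<beta> - ?e i) * (norm (?y (\<beta> - ?e i) $ i))\<^sup>2)"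
    by (rule sum_mono) (use 1 in auto)
  also have "\<dots> = (\<Sum>\<alpha> | mdeg \<alpha> = m. \<Sum>i\<in>UNIV. mweight \<alpha> * (norm (?y \<alpha> $ i))\<^sup>2)"
    by (rule multi_index_Suc_sum[of "\<lambda>i \<alpha>. mweight \<alpha> * (norm (?y \<alpha> $ i))\<^sup>2"])
  also have "\<dots> = (\<Sum>\<alpha> | mdeg \<alpha> = m. mweight \<alpha> * (norm (?y \<alpha>))\<^sup>2)"
    by (simp add: norm_vec_square sum_distrib_left)
  finally show ?thesis .
qed

text \<open>At each degree \<open>julia_isometry\<close> exchanges state and input for output and a
  new column, and only the passage of the column to the next state can lose norm. So the map from
  initial state and input to the output is a contraction; boundedness of \<open>M\<close> and of
  \<open>K\<close> are its two special cases.\<close>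

lemma outcoeff_energy:
  "(\<Sum>k<m. \<Sum>\<alpha> | mdeg \<alpha> = k. mweight \<alpha> * (norm (outcoeff h f \<alpha>))\<^sup>2)
     + (\<Sum>\<alpha> | mdeg \<alpha> = m. mweight \<alpha> * (norm (state h f m \<alpha>))\<^sup>2)
   \<le> (norm h)\<^sup>2 + (\<Sum>k<m. \<Sum>\<alpha> | mdeg \<alpha> = k. mweight \<alpha> * (norm (f \<alpha>))\<^sup>2)"
proof (induction m)
  case 0
  show ?case by (simp add: mdeg_eq_0) (simp add: mweight_def mdeg_def)
next
  case (Suc m)
  have "(\<Sum>\<alpha> | mdeg \<alpha> = m. mweight \<alpha> * (norm (outcoeff h f \<alpha>))\<^sup>2)
      + (\<Sum>\<alpha> | mdeg \<alpha> = m. mweight \<alpha> * (norm (rowad (state h f m \<alpha>) + \<Delta>s (f \<alpha>)))\<^sup>2)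
    = (\<Sum>\<alpha> | mdeg \<alpha> = m. mweight \<alpha> * ((norm (rowad (state h f m \<alpha>) + \<Delta>s (f \<alpha>)))\<^sup>2 + (norm (\<Delta> (state h f m \<alpha>) - rw (f \<alpha>)))\<^sup>2))"
    unfolding sum.distrib[symmetric] by (rule sum.cong) (auto simp: outcoeff_def algebra_simps)
  also have "\<dots> = (\<Sum>\<alpha> | mdeg \<alpha> = m. mweight \<alpha> * (norm (state h f m \<alpha>))\<^sup>2) + (\<Sum>\<alpha> | mdeg \<alpha> = m. mweight \<alpha> * (norm (f \<alpha>))\<^sup>2)"
    unfolding julia_isometry by (simp add: distrib_left sum.distrib)
  finally show ?case using Suc.IH state_energy[of h f m] by (simp del: state.simps)
qed

lemma mdeg_bounded: "finite (G :: 'n multi_index set) \<Longrightarrow> \<exists>m. G \<subseteq> {\<alpha>. mdeg \<alpha> < m}"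
  by (rule exI[of _ "Suc (Max (mdeg ` G))"]) (auto simp: less_Suc_eq_le)

lemma outcoeff_bound:
  fixes f :: "('n, 'h ^ 'n) arveson"
  assumes "finite G"
  shows "(\<Sum>\<alpha>\<in>G. mweight \<alpha> * (norm (outcoeff h (coeff_arv f) \<alpha>))\<^sup>2) \<le> (norm h)\<^sup>2 + (norm f)\<^sup>2"
proof -
  obtain m where m: "G \<subseteq> {\<alpha>. mdeg \<alpha> < m}" using mdeg_bounded[OF assms] by blast
  have U: "{\<alpha> :: 'n multi_index. mdeg \<alpha> < m} = (\<Union>k\<in>{..<m}. {\<alpha>. mdeg \<alpha> = k})" by auto
  have fin: "finite {\<alpha> :: 'n multi_index. mdeg \<alpha> < m}" unfolding U by (auto simp: finite_mdeg)
  have S: "(\<Sum>\<alpha> | mdeg \<alpha> < m. g \<alpha>) = (\<Sum>k<m. \<Sum>\<alpha> | mdeg \<alpha> = k. g \<alpha>)" for g :: "'n multi_index \<Rightarrow> real"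
    unfolding U by (rule sum.UNION_disjoint) (auto simp: finite_mdeg)
  have nn: "0 \<le> mweight \<alpha> * (norm x)\<^sup>2" for \<alpha> :: "'n multi_index" and x :: 'h
    using mweight_pos[of \<alpha>] by simp
  have "(\<Sum>\<alpha>\<in>G. mweight \<alpha> * (norm (outcoeff h (coeff_arv f) \<alpha>))\<^sup>2)
      \<le> (\<Sum>\<alpha> | mdeg \<alpha> < m. mweight \<alpha> * (norm (outcoeff h (coeff_arv f) \<alpha>))\<^sup>2)"
    by (rule sum_mono2[OF fin m nn])
  also have "\<dots> \<le> (norm h)\<^sup>2 + (\<Sum>\<alpha> | mdeg \<alpha> < m. mweight \<alpha> * (norm (coeff_arv f \<alpha>))\<^sup>2)"
    unfolding S using outcoeff_energy[where m = m and h = h and f = "coeff_arv f"] sum_nonneg[of "{\<alpha>. mdeg \<alpha> = m}", OF nn, of "\<lambda>\<alpha>. \<alpha>" "state h (coeff_arv f) m"] by linarith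
  also have "\<dots> \<le> (norm h)\<^sup>2 + (norm f)\<^sup>2" using sum_le_norm_arveson[OF fin, of f] by simp
  finally show ?thesis .
qed

definition W :: "'h \<Rightarrow> ('n, 'h ^ 'n) arveson \<Rightarrow> ('n, 'h) arveson" where
  "W h f = Abs_arv (outcoeff h (coeff_arv f))"

lemma outcoeff_summable: "(\<lambda>\<alpha>. mweight \<alpha> * (norm (outcoeff h (coeff_arv f) \<alpha>))\<^sup>2) summable_on UNIV"
  by (rule nonneg_bdd_above_summable_on)
     (auto intro!: bdd_aboveI2[where M = "(norm h)\<^sup>2 + (norm f)\<^sup>2"] outcoeff_bound mult_nonneg_nonneg less_imp_le[OF mweight_pos])

lemma coeff_W: "coeff_arv (W h f) = outcoeff h (coeff_arv f)"
  unfolding W_def by (rule Abs_arv_inverse) (simp add: outcoeff_summable)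

lemma norm_W: "(norm (W h f))\<^sup>2 \<le> (norm h)\<^sup>2 + (norm f)\<^sup>2"
  unfolding norm_arveson_square[of "W h f"] coeff_W by (rule infsum_le_finite_sums[OF outcoeff_summable outcoeff_bound])

lemma hpart_clinear: "bounded_clinear A \<Longrightarrow> hpart z m (\<lambda>\<alpha>. A (c \<alpha>)) = A (hpart z m c)"
  by (simp add: hpart_def bounded_clinear_sum bounded_clinearD)

lemma hpart_add: "hpart z m (\<lambda>\<alpha>. c \<alpha> + d \<alpha>) = hpart z m c + hpart z m d"
  "hpart z m (\<lambda>\<alpha>. a \<alpha> - b \<alpha>) = hpart z m a - hpart z m b"
  by (simp_all add: hpart_def scaleC_add_right scaleC_diff_right sum.distrib sum_subtractf)

lemma hpart_state:
  "hpart z (Suc m) (state h f (Suc m)) = Sad z (hpart z m (state h f m)) + zrow z (\<Delta>s (hpart z m f))"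
proof -
  let ?y = "\<lambda>\<alpha>. rowad (state h f m \<alpha>) + \<Delta>s (f \<alpha>)" and ?e = "\<lambda>i::'n. single i (Suc 0)"
  have "hpart z (Suc m) (state h f (Suc m))
    = (\<Sum>\<beta> | mdeg \<beta> = Suc m. \<Sum>i | lookup \<beta> i \<noteq> 0. mpow z (\<beta> - ?e i + ?e i) *\<^sub>C (?y (\<beta> - ?e i) $ i))"
    unfolding hpart_def state.simps scaleC_sum_right by (intro sum.cong refl) (simp add: multi_index_minus_single)
  also have "\<dots> = (\<Sum>\<alpha> | mdeg \<alpha> = m. \<Sum>i\<in>UNIV. mpow z (\<alpha> + ?e i) *\<^sub>C (?y \<alpha> $ i))"
    by (rule multi_index_Suc_sum[of "\<lambda>i \<alpha>. mpow z (\<alpha> + ?e i) *\<^sub>C (?y \<alpha> $ i)"])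
  also have "\<dots> = (\<Sum>\<alpha> | mdeg \<alpha> = m. mpow z \<alpha> *\<^sub>C zrow z (?y \<alpha>))"
    by (simp add: mpow_add_single zrow_def scaleC_sum_right scaleC_scaleC)
  also have "\<dots> = zrow z (rowad (hpart z m (state h f m)) + \<Delta>s (hpart z m f))"
    unfolding hpart_def[symmetric] by (simp only: hpart_clinear[OF zrow_clinear] hpart_clinear[OF rowad(3)] hpart_clinear[OF defect_clinear(2)] hpart_add)
  finally show ?thesis by (simp add: Sad_def bounded_clinearD[OF zrow_clinear])
qed

text \<open>The homogeneous parts of the state sum to \<open>x\<close> with
  \<open>x - Sad z x = h + zrow z (\<Delta>s (f z))\<close>, which the resolvent solves.
  \<open>summable_recursion\<close> supplies absolute convergence because
  \<open>norm z < 1\<close>.\<close>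

lemma eval_W:
  assumes "z \<in> ball 0 1"
  shows "arv_eval (W h f) z = \<Delta> (Rad z h) + \<Theta> z (arv_eval f z)"
proof -
  have z: "norm z < 1" using assms by simp
  define X where "X m = hpart z m (state h (coeff_arv f) m)" for m
  define b where "b m = zrow z (\<Delta>s (hpart z m (coeff_arv f)))" for m
  note bc = bounded_clinear_comp[OF zrow_clinear defect_clinear(2)]
  have bs: "b sums zrow z (\<Delta>s (arv_eval f z))"
    unfolding b_def by (rule bounded_linear.sums[OF bounded_clinearD(1)[OF bc] hpart_sums(1)[OF assms]])
  obtain K where K: "\<And>x. norm (zrow z (\<Delta>s x)) \<le> norm x * K" using bounded_linear.bounded[OF bounded_clinearD(1)[OF bc]] by blast
  have bn: "summable (\<lambda>m. norm (b m))"
    by (rule summable_comparison_test'[OF summable_mult2[OF hpart_sums(2)[OF assms, of f], of K]]) (use K in \<open>simp add: b_def\<close>)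
  have XS: "X (Suc m) = Sad z (X m) + b m" for m unfolding X_def b_def by (rule hpart_state)
  have X0: "X 0 = h" by (simp add: X_def hpart_def mdeg_eq_0) (simp add: mpow_def)
  have "summable (\<lambda>m. norm (X m))" by (rule summable_recursion[OF norm_ge_zero _ z bn norm_ge_zero])
       (unfold XS, intro order_trans[OF norm_triangle_ineq] add_right_mono S_norm)
  then have "summable X" by (rule summable_norm_cancel)
  then obtain x where x: "X sums x" by (auto simp: summable_def)
  have "(\<lambda>m. X (Suc m)) sums (Sad z x + zrow z (\<Delta>s (arv_eval f z)))"
    unfolding XS by (intro sums_add bs bounded_linear.sums[OF bounded_clinearD(1)[OF S_clinear(2)] x])
  moreover have "(\<lambda>m. X (Suc m)) sums (x - h)" using sums_Suc_iff[of X "x - h"] x X0 by simp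
  ultimately have "x - h = Sad z x + zrow z (\<Delta>s (arv_eval f z))" by (rule sums_unique2[rotated])
  then have "x - Sad z x = h + zrow z (\<Delta>s (arv_eval f z))" by (simp add: algebra_simps)
  then have xe: "x = Rad z (h + zrow z (\<Delta>s (arv_eval f z)))" using R_props(4)[OF z, of x] by simp
  have "(\<lambda>m. \<Delta> (X m) - rw (hpart z m (coeff_arv f))) sums (\<Delta> x - rw (arv_eval f z))"
    by (intro sums_diff bounded_linear.sums[OF row_simps(1) hpart_sums(1)[OF assms]] bounded_linear.sums[OF defect_simps(1) x])
  moreover have "\<Delta> (X m) - rw (hpart z m (coeff_arv f)) = hpart z m (coeff_arv (W h f))" for m
  proof -
    have "hpart z m (coeff_arv (W h f)) = hpart z m (\<lambda>\<alpha>. \<Delta> (state h (coeff_arv f) m \<alpha>) - rw (coeff_arv f \<alpha>))"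
      unfolding coeff_W by (auto simp: hpart_def outcoeff_def intro!: sum.cong)
    also have "\<dots> = \<Delta> (X m) - rw (hpart z m (coeff_arv f))"
      by (simp only: hpart_add hpart_clinear[OF defect_clinear(1)] hpart_clinear[OF row_clinear] X_def)
    finally show ?thesis by simp
  qed
  ultimately have "(\<lambda>m. hpart z m (coeff_arv (W h f))) sums (\<Delta> x - rw (arv_eval f z))" by simp
  then have "arv_eval (W h f) z = \<Delta> x - rw (arv_eval f z)" using hpart_sums(1)[OF assms] sums_unique2 by blast
  also have "\<dots> = \<Delta> (Rad z h) + \<Theta> z (arv_eval f z)"
    by (simp add: xe char_symbol_eq bounded_clinearD[OF R_props(6)[OF z]] defect_simps)
  finally show ?thesis .
qed

section \<open>Multiplication by the symbol and the Poisson kernel\<close>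

abbreviation "M \<equiv> char_op T"
abbreviation "Mad \<equiv> char_op_adj T"

text \<open>The Poisson kernel arises as the response to the initial state \<open>h\<close> with
  input 0.\<close>

definition K :: "'h \<Rightarrow> ('n, 'h) arveson" where "K h = W h 0"

text \<open>The description in \<open>char_op\<close> has exactly one solution, because values on
  the ball determine an element of Arveson's space.\<close>

lemma char_op_W: "M f = W 0 f"
  unfolding char_op_def
proof (rule the_equality)
  have R0: "Rad z 0 = 0" if "z \<in> ball 0 1" for z using bounded_clinearD(4)[OF R_props(6)[of z]] that by simp
  show *: "\<forall>z\<in>ball 0 1. arv_eval (W 0 f) z = \<Theta> z (arv_eval f z)" by (simp add: eval_W R0[simplified] defect_simps)
  fix g assume "\<forall>z\<in>ball 0 1. arv_eval g z = \<Theta> z (arv_eval f z)"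
  then show "g = W 0 f" using * by (intro arv_eval_inject) simp
qed

lemma eval_M: "z \<in> ball 0 1 \<Longrightarrow> arv_eval (M f) z = \<Theta> z (arv_eval f z)"
  using bounded_clinearD(4)[OF R_props(6)[of z]] by (simp add: char_op_W eval_W defect_simps)

lemma eval_K: "z \<in> ball 0 1 \<Longrightarrow> arv_eval (K h) z = \<Delta> (Rad z h)"
  using bounded_clinearD(4)[OF char_symbol_clinear[of z]] by (simp add: K_def eval_W arv_eval_linear)

lemma M_clinear: "bounded_clinear M"
proof (rule bounded_clinearI[where K = 1])
  fix f g c
  note l = bounded_clinearD[OF char_symbol_clinear]
  show "M (f + g) = M f + M g" by (rule arv_eval_inject) (simp add: eval_M arv_eval_linear l)
  show "M (c *\<^sub>C f) = c *\<^sub>C M f" by (rule arv_eval_inject) (simp add: eval_M arv_eval_linear l)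
  show "norm (M f) \<le> 1 * norm f" using norm_W[of 0 f] by (simp add: char_op_W)
qed

lemma K_clinear: "bounded_clinear K"
proof (rule bounded_clinearI[where K = 1])
  fix f g c
  note l = bounded_clinearD[OF R_props(6)] defect_simps
  show "K (f + g) = K f + K g" by (rule arv_eval_inject) (simp add: eval_K arv_eval_linear l)
  show "K (c *\<^sub>C f) = c *\<^sub>C K f" by (rule arv_eval_inject) (simp add: eval_K arv_eval_linear l)
  show "norm (K f) \<le> 1 * norm f" using norm_W[of f 0] by (simp add: K_def)
qed

lemma M_in: "f \<in> arv_sub Ds \<Longrightarrow> M f \<in> arv_sub D"
  by (auto simp: arv_sub_def char_op_W coeff_W outcoeff_def intro!: complex_vector.subspace_diff spaces defect_in row_in)

lemma K_in: "K h \<in> arv_sub D"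
  by (auto simp: arv_sub_def K_def coeff_W outcoeff_def zero_arveson.rep_eq row_simps intro!: defect_in)

lemmas Mad = adjoint_on[OF M_clinear arv_sub_closed[OF spaces(3)] arv_sub_subspace[OF spaces(4)], folded char_op_adj_def]

lemma Mad_clinear: "bounded_clinear Mad"
  unfolding char_op_adj_def by (rule adjoint_on_clinear[OF M_clinear arv_sub_closed[OF spaces(3)] arv_sub_subspace[OF spaces(4)]])

lemma Mad_kernel:
  assumes "w \<in> ball 0 1" "d \<in> D"
  shows "Mad (arv_kernel w d) = arv_kernel w (\<Theta>ad w d)"
  unfolding char_op_adj_def by (rule adjoint_onI[OF M_clinear arv_sub_closed[OF spaces(3)] arv_sub_subspace[OF spaces(4)]])
     (use assms in \<open>simp_all add: arv_kernel_in spaces char_symbol_in arv_kernel_reproducing eval_M char_symbol_adjoint\<close>)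

lemma Kad_kernel:
  assumes "w \<in> ball 0 1"
  shows "cadjoint K (arv_kernel w d) = R w (\<Delta> d)"
proof (rule cadjointI[OF K_clinear])
  fix h
  have "cinner (\<Delta> (Rad w h)) d = cinner h (R w (\<Delta> d))"
    using R_adjoint[of w "\<Delta> d" h] assms defect_selfadjoint(1)[of "Rad w h" d] by simp (metis cinner_commute)
  then show "cinner (K h) (arv_kernel w d) = cinner h (R w (\<Delta> d))"
    using assms by (simp add: arv_kernel_reproducing eval_K)
qed

text \<open>\<open>P = 1 - M M^* - K K^*\<close> is self-adjoint and kills all kernel functions with
  vectors in \<open>D\<close>, by \<open>char_symbol_kernel_identity\<close>. Since
  \<open>P g\<close> takes values in \<open>D\<close>, pairing it with the kernel function of its
  own value shows that it vanishes.\<close>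

lemma char_op_complement:
  assumes g: "g \<in> arv_sub D"
  shows "M (Mad g) = g - K (cadjoint K g)"
proof -
  define P where "P g = g - M (Mad g) - K (cadjoint K g)" for g
  have MM: "cinner (M (Mad g)) g' = cinner g (M (Mad g'))" for g g'
  proof -
    have "cinner (M (Mad g)) g' = cinner (Mad g) (Mad g')" by (rule Mad(2)[OF Mad(1)])
    also have "\<dots> = cnj (cinner (Mad g') (Mad g))" by (rule cinner_commute)
    also have "\<dots> = cnj (cinner (M (Mad g')) g)" by (simp add: Mad(2)[OF Mad(1)])
    finally show ?thesis by (simp flip: cinner_commute)
  qed
  have self: "cinner (P g) g' = cinner g (P g')" for g g' by (simp add: P_def cinner_diff MM cadjoint[OF K_clinear])
  have ker: "P (arv_kernel w d) = 0" if w: "w \<in> ball 0 1" and d: "d \<in> D" for w d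
  proof (rule arv_eval_zero)
    fix z :: "complex ^ 'n" assume z: "z \<in> ball 0 1"
    have "cmod (cinner z w) \<le> norm z * norm w" by (rule cinner_Cauchy_Schwarz)
    also have "\<dots> < 1 * 1" using z w by (intro mult_strict_mono') auto
    finally have n: "1 - cinner z w \<noteq> 0" by auto
    have "arv_eval (P (arv_kernel w d)) z = (1 / (1 - cinner z w)) *\<^sub>C (d - \<Theta> z (\<Theta>ad w d)) - \<Delta> (Rad z (R w (\<Delta> d)))"
      using z w d bounded_clinearD(2)[OF char_symbol_clinear[of z]]
      by (simp add: P_def arv_eval_linear Mad_kernel eval_M Kad_kernel eval_K arv_eval_kernel scaleC_diff_right)
    also have "d - \<Theta> z (\<Theta>ad w d) = (1 - cinner z w) *\<^sub>C \<Delta> (Rad z (R w (\<Delta> d)))"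
      by (rule char_symbol_kernel_identity) (use z w in auto)
    finally show "arv_eval (P (arv_kernel w d)) z = 0" using n by (simp add: scaleC_scaleC)
  qed
  have Pg: "P g \<in> arv_sub D" unfolding P_def
    by (intro complex_vector.subspace_diff arv_sub_subspace spaces g M_in Mad K_in)
  have "P g = 0"
  proof (rule arv_eval_zero)
    fix w :: "complex ^ 'n" assume w: "w \<in> ball 0 1"
    let ?d = "arv_eval (P g) w"
    have d: "?d \<in> D" by (rule arv_eval_in[OF spaces(1,2) Pg w])
    have "cinner ?d ?d = cinner (P g) (arv_kernel w ?d)" by (rule arv_kernel_reproducing[OF w, symmetric])
    also have "\<dots> = 0" by (simp add: self ker[OF w d])
    finally show "?d = 0" by (simp add: cinner_eq_0_iff)
  qed
  then show ?thesis by (simp add: P_def algebra_simps)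
qed

end

section \<open>Radial limits of square summable power series\<close>

text \<open>The interval covers the circle \<open>n\<close> times. \<open>n = 1\<close> serves the
  Poisson integral, and \<open>n = 2\<close> the sums of two angles from
  \<open>{-pi..pi}\<close>.\<close>

lemma cis_has_integral:
  assumes "m \<noteq> 0"
  shows "((\<lambda>t. cis (of_int m * t)) has_integral 0) {- (real n * pi)..real n * pi}"
proof -
  define g where "g t = cis (of_int m * t) / (\<i> * of_int m)" for t :: real
  have "((\<lambda>t. cis (of_int m * t)) has_integral (g (real n * pi) - g (- (real n * pi)))) {- (real n * pi)..real n * pi}"
  proof (rule fundamental_theorem_of_calculus)
    fix x :: real
    have "((\<lambda>z. exp (\<i> * (of_int m * z)) / (\<i> * of_int m)) has_field_derivative exp (\<i> * (of_int m * of_real x))) (at (of_real x))"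
      using assms by (auto intro!: derivative_eq_intros simp: mult_ac)
    from has_vector_derivative_real_field[OF this]
    show "(g has_vector_derivative cis (of_int m * x)) (at x within {- (real n * pi)..real n * pi})"
      by (simp add: g_def[abs_def] cis_conv_exp has_vector_derivative_at_within)
  qed simp
  moreover have "sin (of_int m * (real n * pi)) = 0"
    unfolding sin_zero_iff_int2 by (rule exI[of _ "m * int n"]) simp
  then have "cis (of_int m * (real n * pi)) = cis (- (of_int m * (real n * pi)))" by (simp add: complex_eq_iff)
  then have "g (real n * pi) - g (- (real n * pi)) = 0" by (simp add: g_def)
  ultimately show ?thesis by simp
qed

text \<open>The boundary function of the power series with coefficients \<open>d\<close>, used where
  these are absolutely summable and the function is therefore continuous.\<close>

definition circ :: "(nat \<Rightarrow> 'a::chilbert_space) \<Rightarrow> real \<Rightarrow> 'a" where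
  "circ d t = suminf (\<lambda>k. cis (real k * t) *\<^sub>C d k)"

lemma circ_summable:
  assumes "summable (\<lambda>k. norm (d k))"
  shows "summable (\<lambda>k. cis (real k * t) *\<^sub>C d k)" "norm (circ d t) \<le> suminf (\<lambda>k. norm (d k))"
proof -
  have n: "norm (cis (real k * t) *\<^sub>C d k) = norm (d k)" for k by (simp add: norm_scaleC)
  have s: "summable (\<lambda>k. norm (cis (real k * t) *\<^sub>C d k))" unfolding n by fact
  then show "summable (\<lambda>k. cis (real k * t) *\<^sub>C d k)" by (rule summable_norm_cancel)
  show "norm (circ d t) \<le> suminf (\<lambda>k. norm (d k))" unfolding circ_def using summable_norm[OF s] unfolding n .
qed

lemma continuous_scaleC:
  assumes "continuous_on X f"
  shows "continuous_on X (\<lambda>\<xi>. f \<xi> *\<^sub>C (v :: 'a::complex_inner))"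
proof -
  have "bounded_linear (\<lambda>c. c *\<^sub>C v)" by (rule bounded_linear_intro[where K = "norm v"])
       (simp_all add: scaleC_add_left norm_scaleC scaleR_scaleC scaleC_scaleC scaleC_complex_def scaleR_conv_of_real)
  from bounded_linear.continuous_on[OF this assms] show ?thesis .
qed

lemma circ_continuous:
  assumes "summable (\<lambda>k. norm (d k))"
  shows "continuous_on UNIV (circ d)"
proof -
  have ck: "continuous_on UNIV (\<lambda>t. cis (real k * t) *\<^sub>C d k)" for k
    by (intro continuous_scaleC continuous_intros)
  have c: "\<forall>\<^sub>F n in sequentially. continuous_on UNIV (\<lambda>t. \<Sum>k<n. cis (real k * t) *\<^sub>C d k)"
    by (rule always_eventually, rule allI, rule continuous_on_sum, rule ck)
  have "uniform_limit UNIV (\<lambda>n t. \<Sum>k<n. cis (real k * t) *\<^sub>C d k) (circ d) sequentially"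
    unfolding circ_def[abs_def] by (rule Weierstrass_m_test[OF _ assms]) (simp add: norm_scaleC)
  from uniform_limit_theorem[OF c this] show ?thesis by simp
qed

lemma circ_parseval_finite:
  "((\<lambda>t. (norm (\<Sum>k<N. cis (real k * t) *\<^sub>C d k))\<^sup>2) has_integral 2 * real n * pi * (\<Sum>k<N. (norm (d k))\<^sup>2)) {- (real n * pi)..real n * pi}"
proof -
  have e: "(norm (\<Sum>k<N. cis (real k * t) *\<^sub>C d k))\<^sup>2
      = (\<Sum>j<N. \<Sum>k<N. Re (cis (of_int (int k - int j) * t) * cinner (d k) (d j)))" for t
    unfolding power2_norm_eq_inner inner_cinner cinner_sum_left cinner_sum_right Re_sum by (intro sum.cong refl)
       (simp add: cinner_scaleC_left cinner_scaleC_right cis_cnj cis_mult mult.assoc[symmetric] left_diff_distrib)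
  have "((\<lambda>t. Re (cis (of_int (int k - int j) * t) * cinner (d k) (d j))) has_integral
      (if j = k then 2 * real n * pi * (norm (d k))\<^sup>2 else 0)) {- (real n * pi)..real n * pi}" for k j
  proof (cases "j = k")
    case True
    have "((\<lambda>t::real. Re (cinner (d k) (d k))) has_integral (real n * pi - - (real n * pi)) *\<^sub>R Re (cinner (d k) (d k))) {- (real n * pi)..real n * pi}"
      by (rule has_integral_const_real[of _ "- (real n * pi)" "real n * pi", simplified content_real_if, THEN has_integral_eq_rhs]) simp
    then show ?thesis using True by (simp add: cinner_same mult_ac)
  next
    case False
    have "bounded_linear (\<lambda>z. Re (z * cinner (d k) (d j)))"
      by (intro bounded_linear_compose[OF bounded_linear_Re] bounded_linear_mult_left)
    from has_integral_linear[OF cis_has_integral this, of "int k - int j" n] False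
    show ?thesis by (simp add: o_def)
  qed
  then have "((\<lambda>t. \<Sum>j<N. \<Sum>k<N. Re (cis (of_int (int k - int j) * t) * cinner (d k) (d j))) has_integral
      (\<Sum>j<N. \<Sum>k<N. (if j = k then 2 * real n * pi * (norm (d k))\<^sup>2 else 0))) {- (real n * pi)..real n * pi}"
    by (intro has_integral_sum) auto
  then show ?thesis unfolding e by (simp add: sum_distrib_left)
qed

lemma norm_square_summable:
  assumes "summable (\<lambda>k. norm (d k))"
  shows "summable (\<lambda>k. (norm (d k))\<^sup>2)"
proof -
  have "(\<lambda>k. norm (d k)) \<longlonglongrightarrow> 0" using summable_LIMSEQ_zero[OF assms] .
  then have "\<forall>\<^sub>F k in sequentially. norm (d k) < 1" by (rule order_tendstoD) simp
  then obtain K where K: "\<And>k. k \<ge> K \<Longrightarrow> norm (d k) < 1" by (auto simp: eventually_sequentially)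
  show ?thesis
  proof (rule summable_comparison_test'[OF assms])
    fix k assume "k \<ge> K"
    then show "norm ((norm (d k))\<^sup>2) \<le> norm (d k)"
      using mult_left_le[of "norm (d k)" "norm (d k)"] K[of k] by (simp add: power2_eq_square)
  qed
qed

lemma circ_parseval:
  assumes d: "summable (\<lambda>k. norm (d k))"
  shows "((\<lambda>t. (norm (circ d t))\<^sup>2) has_integral 2 * real n * pi * suminf (\<lambda>k. (norm (d k))\<^sup>2)) {- (real n * pi)..real n * pi}"
proof -
  let ?I = "{- (real n * pi)..real n * pi}" and ?f = "\<lambda>N t. (norm (\<Sum>k<N. cis (real k * t) *\<^sub>C d k))\<^sup>2"
  have b: "norm (?f N t) \<le> (suminf (\<lambda>k. norm (d k)))\<^sup>2" for N t
  proof -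
    have "norm (\<Sum>k<N. cis (real k * t) *\<^sub>C d k) \<le> (\<Sum>k<N. norm (d k))"
      by (rule order_trans[OF norm_sum]) (simp add: norm_scaleC)
    also have "\<dots> \<le> suminf (\<lambda>k. norm (d k))" by (rule sum_le_suminf[OF d]) auto
    finally show ?thesis by (simp add: power_mono)
  qed
  have l: "(\<lambda>N. ?f N t) \<longlonglongrightarrow> (norm (circ d t))\<^sup>2" for t
    using summable_LIMSEQ[OF circ_summable(1)[OF d, of t]] unfolding circ_def by (intro tendsto_intros)
  have i: "?f N integrable_on ?I" "integral ?I (?f N) = 2 * real n * pi * (\<Sum>k<N. (norm (d k))\<^sup>2)" for N
    using circ_parseval_finite[where N = N and d = d and n = n] by (auto simp: has_integral_integrable integral_unique)
  have D: "(\<lambda>t. (norm (circ d t))\<^sup>2) integrable_on ?I" "(\<lambda>N. integral ?I (?f N)) \<longlonglongrightarrow> integral ?I (\<lambda>t. (norm (circ d t))\<^sup>2)"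
    by (rule dominated_convergence[OF i(1) integrable_const_ivl b l])+
  have "(\<lambda>N. integral ?I (?f N)) \<longlonglongrightarrow> 2 * real n * pi * suminf (\<lambda>k. (norm (d k))\<^sup>2)"
    unfolding i(2) by (intro tendsto_intros summable_LIMSEQ norm_square_summable d)
  then have "integral ?I (\<lambda>t. (norm (circ d t))\<^sup>2) = 2 * real n * pi * suminf (\<lambda>k. (norm (d k))\<^sup>2)"
    by (rule LIMSEQ_unique[OF D(2)])
  then show ?thesis using integrable_integral[OF D(1)] by simp
qed

text \<open>Point evaluation at \<open>r\<close> in the Hardy space, whose kernel function there has
  squared norm \<open>1 / (1 - r^2)\<close>.\<close>

lemma suminf_Cauchy_Schwarz:
  fixes G :: "nat \<Rightarrow> 'a::chilbert_space"
  assumes "summable (\<lambda>k. (norm (G k))\<^sup>2)" "0 \<le> r" "r < 1" "(\<lambda>k. r ^ k *\<^sub>R G k) sums x"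
  shows "(norm x)\<^sup>2 * (1 - r\<^sup>2) \<le> suminf (\<lambda>k. (norm (G k))\<^sup>2)"
proof -
  have r2: "r\<^sup>2 < 1" using assms(2,3) by (simp add: power_less_one_iff abs_square_less_1)
  have "(norm (\<Sum>k<N. r ^ k *\<^sub>R G k))\<^sup>2 * (1 - r\<^sup>2) \<le> suminf (\<lambda>k. (norm (G k))\<^sup>2)" for N
  proof -
    have "norm (\<Sum>k<N. r ^ k *\<^sub>R G k) \<le> (\<Sum>k<N. r ^ k * norm (G k))"
      by (rule order_trans[OF norm_sum]) (use assms(2) in simp)
    then have "(norm (\<Sum>k<N. r ^ k *\<^sub>R G k))\<^sup>2 \<le> (\<Sum>k<N. r ^ k * norm (G k))\<^sup>2" by (intro power_mono) auto
    also have "\<dots> \<le> (\<Sum>k<N. (r ^ k)\<^sup>2) * (\<Sum>k<N. (norm (G k))\<^sup>2)" by (rule Cauchy_Schwarz_ineq_sum)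
    also have "\<dots> \<le> (\<Sum>k<N. (r ^ k)\<^sup>2) * suminf (\<lambda>k. (norm (G k))\<^sup>2)"
      by (intro mult_left_mono sum_le_suminf assms(1) sum_nonneg) auto
    finally have "(norm (\<Sum>k<N. r ^ k *\<^sub>R G k))\<^sup>2 * (1 - r\<^sup>2) \<le> ((\<Sum>k<N. (r ^ k)\<^sup>2) * (1 - r\<^sup>2)) * suminf (\<lambda>k. (norm (G k))\<^sup>2)"
      using r2 by (simp add: mult_right_mono mult_ac)
    also have "(\<Sum>k<N. (r ^ k)\<^sup>2) * (1 - r\<^sup>2) = 1 - (r\<^sup>2) ^ N"
      unfolding one_diff_power_eq by (simp add: power2_eq_square power_mult_distrib mult.commute)
    also have "(1 - (r\<^sup>2) ^ N) * suminf (\<lambda>k. (norm (G k))\<^sup>2) \<le> 1 * suminf (\<lambda>k. (norm (G k))\<^sup>2)"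
      by (intro mult_right_mono suminf_nonneg assms(1)) auto
    finally show ?thesis by simp
  qed
  then have b: "\<exists>N0. \<forall>N\<ge>N0. (norm (\<Sum>k<N. r ^ k *\<^sub>R G k))\<^sup>2 * (1 - r\<^sup>2) \<le> suminf (\<lambda>k. (norm (G k))\<^sup>2)" by blast
  have "(\<lambda>N. (norm (\<Sum>k<N. r ^ k *\<^sub>R G k))\<^sup>2 * (1 - r\<^sup>2)) \<longlonglongrightarrow> (norm x)\<^sup>2 * (1 - r\<^sup>2)"
    using assms(4) unfolding sums_def by (intro tendsto_intros)
  from LIMSEQ_le_const2[OF this b] show ?thesis .
qed

text \<open>The Poisson integral inequality is obtained from Parseval's identity and the point
  evaluation bound in \<open>H\<^sup>2\<close>, applied to \<open>g(\<lambda>) / (1 - r \<lambda>)\<close>, whose coefficients are \<open>G\<close>.\<close>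

lemma poisson_inequality:
  fixes d :: "nat \<Rightarrow> 'a::chilbert_space"
  assumes d: "summable (\<lambda>k. norm (d k))" and r: "0 \<le> r" "r < 1"
  shows "2 * pi * (norm (suminf (\<lambda>k. r ^ k *\<^sub>R d k)))\<^sup>2
    \<le> integral {- pi..pi} (\<lambda>s. (1 - r\<^sup>2) / (cmod (1 - of_real r * cis s))\<^sup>2 * (norm (circ d s))\<^sup>2)"
proof -
  define G where "G = rec_nat (d 0) (\<lambda>k x. r *\<^sub>R x + d (Suc k))"
  have G0: "G 0 = d 0" and GS: "G (Suc k) = r *\<^sub>R G k + d (Suc k)" for k by (simp_all add: G_def)
  have G: "summable (\<lambda>k. norm (G k))"
  proof (rule summable_recursion[OF norm_ge_zero _ r(2) _ norm_ge_zero])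
    show "summable (\<lambda>k. norm (d (Suc k)))" using d by (simp add: summable_Suc_iff[of "\<lambda>k. norm (d k)"])
    show "norm (G (Suc k)) \<le> r * norm (G k) + norm (d (Suc k))" for k
      using norm_triangle_ineq[of "r *\<^sub>R G k" "d (Suc k)"] r(1) by (simp add: GS)
  qed
  have shift: "(1 - r * t) *\<^sub>C suminf (\<lambda>k. t ^ k *\<^sub>C G k) = suminf (\<lambda>k. t ^ k *\<^sub>C d k)" if t: "cmod t \<le> 1" for t :: complex
  proof -
    have p: "cmod (t ^ k) \<le> 1" for k using t by (simp add: norm_power power_le_one)
    have ts: "summable (\<lambda>k. t ^ k *\<^sub>C e k)" if "summable (\<lambda>k. norm (e k))" for e :: "nat \<Rightarrow> 'a"
      by (rule summable_comparison_test'[OF that]) (use p in \<open>simp add: norm_scaleC mult_left_le_one_le\<close>)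
    obtain x y where x: "(\<lambda>k. t ^ k *\<^sub>C G k) sums x" and y: "(\<lambda>k. t ^ k *\<^sub>C d k) sums y"
      using ts[OF G] ts[OF d] by (auto simp: summable_def)
    have "(\<lambda>k. t ^ Suc k *\<^sub>C G (Suc k)) sums (x - d 0)" using sums_Suc_iff[of "\<lambda>k. t ^ k *\<^sub>C G k" "x - d 0"] x by (simp add: G0)
    moreover have "(\<lambda>k. t ^ Suc k *\<^sub>C d (Suc k)) sums (y - d 0)" using sums_Suc_iff[of "\<lambda>k. t ^ k *\<^sub>C d k" "y - d 0"] y by simp
    moreover have "(\<lambda>k. (of_real r * t) *\<^sub>C (t ^ k *\<^sub>C G k)) sums ((of_real r * t) *\<^sub>C x)"
      by (rule bounded_linear.sums[OF bounded_clinearD(1)[OF bounded_clinear_scaleC[OF bounded_clinear_id]] x])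
    ultimately have "(\<lambda>k. (of_real r * t) *\<^sub>C (t ^ k *\<^sub>C G k) + t ^ Suc k *\<^sub>C d (Suc k)) sums ((of_real r * t) *\<^sub>C x + (y - d 0))"
      by (intro sums_add)
    moreover have "(of_real r * t) *\<^sub>C (t ^ k *\<^sub>C G k) + t ^ Suc k *\<^sub>C d (Suc k) = t ^ Suc k *\<^sub>C G (Suc k)" for k
      by (simp add: GS scaleC_add_right scaleR_scaleC scaleC_scaleC mult_ac)
    ultimately have "(of_real r * t) *\<^sub>C x + (y - d 0) = x - d 0"
      using \<open>(\<lambda>k. t ^ Suc k *\<^sub>C G (Suc k)) sums (x - d 0)\<close> by (simp add: sums_unique2)
    then have "(1 - of_real r * t) *\<^sub>C x = y" by (simp add: complex_vector.scale_left_diff_distrib algebra_simps)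
    then show ?thesis using x y by (simp add: sums_iff)
  qed
  have cisp: "cis (real k * s) = cis s ^ k" for k s by (rule Complex.DeMoivre[symmetric])
  have cG: "circ d s = (1 - of_real r * cis s) *\<^sub>C circ G s" for s
    unfolding circ_def cisp by (rule shift[symmetric]) simp
  define x where "x = suminf (\<lambda>k. of_real r ^ k *\<^sub>C G k)"
  have dx: "suminf (\<lambda>k. r ^ k *\<^sub>R d k) = (1 - of_real (r\<^sup>2)) *\<^sub>C x"
    using shift[of "of_real r"] r unfolding x_def by (simp add: scaleR_scaleC power2_eq_square)
  have r2: "r\<^sup>2 < 1" using r by (simp add: abs_square_less_1)
  have "cmod (1 - (of_real r)\<^sup>2) = 1 - r\<^sup>2"
    using r2 norm_of_real[of "1 - r\<^sup>2", where ?'a = complex] by simp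
  then have nx: "(norm (suminf (\<lambda>k. r ^ k *\<^sub>R d k)))\<^sup>2 = (1 - r\<^sup>2)\<^sup>2 * (norm x)\<^sup>2"
    unfolding dx by (simp add: norm_scaleC power_mult_distrib)
  have "summable (\<lambda>k. r ^ k *\<^sub>R G k)"
    by (rule summable_comparison_test'[OF G]) (use r in \<open>simp add: mult_left_le_one_le power_le_one\<close>)
  then have "(\<lambda>k. r ^ k *\<^sub>R G k) sums x" unfolding x_def by (simp add: scaleR_scaleC summable_sums)
  from suminf_Cauchy_Schwarz[OF norm_square_summable[OF G] r this]
  have 1: "(norm (suminf (\<lambda>k. r ^ k *\<^sub>R d k)))\<^sup>2 \<le> (1 - r\<^sup>2) * suminf (\<lambda>k. (norm (G k))\<^sup>2)"
    unfolding nx using r2 by (simp add: power2_eq_square[of "1 - r\<^sup>2"] mult.assoc mult_left_mono mult.commute)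
  have "(1 - r\<^sup>2) / (cmod (1 - of_real r * cis s))\<^sup>2 * (norm (circ d s))\<^sup>2 = (1 - r\<^sup>2) * (norm (circ G s))\<^sup>2" for s
  proof -
    have "cmod (of_real r * cis s) < 1" using r by (simp add: norm_mult)
    then have "1 - of_real r * cis s \<noteq> 0" by auto
    then show ?thesis by (simp add: cG norm_scaleC power_mult_distrib)
  qed
  moreover have "((\<lambda>s. (1 - r\<^sup>2) * (norm (circ G s))\<^sup>2) has_integral (1 - r\<^sup>2) * (2 * pi * suminf (\<lambda>k. (norm (G k))\<^sup>2))) {-pi..pi}"
    using has_integral_mult_right[OF circ_parseval[OF G, of 1], of "1 - r\<^sup>2"] by simp
  ultimately have "((\<lambda>s. (1 - r\<^sup>2) / (cmod (1 - of_real r * cis s))\<^sup>2 * (norm (circ d s))\<^sup>2) has_integral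
      (1 - r\<^sup>2) * (2 * pi * suminf (\<lambda>k. (norm (G k))\<^sup>2))) {-pi..pi}" by (simp only:)
  note integral_unique[OF this]
  then show ?thesis using 1 mult_left_mono[OF 1, of "2 * pi"] by (simp add: mult_ac)
qed

text \<open>With \<open>h = 1 - r\<close> this majorises the Poisson kernel on
  \<open>{-pi..pi}\<close> for \<open>r \<ge> 1/2\<close>; the 6 comes from
  \<open>one_minus_cos_lower\<close>.\<close>

abbreviation pkernel :: "real \<Rightarrow> real \<Rightarrow> real" where
  "pkernel h s \<equiv> 2 * h / (h\<^sup>2 + s\<^sup>2 / 6)"

text \<open>At the half angle \<open>x = s / 2\<close> one has \<open>|x| \<le> 2\<close>, so
  Taylor's formula of order 4 gives \<open>1 - cos x \<ge> x^2 / 3\<close>. Doubling the angle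
  multiplies this by \<open>2 (1 + cos x) \<ge> 2\<close>.\<close>

lemma one_minus_cos_lower:
  assumes "\<bar>s\<bar> \<le> pi"
  shows "s\<^sup>2 / 6 \<le> 1 - cos s"
proof -
  define x where "x = s / 2"
  have x: "\<bar>x\<bar> \<le> pi / 2" using assms by (simp add: x_def)
  obtain t where t: "cos x = (\<Sum>m<4. cos_coeff m * x ^ m) + (cos (t + 1/2 * real 4 * pi) / fact 4) * x ^ 4"
    using Maclaurin_cos_expansion[of x 4] by blast
  have "{..<4} = {0, 1, 2, 3::nat}" by auto
  then have "(\<Sum>m<4. cos_coeff m * x ^ m) = 1 - x\<^sup>2 / 2" by (simp add: cos_coeff_def)
  moreover have "(cos (t + 1/2 * real 4 * pi) / fact 4) * x ^ 4 \<le> (1 / 24) * x ^ 4"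
    by (intro mult_right_mono) (simp_all add: fact_numeral)
  ultimately have c: "cos x \<le> 1 - x\<^sup>2 / 2 + x ^ 4 / 24" using t by simp
  have "\<bar>x\<bar> \<le> 2" using x pi_less_4 by simp
  then have "x\<^sup>2 \<le> 2\<^sup>2" by (metis abs_le_square_iff abs_numeral)
  then have "x\<^sup>2 * x\<^sup>2 \<le> 4 * x\<^sup>2" by (intro mult_right_mono) auto
  then have "x ^ 4 \<le> 4 * x\<^sup>2" by (simp add: power_numeral_even power2_eq_square mult.assoc)
  then have 1: "x\<^sup>2 / 3 \<le> 1 - cos x" using c by simp
  have "cos x \<ge> 0" using x by (intro cos_ge_zero) auto
  then have "(1 - cos x) * 1 \<le> (1 - cos x) * (1 + cos x)" by (intro mult_left_mono) auto
  moreover have "1 - cos s = 2 * ((1 - cos x) * (1 + cos x))"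
    using cos_double_cos[of x] by (simp add: x_def algebra_simps power2_eq_square)
  ultimately show ?thesis using 1 by (simp add: x_def power_divide)
qed

lemma poisson_kernel_le:
  assumes "1/2 \<le> r" "r < 1" "\<bar>s\<bar> \<le> pi"
  shows "(1 - r\<^sup>2) / (cmod (1 - of_real r * cis s))\<^sup>2 \<le> pkernel (1 - r) s"
proof -
  have "(cmod (1 - of_real r * cis s))\<^sup>2 = (1 - r * cos s)\<^sup>2 + (r * sin s)\<^sup>2" by (simp add: cmod_power2)
  also have "\<dots> = 1 - 2 * r * cos s + r\<^sup>2 * ((sin s)\<^sup>2 + (cos s)\<^sup>2)" by algebra
  also have "\<dots> = (1 - r)\<^sup>2 + 2 * r * (1 - cos s)" unfolding sin_cos_squared_add by (simp add: power2_eq_square algebra_simps)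
  finally have e: "(cmod (1 - of_real r * cis s))\<^sup>2 = (1 - r)\<^sup>2 + 2 * r * (1 - cos s)" .
  have "1 * (s\<^sup>2 / 6) \<le> (2 * r) * (1 - cos s)" using assms one_minus_cos_lower by (intro mult_mono) auto
  then have "(1 - r)\<^sup>2 + s\<^sup>2 / 6 \<le> (cmod (1 - of_real r * cis s))\<^sup>2" unfolding e by simp
  moreover have "0 < (1 - r)\<^sup>2 + s\<^sup>2 / 6" using assms(2) by (intro add_pos_nonneg) auto
  moreover have "1 - r\<^sup>2 \<le> 2 * (1 - r)"
    using assms mult_right_mono[of "1 + r" 2 "1 - r"] by (simp add: power2_eq_square algebra_simps)
  moreover have "r\<^sup>2 \<le> 1" using assms by (simp add: abs_square_le_1)
  ultimately show ?thesis by (intro frac_le) auto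
qed

text \<open>A mixture of indicators of intervals around 0 dominates the kernel, which reduces its
  integrals to averages. On the shell \<open>2^(k-1) h < |s| \<le> 2^k h\<close> the kernel is at
  most \<open>12 h / s^2\<close>, hence at most \<open>(48 / h) / 4^k\<close>. The cut-off \<delta>
  keeps the intervals inside the range where averages are controlled.\<close>

lemma dyadic_kernel_bound:
  fixes h \<delta> :: real
  assumes h: "0 < h" and \<delta>: "0 < \<delta>"
  shows "\<exists>N. \<forall>s. pkernel h s
    \<le> (\<Sum>k\<le>N. (48 / h) * (1/4) ^ k * indicator {- min (2 ^ k * h) \<delta>..min (2 ^ k * h) \<delta>} s) + 12 * h / \<delta>\<^sup>2"
proof -
  obtain N where N: "\<delta> / h < 2 ^ N" using real_arch_pow[where x = 2 and y = "\<delta> / h"] by auto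
  have "pkernel h s \<le> (\<Sum>k\<le>N. (48 / h) * (1/4) ^ k * indicator {- min (2 ^ k * h) \<delta>..min (2 ^ k * h) \<delta>} s) + 12 * h / \<delta>\<^sup>2" for s
  proof -
    let ?K = "pkernel h s"
    let ?g = "\<lambda>k. (48 / h) * (1/4) ^ k * indicator {- min (2 ^ k * h) \<delta>..min (2 ^ k * h) \<delta>} s :: real"
    have g0: "0 \<le> ?g k" for k using h by simp
    have far: "?K \<le> 12 * h / u\<^sup>2" if "0 < u" "u \<le> \<bar>s\<bar>" for u
    proof -
      have "u\<^sup>2 \<le> s\<^sup>2" using that by (metis abs_le_square_iff abs_of_pos)
      then have "u\<^sup>2 / 6 \<le> h\<^sup>2 + s\<^sup>2 / 6" using zero_le_power2[of h] by linarith
      then have "?K \<le> 2 * h / (u\<^sup>2 / 6)" using h that by (intro divide_left_mono) (auto intro!: mult_pos_pos add_pos_nonneg)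
      then show ?thesis by simp
    qed
    show ?thesis
    proof (cases "\<bar>s\<bar> \<le> \<delta>")
      case False
      then have "?K \<le> 12 * h / \<delta>\<^sup>2" using far[of \<delta>] \<delta> by simp
      then show ?thesis using sum_nonneg[of "{..N}" ?g] g0 by (simp add: add_increasing)
    next
      case True
      have ex: "\<bar>s\<bar> \<le> 2 ^ N * h" using True N h by (simp add: field_simps)
      define k where "k = (LEAST k. \<bar>s\<bar> \<le> 2 ^ k * h)"
      have k: "\<bar>s\<bar> \<le> 2 ^ k * h" unfolding k_def by (rule LeastI[of "\<lambda>k. \<bar>s\<bar> \<le> 2 ^ k * h", OF ex])
      have kN: "k \<le> N" unfolding k_def by (rule Least_le[of "\<lambda>k. \<bar>s\<bar> \<le> 2 ^ k * h", OF ex])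
      have "?K \<le> (48 / h) * (1/4) ^ k"
      proof (cases k)
        case 0
        have "?K \<le> 2 * h / h\<^sup>2" using h by (intro divide_left_mono) (auto intro!: mult_pos_pos add_pos_nonneg)
        also have "\<dots> \<le> 48 / h" using h by (simp add: power2_eq_square divide_simps)
        finally show ?thesis using 0 by simp
      next
        case (Suc j)
        have "\<not> \<bar>s\<bar> \<le> 2 ^ j * h" using not_less_Least[of j "\<lambda>k. \<bar>s\<bar> \<le> 2 ^ k * h"] Suc by (simp add: k_def)
        then have "?K \<le> 12 * h / (2 ^ j * h)\<^sup>2" using far[of "2 ^ j * h"] h by simp
        also have "\<dots> = (48 / h) * (1/4) ^ k"
        proof -
          have "(2 ^ j :: real)\<^sup>2 = 4 ^ j" by (simp add: power2_eq_square flip: power_mult_distrib)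
          then show ?thesis using h Suc by (simp add: power_mult_distrib power_divide field_simps power2_eq_square)
        qed
        finally show ?thesis .
      qed
      also have "\<dots> = ?g k" using k True by (simp add: indicator_def) linarith?
      also have "\<dots> \<le> (\<Sum>k\<le>N. ?g k)" by (rule member_le_sum) (use kN g0 in auto)
      finally show ?thesis using h by (simp add: add_increasing2)
    qed
  qed
  then show ?thesis by blast
qed

text \<open>The dyadic interval \<open>k\<close> contributes at most
  \<open>(48 / h) 4^(-k) L 2^k h = 48 L 2^(-k)\<close>, in total \<open>96 L\<close>. The remainder
  disappears as \<open>h\<close> tends to 0, so in the limit only averages near 0 count.\<close>

lemma kernel_integral_bound:
  fixes \<psi> :: "real \<Rightarrow> real"
  assumes \<psi>: "integrable lborel \<psi>" "\<And>s. 0 \<le> \<psi> s" and h: "0 < h" and \<delta>: "0 < \<delta>" and L: "0 \<le> L"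
    and avg: "\<And>t. 0 < t \<Longrightarrow> t \<le> \<delta> \<Longrightarrow> (LINT s|lborel. indicator {-t..t} s * \<psi> s) \<le> L * t"
  shows "integrable lborel (\<lambda>s. pkernel h s * \<psi> s)"
    "(LINT s|lborel. pkernel h s * \<psi> s) \<le> 96 * L + 12 * h / \<delta>\<^sup>2 * (LINT s|lborel. \<psi> s)"
proof -
  obtain N where N: "\<And>s. pkernel h s
    \<le> (\<Sum>k\<le>N. (48 / h) * (1/4) ^ k * indicator {- min (2 ^ k * h) \<delta>..min (2 ^ k * h) \<delta>} s) + 12 * h / \<delta>\<^sup>2"
    using dyadic_kernel_bound[OF h \<delta>] by blast
  let ?m = "\<lambda>k. min (2 ^ k * h) \<delta>"
  have ii: "integrable lborel (\<lambda>s. indicator {-t..t} s * \<psi> s)" for t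
    using integrable_real_mult_indicator[OF _ \<psi>(1), of "{-t..t}"] by (simp add: mult.commute)
  have K: "0 \<le> pkernel h s" for s using h by simp
  have "integrable lborel (\<lambda>s. (2 / h) * \<psi> s)" using \<psi>(1) by simp
  then show iK: "integrable lborel (\<lambda>s. pkernel h s * \<psi> s)"
  proof (rule Bochner_Integration.integrable_bound)
    show "(\<lambda>s. pkernel h s * \<psi> s) \<in> borel_measurable lborel" using \<psi>(1) by (auto dest: borel_measurable_integrable)
    show "AE s in lborel. norm (pkernel h s * \<psi> s) \<le> norm ((2 / h) * \<psi> s)"
    proof (rule AE_I2)
      fix s
      have "pkernel h s \<le> 2 * h / h\<^sup>2" using h by (intro divide_left_mono) (auto intro!: mult_pos_pos add_pos_nonneg)
      also have "\<dots> = 2 / h" using h by (simp add: power2_eq_square)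
      finally have "pkernel h s * \<psi> s \<le> (2 / h) * \<psi> s" by (rule mult_right_mono[OF _ \<psi>(2)])
      then show "norm (pkernel h s * \<psi> s) \<le> norm ((2 / h) * \<psi> s)"
        using mult_nonneg_nonneg[OF K \<psi>(2), of s s] by (simp only: real_norm_def abs_of_nonneg abs_ge_self order_trans)
    qed
  qed
  have "(LINT s|lborel. pkernel h s * \<psi> s)
    \<le> (LINT s|lborel. (\<Sum>k\<le>N. (48 / h) * (1/4) ^ k * (indicator {- ?m k..?m k} s * \<psi> s)) + 12 * h / \<delta>\<^sup>2 * \<psi> s)"
  proof (rule integral_mono[OF iK])
    show "integrable lborel (\<lambda>s. (\<Sum>k\<le>N. (48 / h) * (1/4) ^ k * (indicator {- ?m k..?m k} s * \<psi> s)) + 12 * h / \<delta>\<^sup>2 * \<psi> s)"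
      by (intro Bochner_Integration.integrable_add Bochner_Integration.integrable_sum integrable_mult_right ii \<psi>)
    show "pkernel h s * \<psi> s \<le> (\<Sum>k\<le>N. (48 / h) * (1/4) ^ k * (indicator {- ?m k..?m k} s * \<psi> s)) + 12 * h / \<delta>\<^sup>2 * \<psi> s" for s
      using mult_right_mono[OF N[of s] \<psi>(2)[of s]] by (simp only: distrib_right sum_distrib_right mult.assoc)
  qed
  also have "\<dots> = (\<Sum>k\<le>N. (48 / h) * (1/4) ^ k * (LINT s|lborel. indicator {- ?m k..?m k} s * \<psi> s)) + 12 * h / \<delta>\<^sup>2 * (LINT s|lborel. \<psi> s)"
    by (subst Bochner_Integration.integral_add)
       (auto intro!: Bochner_Integration.integrable_sum integrable_mult_right ii \<psi> simp: Bochner_Integration.integral_sum ii)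
  also have "(\<Sum>k\<le>N. (48 / h) * (1/4) ^ k * (LINT s|lborel. indicator {- ?m k..?m k} s * \<psi> s)) \<le> (\<Sum>k\<le>N. 48 * L * (1/2) ^ k)"
  proof (rule sum_mono)
    fix k
    have "(LINT s|lborel. indicator {- ?m k..?m k} s * \<psi> s) \<le> L * ?m k" by (rule avg) (use h \<delta> in auto)
    also have "\<dots> \<le> L * (2 ^ k * h)" by (intro mult_left_mono L) simp
    finally have "(48 / h) * (1/4) ^ k * (LINT s|lborel. indicator {- ?m k..?m k} s * \<psi> s) \<le> (48 / h) * (1/4) ^ k * (L * (2 ^ k * h))"
      by (intro mult_left_mono) (use h in auto)
    also have "\<dots> = 48 * L * ((1/4) ^ k * 2 ^ k)" using h by simp
    also have "(1/4) ^ k * 2 ^ k = (1/2 :: real) ^ k" by (simp flip: power_mult_distrib)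
    finally show "(48 / h) * (1/4) ^ k * (LINT s|lborel. indicator {- ?m k..?m k} s * \<psi> s) \<le> 48 * L * (1/2) ^ k" .
  qed
  also have "(\<Sum>k\<le>N. 48 * L * (1/2) ^ k) \<le> 96 * L"
  proof -
    have "(\<Sum>k\<le>N. (1/2 :: real) ^ k) \<le> 2" by (simp add: sum_gp0)
    from mult_left_mono[OF this, of "48 * L"] L show ?thesis unfolding sum_distrib_left[symmetric] by simp
  qed
  finally show "(LINT s|lborel. pkernel h s * \<psi> s) \<le> 96 * L + 12 * h / \<delta>\<^sup>2 * (LINT s|lborel. \<psi> s)" by simp
qed

lemma AE_lborel_shift:
  fixes a :: real
  assumes "AE x in lborel. P x"
  shows "AE s in lborel. P (a + s)"
proof -
  obtain N where N: "N \<in> null_sets lborel" "{x. \<not> P x} \<subseteq> N" using assms by (auto simp: eventually_ae_filter)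
  have "{s. s - (- a) \<in> N} \<in> null_sets lborel" by (rule null_sets_translation[OF N(1)])
  then show ?thesis by (rule AE_I') (use N(2) in \<open>auto simp: add.commute\<close>)
qed

lemma negligible_AE_lborel:
  assumes "negligible N"
  shows "AE x in lborel. x \<notin> N"
proof -
  have "N \<in> null_sets lebesgue" using assms by (simp add: negligible_iff_null_sets)
  then have "AE x in lebesgue. x \<notin> N" by (rule AE_not_in)
  then show ?thesis by (simp add: AE_completion_iff)
qed

text \<open>One-sided differentiation is applied to \<open>g\<close> and to its reflection; the
  factor 2 stems from the two halves of \<open>{-t..t}\<close>.\<close>

lemma symmetric_Lebesgue_differentiation:
  fixes g :: "real \<Rightarrow> real"
  assumes g: "integrable lborel g"
  shows "AE x in lborel. \<forall>e>0. \<exists>d>0. \<forall>t. 0 < t \<and> t \<le> d \<longrightarrow>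
    (LINT s|lborel. indicator {-t..t} s * g (x + s)) \<le> (2 * g x + e) * t"
proof -
  have si: "set_integrable lborel {a..b} f" if "integrable lborel f" for a b and f :: "real \<Rightarrow> real"
    unfolding set_integrable_def by (rule integrable_mult_indicator[OF _ that]) simp
  have io: "f integrable_on {a..b}" if "integrable lborel f" for a b and f :: "real \<Rightarrow> real"
    by (rule set_borel_integral_eq_integral(1)[OF si[OF that]])
  have g': "integrable lborel (\<lambda>x. g (- x))" using lborel_integrable_real_affine[OF g, of "-1" 0] by simp
  obtain N1 where N1: "negligible N1"
    "\<And>x e. \<lbrakk>x \<notin> N1; 0 < e\<rbrakk> \<Longrightarrow> \<exists>d>0. \<forall>h. 0 < h \<and> h < d \<longrightarrow> norm (integral {x..x + h} g / h - g x) < e"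
    using integrable_ccontinuous_explicit[of g] io[OF g] by (auto simp: divide_inverse mult.commute)
  obtain N2 where N2: "negligible N2"
    "\<And>x e. \<lbrakk>x \<notin> N2; 0 < e\<rbrakk> \<Longrightarrow> \<exists>d>0. \<forall>h. 0 < h \<and> h < d \<longrightarrow> norm (integral {x..x + h} (\<lambda>x. g (- x)) / h - g (- x)) < e"
    using integrable_ccontinuous_explicit[of "\<lambda>x. g (- x)"] io[OF g'] by (auto simp: divide_inverse mult.commute)
  have "negligible (uminus ` N2)" by (rule negligible_differentiable_image_negligible[OF _ N2(1)]) auto
  then have "negligible (N1 \<union> uminus ` N2)" using N1(1) by simp
  from negligible_AE_lborel[OF this] show ?thesis
  proof (rule AE_mp, intro AE_I2 impI allI)
    fix x e :: real assume x: "x \<notin> N1 \<union> uminus ` N2" and e: "0 < e"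
    then have x2: "- x \<notin> N2" by (metis UnI2 image_eqI minus_minus)
    obtain d1 where d1: "d1 > 0" "\<And>h. 0 < h \<Longrightarrow> h < d1 \<Longrightarrow> norm (integral {x..x + h} g / h - g x) < e / 2"
      using N1(2)[of x "e / 2"] x e by auto
    obtain d2 where d2: "d2 > 0" "\<And>h. 0 < h \<Longrightarrow> h < d2 \<Longrightarrow> norm (integral {- x..- x + h} (\<lambda>x. g (- x)) / h - g x) < e / 2"
      using N2(2)[of "- x" "e / 2"] x2 e by auto
    show "\<exists>d>0. \<forall>t. 0 < t \<and> t \<le> d \<longrightarrow> (LINT s|lborel. indicator {-t..t} s * g (x + s)) \<le> (2 * g x + e) * t"
    proof (intro exI[of _ "min d1 d2 / 2"] conjI allI impI)
      fix t assume "0 < t \<and> t \<le> min d1 d2 / 2"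
      then have t: "0 < t" "t < d1" "t < d2" using d1(1) d2(1) by (auto simp: min_def split: if_splits)
      have "(LINT s|lborel. indicator {-t..t} s * g (x + s)) = (LINT u|lborel. indicator {x-t..x+t} u * g u)"
        using lborel_integral_real_affine[of 1 "\<lambda>u. indicator {x-t..x+t} u * g u" x]
        by (simp add: indicator_def if_distrib[of "\<lambda>a. a * _"] cong: if_cong)
      also have "\<dots> = integral {x-t..x+t} g"
        using set_borel_integral_eq_integral(2)[OF si[OF g, of "x-t" "x+t"]] by (simp add: set_lebesgue_integral_def)
      also have "\<dots> = integral {x-t..x} g + integral {x..x+t} g"
        by (rule Henstock_Kurzweil_Integration.integral_combine[symmetric]) (use t io[OF g] in auto)
      also have "integral {x-t..x} g = integral {- x..- x + t} (\<lambda>x. g (- x))"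
        using Henstock_Kurzweil_Integration.integral_reflect_real[of x "x - t" g] by simp
      finally have eq: "(LINT s|lborel. indicator {-t..t} s * g (x + s)) = integral {- x..- x + t} (\<lambda>x. g (- x)) + integral {x..x+t} g" .
      have "integral {x..x + t} g / t - g x < e / 2" "integral {- x..- x + t} (\<lambda>x. g (- x)) / t - g x < e / 2"
        using d1(2)[OF t(1,2)] d2(2)[OF t(1,3)] unfolding real_norm_def by linarith+
      then have "(integral {- x..- x + t} (\<lambda>x. g (- x)) + integral {x..x+t} g) / t \<le> 2 * g x + e" unfolding add_divide_distrib by linarith
      then show "(LINT s|lborel. indicator {-t..t} s * g (x + s)) \<le> (2 * g x + e) * t"
        unfolding eq using t(1) by (simp add: pos_divide_le_eq)
    qed (use d1(1) d2(1) in simp)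
  qed
qed

lemma convergent_filterI:
  fixes f :: "'b \<Rightarrow> 'a::complete_space"
  assumes "\<And>e. e > 0 \<Longrightarrow> \<exists>y. eventually (\<lambda>x. dist (f x) y < e) G" "G \<noteq> bot"
  shows "\<exists>l. (f \<longlongrightarrow> l) G"
proof -
  have "cauchy_filter (filtermap f G)"
    unfolding cauchy_filter_metric_filtermap
  proof (intro allI impI)
    fix e :: real assume "0 < e"
    then obtain y where "eventually (\<lambda>x. dist (f x) y < e / 2) G" using assms(1)[of "e / 2"] by auto
    then show "\<exists>P. eventually P G \<and> (\<forall>x x'. P x \<and> P x' \<longrightarrow> dist (f x) (f x') < e)"
      by (intro exI[of _ "\<lambda>x. dist (f x) y < e / 2"]) (auto intro: dist_triangle_half_l)
  qed
  then obtain l where "filtermap f G \<le> nhds l"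
    using cauchy_filter_complete_converges[OF _ complete_UNIV, of "filtermap f G"] assms(2) by (auto simp: filtermap_bot_iff)
  then show ?thesis by (auto simp: filterlim_def)
qed

lemma power_series_continuous:
  fixes e :: "nat \<Rightarrow> 'a::banach"
  assumes B: "\<And>k. norm (e k) \<le> B" and q: "0 \<le> q" "q < 1"
  shows "continuous_on {0..q} (\<lambda>x. suminf (\<lambda>k. x ^ k *\<^sub>R e k))" "summable (\<lambda>k. norm (q ^ k *\<^sub>R e k))"
proof -
  have s: "summable (\<lambda>k. q ^ k * B)" using q by (intro summable_mult2 summable_geometric) simp
  have n: "norm (x ^ k *\<^sub>R e k) \<le> q ^ k * B" if "x \<in> {0..q}" for x k
    using that B[of k] order_trans[OF norm_ge_zero B] by (auto intro!: mult_mono power_mono)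
  have "uniform_limit {0..q} (\<lambda>n x. \<Sum>k<n. x ^ k *\<^sub>R e k) (\<lambda>x. suminf (\<lambda>k. x ^ k *\<^sub>R e k)) sequentially"
    by (rule Weierstrass_m_test[OF n s])
  then show "continuous_on {0..q} (\<lambda>x. suminf (\<lambda>k. x ^ k *\<^sub>R e k))"
    by (rule uniform_limit_theorem[rotated]) (auto intro!: always_eventually continuous_intros)
  show "summable (\<lambda>k. norm (q ^ k *\<^sub>R e k))" by (rule summable_comparison_test'[OF s]) (use n[of q] q in simp)
qed

lemma one_minus_power_square:
  fixes \<rho> x :: real
  assumes "0 \<le> \<rho>" "\<rho> \<le> 1" "0 \<le> x"
  shows "norm ((1 - \<rho> ^ k)\<^sup>2 * x) \<le> x"
proof -
  have "0 \<le> \<rho> ^ k" "\<rho> ^ k \<le> 1" using assms by (auto intro: power_le_one)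
  then have "(1 - \<rho> ^ k)\<^sup>2 \<le> 1" by (simp add: abs_square_le_1)
  then show ?thesis using assms by (simp add: mult_left_le_one_le)
qed

lemma abel_defect_small:
  fixes c :: "nat \<Rightarrow> 'a::real_normed_vector"
  assumes c: "summable (\<lambda>k. (norm (c k))\<^sup>2)" and e: "0 < e"
  shows "\<exists>\<rho>. 1 - e \<le> \<rho> \<and> 0 \<le> \<rho> \<and> \<rho> < 1 \<and> suminf (\<lambda>k. (1 - \<rho> ^ k)\<^sup>2 * (norm (c k))\<^sup>2) < e"
proof -
  define g where "g \<rho> = suminf (\<lambda>k. (1 - \<rho> ^ k)\<^sup>2 * (norm (c k))\<^sup>2)" for \<rho> :: real
  have n: "norm ((1 - \<rho> ^ k)\<^sup>2 * (norm (c k))\<^sup>2) \<le> (norm (c k))\<^sup>2" if "\<rho> \<in> {0..1}" for \<rho> :: real and k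
    by (rule one_minus_power_square) (use that in auto)
  have "uniform_limit {0..1} (\<lambda>n \<rho>. \<Sum>k<n. (1 - \<rho> ^ k)\<^sup>2 * (norm (c k))\<^sup>2) g sequentially"
    unfolding g_def[abs_def] by (rule Weierstrass_m_test[OF n c])
  then have "continuous_on {0..1} g"
    by (rule uniform_limit_theorem[rotated]) (auto intro!: always_eventually continuous_intros)
  moreover have "g 1 = 0" by (simp add: g_def)
  ultimately have "(g \<longlongrightarrow> 0) (at 1 within {0..1})" by (metis continuous_on_def atLeastAtMost_iff order_refl zero_le_one)
  then have "(g \<longlongrightarrow> 0) (at_left 1)" by (simp add: at_within_Icc_at_left)
  then have "\<forall>\<^sub>F \<rho> in at_left 1. dist (g \<rho>) 0 < e" by (rule tendstoD[OF _ e])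
  moreover have "\<forall>\<^sub>F \<rho> in at_left 1. \<rho> \<in> {max 0 (1 - e)<..<1}" by (rule eventually_at_left_real) (use e in auto)
  ultimately have "\<forall>\<^sub>F \<rho> in at_left 1. 1 - e \<le> \<rho> \<and> 0 \<le> \<rho> \<and> \<rho> < 1 \<and> g \<rho> < e"
    by eventually_elim (auto simp: dist_real_def)
  then show ?thesis unfolding g_def using eventually_happens[of _ "at_left (1::real)"] by auto
qed

lemma circ_sum:
  assumes "finite I" "\<And>i. i \<in> I \<Longrightarrow> summable (\<lambda>k. norm (d i k))"
  shows "circ (\<lambda>k. \<Sum>i\<in>I. d i k) t = (\<Sum>i\<in>I. circ (d i) t)"
proof -
  have "(\<lambda>k. \<Sum>i\<in>I. cis (real k * t) *\<^sub>C d i k) sums (\<Sum>i\<in>I. circ (d i) t)"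
    unfolding circ_def by (intro sums_sum summable_sums circ_summable(1) assms)
  then show ?thesis unfolding circ_def by (simp add: sums_iff scaleC_sum_right)
qed

text \<open>Dilations by \<rho> l are chosen with mean square differences of order
  \<open>(1/8) ^ l\<close>. The weighted squared differences \<open>\<phi> l\<close> have integrable
  sum, and the tail \<open>\<Phi> j\<close> majorises, up to a factor 2, the squared difference of
  the dilations \<open>i\<close> and \<open>j\<close> for all \<open>i \<ge> j\<close>. The Poisson
  inequality, with differentiation of the integral of \<open>\<Phi> j\<close> at \<theta>, carries
  this bound from the circle to the radius, and \<open>\<Phi> j \<theta>\<close> tends to 0. Only
  countably many exceptional null sets occur.\<close>

theorem Fatou_radial_limit:
  fixes c :: "nat \<Rightarrow> 'a::chilbert_space"
  assumes c: "summable (\<lambda>k. (norm (c k))\<^sup>2)"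
  shows "AE \<theta> in lborel. \<theta> \<in> {-pi..pi} \<longrightarrow>
    (\<exists>l. ((\<lambda>r. suminf (\<lambda>k. r ^ k *\<^sub>R (cis (real k * \<theta>) *\<^sub>C c k))) \<longlongrightarrow> l) (at_left 1))"
proof -
  have "\<exists>\<rho>. 1 - (1/8) ^ l \<le> \<rho> \<and> 0 \<le> \<rho> \<and> \<rho> < 1 \<and> suminf (\<lambda>k. (1 - \<rho> ^ k)\<^sup>2 * (norm (c k))\<^sup>2) < (1/8) ^ l" for l
    by (rule abel_defect_small[OF c]) simp
  then have "\<exists>\<rho>. \<forall>l. 1 - (1/8) ^ l \<le> \<rho> l \<and> 0 \<le> \<rho> l \<and> \<rho> l < 1 \<and> suminf (\<lambda>k. (1 - \<rho> l ^ k)\<^sup>2 * (norm (c k))\<^sup>2) < (1/8) ^ l"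
    by (intro choice allI)
  then obtain \<rho> where "\<forall>l. 1 - (1/8) ^ l \<le> \<rho> l \<and> 0 \<le> \<rho> l \<and> \<rho> l < 1 \<and> suminf (\<lambda>k. (1 - \<rho> l ^ k)\<^sup>2 * (norm (c k))\<^sup>2) < (1/8) ^ l"
    by (rule exE)
  then have \<rho>: "\<And>l. 1 - (1/8) ^ l \<le> \<rho> l" "\<And>l. 0 \<le> \<rho> l" "\<And>l. \<rho> l < 1"
    "\<And>l. suminf (\<lambda>k. (1 - \<rho> l ^ k)\<^sup>2 * (norm (c k))\<^sup>2) < (1/8) ^ l" by simp_all
  have \<rho>lim: "\<rho> \<longlonglongrightarrow> 1"
  proof (rule tendsto_sandwich)
    have "(\<lambda>l. 1 - (1/8 :: real) ^ l) \<longlonglongrightarrow> 1 - 0" by (intro tendsto_intros LIMSEQ_realpow_zero) auto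
    then show "(\<lambda>l. 1 - (1/8 :: real) ^ l) \<longlonglongrightarrow> 1" by simp
  qed (auto intro!: always_eventually \<rho>(1) less_imp_le[OF \<rho>(3)])
  obtain B where B: "norm (c k) \<le> B" for k
  proof -
    have "norm (c k) \<le> sqrt (suminf (\<lambda>k. (norm (c k))\<^sup>2))" for k
      using sum_le_suminf[OF c, of "{k}"] by (intro real_le_rsqrt) auto
    then show ?thesis by (rule that)
  qed
  have sumr: "summable (\<lambda>k. norm (q ^ k *\<^sub>R c k))" if "0 \<le> q" "q < 1" for q
    by (rule power_series_continuous(2)[OF B that])
  \<comment> \<open>Differences of consecutive dilations. Their boundary functions are continuous
    although the original series need not converge on the circle.\<close>
  define D where "D l k = (\<rho> (Suc l) ^ k - \<rho> l ^ k) *\<^sub>R c k" for l k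
  have sumd: "summable (\<lambda>k. norm ((\<rho> i ^ k - \<rho> j ^ k) *\<^sub>R c k))" for i j
    by (rule summable_comparison_test'[OF summable_add[OF sumr[OF \<rho>(2,3)[of i]] sumr[OF \<rho>(2,3)[of j]]]])
       (simp add: norm_triangle_ineq4 scaleR_left_diff_distrib del: norm_scaleR)
  have D: "summable (\<lambda>k. norm (D l k))" for l unfolding D_def by (rule sumd)
  have D2: "suminf (\<lambda>k. (norm (D l k))\<^sup>2) \<le> 4 * (1/8) ^ l" for l
  proof -
    have s: "summable (\<lambda>k. (1 - \<rho> l ^ k)\<^sup>2 * (norm (c k))\<^sup>2)" for l
      by (rule summable_comparison_test'[OF c one_minus_power_square]) (use \<rho>(2,3)[of l] in auto)
    have "(norm (D l k))\<^sup>2 \<le> 2 * ((1 - \<rho> (Suc l) ^ k)\<^sup>2 * (norm (c k))\<^sup>2) + 2 * ((1 - \<rho> l ^ k)\<^sup>2 * (norm (c k))\<^sup>2)" for k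
    proof -
      have "(a - b)\<^sup>2 \<le> 2 * (1 - a)\<^sup>2 + 2 * (1 - b)\<^sup>2" for a b :: real
        using zero_le_power2[of "2 - a - b"] by (simp add: power2_eq_square algebra_simps)
      from mult_right_mono[OF this, of "(norm (c k))\<^sup>2" "\<rho> (Suc l) ^ k" "\<rho> l ^ k"]
      show ?thesis by (simp add: D_def power_mult_distrib distrib_right mult.assoc)
    qed
    then have "suminf (\<lambda>k. (norm (D l k))\<^sup>2) \<le> suminf (\<lambda>k. 2 * ((1 - \<rho> (Suc l) ^ k)\<^sup>2 * (norm (c k))\<^sup>2) + 2 * ((1 - \<rho> l ^ k)\<^sup>2 * (norm (c k))\<^sup>2))"
      by (intro suminf_le norm_square_summable D summable_add summable_mult s)
    also have "\<dots> = 2 * suminf (\<lambda>k. (1 - \<rho> (Suc l) ^ k)\<^sup>2 * (norm (c k))\<^sup>2) + 2 * suminf (\<lambda>k. (1 - \<rho> l ^ k)\<^sup>2 * (norm (c k))\<^sup>2)"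
      by (subst suminf_add[symmetric]) (auto intro!: summable_mult s simp: suminf_mult[OF s])
    also have "\<dots> \<le> 2 * (1/8) ^ Suc l + 2 * (1/8) ^ l" using \<rho>(4)[of l] \<rho>(4)[of "Suc l"] by linarith
    also have "\<dots> \<le> 4 * (1/8) ^ l" by simp
    finally show ?thesis .
  qed
  \<comment> \<open>The factor \<open>2 ^ l\<close> pays for the Cauchy-Schwarz weights
    \<open>(1/2) ^ l\<close> used in \<open>n2\<close>; the integrals remain summable because of the
    rate \<open>(1/8) ^ l\<close>.\<close>
  define \<phi> where "\<phi> l t = 2 ^ l * (norm (circ (D l) t))\<^sup>2" for l t
  \<comment> \<open>The interval contains \<open>\<theta> + s\<close> for all angles \<theta> and
    \<open>s\<close> in \<open>{-pi..pi}\<close>.\<close>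
  define f where "f l t = indicator {-2*pi..2*pi} t *\<^sub>R \<phi> l t" for l t
  have f0: "0 \<le> f l t" for l t by (simp add: f_def \<phi>_def)
  have \<phi>c: "continuous_on S (\<phi> l)" for l S
    unfolding \<phi>_def[abs_def] by (intro continuous_intros continuous_on_subset[OF circ_continuous[OF D]]) auto
  have si: "set_integrable lborel {-2*pi..2*pi} (\<phi> l)" for l by (rule borel_integrable_atLeastAtMost'[OF \<phi>c])
  then have fi: "integrable lborel (f l)" for l by (simp add: set_integrable_def f_def[abs_def])
  have fI: "integral\<^sup>L lborel (f l) \<le> 16 * pi * (1/4) ^ l" for l
  proof -
    have "integral\<^sup>L lborel (f l) = integral {-2*pi..2*pi} (\<phi> l)"
      using set_borel_integral_eq_integral(2)[OF si[of l]] by (simp add: set_lebesgue_integral_def f_def[abs_def])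
    also have "\<dots> = 2 ^ l * (4 * pi * suminf (\<lambda>k. (norm (D l k))\<^sup>2))"
      using has_integral_mult_right[OF circ_parseval[OF D[of l], of 2], of "2 ^ l"]
      by (intro integral_unique) (simp add: \<phi>_def[abs_def])
    also have "\<dots> \<le> 2 ^ l * (4 * pi * (4 * (1/8) ^ l))" by (intro mult_left_mono D2) auto
    also have "\<dots> = 16 * pi * (2 ^ l * (1/8) ^ l)" by simp
    also have "2 ^ l * (1/8) ^ l = (1/4 :: real) ^ l" by (simp flip: power_mult_distrib)
    finally show ?thesis .
  qed
  have fI0: "0 \<le> integral\<^sup>L lborel (f l)" for l by (rule Bochner_Integration.integral_nonneg) (rule f0)
  have fsum: "summable (\<lambda>l. integral\<^sup>L lborel (f l))"
    by (rule summable_comparison_test'[OF summable_mult[OF summable_geometric[of "1/4 :: real"], of "16 * pi"]])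
       (use fI fI0 in auto)
  have aes: "AE t in lborel. summable (\<lambda>l. f l t)"
  proof -
    have "(\<integral>\<^sup>+t. suminf (\<lambda>l. ennreal (f l t)) \<partial>lborel) = suminf (\<lambda>l. \<integral>\<^sup>+t. ennreal (f l t) \<partial>lborel)"
      by (rule nn_integral_suminf) (use fi in \<open>auto dest: borel_measurable_integrable\<close>)
    also have "\<dots> = suminf (\<lambda>l. ennreal (integral\<^sup>L lborel (f l)))"
      by (intro suminf_cong nn_integral_eq_integral fi) (simp add: f0)
    also have "\<dots> = ennreal (suminf (\<lambda>l. integral\<^sup>L lborel (f l)))" by (rule suminf_ennreal2[OF fI0 fsum])
    finally have "(\<integral>\<^sup>+t. suminf (\<lambda>l. ennreal (f l t)) \<partial>lborel) \<noteq> \<infinity>" by simp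
    then have "AE t in lborel. suminf (\<lambda>l. ennreal (f l t)) \<noteq> \<infinity>"
      by (rule nn_integral_PInf_AE[rotated]) (use fi in \<open>auto dest!: borel_measurable_integrable intro!: borel_measurable_suminf_order\<close>)
    then show ?thesis by eventually_elim (rule summable_suminf_not_top[OF f0], simp)
  qed
  \<comment> \<open>The absolute value secures nonnegativity also at points where the series
    diverges and \<open>suminf\<close> is unspecified.\<close>
  define \<Phi> where "\<Phi> j t = \<bar>suminf (\<lambda>l. f (l + j) t)\<bar>" for j t
  have \<Phi>i: "integrable lborel (\<Phi> j)" for j
    unfolding \<Phi>_def[abs_def]
  proof (rule integrable_abs, rule integrable_suminf)
    show "AE t in lborel. summable (\<lambda>l. norm (f (l + j) t))"
      using aes by eventually_elim (simp add: f0 summable_iff_shift[of "\<lambda>l. f l _"])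
    show "summable (\<lambda>l. LINT t|lborel. norm (f (l + j) t))"
      using summable_ignore_initial_segment[OF fsum, of j] by (simp add: f0)
  qed (rule fi)
  have good: "AE \<theta> in lborel. summable (\<lambda>l. f l \<theta>) \<and> (\<forall>j. \<forall>e>0. \<exists>d>0. \<forall>t. 0 < t \<and> t \<le> d \<longrightarrow>
      (LINT s|lborel. indicator {-t..t} s * \<Phi> j (\<theta> + s)) \<le> (2 * \<Phi> j \<theta> + e) * t)"
    using aes symmetric_Lebesgue_differentiation[OF \<Phi>i] unfolding AE_conj_iff AE_all_countable by blast
  show ?thesis using good
  proof (rule AE_mp, intro AE_I2 impI)
    fix \<theta> :: real
    assume G: "summable (\<lambda>l. f l \<theta>) \<and> (\<forall>j. \<forall>e>0. \<exists>d>0. \<forall>t. 0 < t \<and> t \<le> d \<longrightarrow>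
      (LINT s|lborel. indicator {-t..t} s * \<Phi> j (\<theta> + s)) \<le> (2 * \<Phi> j \<theta> + e) * t)" and \<theta>: "\<theta> \<in> {-pi..pi}"
    define e where "e k = cis (real k * \<theta>) *\<^sub>C c k" for k
    have eB: "norm (e k) \<le> B" for k using B by (simp add: e_def norm_scaleC)
    define F where "F r = suminf (\<lambda>k. r ^ k *\<^sub>R e k)" for r :: real
    have Fs: "summable (\<lambda>k. r ^ k *\<^sub>R e k)" if "0 \<le> r" "r < 1" for r
      by (rule summable_norm_cancel[OF power_series_continuous(2)[OF eB that]])
    have Fc: "isCont F x" if "0 < x" "x < 1" for x
    proof -
      have "continuous_on {0..(x + 1) / 2} F"
        unfolding F_def[abs_def] by (rule power_series_continuous(1)[OF eB]) (use that in auto)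
      then show ?thesis by (rule continuous_on_interior) (use that in auto)
    qed
    \<comment> \<open>The right-hand side depends on \<open>j\<close> but not on \<open>i\<close>,
      so \<open>i\<close> can be sent to infinity afterwards.\<close>
    have bound: "2 * pi * (norm (F (r * \<rho> i) - F (r * \<rho> j)))\<^sup>2 \<le> 2 * (96 * L + 12 * (1 - r) / \<delta>\<^sup>2 * (LINT s|lborel. \<Phi> j (\<theta> + s)))"
      if ij: "j \<le> i" and r: "1/2 \<le> r" "r < 1" and \<delta>: "0 < \<delta>" and L: "0 \<le> L"
        and avg: "\<And>t. 0 < t \<Longrightarrow> t \<le> \<delta> \<Longrightarrow> (LINT s|lborel. indicator {-t..t} s * \<Phi> j (\<theta> + s)) \<le> L * t" for i j r \<delta> L
    proof -
      define d where "d k = (\<rho> i ^ k - \<rho> j ^ k) *\<^sub>R e k" for k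
      have nd: "norm (d k) = norm ((\<rho> i ^ k - \<rho> j ^ k) *\<^sub>R c k)" for k by (simp add: d_def e_def norm_scaleC)
      have sd: "summable (\<lambda>k. norm (d k))" unfolding nd by (rule sumd)
      have Fd: "F (r * \<rho> i) - F (r * \<rho> j) = suminf (\<lambda>k. r ^ k *\<^sub>R d k)"
      proof -
        have *: "0 \<le> r * \<rho> l" "r * \<rho> l < 1" for l
          using r \<rho>(2,3)[of l] mult_strict_mono[of r 1 "\<rho> l" 1] by auto
        show ?thesis unfolding F_def by (subst suminf_diff[OF Fs[OF *] Fs[OF *]])
             (simp add: d_def power_mult_distrib scaleR_diff_left[symmetric] right_diff_distrib)
      qed
      have cd: "circ d s = (\<Sum>l\<in>{j..<i}. circ (D l) (\<theta> + s))" for s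
      proof -
        have "circ d s = circ (\<lambda>k. (\<rho> i ^ k - \<rho> j ^ k) *\<^sub>R c k) (\<theta> + s)"
          unfolding circ_def d_def e_def
          by (intro suminf_cong) (simp add: scaleR_scaleC scaleC_scaleC cis_mult mult_ac distrib_left add.commute)
        also have "(\<lambda>k. (\<rho> i ^ k - \<rho> j ^ k) *\<^sub>R c k) = (\<lambda>k. \<Sum>l\<in>{j..<i}. D l k)"
          using sum_Suc_diff'[OF ij, of "\<lambda>l. \<rho> l ^ _"] by (simp add: D_def scaleR_left.sum[symmetric])
        also have "circ \<dots> (\<theta> + s) = (\<Sum>l\<in>{j..<i}. circ (D l) (\<theta> + s))" by (rule circ_sum[OF _ D]) simp
        finally show ?thesis .
      qed
      have n2: "(norm (circ d s))\<^sup>2 \<le> 2 * (\<Sum>l\<in>{j..<i}. \<phi> l (\<theta> + s))" for s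
      proof -
        have "(norm (circ d s))\<^sup>2 \<le> (\<Sum>l\<in>{j..<i}. (1/2) ^ l) * (\<Sum>l\<in>{j..<i}. (norm (circ (D l) (\<theta> + s)))\<^sup>2 / (1/2) ^ l)"
          unfolding cd by (rule weighted_sum_norm) auto
        also have "(\<Sum>l\<in>{j..<i}. (norm (circ (D l) (\<theta> + s)))\<^sup>2 / (1/2) ^ l) = (\<Sum>l\<in>{j..<i}. \<phi> l (\<theta> + s))"
          by (simp add: \<phi>_def power_one_over field_simps)
        also have "(\<Sum>l\<in>{j..<i}. (1/2 :: real) ^ l) \<le> (\<Sum>l<i. (1/2) ^ l)" by (rule sum_mono2) auto
        also have "\<dots> \<le> 2" by (simp add: sum_gp_strict)
        finally show ?thesis by (simp add: mult_right_mono sum_nonneg \<phi>_def)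
      qed
      have \<Psi>: "integrable lborel (\<lambda>s. \<Phi> j (\<theta> + s))" using lborel_integrable_real_affine[OF \<Phi>i[of j], of 1 \<theta>] by simp
      have \<Psi>0: "0 \<le> \<Phi> j (\<theta> + s)" for s by (simp add: \<Phi>_def)
      let ?K = "\<lambda>s. pkernel (1 - r) s"
      note kb = kernel_integral_bound[OF \<Psi> \<Psi>0 _ \<delta> L avg, of "1 - r"]
      let ?P = "\<lambda>s. (1 - r\<^sup>2) / (cmod (1 - of_real r * cis s))\<^sup>2 * (norm (circ d s))\<^sup>2"
      have Pc: "continuous_on {-pi..pi} ?P"
      proof (intro continuous_intros continuous_on_subset[OF circ_continuous[OF sd]])
        have "cmod (of_real r * cis s) < 1" for s using r by (simp add: norm_mult)
        then show "\<forall>s\<in>{-pi..pi}. (cmod (1 - of_real r * cis s))\<^sup>2 \<noteq> 0"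
          by (auto) (metis less_irrefl norm_one)
      qed auto
      have Ps: "set_integrable lborel {-pi..pi} ?P" by (rule borel_integrable_atLeastAtMost'[OF Pc])
      have aes': "AE s in lborel. summable (\<lambda>l. f l (\<theta> + s))" by (rule AE_lborel_shift[OF aes])
      have "2 * pi * (norm (suminf (\<lambda>k. r ^ k *\<^sub>R d k)))\<^sup>2 \<le> integral {-pi..pi} ?P"
        by (rule poisson_inequality[OF sd]) (use r in auto)
      also have "\<dots> = (LINT s|lborel. indicator {-pi..pi} s *\<^sub>R ?P s)"
        using set_borel_integral_eq_integral(2)[OF Ps] by (simp add: set_lebesgue_integral_def)
      also have "\<dots> \<le> (LINT s|lborel. 2 * (?K s * \<Phi> j (\<theta> + s)))"
      proof (rule integral_mono_AE)
        show "integrable lborel (\<lambda>s. indicator {-pi..pi} s *\<^sub>R ?P s)" using Ps by (simp add: set_integrable_def)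
        show "integrable lborel (\<lambda>s. 2 * (?K s * \<Phi> j (\<theta> + s)))" by (rule integrable_mult_right[OF kb(1)]) (use r in auto)
        show "AE s in lborel. indicator {-pi..pi} s *\<^sub>R ?P s \<le> 2 * (?K s * \<Phi> j (\<theta> + s))" using aes'
        proof eventually_elim
          case (elim s)
          have K0: "0 \<le> ?K s" using r by simp
          show ?case
          proof (cases "s \<in> {-pi..pi}")
            case True
            have "(\<Sum>l\<in>{j..<i}. \<phi> l (\<theta> + s)) = (\<Sum>l\<in>{j..<i}. f l (\<theta> + s))"
              using True \<theta> by (simp add: f_def indicator_def)
            also have "\<dots> = (\<Sum>l<i - j. f (l + j) (\<theta> + s))"
              by (rule sum.reindex_bij_witness[where i = "\<lambda>l. l + j" and j = "\<lambda>l. l - j"]) auto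
            also have "\<dots> \<le> suminf (\<lambda>l. f (l + j) (\<theta> + s))"
              by (rule sum_le_suminf[OF summable_ignore_initial_segment[OF elim]]) (auto simp: f0)
            also have "\<dots> \<le> \<Phi> j (\<theta> + s)" by (simp add: \<Phi>_def)
            finally have "(norm (circ d s))\<^sup>2 \<le> 2 * \<Phi> j (\<theta> + s)" using n2[of s] by linarith
            moreover have "(1 - r\<^sup>2) / (cmod (1 - of_real r * cis s))\<^sup>2 \<le> ?K s"
              by (rule poisson_kernel_le) (use r True in auto)
            ultimately have "?P s \<le> ?K s * (2 * \<Phi> j (\<theta> + s))" using K0 by (intro mult_mono) auto
            then show ?thesis using True by simp
          next
            case False
            have "0 \<le> 2 * (?K s * \<Phi> j (\<theta> + s))" by (intro mult_nonneg_nonneg K0 \<Psi>0) simp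
            then show ?thesis using False by simp
          qed
        qed
      qed
      also have "\<dots> = 2 * (LINT s|lborel. ?K s * \<Phi> j (\<theta> + s))" by (rule integral_mult_right_zero)
      also have "\<dots> \<le> 2 * (96 * L + 12 * (1 - r) / \<delta>\<^sup>2 * (LINT s|lborel. \<Phi> j (\<theta> + s)))"
        by (intro mult_left_mono kb(2)) (use r in auto)
      finally show ?thesis unfolding Fd .
    qed
    have "\<exists>l. (F \<longlongrightarrow> l) (at_left 1)"
    proof (rule convergent_filterI)
      fix \<eta> :: real assume \<eta>: "\<eta> > 0"
      \<comment> \<open>With \<open>L = 3 * \<epsilon>\<close> the bound \<open>b\<close> tends to
        \<open>576 * \<epsilon>\<close> and is eventually below \<open>600 * \<epsilon>\<close>,
        which is less than \<open>(\<eta> / 2)\<^sup>2\<close>.\<close>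
      define \<epsilon> where "\<epsilon> = \<eta>\<^sup>2 / 10000"
      have \<epsilon>: "\<epsilon> > 0" using \<eta> by (simp add: \<epsilon>_def)
      obtain N where N: "\<And>n. n \<ge> N \<Longrightarrow> norm (suminf (\<lambda>l. f (l + n) \<theta>)) < \<epsilon>"
        using suminf_exist_split[OF \<epsilon>, of "\<lambda>l. f l \<theta>"] G by auto
      \<comment> \<open>The successor makes \<open>j\<close> positive, so that
        \<open>\<rho> j \<ge> 7/8\<close>; \<rho> 0 might be 0, and continuity of \<open>F\<close>
        is available at positive radii.\<close>
      define j where "j = Suc N"
      have j: "\<Phi> j \<theta> < \<epsilon>" using N[of j] by (simp add: \<Phi>_def j_def)
      obtain \<delta> where \<delta>: "\<delta> > 0" "\<And>t. 0 < t \<Longrightarrow> t \<le> \<delta> \<Longrightarrow> (LINT s|lborel. indicator {-t..t} s * \<Phi> j (\<theta> + s)) \<le> (2 * \<Phi> j \<theta> + \<epsilon>) * t"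
        using G \<epsilon> by metis
      have avg: "(LINT s|lborel. indicator {-t..t} s * \<Phi> j (\<theta> + s)) \<le> (3 * \<epsilon>) * t" if "0 < t" "t \<le> \<delta>" for t
      proof -
        have "(2 * \<Phi> j \<theta> + \<epsilon>) * t \<le> (3 * \<epsilon>) * t" using j that(1) by (intro mult_right_mono) auto
        then show ?thesis using \<delta>(2)[OF that] by linarith
      qed
      define b where "b r = 2 * (96 * (3 * \<epsilon>) + 12 * (1 - r) / \<delta>\<^sup>2 * (LINT s|lborel. \<Phi> j (\<theta> + s)))" for r
      have 1: "2 * pi * (norm (F r - F (r * \<rho> j)))\<^sup>2 \<le> b r" if r: "1/2 \<le> r" "r < 1" for r
      proof (rule LIMSEQ_le_const2)
        have "(\<lambda>i. r * \<rho> i) \<longlonglongrightarrow> r * 1" by (intro tendsto_intros \<rho>lim)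
        then have "(\<lambda>i. F (r * \<rho> i)) \<longlonglongrightarrow> F r" using Fc[of r] r by (intro isCont_tendsto_compose[of r F]) auto
        then show "(\<lambda>i. 2 * pi * (norm (F (r * \<rho> i) - F (r * \<rho> j)))\<^sup>2) \<longlonglongrightarrow> 2 * pi * (norm (F r - F (r * \<rho> j)))\<^sup>2"
          by (intro tendsto_intros)
        show "\<exists>M. \<forall>i\<ge>M. 2 * pi * (norm (F (r * \<rho> i) - F (r * \<rho> j)))\<^sup>2 \<le> b r"
          unfolding b_def by (intro exI[of _ j] allI impI bound r \<delta>(1) avg) (use \<epsilon> in auto)
      qed
      have "(b \<longlongrightarrow> 2 * (96 * (3 * \<epsilon>) + 12 * (1 - 1) / \<delta>\<^sup>2 * (LINT s|lborel. \<Phi> j (\<theta> + s)))) (at_left 1)"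
        unfolding b_def[abs_def] by (intro tendsto_intros) (use \<delta>(1) in auto)
      then have b: "\<forall>\<^sub>F r in at_left 1. b r < 600 * \<epsilon>" by (rule order_tendstoD) (use \<epsilon> in simp)
      have \<rho>j: "0 < \<rho> j" using \<rho>(1)[of j] power_decreasing[of 1 j "1/8 :: real"] by (simp add: j_def)
      have "((\<lambda>r. r * \<rho> j) \<longlongrightarrow> 1 * \<rho> j) (at_left 1)" by (intro tendsto_intros)
      then have "((\<lambda>r. F (r * \<rho> j)) \<longlongrightarrow> F (\<rho> j)) (at_left 1)"
        using Fc[OF \<rho>j \<rho>(3)] by (intro isCont_tendsto_compose[of "\<rho> j" F]) auto
      then have 2: "\<forall>\<^sub>F r in at_left 1. dist (F (r * \<rho> j)) (F (\<rho> j)) < \<eta> / 2" by (rule tendstoD) (use \<eta> in simp)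
      have 3: "\<forall>\<^sub>F r in at_left 1. r \<in> {1/2<..<1::real}" by (rule eventually_at_left_real) simp
      have "\<forall>\<^sub>F r in at_left 1. dist (F r) (F (\<rho> j)) < \<eta>" using b 2 3
      proof eventually_elim
        case (elim r)
        have "2 * pi * (norm (F r - F (r * \<rho> j)))\<^sup>2 < 600 * \<epsilon>" using 1[of r] elim by auto
        moreover have "1 * (norm (F r - F (r * \<rho> j)))\<^sup>2 \<le> 2 * pi * (norm (F r - F (r * \<rho> j)))\<^sup>2"
          using pi_gt3 by (intro mult_right_mono) auto
        ultimately have "(norm (F r - F (r * \<rho> j)))\<^sup>2 < 600 * \<epsilon>" by linarith
        also have "\<dots> \<le> (\<eta> / 2)\<^sup>2" using \<eta> by (simp add: \<epsilon>_def power_divide)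
        finally have "norm (F r - F (r * \<rho> j)) < \<eta> / 2" by (rule power_less_imp_less_base) (use \<eta> in simp)
        then show ?case using elim(2) dist_triangle[of "F r" "F (\<rho> j)" "F (r * \<rho> j)"] by (simp add: dist_norm)
      qed
      then show "\<exists>y. \<forall>\<^sub>F r in at_left 1. dist (F r) y < \<eta>" by blast
    qed simp
    then show "\<exists>l. ((\<lambda>r. suminf (\<lambda>k. r ^ k *\<^sub>R (cis (real k * \<theta>) *\<^sub>C c k))) \<longlongrightarrow> l) (at_left 1)"
      by (simp add: F_def[abs_def] e_def)
  qed
qed

section \<open>Integration over the sphere\<close>

abbreviation (input) sphere_measure :: "(complex ^ 'n::finite) measure" where
  "sphere_measure \<equiv> sphere_prob"

lemma space_sphere_prob: "space (sphere_prob :: 'a::euclidean_space measure) = sphere 0 1"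
  by (simp add: sphere_prob_def space_restrict_space)

lemma sets_sphere_prob: "sets (sphere_prob :: 'a::euclidean_space measure) = sets (restrict_space borel (sphere 0 1))"
  unfolding sphere_prob_def by (rule sets_restrict_space_cong) simp

lemma finite_measure_sphere_prob: "finite_measure (sphere_prob :: 'a::euclidean_space measure)"
  by (rule finite_measureI) (simp add: emeasure_sphere_prob_space)

lemma measure_sphere_prob: "measure (sphere_prob :: 'a::euclidean_space measure) (sphere 0 1) = 1"
  using emeasure_sphere_prob_space[where ?'a = 'a] by (simp add: measure_def space_sphere_prob)

lemma sphere_measurable:
  fixes g :: "'a::euclidean_space \<Rightarrow> 'b::topological_space"
  assumes "continuous_on (sphere 0 1) g"
  shows "g \<in> borel_measurable sphere_prob"
  using borel_measurable_continuous_on_restrict[OF assms] measurable_cong_sets[OF sets_sphere_prob refl] by blast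

lemma sphere_integrable:
  fixes g :: "'a::euclidean_space \<Rightarrow> 'b::{banach, second_countable_topology}"
  assumes "continuous_on (sphere 0 1) g"
  shows "integrable sphere_prob g"
proof -
  interpret finite_measure "sphere_prob :: 'a measure" by (rule finite_measure_sphere_prob)
  have "compact (g ` sphere 0 1)" by (rule compact_continuous_image[OF assms compact_sphere])
  then obtain B where B: "\<And>x. x \<in> sphere 0 1 \<Longrightarrow> norm (g x) \<le> B"
    using compact_imp_bounded bounded_iff by (metis image_eqI)
  show ?thesis
    by (rule integrable_const_bound[of _ B]) (use B sphere_measurable[OF assms] in \<open>auto simp: space_sphere_prob\<close>)
qed

section \<open>Rotations and integrals of monomials over the sphere\<close>

lemma rotation_measurable:
  fixes f :: "'a::euclidean_space \<Rightarrow> 'a"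
  assumes "orthogonal_transformation f"
  shows "f \<in> measurable sphere_prob sphere_prob"
proof -
  have "continuous_on (sphere 0 1) f"
    by (intro linear_continuous_on linear_conv_bounded_linear[THEN iffD1] orthogonal_transformation_linear assms)
  from sphere_measurable[OF this]
  have "f \<in> measurable sphere_prob (restrict_space borel (sphere 0 1))"
    by (intro measurable_restrict_space2) (use assms in \<open>auto simp: space_sphere_prob orthogonal_transformation\<close>)
  then show ?thesis using measurable_cong_sets[OF refl sets_sphere_prob] by blast
qed

lemma sphere_integral_rotation:
  fixes f :: "'a::euclidean_space \<Rightarrow> 'a" and g :: "'a \<Rightarrow> 'b::{banach, second_countable_topology}"
  assumes f: "orthogonal_transformation f" and g: "continuous_on (sphere 0 1) g"
  shows "(LINT x|sphere_prob. g (f x)) = (LINT x|sphere_prob. g x)"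
  using integral_distr[OF rotation_measurable[OF f] sphere_measurable[OF g]]
  by (simp add: sphere_prob_rotation_invariant[OF f])

lemma orthogonal_phase:
  fixes u :: "complex ^ 'n::finite"
  assumes "\<And>i. cmod (u $ i) = 1"
  shows "orthogonal_transformation (\<lambda>\<xi> :: complex ^ 'n. \<chi> i. u $ i * \<xi> $ i)"
  unfolding orthogonal_transformation
proof (intro conjI allI)
  show "linear (\<lambda>\<xi> :: complex ^ 'n. \<chi> i. u $ i * \<xi> $ i)"
    by (rule linearI) (simp_all add: vec_eq_iff algebra_simps)
  show "norm (\<chi> i. u $ i * \<xi> $ i) = norm \<xi>" for \<xi> :: "complex ^ 'n"
    by (simp add: norm_vec_def norm_mult assms)
qed

lemma orthogonal_cis: "orthogonal_transformation (\<lambda>\<xi> :: complex ^ 'n::finite. cis t *\<^sub>C \<xi>)"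
  using orthogonal_phase[of "\<chi> i. cis t"] by (simp add: scaleC_vec_def scaleC_complex_def)

lemma mpow_continuous: "continuous_on S (\<lambda>\<xi> :: complex ^ 'n::finite. mpow \<xi> \<alpha>)"
  unfolding mpow_def by (intro continuous_intros)

text \<open>In a coordinate where the exponents differ, a phase rotation can be chosen that
  multiplies the integrand by -1.\<close>

lemma sphere_mono_orthogonal:
  fixes \<alpha> \<beta> :: "'n::finite multi_index"
  assumes "\<alpha> \<noteq> \<beta>"
  shows "(LINT \<xi>|sphere_measure. mpow \<xi> \<alpha> * cnj (mpow \<xi> \<beta>)) = 0"
proof -
  obtain i where i: "lookup \<alpha> i \<noteq> lookup \<beta> i" using assms by (metis poly_mapping_eqI)
  define a b where "a = real (lookup \<alpha> i)" and "b = real (lookup \<beta> i)"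
  have ab: "a - b \<noteq> 0" using i by (simp add: a_def b_def)
  define t where "t = pi / (a - b)"
  define u where "u = (\<chi> j. if j = i then cis t else (1 :: complex))"
  have m: "mpow (\<chi> j. u $ j * \<xi> $ j) \<gamma> = cis t ^ lookup \<gamma> i * mpow \<xi> \<gamma>" for \<xi> and \<gamma> :: "'n multi_index"
  proof -
    have "(u $ j) ^ lookup \<gamma> j = (if j = i then cis t ^ lookup \<gamma> i else 1)" for j by (simp add: u_def)
    then show ?thesis by (simp add: mpow_def power_mult_distrib prod.distrib)
  qed
  have o: "orthogonal_transformation (\<lambda>\<xi> :: complex ^ 'n. \<chi> j. u $ j * \<xi> $ j)"
    by (rule orthogonal_phase) (simp add: u_def)
  have "cis t ^ lookup \<alpha> i * cnj (cis t ^ lookup \<beta> i) = cis (t * (a - b))"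
    unfolding Complex.DeMoivre cis_cnj cis_mult a_def b_def by (simp add: algebra_simps)
  also have "\<dots> = -1" using ab by (simp add: t_def)
  finally have c: "cis t ^ lookup \<alpha> i * cnj (cis t ^ lookup \<beta> i) = -1" .
  have e: "mpow (\<chi> j. u $ j * \<xi> $ j) \<alpha> * cnj (mpow (\<chi> j. u $ j * \<xi> $ j) \<beta>) = - (mpow \<xi> \<alpha> * cnj (mpow \<xi> \<beta>))" for \<xi>
  proof -
    have "mpow (\<chi> j. u $ j * \<xi> $ j) \<alpha> * cnj (mpow (\<chi> j. u $ j * \<xi> $ j) \<beta>)
      = (cis t ^ lookup \<alpha> i * cnj (cis t ^ lookup \<beta> i)) * (mpow \<xi> \<alpha> * cnj (mpow \<xi> \<beta>))"
      unfolding m by (simp add: mult_ac)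
    then show ?thesis unfolding c by simp
  qed
  have "(LINT \<xi>|sphere_measure. mpow \<xi> \<alpha> * cnj (mpow \<xi> \<beta>)) = (LINT \<xi>|sphere_measure. - (mpow \<xi> \<alpha> * cnj (mpow \<xi> \<beta>)))"
    using sphere_integral_rotation[OF o, of "\<lambda>\<xi>. mpow \<xi> \<alpha> * cnj (mpow \<xi> \<beta>)"]
    unfolding e by (simp add: continuous_on_mult continuous_on_cnj mpow_continuous)
  then have "(LINT \<xi>|sphere_measure. mpow \<xi> \<alpha> * cnj (mpow \<xi> \<beta>)) = - (LINT \<xi>|sphere_measure. mpow \<xi> \<alpha> * cnj (mpow \<xi> \<beta>))" by simp
  then show ?thesis by (simp add: complex_eq_iff)
qed

lemma orthogonal_householder:
  fixes v :: "complex ^ 'n::finite"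
  defines "f \<equiv> \<lambda>\<xi>. \<xi> - (2 * cinner \<xi> v / of_real ((norm v)\<^sup>2)) *\<^sub>C v"
  shows "orthogonal_transformation f" "cinner (f \<xi>) \<eta> = cinner \<xi> (f \<eta>)"
proof -
  show s: "cinner (f \<xi>) \<eta> = cinner \<xi> (f \<eta>)" for \<xi> \<eta>
    using cinner_commute[of v \<eta>] by (simp add: f_def cinner_diff cinner_scaleC_left cinner_scaleC_right mult_ac)
  have ff: "f (f \<xi>) = \<xi>" for \<xi>
  proof (cases "v = 0")
    case False
    then have "cinner (f \<xi>) v = - cinner \<xi> v"
      by (simp add: f_def cinner_diff cinner_scaleC_left cinner_same[of v] del: of_real_power)
    then show ?thesis by (simp add: f_def)
  qed (simp add: f_def)
  show "orthogonal_transformation f"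
    unfolding orthogonal_transformation
  proof (intro conjI allI)
    show "linear f" by (rule linearI)
         (simp_all add: f_def cinner_add_left add_divide_distrib distrib_left scaleC_add_left scaleR_scaleC cinner_scaleC_left
            scaleC_diff_right scaleC_scaleC mult_ac)
    fix \<xi>
    have "cinner (f \<xi>) (f \<xi>) = cinner \<xi> \<xi>" by (simp add: s ff)
    then have "complex_of_real ((norm (f \<xi>))\<^sup>2) = complex_of_real ((norm \<xi>)\<^sup>2)" by (simp add: cinner_same)
    then have "(norm (f \<xi>))\<^sup>2 = (norm \<xi>)\<^sup>2" by (simp only: of_real_eq_iff)
    then show "norm (f \<xi>) = norm \<xi>" by (simp add: power2_eq_iff_nonneg)
  qed
qed

lemma cinner_continuous: "continuous_on S (\<lambda>\<xi>. cinner \<xi> w)"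
  by (rule linear_continuous_on[OF bounded_linear_cinner_left])

text \<open>A phase \<open>c\<close> makes the inner product of \<open>w\<close> and
  \<open>c *\<^sub>C w'\<close> real; the reflection along their difference then exchanges the two
  vectors. The modulus of the pairing does not see \<open>c\<close>.\<close>

lemma sphere_zonal_eq:
  fixes w w' :: "complex ^ 'n::finite"
  assumes "norm w = norm w'"
  shows "(LINT \<xi>|sphere_measure. cmod (cinner \<xi> w) ^ k) = (LINT \<xi>|sphere_measure. cmod (cinner \<xi> w') ^ k)"
proof -
  define c where "c = (if cinner w w' = 0 then 1 else sgn (cinner w w'))"
  have c1: "cmod c = 1" by (simp add: c_def norm_sgn)
  define w2 where "w2 = c *\<^sub>C w'"
  have n2: "norm w2 = norm w" by (simp add: w2_def norm_scaleC c1 assms)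
  define x where "x = cmod (cinner w w')"
  have x: "cinner w w2 = of_real x"
  proof (cases "cinner w w' = 0")
    case False
    have "cnj (sgn z) * z = of_real (cmod z)" if "z \<noteq> 0" for z :: complex
      using that by (simp add: sgn_div_norm scaleR_conv_of_real mult_ac complex_norm_square[symmetric] power2_eq_square)
        (simp add: field_simps complex_norm_square[symmetric] power2_eq_square mult.commute[of "cnj z"])?
    then show ?thesis using False by (simp add: w2_def c_def cinner_scaleC_right x_def)
  qed (simp add: w2_def cinner_scaleC_right x_def)
  have x': "cinner w2 w = of_real x" using cinner_commute[of w2 w] x by simp
  define v where "v = w - w2"
  define f where "f \<xi> = \<xi> - (2 * cinner \<xi> v / of_real ((norm v)\<^sup>2)) *\<^sub>C v" for \<xi>
  have F: "orthogonal_transformation f" "cinner (f \<xi>) \<eta> = cinner \<xi> (f \<eta>)" for \<xi> \<eta>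
    unfolding f_def[abs_def] by (fact orthogonal_householder)+
  have fw: "f w2 = w"
  proof (cases "v = 0")
    case False
    have "of_real ((norm v)\<^sup>2) = cinner v v" by (simp add: cinner_same)
    also have "cinner v v = cinner w w - cinner w w2 - cinner w2 w + cinner w2 w2"
      unfolding v_def by (simp add: cinner_diff)
    also have "\<dots> = 2 * (of_real ((norm w)\<^sup>2) - of_real x)" by (simp add: x x' cinner_same n2)
    finally have nv: "complex_of_real ((norm v)\<^sup>2) = 2 * (of_real ((norm w)\<^sup>2) - of_real x)" .
    have "2 * cinner w2 v = - complex_of_real ((norm v)\<^sup>2)"
      unfolding nv by (simp add: v_def cinner_diff x' cinner_same n2)
    then have "2 * cinner w2 v / of_real ((norm v)\<^sup>2) = -1" using False by (simp add: divide_eq_minus_1_iff)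
    then show ?thesis by (simp add: f_def v_def)
  qed (simp add: f_def v_def)
  have "(LINT \<xi>|sphere_measure. cmod (cinner \<xi> w) ^ k) = (LINT \<xi>|sphere_measure. cmod (cinner (f \<xi>) w2) ^ k)"
    unfolding F(2) fw ..
  also have "\<dots> = (LINT \<xi>|sphere_measure. cmod (cinner \<xi> w2) ^ k)"
    by (rule sphere_integral_rotation[OF F(1)]) (intro continuous_intros cinner_continuous)
  finally show ?thesis by (simp add: w2_def cinner_scaleC_right norm_mult c1)
qed

lemma integral_double_sum:
  fixes f :: "'i \<Rightarrow> 'j \<Rightarrow> 'x \<Rightarrow> 'b::{real_normed_field, banach, second_countable_topology}"
  assumes "\<And>i j. integrable M (f i j)"
  shows "(LINT x|M. (\<Sum>i\<in>I. \<Sum>j\<in>J. c i j * f i j x)) = (\<Sum>i\<in>I. \<Sum>j\<in>J. c i j * (LINT x|M. f i j x))"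
  by (simp add: Bochner_Integration.integral_sum Bochner_Integration.integrable_sum assms)

text \<open>By unitary invariance the integral of \<open>|\<langle>\<xi>, w\<rangle>|\<close> to the power \<open>2 m\<close> is a multiple of the
  same power of the norm of \<open>w\<close>; comparing coefficients gives the integrals of the monomials.\<close>

lemma sphere_mono_integral:
  fixes \<alpha> :: "'n::finite multi_index"
  shows "(LINT \<xi>|sphere_measure. (cmod (mpow \<xi> \<alpha>))\<^sup>2) = mweight \<alpha> / real (card {\<beta> :: 'n multi_index. mdeg \<beta> = mdeg \<alpha>})"
proof -
  define m where "m = mdeg \<alpha>"
  let ?A = "{\<beta> :: 'n multi_index. mdeg \<beta> = m}"
  define d where "d \<beta> = (LINT \<xi>|sphere_measure. (cmod (mpow \<xi> \<beta>))\<^sup>2)" for \<beta> :: "'n multi_index"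
  have dc: "complex_of_real (d \<beta>) = (LINT \<xi>|sphere_measure. mpow \<xi> \<beta> * cnj (mpow \<xi> \<beta>))" for \<beta>
    unfolding d_def complex_norm_square[symmetric] by (rule integral_complex_of_real[symmetric])
  obtain w0 :: "complex ^ 'n" where w0: "norm w0 = 1" using vector_choose_size[of 1] by auto
  define \<kappa> where "\<kappa> = (LINT \<xi>|sphere_measure. cmod (cinner \<xi> w0) ^ (2 * m))"
  have zon: "(LINT \<xi>|sphere_measure. cmod (cinner \<xi> w) ^ (2 * m)) = (norm w) ^ (2 * m) * \<kappa>" for w :: "complex ^ 'n"
  proof -
    have "norm w = norm (complex_of_real (norm w) *\<^sub>C w0)" by (simp add: norm_scaleC w0)
    from sphere_zonal_eq[OF this, of "2 * m"]
    show ?thesis by (simp add: cinner_scaleC_right norm_mult power_mult_distrib \<kappa>_def)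
  qed
  have mp: "mpow (\<chi> i. a $ i * b $ i) \<beta> = mpow a \<beta> * mpow b \<beta>" for a b :: "complex ^ 'n" and \<beta>
    by (simp add: mpow_def power_mult_distrib prod.distrib)
  have mc: "mpow (\<chi> i. cnj (a $ i)) \<beta> = cnj (mpow a \<beta>)" for a :: "complex ^ 'n" and \<beta> by (simp add: mpow_def)
  have expn: "cinner \<xi> w ^ m = (\<Sum>\<beta>\<in>?A. mpow \<xi> \<beta> * cnj (mpow w \<beta>) / of_real (mweight \<beta>))" for \<xi> w :: "complex ^ 'n"
    using multinomial[where k = m and z = "\<chi> i. \<xi> $ i * (\<chi> i. cnj (w $ i)) $ i"] unfolding mp mc
    by (simp add: cinner_vec_def cinner_complex_def)
  have sq: "complex_of_real (cmod (cinner \<xi> w) ^ (2 * m)) = (\<Sum>\<beta>\<in>?A. \<Sum>\<gamma>\<in>?A.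
      (cnj (mpow w \<beta>) * mpow w \<gamma> / of_real (mweight \<beta> * mweight \<gamma>)) * (mpow \<xi> \<beta> * cnj (mpow \<xi> \<gamma>)))" for \<xi> w :: "complex ^ 'n"
  proof -
    have "complex_of_real (cmod (cinner \<xi> w) ^ (2 * m)) = complex_of_real ((cmod (cinner \<xi> w ^ m))\<^sup>2)"
      by (simp add: norm_power power_mult[symmetric] mult.commute)
    also have "\<dots> = cinner \<xi> w ^ m * cnj (cinner \<xi> w ^ m)" by (rule complex_norm_square)
    finally show ?thesis unfolding expn by (simp add: sum_product mult_ac)
  qed
  have cont: "continuous_on (sphere 0 1) (\<lambda>\<xi> :: complex ^ 'n. mpow \<xi> \<beta> * cnj (mpow \<xi> \<gamma>))" for \<beta> \<gamma>
    by (intro continuous_intros mpow_continuous)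
  \<comment> \<open>The integral and \<kappa> times the power of the norm of \<open>w\<close> are
    polynomials in the squared moduli of the coordinates of \<open>w\<close>. Taking
    \<open>w\<close> to be the coordinatewise root of a positive \<open>z\<close> prepares the
    comparison of coefficients.\<close>
  have sumw: "(\<Sum>\<beta>\<in>?A. (of_real (d \<beta> / mweight \<beta> - \<kappa>) / of_real (mweight \<beta>)) * mpow z \<beta>) = 0"
    if z: "\<And>i. \<exists>x>0. z $ i = complex_of_real x" for z :: "complex ^ 'n"
  proof -
    obtain x where x: "\<And>i. x i > 0" "\<And>i. z $ i = complex_of_real (x i)" using z by metis
    define w where "w = (\<chi> i. complex_of_real (sqrt (x i)))"
    have ww: "cnj (mpow w \<beta>) * mpow w \<beta> = mpow z \<beta>" for \<beta>
    proof -
      have "z = (\<chi> i. w $ i * (\<chi> i. cnj (w $ i)) $ i)"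
        using x by (simp add: vec_eq_iff w_def flip: of_real_mult) (simp add: less_imp_le)
      then have "mpow z \<beta> = mpow w \<beta> * cnj (mpow w \<beta>)" using mp[of w "\<chi> i. cnj (w $ i)" \<beta>] mc by simp
      then show ?thesis by (simp add: mult.commute)
    qed
    have "of_real ((norm w) ^ (2 * m) * \<kappa>) = (LINT \<xi>|sphere_measure. complex_of_real (cmod (cinner \<xi> w) ^ (2 * m)))"
      unfolding zon[symmetric] by (rule integral_complex_of_real[symmetric])
    also have "\<dots> = (\<Sum>\<beta>\<in>?A. \<Sum>\<gamma>\<in>?A. (cnj (mpow w \<beta>) * mpow w \<gamma> / of_real (mweight \<beta> * mweight \<gamma>)) *
        (LINT \<xi>|sphere_measure. mpow \<xi> \<beta> * cnj (mpow \<xi> \<gamma>)))"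
      unfolding sq by (rule integral_double_sum[OF sphere_integrable[OF cont]])
    also have "\<dots> = (\<Sum>\<beta>\<in>?A. \<Sum>\<gamma>\<in>?A. if \<gamma> = \<beta> then of_real (d \<beta> / (mweight \<beta> * mweight \<beta>)) * mpow z \<beta> else 0)"
      by (intro sum.cong refl) (auto simp: dc[symmetric] ww sphere_mono_orthogonal)
    also have "\<dots> = (\<Sum>\<beta>\<in>?A. of_real (d \<beta> / (mweight \<beta> * mweight \<beta>)) * mpow z \<beta>)" by (simp add: finite_mdeg)
    finally have 1: "of_real ((norm w) ^ (2 * m) * \<kappa>) = (\<Sum>\<beta>\<in>?A. of_real (d \<beta> / (mweight \<beta> * mweight \<beta>)) * mpow z \<beta>)" .
    have "complex_of_real ((norm w) ^ (2 * m)) = cinner w w ^ m" by (simp add: cinner_same power_mult)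
    also have "\<dots> = (\<Sum>\<beta>\<in>?A. mpow z \<beta> / of_real (mweight \<beta>))" unfolding expn using ww by (simp add: mult.commute)
    finally have "of_real ((norm w) ^ (2 * m) * \<kappa>) = (\<Sum>\<beta>\<in>?A. of_real \<kappa> / of_real (mweight \<beta>) * mpow z \<beta>)"
      by (simp add: sum_distrib_left mult_ac)
    then show ?thesis using 1 by (simp add: diff_divide_distrib left_diff_distrib sum_subtractf)
  qed
  have dk: "d \<beta> = \<kappa> * mweight \<beta>" if "\<beta> \<in> ?A" for \<beta>
  proof -
    have "complex_of_real (d \<beta> / mweight \<beta> - \<kappa>) / of_real (mweight \<beta>) = 0"
      by (rule mpow_independent[OF finite_mdeg sumw that])
    then have "d \<beta> / mweight \<beta> - \<kappa> = 0" using mweight_pos[of \<beta>] by (simp only: divide_eq_0_iff of_real_eq_0_iff) auto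
    then show ?thesis using mweight_pos[of \<beta>] by (simp add: field_simps)
  qed
  \<comment> \<open>The constant \<kappa> is determined by integrating the even power of the norm,
    which is 1 on the sphere.\<close>
  have "complex_of_real 1 = (LINT \<xi>|(sphere_measure :: (complex ^ 'n) measure). complex_of_real (norm \<xi> ^ (2 * m)))"
  proof -
    have "(LINT \<xi>|(sphere_measure :: (complex ^ 'n) measure). complex_of_real (norm \<xi> ^ (2 * m))) = (LINT \<xi>|(sphere_measure :: (complex ^ 'n) measure). 1)"
      by (rule Bochner_Integration.integral_cong) (auto simp: space_sphere_prob)
    then show ?thesis by (simp add: space_sphere_prob measure_sphere_prob)
  qed
  also have "\<dots> = (LINT \<xi>|sphere_measure. (\<Sum>\<beta>\<in>?A. (1 / of_real (mweight \<beta>)) * (mpow \<xi> \<beta> * cnj (mpow \<xi> \<beta>))))"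
  proof (rule Bochner_Integration.integral_cong[OF refl])
    fix \<xi> :: "complex ^ 'n"
    have "complex_of_real (norm \<xi> ^ (2 * m)) = cinner \<xi> \<xi> ^ m" by (simp add: cinner_same power_mult)
    then show "complex_of_real (norm \<xi> ^ (2 * m)) = (\<Sum>\<beta>\<in>?A. (1 / of_real (mweight \<beta>)) * (mpow \<xi> \<beta> * cnj (mpow \<xi> \<beta>)))"
      unfolding expn by simp
  qed
  also have "\<dots> = (\<Sum>\<beta>\<in>?A. (1 / of_real (mweight \<beta>)) * of_real (d \<beta>))"
    unfolding dc by (subst Bochner_Integration.integral_sum) (intro integrable_mult_right sphere_integrable cont, simp)
  also have "\<dots> = (\<Sum>\<beta>\<in>?A. of_real \<kappa>)"
  proof (intro sum.cong refl)
    fix \<beta> :: "'n multi_index" assume "\<beta> \<in> ?A"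
    then show "(1 / complex_of_real (mweight \<beta>)) * of_real (d \<beta>) = of_real \<kappa>"
      using dk[of \<beta>] less_imp_neq[OF mweight_pos[of \<beta>]] by simp
  qed
  also have "\<dots> = of_real (real (card ?A) * \<kappa>)" by simp
  finally have k: "real (card ?A) * \<kappa> = 1" using of_real_eq_iff[where ?'a = complex] by metis
  then have "\<kappa> = 1 / real (card ?A)" by (metis mult_zero_left nonzero_mult_div_cancel_left zero_neq_one)
  then show ?thesis using dk[of \<alpha>] by (simp add: d_def m_def)
qed

lemma sphere_homogeneous_integral:
  fixes x :: "'n::finite multi_index \<Rightarrow> 'a::complex_inner"
  shows "(LINT \<xi>|sphere_measure. (norm (\<Sum>\<alpha> | mdeg \<alpha> = m. (cnj (mpow \<xi> \<alpha>) / of_real (mweight \<alpha>)) *\<^sub>C x \<alpha>))\<^sup>2)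
    = (\<Sum>\<alpha> | mdeg \<alpha> = m. (norm (x \<alpha>))\<^sup>2 / mweight \<alpha>) / real (card {\<alpha> :: 'n multi_index. mdeg \<alpha> = m})"
proof -
  let ?A = "{\<alpha> :: 'n multi_index. mdeg \<alpha> = m}"
  let ?t = "\<lambda>\<xi> \<alpha>. (cnj (mpow \<xi> \<alpha>) / of_real (mweight \<alpha>)) *\<^sub>C x \<alpha>"
  have e: "complex_of_real ((norm (\<Sum>\<alpha>\<in>?A. ?t \<xi> \<alpha>))\<^sup>2)
     = (\<Sum>\<alpha>\<in>?A. \<Sum>\<beta>\<in>?A. (cinner (x \<beta>) (x \<alpha>) / of_real (mweight \<alpha> * mweight \<beta>)) * (mpow \<xi> \<alpha> * cnj (mpow \<xi> \<beta>)))" for \<xi>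
    unfolding cinner_same[symmetric] cinner_sum_left cinner_sum_right
    by (intro sum.cong refl) (simp add: cinner_scaleC_left cinner_scaleC_right mult_ac)
  have cont: "continuous_on (sphere 0 1) (\<lambda>\<xi> :: complex ^ 'n. mpow \<xi> \<beta> * cnj (mpow \<xi> \<gamma>))" for \<beta> \<gamma>
    by (intro continuous_intros mpow_continuous)
  have "complex_of_real (LINT \<xi>|sphere_measure. (norm (\<Sum>\<alpha>\<in>?A. ?t \<xi> \<alpha>))\<^sup>2)
    = (LINT \<xi>|sphere_measure. complex_of_real ((norm (\<Sum>\<alpha>\<in>?A. ?t \<xi> \<alpha>))\<^sup>2))" by (rule integral_complex_of_real[symmetric])
  also have "\<dots> = (\<Sum>\<alpha>\<in>?A. \<Sum>\<beta>\<in>?A. (cinner (x \<beta>) (x \<alpha>) / of_real (mweight \<alpha> * mweight \<beta>)) * (LINT \<xi>|sphere_measure. mpow \<xi> \<alpha> * cnj (mpow \<xi> \<beta>)))"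
    unfolding e by (rule integral_double_sum[OF sphere_integrable[OF cont]])
  also have "\<dots> = (\<Sum>\<alpha>\<in>?A. \<Sum>\<beta>\<in>?A. if \<beta> = \<alpha> then of_real ((norm (x \<alpha>))\<^sup>2 / mweight \<alpha> / real (card ?A)) else 0)"
  proof (intro sum.cong refl)
    fix \<alpha> \<beta> :: "'n multi_index" assume a: "\<alpha> \<in> ?A" "\<beta> \<in> ?A"
    show "(cinner (x \<beta>) (x \<alpha>) / of_real (mweight \<alpha> * mweight \<beta>)) * (LINT \<xi>|sphere_measure. mpow \<xi> \<alpha> * cnj (mpow \<xi> \<beta>))
      = (if \<beta> = \<alpha> then of_real ((norm (x \<alpha>))\<^sup>2 / mweight \<alpha> / real (card ?A)) else 0)"
    proof (cases "\<beta> = \<alpha>")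
      case True
      have "(LINT \<xi>|sphere_measure. mpow \<xi> \<alpha> * cnj (mpow \<xi> \<alpha>)) = complex_of_real (mweight \<alpha> / real (card ?A))"
        unfolding complex_norm_square[symmetric] integral_complex_of_real sphere_mono_integral using a(1) by simp
      then show ?thesis using True less_imp_neq[OF mweight_pos[of \<alpha>]] by (simp add: cinner_same)
    qed (use sphere_mono_orthogonal[of \<alpha> \<beta>] in auto)
  qed
  also have "\<dots> = of_real ((\<Sum>\<alpha>\<in>?A. (norm (x \<alpha>))\<^sup>2 / mweight \<alpha>) / real (card ?A))"
    by (simp add: finite_mdeg sum_divide_distrib)
  finally show ?thesis by (simp only: of_real_eq_iff)
qed

section \<open>Measurability of radial limits and reduction to circles\<close>

lemma radial_sequence:
  obtains \<rho> :: "nat \<Rightarrow> real" where "\<And>j. 0 < \<rho> j" "\<And>j. \<rho> j < 1" "\<rho> \<longlonglongrightarrow> 1" "filterlim \<rho> (at_left 1) sequentially"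
proof
  let ?\<rho> = "\<lambda>j. 1 - 1 / real (j + 2)"
  show "0 < ?\<rho> j" "?\<rho> j < 1" for j by auto
  show "?\<rho> \<longlonglongrightarrow> 1"
    using tendsto_diff[OF tendsto_const LIMSEQ_Suc[OF LIMSEQ_inverse_real_of_nat], of 1] by (simp add: inverse_eq_divide add.commute)
  then show "filterlim ?\<rho> (at_left 1) sequentially" by (rule tendsto_imp_filterlim_at_left) auto
qed

text \<open>Existence of the limit is a Cauchy condition, countable over the sets
  \<open>C k t\<close>; each of these is closed, being an intersection of closed sets over
  uncountably many pairs of radii. Where the limit fails to exist, \<open>Lim\<close> is the value
  of an unsatisfiable description and so a constant.\<close>

lemma radial_limit_measurable:
  fixes g :: "real \<Rightarrow> 'a::euclidean_space \<Rightarrow> complex"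
  assumes c: "\<And>r. 0 < r \<Longrightarrow> r < 1 \<Longrightarrow> continuous_on (sphere 0 1) (g r)"
  shows "{\<xi> \<in> sphere 0 1. \<exists>l. ((\<lambda>r. g r \<xi>) \<longlongrightarrow> l) (at_left 1)} \<in> sets sphere_prob" (is "?Z \<in> _")
    "(\<lambda>\<xi>. Lim (at_left 1) (\<lambda>r. g r \<xi>)) \<in> borel_measurable sphere_prob"
proof -
  define I where "I k = {real k / real (Suc k)<..<1}" for k
  have I: "0 < r \<and> r < 1" if "r \<in> I k" for r k
    using that order_le_less_trans[of 0 "real k / real (Suc k)"] by (auto simp: I_def simp del: of_nat_Suc)
  have evI: "\<forall>\<^sub>F r in at_left 1. r \<in> I k" for k unfolding I_def by (rule eventually_at_left_real) simp
  define C where "C k t = {\<xi> \<in> sphere 0 1. \<forall>p\<in>I k. \<forall>q\<in>I k. dist (g p \<xi>) (g q \<xi>) \<le> t}" for k t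
  have "\<xi> \<in> ?Z \<longleftrightarrow> \<xi> \<in> (\<Inter>n. \<Union>k. C k (1 / real (Suc n)))" for \<xi>
  proof
    assume "\<xi> \<in> ?Z"
    then obtain l where \<xi>: "\<xi> \<in> sphere 0 1" and l: "((\<lambda>r. g r \<xi>) \<longlongrightarrow> l) (at_left 1)" by blast
    have "\<exists>k. \<xi> \<in> C k e" if "e > 0" for e
    proof -
      have "\<forall>\<^sub>F r in at_left 1. dist (g r \<xi>) l < e / 2" by (rule tendstoD[OF l]) (use that in simp)
      then obtain b where b: "b < 1" "\<And>r. b < r \<Longrightarrow> r < 1 \<Longrightarrow> dist (g r \<xi>) l < e / 2"
        by (auto simp: eventually_at_left_field)
      obtain k where "1 / (1 - b) < real k" using reals_Archimedean2 by blast
      then have "b < real k / real (Suc k)" using b(1) by (simp add: field_simps)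
      then have k: "dist (g r \<xi>) l < e / 2" if "r \<in> I k" for r using that b(2)[of r] by (auto simp: I_def)
      have "dist (g p \<xi>) (g q \<xi>) \<le> e" if "p \<in> I k" "q \<in> I k" for p q
        using dist_triangle2[of "g p \<xi>" "g q \<xi>" l] k[OF that(1)] k[OF that(2)] by linarith
      then show ?thesis using \<xi> by (auto simp: C_def)
    qed
    then show "\<xi> \<in> (\<Inter>n. \<Union>k. C k (1 / real (Suc n)))" by simp
  next
    assume \<xi>: "\<xi> \<in> (\<Inter>n. \<Union>k. C k (1 / real (Suc n)))"
    have "\<exists>l. ((\<lambda>r. g r \<xi>) \<longlongrightarrow> l) (at_left 1)"
    proof (rule convergent_filterI)
      fix e :: real assume "e > 0"
      then obtain n where n: "1 / real (Suc n) < e" using reals_Archimedean[of e] by (auto simp: inverse_eq_divide)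
      obtain k where k: "\<xi> \<in> C k (1 / real (Suc n))" using \<xi> by blast
      obtain q where q: "q \<in> I k" using eventually_happens[OF evI] by fastforce
      have d: "dist (g r \<xi>) (g q \<xi>) < e" if "r \<in> I k" for r
      proof -
        have "dist (g r \<xi>) (g q \<xi>) \<le> 1 / real (Suc n)" using k q that unfolding C_def by blast
        then show ?thesis using n by linarith
      qed
      show "\<exists>y. \<forall>\<^sub>F r in at_left 1. dist (g r \<xi>) y < e"
        by (rule exI, rule eventually_mono[OF evI[of k]]) (rule d)
    qed simp
    then show "\<xi> \<in> ?Z" using \<xi> by (auto simp: C_def)
  qed
  then have Z: "?Z = (\<Inter>n. \<Union>k. C k (1 / real (Suc n)))" by blast
  have "closed (C k t)" for k t
  proof -
    have "C k t = sphere 0 1 \<inter> (\<Inter>p\<in>I k. \<Inter>q\<in>I k. sphere 0 1 \<inter> (\<lambda>\<xi>. dist (g p \<xi>) (g q \<xi>)) -` {..t})"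
      by (auto simp: C_def)
    also have "closed \<dots>"
      by (intro closed_Int closed_INT ballI continuous_closed_preimage continuous_intros c closed_sphere closed_atMost)
         (use I in auto)
    finally show ?thesis .
  qed
  then have "?Z \<in> sets borel" unfolding Z by (intro sets.countable_INT' sets.countable_UN') auto
  then show *: "?Z \<in> sets sphere_prob" unfolding sets_sphere_prob by (subst sets_restrict_space_iff) auto
  obtain \<rho> :: "nat \<Rightarrow> real" where \<rho>: "\<And>j. 0 < \<rho> j" "\<And>j. \<rho> j < 1" "filterlim \<rho> (at_left 1) sequentially"
    using radial_sequence by metis
  have "(\<lambda>\<xi>. if \<xi> \<in> ?Z then lim (\<lambda>j. g (\<rho> j) \<xi>) else (THE l::complex. False)) \<in> borel_measurable sphere_prob"
    using * sphere_measurable[OF c[OF \<rho>(1,2)]] by (intro measurable_If_set borel_measurable_lim_metric) auto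
  also have "?this \<longleftrightarrow> (\<lambda>\<xi>. Lim (at_left 1) (\<lambda>r. g r \<xi>)) \<in> borel_measurable sphere_prob"
  proof (rule measurable_cong)
    fix \<xi> :: 'a assume \<xi>: "\<xi> \<in> space sphere_prob"
    show "(if \<xi> \<in> ?Z then lim (\<lambda>j. g (\<rho> j) \<xi>) else (THE l::complex. False)) = Lim (at_left 1) (\<lambda>r. g r \<xi>)"
    proof (cases "\<exists>l. ((\<lambda>r. g r \<xi>) \<longlongrightarrow> l) (at_left 1)")
      case True
      then obtain l where l: "((\<lambda>r. g r \<xi>) \<longlongrightarrow> l) (at_left 1)" by blast
      have "lim (\<lambda>j. g (\<rho> j) \<xi>) = l" by (rule limI[OF filterlim_compose[OF l \<rho>(3)]])
      moreover have "Lim (at_left 1) (\<lambda>r. g r \<xi>) = l" by (rule tendsto_Lim[OF _ l]) simp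
      ultimately show ?thesis using True \<xi> by (simp add: space_sphere_prob)
    qed (simp add: t2_space_class.Lim_def)
  qed
  finally show "(\<lambda>\<xi>. Lim (at_left 1) (\<lambda>r. g r \<xi>)) \<in> borel_measurable sphere_prob" .
qed

text \<open>By rotation invariance the exceptional set has the same measure as its rotated copies.
  Integrating over the angle and exchanging the integrals leaves a null set of angles for each
  \<xi>.\<close>

lemma sphere_AE_slices:
  fixes P :: "complex ^ 'n::finite \<Rightarrow> bool"
  assumes m: "{\<xi> \<in> sphere 0 1. P \<xi>} \<in> sets sphere_measure"
    and P: "\<And>\<xi>. \<xi> \<in> sphere 0 1 \<Longrightarrow> AE \<theta> in lborel. \<theta> \<in> {-pi..pi} \<longrightarrow> P (cis (- \<theta>) *\<^sub>C \<xi>)"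
  shows "AE \<xi> in sphere_measure. P \<xi>"
proof -
  interpret S: finite_measure sphere_measure by (rule finite_measure_sphere_prob)
  interpret PS: pair_sigma_finite lborel sphere_measure ..
  define N where "N = {\<xi> \<in> sphere 0 1. \<not> P \<xi>}"
  have "N = space sphere_measure - {\<xi> \<in> sphere 0 1. P \<xi>}" by (auto simp: N_def space_sphere_prob)
  then have N: "N \<in> sets sphere_measure" using m by auto
  let ?rot = "\<lambda>(\<theta>, \<xi>). cis (- \<theta>) *\<^sub>C (\<xi> :: complex ^ 'n)"
  have rot: "?rot \<in> measurable (lborel \<Otimes>\<^sub>M sphere_measure) sphere_measure"
  proof -
    have 1: "(\<lambda>p. (fst p, snd p)) \<in> measurable (lborel \<Otimes>\<^sub>M sphere_measure) (borel \<Otimes>\<^sub>M borel)"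
    proof (rule measurable_Pair)
      have "(\<lambda>\<xi>. \<xi>) \<in> borel_measurable sphere_measure" by (rule sphere_measurable) (rule continuous_on_id)
      then show "snd \<in> measurable (lborel \<Otimes>\<^sub>M sphere_measure) borel" by (metis (no_types, lifting) measurable_snd measurable_compose measurable_cong)
      show "fst \<in> measurable (lborel \<Otimes>\<^sub>M sphere_measure) borel" using measurable_fst measurable_lborel1 by (simp add: measurable_lborel2[symmetric])
    qed
    have "continuous_on UNIV ?rot"
    proof -
      have "?rot = (\<lambda>p. \<chi> i. cis (- fst p) * snd p $ i)" by (auto simp: scaleC_vec_def scaleC_complex_def)
      then show ?thesis by (auto intro!: continuous_intros)
    qed
    then have "?rot \<in> measurable (borel \<Otimes>\<^sub>M borel) borel" unfolding borel_prod by (rule borel_measurable_continuous_onI)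
    from measurable_compose[OF 1 this]
    have "?rot \<in> measurable (lborel \<Otimes>\<^sub>M sphere_measure) borel" by (simp add: case_prod_unfold)
    then have "?rot \<in> measurable (lborel \<Otimes>\<^sub>M sphere_measure) (restrict_space borel (sphere 0 1))"
      by (rule measurable_restrict_space2[rotated]) (auto simp: space_pair_measure space_sphere_prob norm_scaleC)
    then show ?thesis using measurable_cong_sets[OF refl sets_sphere_prob] by blast
  qed
  let ?h = "\<lambda>(\<theta>, \<xi>). indicator {-pi..pi} \<theta> * indicator N (?rot (\<theta>, \<xi>)) :: ennreal"
  have h: "?h \<in> borel_measurable (lborel \<Otimes>\<^sub>M sphere_measure)"
  proof -
    have "(\<lambda>p. indicator N (?rot p) :: ennreal) \<in> borel_measurable (lborel \<Otimes>\<^sub>M sphere_measure)"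
      by (rule measurable_compose[OF rot]) (use N in simp)
    moreover have "(\<lambda>p. indicator {-pi..pi} (fst p) :: ennreal) \<in> borel_measurable (lborel \<Otimes>\<^sub>M sphere_measure)"
      by (rule measurable_compose[OF measurable_fst]) simp
    ultimately show ?thesis by (simp add: case_prod_unfold borel_measurable_times)
  qed
  have "(\<integral>\<^sup>+\<theta>. \<integral>\<^sup>+\<xi>. ?h (\<theta>, \<xi>) \<partial>sphere_measure \<partial>lborel) = (\<integral>\<^sup>+\<theta>. indicator {-pi..pi} \<theta> * emeasure sphere_measure N \<partial>lborel)"
  proof (rule nn_integral_cong)
    fix \<theta> :: real
    have r: "(\<lambda>\<xi> :: complex ^ 'n. cis (- \<theta>) *\<^sub>C \<xi>) \<in> measurable sphere_measure sphere_measure" by (rule rotation_measurable[OF orthogonal_cis])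
    have "(\<integral>\<^sup>+\<xi>. ?h (\<theta>, \<xi>) \<partial>sphere_measure) = indicator {-pi..pi} \<theta> * (\<integral>\<^sup>+\<xi>. indicator N (cis (- \<theta>) *\<^sub>C \<xi>) \<partial>sphere_measure)"
      by (simp, rule nn_integral_cmult, rule measurable_compose[OF r]) (use N in simp)
    also have "(\<integral>\<^sup>+\<xi>. indicator N (cis (- \<theta>) *\<^sub>C \<xi>) \<partial>sphere_measure) = (\<integral>\<^sup>+\<xi>. indicator N \<xi> \<partial>distr sphere_measure sphere_measure (\<lambda>\<xi>. cis (- \<theta>) *\<^sub>C \<xi>))"
      by (rule nn_integral_distr[symmetric, OF r]) (use N in simp)
    also have "\<dots> = emeasure sphere_measure N" unfolding sphere_prob_rotation_invariant[OF orthogonal_cis] using N by simp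
    finally show "(\<integral>\<^sup>+\<xi>. ?h (\<theta>, \<xi>) \<partial>sphere_measure) = indicator {-pi..pi} \<theta> * emeasure sphere_measure N" .
  qed
  also have "\<dots> = ennreal (2 * pi) * emeasure sphere_measure N" by (subst nn_integral_multc) auto
  finally have 1: "(\<integral>\<^sup>+\<theta>. \<integral>\<^sup>+\<xi>. ?h (\<theta>, \<xi>) \<partial>sphere_measure \<partial>lborel) = ennreal (2 * pi) * emeasure sphere_measure N" .
  have "(\<integral>\<^sup>+\<theta>. \<integral>\<^sup>+\<xi>. ?h (\<theta>, \<xi>) \<partial>sphere_measure \<partial>lborel) = (\<integral>\<^sup>+\<xi>. \<integral>\<^sup>+\<theta>. ?h (\<theta>, \<xi>) \<partial>lborel \<partial>sphere_measure)"
    using PS.Fubini[OF h] by simp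
  also have "\<dots> = (\<integral>\<^sup>+\<xi>. 0 \<partial>(sphere_measure :: (complex ^ 'n) measure))"
  proof (rule nn_integral_cong)
    fix \<xi> :: "complex ^ 'n" assume "\<xi> \<in> space sphere_measure"
    then have "AE \<theta> in lborel. \<theta> \<in> {-pi..pi} \<longrightarrow> P (cis (- \<theta>) *\<^sub>C \<xi>)" using P by (simp add: space_sphere_prob)
    then have "AE \<theta> in lborel. ?h (\<theta>, \<xi>) = 0" by eventually_elim (auto simp: indicator_def N_def)
    then have "(\<integral>\<^sup>+\<theta>. ?h (\<theta>, \<xi>) \<partial>lborel) = (\<integral>\<^sup>+\<theta>. 0 \<partial>(lborel :: real measure))" by (rule nn_integral_cong_AE)
    then show "(\<integral>\<^sup>+\<theta>. ?h (\<theta>, \<xi>) \<partial>lborel) = 0" by simp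
  qed
  finally have "ennreal (2 * pi) * emeasure sphere_measure N = 0" using 1 by simp
  then have "emeasure sphere_measure N = 0" by simp
  then have "N \<in> null_sets sphere_measure" using N by auto
  then show ?thesis by (rule AE_I') (auto simp: N_def space_sphere_prob)
qed

section \<open>Curvature\<close>

text \<open>Pascal's rule for multinomial coefficients, which are the reciprocals of the
  weights.\<close>

lemma mweight_reciprocal_sum:
  fixes \<beta> :: "'n::finite multi_index"
  assumes "mdeg \<beta> = Suc m"
  shows "(\<Sum>i | lookup \<beta> i \<noteq> 0. 1 / mweight (\<beta> - single i (Suc 0))) = 1 / mweight \<beta>"
proof -
  let ?e = "\<lambda>i::'n. single i (Suc 0)" and ?I = "{i. lookup \<beta> i \<noteq> 0}"
  have "(\<Sum>i\<in>?I. 1 / mweight (\<beta> - ?e i)) = (\<Sum>i\<in>?I. real (lookup \<beta> i) / (mweight \<beta> * real (Suc m)))"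
  proof (rule sum.cong[OF refl])
    fix i assume i: "i \<in> ?I"
    then have "mweight \<beta> * real (Suc m) = mweight (\<beta> - ?e i) * real (lookup \<beta> i)"
      using multi_index_minus_single(3)[of \<beta> i] assms by simp
    then show "1 / mweight (\<beta> - ?e i) = real (lookup \<beta> i) / (mweight \<beta> * real (Suc m))"
      using i mweight_pos[of "\<beta> - ?e i"] by (simp add: field_simps)
  qed
  also have "\<dots> = (\<Sum>i\<in>UNIV. real (lookup \<beta> i)) / (mweight \<beta> * real (Suc m))"
    unfolding sum_divide_distrib by (rule sum.mono_neutral_left) auto
  also have "(\<Sum>i\<in>UNIV. real (lookup \<beta> i)) = real (Suc m)"
    unfolding of_nat_sum[symmetric] mdeg_def[symmetric] assms ..
  finally show ?thesis by simp
qed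

lemma Lim_cong: "eventually (\<lambda>x. f x = g x) F \<Longrightarrow> Lim F f = Lim F g"
  unfolding t2_space_class.Lim_def by (simp add: tendsto_cong)

text \<open>A decreasing sequence stays above its limit, and so do its Abel means. For the upper
  bound the first \<open>M\<close> terms are split off; they vanish with
  \<open>1 - x j\<close>.\<close>

lemma abel_mean_limit:
  fixes b :: "nat \<Rightarrow> real"
  assumes dec: "decseq b" and b0: "\<And>m. 0 \<le> b m" and lim: "b \<longlonglongrightarrow> \<beta>"
    and x: "x \<longlonglongrightarrow> 1" "\<And>j. 0 \<le> x j" "\<And>j. x j < 1"
    and s: "\<And>j. (\<lambda>m. x j ^ m * b m) sums y j"
  shows "(\<lambda>j. (1 - x j) * y j) \<longlonglongrightarrow> \<beta>"
proof (rule LIMSEQ_I)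
  have geo: "(\<lambda>m. x j ^ m * c) sums (c / (1 - x j))" for j c
    using sums_mult2[OF geometric_sums[of "x j"], of c] x(2,3)[of j] by simp
  have lower: "\<beta> \<le> (1 - x j) * y j" for j
  proof -
    have "\<beta> / (1 - x j) \<le> y j"
      by (rule sums_le[OF _ geo s]) (use decseq_ge[OF dec lim] x(2) in \<open>simp add: mult_left_mono\<close>)
    then show ?thesis using x(3)[of j] by (simp add: field_simps)
  qed
  have upper: "(1 - x j) * y j \<le> b M + (1 - x j) * (real M * b 0)" for j M
  proof -
    let ?h = "\<lambda>m. if m < M then b 0 else 0"
    have "?h sums (\<Sum>m<M. b 0)" using sums_If_finite_set[of "{..<M}" "\<lambda>_. b 0"] by simp
    then have h: "(\<lambda>m. x j ^ m * b M + ?h m) sums (b M / (1 - x j) + real M * b 0)" by (intro sums_add geo) simp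
    have "y j \<le> b M / (1 - x j) + real M * b 0"
    proof (rule sums_le[OF _ s h])
      fix m
      have p: "0 \<le> x j ^ m" "x j ^ m \<le> 1" using x(2,3)[of j] by (auto intro: power_le_one)
      show "x j ^ m * b m \<le> x j ^ m * b M + ?h m"
      proof (cases "m < M")
        case True
        have "x j ^ m * b m \<le> 1 * b 0" by (intro mult_mono decseqD[OF dec] p b0) auto
        then show ?thesis using True p b0 by (simp add: add_increasing)
      next
        case False
        then show ?thesis using decseqD[OF dec, of M m] p by (simp add: mult_left_mono)
      qed
    qed
    then have "(1 - x j) * y j \<le> (1 - x j) * (b M / (1 - x j) + real M * b 0)"
      using x(3)[of j] by (intro mult_left_mono) auto
    then show ?thesis using x(3)[of j] by (simp add: distrib_left)
  qed
  fix e :: real assume e: "0 < e"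
  obtain M where M: "b M < \<beta> + e / 2"
    using order_tendstoD(2)[OF lim, of "\<beta> + e / 2"] e by (auto simp: eventually_sequentially)
  have "(\<lambda>j. (1 - x j) * (real M * b 0)) \<longlonglongrightarrow> (1 - 1) * (real M * b 0)" by (intro tendsto_intros x)
  then have "\<forall>\<^sub>F j in sequentially. (1 - x j) * (real M * b 0) < e / 2" by (rule order_tendstoD) (use e in simp)
  then obtain J where J: "\<And>j. j \<ge> J \<Longrightarrow> (1 - x j) * (real M * b 0) < e / 2" by (auto simp: eventually_sequentially)
  have "norm ((1 - x j) * y j - \<beta>) < e" if "j \<ge> J" for j
    using lower[of j] upper[of j M] J[OF that] M by (simp add: abs_of_nonneg)
  then show "\<exists>J. \<forall>j\<ge>J. norm ((1 - x j) * y j - \<beta>) < e" by blast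
qed

context row_contraction
begin

text \<open>The multinomial theorem for commuting operators, with the coefficients in the form of
  reciprocal weights.\<close>

lemma S_power:
  "(S \<xi> ^^ m) x = (\<Sum>\<alpha> | mdeg \<alpha> = m. (cnj (mpow \<xi> \<alpha>) / of_real (mweight \<alpha>)) *\<^sub>C op_monomial T \<alpha> x)"
proof (induction m arbitrary: x)
  case 0
  show ?case by (simp add: mdeg_eq_0) (simp add: mweight_def mdeg_def mpow_def op_monomial_zero)
next
  case (Suc m)
  let ?e = "\<lambda>i::'n. single i (Suc 0)"
  let ?c = "\<lambda>i \<alpha>. (cnj (mpow \<xi> (\<alpha> + ?e i)) / of_real (mweight \<alpha>)) *\<^sub>C op_monomial T (\<alpha> + ?e i) x"
  have "(S \<xi> ^^ Suc m) x = (S \<xi> ^^ m) (S \<xi> x)" by (simp add: funpow_swap1)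
  also have "\<dots> = (\<Sum>\<alpha> | mdeg \<alpha> = m. \<Sum>i\<in>UNIV. ?c i \<alpha>)"
    unfolding Suc.IH S_sum by (intro sum.cong refl)
       (simp add: bounded_clinear_sum[OF op_monomial_clinear] op_monomial_linear scaleC_sum_right scaleC_scaleC mpow_add_single op_monomial_Suc)
  also have "\<dots> = (\<Sum>\<beta> | mdeg \<beta> = Suc m. \<Sum>i | lookup \<beta> i \<noteq> 0. ?c i (\<beta> - ?e i))"
    by (rule multi_index_Suc_sum[symmetric])
  also have "\<dots> = (\<Sum>\<beta> | mdeg \<beta> = Suc m. (cnj (mpow \<xi> \<beta>) / of_real (mweight \<beta>)) *\<^sub>C op_monomial T \<beta> x)"
  proof (intro sum.cong refl)
    fix \<beta> :: "'n multi_index" assume b: "\<beta> \<in> {\<beta>. mdeg \<beta> = Suc m}"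
    let ?I = "{i. lookup \<beta> i \<noteq> 0}"
    have "(\<Sum>i\<in>?I. ?c i (\<beta> - ?e i)) = (\<Sum>i\<in>?I. (cnj (mpow \<xi> \<beta>) * of_real (1 / mweight (\<beta> - ?e i))) *\<^sub>C op_monomial T \<beta> x)"
      by (intro sum.cong refl) (simp add: multi_index_minus_single)
    also have "\<dots> = (cnj (mpow \<xi> \<beta>) * of_real (\<Sum>i\<in>?I. 1 / mweight (\<beta> - ?e i))) *\<^sub>C op_monomial T \<beta> x"
      by (simp add: complex_vector.scale_sum_left[symmetric] sum_distrib_left)
    also have "(\<Sum>i\<in>?I. 1 / mweight (\<beta> - ?e i)) = 1 / mweight \<beta>" by (rule mweight_reciprocal_sum) (use b in simp)
    finally show "(\<Sum>i\<in>?I. ?c i (\<beta> - ?e i)) = (cnj (mpow \<xi> \<beta>) / of_real (mweight \<beta>)) *\<^sub>C op_monomial T \<beta> x" by simp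
  qed
  finally show ?case .
qed

text \<open>For \<open>x = \<Delta> e\<close>, summed over an orthonormal basis of the defect space,
  the numerator is the trace of \<Phi>^m(\<Delta>^2), where \<Phi> sends \<open>X\<close> to the sum
  of the \<open>T_i X T_i^*\<close>. The denominator is the dimension of the homogeneous polynomials
  of degree \<open>m\<close>.\<close>

definition homog_mean :: "nat \<Rightarrow> 'h \<Rightarrow> real" where
  "homog_mean m x = (\<Sum>\<alpha> | mdeg \<alpha> = m. (norm (op_monomial T \<alpha> x))\<^sup>2 / mweight \<alpha>) / real (card {\<alpha> :: 'n multi_index. mdeg \<alpha> = m})"

lemma S_power_integral: "(LINT \<xi>|sphere_measure. (norm ((S \<xi> ^^ m) x))\<^sup>2) = homog_mean m x"
  unfolding S_power homog_mean_def by (rule sphere_homogeneous_integral)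

lemma S_scale: "S (c *\<^sub>C \<xi>) x = cnj c *\<^sub>C S \<xi> x" "(S (c *\<^sub>C \<xi>) ^^ m) x = cnj c ^ m *\<^sub>C (S \<xi> ^^ m) x"
proof -
  show 1: "S (c *\<^sub>C \<xi>) x = cnj c *\<^sub>C S \<xi> x" for x
    by (simp add: S_sum scaleC_vec_def scaleC_complex_def scaleC_sum_right scaleC_scaleC)
  show "(S (c *\<^sub>C \<xi>) ^^ m) x = cnj c ^ m *\<^sub>C (S \<xi> ^^ m) x"
    by (induction m) (simp_all add: 1 bounded_clinearD[OF S_clinear(1)] scaleC_scaleC mult.commute)
qed

lemma S_power_continuous: "continuous_on X (\<lambda>\<xi>. (S \<xi> ^^ m) x)"
  unfolding S_power by (intro continuous_intros continuous_scaleC mpow_continuous) (simp add: less_imp_neq[OF mweight_pos, THEN not_sym])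

lemma S_power_norm: "\<xi> \<in> sphere 0 1 \<Longrightarrow> norm ((S \<xi> ^^ m) x) \<le> norm x"
proof (induction m)
  case (Suc m)
  then show ?case using S_norm(1)[of \<xi> "(S \<xi> ^^ m) x"] by simp
qed simp

text \<open>Hardly visible in the sum over \<alpha>, monotonicity holds pointwise in the integral
  over the sphere, because \<open>S \<xi>\<close> is a contraction for unit vectors \<xi>.\<close>

lemma homog_mean_decseq: "decseq (\<lambda>m. homog_mean m x)"
proof (rule decseq_SucI)
  fix m
  have "continuous_on X (\<lambda>\<xi>. (norm ((S \<xi> ^^ m) x))\<^sup>2)" for X m by (intro continuous_intros S_power_continuous)
  then show "homog_mean (Suc m) x \<le> homog_mean m x"
    unfolding S_power_integral[symmetric]
  proof (intro integral_mono sphere_integrable)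
    fix \<xi> :: "complex ^ 'n" assume "\<xi> \<in> space sphere_measure"
    then show "(norm ((S \<xi> ^^ Suc m) x))\<^sup>2 \<le> (norm ((S \<xi> ^^ m) x))\<^sup>2"
      using S_norm(1)[of \<xi> "(S \<xi> ^^ m) x"] by (intro power_mono) (simp_all add: space_sphere_prob)
  qed
qed

lemma homog_mean_nonneg: "0 \<le> homog_mean m x"
  unfolding homog_mean_def by (intro divide_nonneg_nonneg sum_nonneg) (simp_all add: less_imp_le[OF mweight_pos])

text \<open>Powers of different degree react differently to a common phase of \<xi>; the phase is
  chosen to turn the integrand into its negative.\<close>

lemma S_power_orthogonal:
  assumes "m \<noteq> k"
  shows "(LINT \<xi>|sphere_measure. inner ((S \<xi> ^^ m) x) ((S \<xi> ^^ k) x)) = 0"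
proof -
  define t where "t = pi / (real m - real k)"
  have "cnj (cis t) ^ m * cnj (cnj (cis t) ^ k) = cis (- (real m * t) + real k * t)"
    by (simp add: cis_cnj Complex.DeMoivre cis_mult)
  also have "- (real m * t) + real k * t = - ((real m - real k) * t)" by (simp add: algebra_simps)
  also have "(real m - real k) * t = pi" using assms by (simp add: t_def)
  also have "cis (- pi) = -1" by (simp add: complex_eq_iff)
  finally have c: "cnj (cis t) ^ m * cnj (cnj (cis t) ^ k) = -1" .
  have e: "inner ((S (cis t *\<^sub>C \<xi>) ^^ m) x) ((S (cis t *\<^sub>C \<xi>) ^^ k) x) = - inner ((S \<xi> ^^ m) x) ((S \<xi> ^^ k) x)" for \<xi>
  proof -
    have "cinner ((S (cis t *\<^sub>C \<xi>) ^^ m) x) ((S (cis t *\<^sub>C \<xi>) ^^ k) x) = (cnj (cis t) ^ m * cnj (cnj (cis t) ^ k)) * cinner ((S \<xi> ^^ m) x) ((S \<xi> ^^ k) x)"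
      unfolding S_scale cinner_scaleC_left cinner_scaleC_right by (simp only: mult_ac)
    then show ?thesis unfolding c inner_cinner by simp
  qed
  have "(LINT \<xi>|sphere_measure. inner ((S \<xi> ^^ m) x) ((S \<xi> ^^ k) x)) = (LINT \<xi>|sphere_measure. - inner ((S \<xi> ^^ m) x) ((S \<xi> ^^ k) x))"
    using sphere_integral_rotation[OF orthogonal_cis[of t], of "\<lambda>\<xi>. inner ((S \<xi> ^^ m) x) ((S \<xi> ^^ k) x)"] unfolding e
    by (simp add: continuous_on_inner S_power_continuous)
  then show ?thesis by simp
qed

lemma R_ball_continuous: "continuous_on (ball 0 1) (\<lambda>z. R z x)"
proof (rule continuous_at_imp_continuous_on, rule ballI)
  fix w :: "complex ^ 'n" assume "w \<in> ball 0 1"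
  then have w: "norm w < 1" by simp
  define q where "q = (1 + norm w) / 2"
  have q: "norm w < q" "q < 1" using w by (auto simp: q_def)
  have Sdiff: "S z h - S w h = S (z - w) h" for z h
    by (simp add: S_sum sum_subtractf[symmetric] complex_vector.scale_left_diff_distrib)
  have b: "norm (R z x - R w x) \<le> norm (z - w) * (norm x / (1 - q) / (1 - q))" if z: "norm z < q" for z
  proof -
    have z1: "norm z < 1" using z q by linarith
    have "R z x - R w x = R z (x - (R w x - S z (R w x)))"
      using R_props(2)[OF z1, of "R w x"] by (simp add: bounded_clinearD[OF R_props(5)[OF z1]])
    also have "x - (R w x - S z (R w x)) = S (z - w) (R w x)"
      using R_props(1)[OF w, of x] Sdiff[of z "R w x"] by (simp add: algebra_simps)
    finally have "norm (R z x - R w x) \<le> norm (S (z - w) (R w x)) / (1 - norm z)" using R_props(9)[OF z1] by simp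
    also have "\<dots> \<le> norm (S (z - w) (R w x)) / (1 - q)" using z q by (intro divide_left_mono) auto
    also have "\<dots> \<le> (norm (z - w) * (norm x / (1 - q))) / (1 - q)"
    proof (intro divide_right_mono order_trans[OF S_norm(1)] mult_left_mono)
      show "norm (R w x) \<le> norm x / (1 - q)" using R_props(9)[OF w, of x] q by (smt (verit) frac_le norm_ge_zero)
    qed (use q in auto)
    finally show ?thesis by simp
  qed
  have "((\<lambda>z. R z x - R w x) \<longlongrightarrow> 0) (at w)"
  proof (rule Lim_null_comparison)
    have "open (ball 0 q :: (complex ^ 'n) set)" "w \<in> ball 0 q" using q by auto
    then have "\<forall>\<^sub>F z in at w. z \<in> ball 0 q" by (rule eventually_at_in_open')
    then show "\<forall>\<^sub>F z in at w. norm (R z x - R w x) \<le> norm (z - w) * (norm x / (1 - q) / (1 - q))"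
      by eventually_elim (use b in auto)
    have "((\<lambda>z. norm (z - w) * (norm x / (1 - q) / (1 - q))) \<longlongrightarrow> norm (w - w) * (norm x / (1 - q) / (1 - q))) (at w)"
      by (rule tendsto_mult_right[OF tendsto_norm[OF tendsto_diff[OF tendsto_ident_at tendsto_const]]])
    then show "((\<lambda>z. norm (z - w) * (norm x / (1 - q) / (1 - q))) \<longlongrightarrow> 0) (at w)" by simp
  qed
  then show "isCont (\<lambda>z. R z x) w" by (simp add: isCont_def LIM_zero_iff)
qed

lemma sphere_radial: "0 \<le> r \<Longrightarrow> r < 1 \<Longrightarrow> \<xi> \<in> sphere 0 1 \<Longrightarrow> norm (r *\<^sub>R (\<xi> :: complex ^ 'n)) = r \<and> norm (r *\<^sub>R \<xi>) < 1"
  by simp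

lemma R_power_series:
  assumes r: "0 \<le> r" "r < 1" and \<xi>: "\<xi> \<in> sphere 0 1"
  shows "(\<lambda>m. r ^ m *\<^sub>R (S \<xi> ^^ m) x) sums R (r *\<^sub>R \<xi>) x"
proof -
  have "(S (r *\<^sub>R \<xi>) ^^ m) x = r ^ m *\<^sub>R (S \<xi> ^^ m) x" for m
    unfolding scaleR_scaleC[of r \<xi>] S_scale by (simp add: scaleR_scaleC)
  then show ?thesis using R_props(7)[of "r *\<^sub>R \<xi>" x] sphere_radial[OF r \<xi>] by simp
qed

lemma R_radial_continuous: "0 \<le> r \<Longrightarrow> r < 1 \<Longrightarrow> continuous_on (sphere 0 1) (\<lambda>\<xi>. R (r *\<^sub>R \<xi>) x)"
  by (rule continuous_on_compose2[OF R_ball_continuous]) (auto intro!: continuous_intros)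

text \<open>Expansion of the resolvent in its Neumann series; orthogonality of different degrees
  leaves only the diagonal.\<close>

lemma R_integral:
  assumes r: "0 \<le> r" "r < 1"
  shows "(\<lambda>m. (r\<^sup>2) ^ m * homog_mean m x) sums (LINT \<xi>|sphere_measure. (norm (R (r *\<^sub>R \<xi>) x))\<^sup>2)"
proof -
  let ?f = "\<lambda>N \<xi>. (norm (\<Sum>m<N. r ^ m *\<^sub>R (S \<xi> ^^ m) x))\<^sup>2"
  have c: "continuous_on X (?f N)" for N X by (intro continuous_intros S_power_continuous)
  have 1: "(LINT \<xi>|sphere_measure. ?f N \<xi>) = (\<Sum>m<N. (r\<^sup>2) ^ m * homog_mean m x)" for N
  proof -
    have ic: "integrable sphere_measure (\<lambda>\<xi>. inner ((S \<xi> ^^ m) x) ((S \<xi> ^^ k) x))" for m k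
      by (intro sphere_integrable continuous_intros S_power_continuous)
    have "?f N \<xi> = (\<Sum>m<N. \<Sum>k<N. r ^ m * r ^ k * inner ((S \<xi> ^^ m) x) ((S \<xi> ^^ k) x))" for \<xi>
      by (simp add: power2_norm_eq_inner inner_sum_left inner_sum_right inner_commute mult_ac)
    then have "(LINT \<xi>|sphere_measure. ?f N \<xi>) = (\<Sum>m<N. \<Sum>k<N. r ^ m * r ^ k * (LINT \<xi>|sphere_measure. inner ((S \<xi> ^^ m) x) ((S \<xi> ^^ k) x)))"
      by (simp only: integral_double_sum[OF ic])
    also have "\<dots> = (\<Sum>m<N. \<Sum>k<N. if k = m then (r\<^sup>2) ^ m * homog_mean m x else 0)"
    proof (intro sum.cong refl)
      fix m k
      show "r ^ m * r ^ k * (LINT \<xi>|sphere_measure. inner ((S \<xi> ^^ m) x) ((S \<xi> ^^ k) x)) = (if k = m then (r\<^sup>2) ^ m * homog_mean m x else 0)"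
        using S_power_orthogonal[of m k x] S_power_integral[of m x]
        by (auto simp: power2_norm_eq_inner[symmetric] power_mult_distrib power2_eq_square[of r])
    qed
    finally show ?thesis by simp
  qed
  have "(\<lambda>N. LINT \<xi>|sphere_measure. ?f N \<xi>) \<longlonglongrightarrow> (LINT \<xi>|sphere_measure. (norm (R (r *\<^sub>R \<xi>) x))\<^sup>2)"
  proof (rule integral_dominated_convergence[where w = "\<lambda>_. (norm x / (1 - r))\<^sup>2"])
    show "(\<lambda>\<xi>. (norm (R (r *\<^sub>R \<xi>) x))\<^sup>2) \<in> borel_measurable sphere_measure"
      by (intro sphere_measurable continuous_intros R_radial_continuous r)
    show "?f N \<in> borel_measurable sphere_measure" for N by (intro sphere_measurable c)
    show "integrable sphere_measure (\<lambda>_ :: complex ^ 'n. (norm x / (1 - r))\<^sup>2)" by (intro sphere_integrable continuous_intros)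
    show "AE \<xi> in sphere_measure. (\<lambda>N. ?f N \<xi>) \<longlonglongrightarrow> (norm (R (r *\<^sub>R \<xi>) x))\<^sup>2"
      using R_power_series[OF r] by (intro AE_I2 tendsto_intros) (auto simp: space_sphere_prob sums_def)
    show "AE \<xi> in sphere_measure. norm (?f N \<xi>) \<le> (norm x / (1 - r))\<^sup>2" for N
    proof (rule AE_I2)
      fix \<xi> :: "complex ^ 'n" assume "\<xi> \<in> space sphere_measure"
      then have \<xi>: "\<xi> \<in> sphere 0 1" by (simp add: space_sphere_prob)
      have "norm (\<Sum>m<N. r ^ m *\<^sub>R (S \<xi> ^^ m) x) \<le> (\<Sum>m<N. r ^ m * norm x)"
        by (rule order_trans[OF norm_sum sum_mono]) (use r S_power_norm[OF \<xi>] in \<open>simp add: mult_left_mono\<close>)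
      also have "\<dots> \<le> suminf (\<lambda>m. r ^ m * norm x)"
        by (rule sum_le_suminf) (use r in \<open>auto intro!: summable_mult2 summable_geometric\<close>)
      also have "\<dots> = norm x / (1 - r)"
        using suminf_mult2[OF summable_geometric[of r], of "norm x"] suminf_geometric[of r] r by simp
      finally show "norm (?f N \<xi>) \<le> (norm x / (1 - r))\<^sup>2" by (simp add: power_mono)
    qed
  qed
  then show ?thesis unfolding 1 sums_def .
qed

text \<open>The kernel identity on the diagonal, paired with \<open>e\<close>. It bounds the
  curvature integrand and ties its limits to radial limits of the adjoint symbol.\<close>

lemma norm_char_symbol_adj:
  assumes "norm z < 1"
  shows "(1 - (norm z)\<^sup>2) * (norm (R z (\<Delta> e)))\<^sup>2 = (norm e)\<^sup>2 - (norm (\<Theta>ad z e))\<^sup>2"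
proof -
  have "cinner (\<Delta> (Rad z (R z (\<Delta> e)))) e = cinner (Rad z (R z (\<Delta> e))) (\<Delta> e)" by (rule defect_selfadjoint)
  also have "\<dots> = cnj (cinner (R z (\<Delta> e)) (R z (\<Delta> e)))" using R_adjoint[OF assms] by (metis cinner_commute)
  finally have "cinner (e - \<Theta> z (\<Theta>ad z e)) e = (1 - cinner z z) * cnj (cinner (R z (\<Delta> e)) (R z (\<Delta> e)))"
    by (simp add: char_symbol_kernel_identity[OF assms assms] cinner_scaleC_left)
  moreover have "cinner (e - \<Theta> z (\<Theta>ad z e)) e = cinner e e - cinner (\<Theta>ad z e) (\<Theta>ad z e)"
    by (simp add: cinner_diff char_symbol_adjoint[OF assms])
  ultimately have "complex_of_real ((1 - (norm z)\<^sup>2) * (norm (R z (\<Delta> e)))\<^sup>2) = complex_of_real ((norm e)\<^sup>2 - (norm (\<Theta>ad z e))\<^sup>2)"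
    by (simp add: cinner_same)
  then show ?thesis by (simp only: of_real_eq_iff)
qed

text \<open>The rotation is by \<open>- \<theta>\<close> because \<open>S\<close> is conjugate
  linear in its parameter; the adjoint symbol then becomes a power series in
  \<open>r * cis \<theta>\<close>.\<close>

abbreviation "slice \<theta> \<xi> e r \<equiv> (1 - r\<^sup>2) * (norm (R (r *\<^sub>R (cis (- \<theta>) *\<^sub>C \<xi>)) (\<Delta> e)))\<^sup>2"

text \<open>The defect identity and \<open>norm \<xi> = 1\<close> give each coefficient after the
  first as a difference of consecutive squared norms of \<open>y\<close>. The sum telescopes, so the
  coefficients are square summable and Fatou's theorem applies for every \<xi>.\<close>

lemma char_symbol_slice_limit:
  assumes \<xi>: "\<xi> \<in> sphere 0 1"
  shows "AE \<theta> in lborel. \<theta> \<in> {-pi..pi} \<longrightarrow>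
    (\<exists>l. ((\<lambda>r. slice \<theta> \<xi> e r) \<longlongrightarrow> l) (at_left 1))"
proof -
  define y where "y k = (S \<xi> ^^ k) (\<Delta> e)" for k
  define c where "c k = (case k of 0 \<Rightarrow> - rowad e | Suc j \<Rightarrow> \<Delta>s (zcol \<xi> (y j)))" for k
  have nc: "(norm (c (Suc j)))\<^sup>2 = (norm (y j))\<^sup>2 - (norm (y (Suc j)))\<^sup>2" for j
    using \<xi> by (simp add: c_def norm_defect norm_zcol y_def S_def)
  have "(\<Sum>j<N. (norm (c (Suc j)))\<^sup>2) = (norm (y 0))\<^sup>2 - (norm (y N))\<^sup>2" for N
    by (induction N) (simp_all add: nc)
  then have "summable (\<lambda>j. (norm (c (Suc j)))\<^sup>2)"
    by (intro summableI_nonneg_bounded[where x = "(norm (y 0))\<^sup>2"]) auto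
  then have "summable (\<lambda>k. (norm (c k))\<^sup>2)" using summable_Suc_iff[of "\<lambda>k. (norm (c k))\<^sup>2"] by simp
  from Fatou_radial_limit[OF this] show ?thesis
  proof eventually_elim
    case (elim \<theta>)
    show ?case
    proof
      assume "\<theta> \<in> {-pi..pi}"
      with elim obtain l where l: "((\<lambda>r. suminf (\<lambda>k. r ^ k *\<^sub>R (cis (real k * \<theta>) *\<^sub>C c k))) \<longlongrightarrow> l) (at_left 1)" by blast
      have eq: "slice \<theta> \<xi> e r
          = (norm e)\<^sup>2 - (norm (suminf (\<lambda>k. r ^ k *\<^sub>R (cis (real k * \<theta>) *\<^sub>C c k))))\<^sup>2" if r: "0 < r" "r < 1" for r
      proof -
        define z where "z = r *\<^sub>R (cis (- \<theta>) *\<^sub>C \<xi>)"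
        have z': "z = (of_real r * cis (- \<theta>)) *\<^sub>C \<xi>" by (simp add: z_def scaleR_scaleC scaleC_scaleC)
        have nz: "norm z = r" using r \<xi> by (simp add: z_def norm_scaleC)
        have cz: "cnj (of_real r * cis (- \<theta>)) = of_real r * cis \<theta>" by (simp add: cis_cnj)
        have Sz: "(S z ^^ k) (\<Delta> e) = (of_real r * cis \<theta>) ^ k *\<^sub>C y k" for k
          unfolding z' S_scale cz y_def ..
        have zz: "zcol z h = (of_real r * cis \<theta>) *\<^sub>C zcol \<xi> h" for h
          unfolding z' by (simp add: zcol_def vec_eq_iff scaleC_vec_def scaleC_complex_def scaleC_scaleC cis_cnj)
        have "(\<lambda>k. \<Delta>s (zcol z ((S z ^^ k) (\<Delta> e)))) sums \<Delta>s (zcol z (R z (\<Delta> e)))"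
          by (rule bounded_linear.sums[OF bounded_clinearD(1)[OF bounded_clinear_comp[OF defect_clinear(2) zcol_clinear]] R_props(7)])
             (use nz r in simp)
        moreover have "\<Delta>s (zcol z ((S z ^^ k) (\<Delta> e))) = r ^ Suc k *\<^sub>R (cis (real (Suc k) * \<theta>) *\<^sub>C c (Suc k))" for k
        proof -
          have "\<Delta>s (zcol z ((S z ^^ k) (\<Delta> e))) = (of_real r * cis \<theta>) ^ Suc k *\<^sub>C c (Suc k)"
            by (simp add: zz Sz c_def bounded_clinearD[OF zcol_clinear] defect_simps scaleC_scaleC)
          then show ?thesis
            unfolding power_mult_distrib Complex.DeMoivre by (simp add: scaleR_scaleC scaleC_scaleC)
        qed
        ultimately have "(\<lambda>k. r ^ Suc k *\<^sub>R (cis (real (Suc k) * \<theta>) *\<^sub>C c (Suc k))) sums \<Delta>s (zcol z (R z (\<Delta> e)))" by simp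
        then have "(\<lambda>k. r ^ k *\<^sub>R (cis (real k * \<theta>) *\<^sub>C c k)) sums (\<Delta>s (zcol z (R z (\<Delta> e))) + r ^ 0 *\<^sub>R (cis (real 0 * \<theta>) *\<^sub>C c 0))"
          by (subst (asm) sums_Suc_iff) simp
        then have "suminf (\<lambda>k. r ^ k *\<^sub>R (cis (real k * \<theta>) *\<^sub>C c k)) = \<Theta>ad z e"
          by (simp add: sums_iff \<Theta>ad_def c_def)
        then show ?thesis using norm_char_symbol_adj[of z e] nz r unfolding z_def[symmetric] by simp
      qed
      have "((\<lambda>r. (norm e)\<^sup>2 - (norm (suminf (\<lambda>k. r ^ k *\<^sub>R (cis (real k * \<theta>) *\<^sub>C c k))))\<^sup>2) \<longlongrightarrow> (norm e)\<^sup>2 - (norm l)\<^sup>2) (at_left 1)"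
        by (intro tendsto_intros l)
      moreover have "\<forall>\<^sub>F r in at_left 1. r \<in> {0<..<1::real}" by (rule eventually_at_left_real) simp
      then have "\<forall>\<^sub>F r in at_left 1. slice \<theta> \<xi> e r
          = (norm e)\<^sup>2 - (norm (suminf (\<lambda>k. r ^ k *\<^sub>R (cis (real k * \<theta>) *\<^sub>C c k))))\<^sup>2"
        by eventually_elim (use eq in auto)
      ultimately have "((\<lambda>r. slice \<theta> \<xi> e r) \<longlongrightarrow> (norm e)\<^sup>2 - (norm l)\<^sup>2) (at_left 1)"
        by (simp only: tendsto_cong)
      then show "\<exists>l. ((\<lambda>r. slice \<theta> \<xi> e r) \<longlongrightarrow> l) (at_left 1)" by blast
    qed
  qed
qed

end

section \<open>Defect operators of finite rank\<close>

locale finite_rank_row_contraction = row_contraction T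
  for T :: "'n::finite \<Rightarrow> 'h::chilbert_space \<Rightarrow> 'h" +
  fixes E :: "'h set"
  assumes E: "finite E" "orthonormal E" "cspan E = range (defect T)"
begin

lemma D_span: "D = cspan E" "D = range \<Delta>"
  unfolding defect_space_def E(3)[symmetric] using closure_closed[OF closed_span_orthonormal[OF E(2,1)]] by auto

lemma E_D: "e \<in> E \<Longrightarrow> e \<in> D"
  unfolding D_span by (rule complex_vector.span_base)

lemma E_norm: "e \<in> E \<Longrightarrow> norm e = 1"
  using E(2) unfolding orthonormal_def by (metis cinner_same norm_ge_zero of_real_1 of_real_eq_iff power2_eq_1_iff zero_le_square not_one_le_zero neg_0_le_iff_le)

lemma D_expand: "h \<in> D \<Longrightarrow> h = (\<Sum>e\<in>E. cinner h e *\<^sub>C e)"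
  unfolding D_span by (rule orthonormal_span[OF E(2,1)])

lemma trace_D:
  assumes "bounded_clinear A" "\<And>h. h \<in> D \<Longrightarrow> B h = A h"
  shows "trace_on D B = (\<Sum>e\<in>E. cinner (A e) e)"
proof (rule trace_on_finite_rank[OF spaces(1,2) E_D])
  fix f assume f: "f \<in> D"
  have "A f = A (\<Sum>e\<in>E. cinner f e *\<^sub>C e)" using D_expand[OF f] by simp
  then show "B f = (\<Sum>e\<in>E. cinner f e *\<^sub>C A e)"
    using assms(2)[OF f] by (simp add: bounded_clinear_sum[OF assms(1)] bounded_clinearD[OF assms(1)])
qed

text \<open>The common value of two traces at radius \<open>r\<close>: the one in the definition of
  the curvature and the one formed with the characteristic function.\<close>

definition density :: "real \<Rightarrow> complex ^ 'n \<Rightarrow> real" where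
  "density r \<xi> = (\<Sum>e\<in>E. (1 - r\<^sup>2) * (norm (R (r *\<^sub>R \<xi>) (\<Delta> e)))\<^sup>2)"

lemma trace_resolvent:
  assumes "norm z < 1"
  shows "(\<Sum>e\<in>E. cinner (\<Delta> (Rad z (R z (\<Delta> e)))) e) = of_real (\<Sum>e\<in>E. (norm (R z (\<Delta> e)))\<^sup>2)"
  unfolding of_real_sum
proof (rule sum.cong[OF refl])
  fix e
  have "cinner (\<Delta> (Rad z (R z (\<Delta> e)))) e = cnj (cinner (R z (\<Delta> e)) (R z (\<Delta> e)))"
    using R_adjoint[OF assms] defect_selfadjoint(1) by (metis cinner_commute)
  then show "cinner (\<Delta> (Rad z (R z (\<Delta> e)))) e = of_real ((norm (R z (\<Delta> e)))\<^sup>2)" by (simp add: cinner_same)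
qed

lemma resolvent_clinear: "norm z < 1 \<Longrightarrow> bounded_clinear (\<lambda>h. \<Delta> (Rad z (R z (\<Delta> h))))"
  by (intro bounded_clinear_comp[OF defect_clinear(1)] bounded_clinear_comp[OF R_props(6)] bounded_clinear_comp[OF R_props(5)] defect_clinear)

lemma trace_char_symbol:
  assumes r: "0 < r" "r < 1" and \<xi>: "\<xi> \<in> sphere 0 1"
  shows "trace_on D (\<lambda>h. h - \<Theta> (r *\<^sub>R \<xi>) (char_symbol_adj T (r *\<^sub>R \<xi>) h)) = of_real (density r \<xi>)"
proof -
  have z: "norm (r *\<^sub>R \<xi>) < 1" "norm (r *\<^sub>R \<xi>) = r" using sphere_radial[OF less_imp_le[OF r(1)] r(2) \<xi>] by auto
  have "trace_on D (\<lambda>h. h - \<Theta> (r *\<^sub>R \<xi>) (char_symbol_adj T (r *\<^sub>R \<xi>) h))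
    = (\<Sum>e\<in>E. cinner ((1 - cinner (r *\<^sub>R \<xi>) (r *\<^sub>R \<xi>)) *\<^sub>C \<Delta> (Rad (r *\<^sub>R \<xi>) (R (r *\<^sub>R \<xi>) (\<Delta> e)))) e)"
    by (rule trace_D[OF bounded_clinear_scaleC[OF resolvent_clinear[OF z(1)]]])
       (simp add: char_symbol_adj_eq[OF z(1)] char_symbol_kernel_identity[OF z(1) z(1)])
  also have "\<dots> = (1 - cinner (r *\<^sub>R \<xi>) (r *\<^sub>R \<xi>)) * of_real (\<Sum>e\<in>E. (norm (R (r *\<^sub>R \<xi>) (\<Delta> e)))\<^sup>2)"
    unfolding cinner_scaleC_left sum_distrib_left[symmetric] trace_resolvent[OF z(1)] ..
  also have "cinner (r *\<^sub>R \<xi>) (r *\<^sub>R \<xi>) = of_real (r\<^sup>2)" unfolding cinner_same z(2) ..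
  finally show ?thesis by (simp add: density_def sum_distrib_left)
qed

lemma trace_curvature:
  assumes r: "0 < r" "r < 1" and \<xi>: "\<xi> \<in> sphere 0 1"
  shows "of_real (1 - r\<^sup>2) * trace_on D (\<lambda>h. \<Delta>
         (inv (\<lambda>x. x - (\<Sum>i\<in>UNIV. (of_real r * \<xi> $ i) *\<^sub>C cadjoint (T i) x))
           (inv (\<lambda>x. x - (\<Sum>i\<in>UNIV. (of_real r * cnj (\<xi> $ i)) *\<^sub>C T i x)) (\<Delta> h)))) = of_real (density r \<xi>)"
proof -
  have z: "norm (r *\<^sub>R \<xi>) < 1" using sphere_radial[OF less_imp_le[OF r(1)] r(2) \<xi>] by auto
  have c: "(r *\<^sub>R \<xi>) $ i = of_real r * \<xi> $ i" for i by (simp add: scaleR_conv_of_real[of r "\<xi> $ i"])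
  have "inv (\<lambda>x. x - (\<Sum>i\<in>UNIV. (of_real r * \<xi> $ i) *\<^sub>C cadjoint (T i) x)) = Rad (r *\<^sub>R \<xi>)"
    "inv (\<lambda>x. x - (\<Sum>i\<in>UNIV. (of_real r * cnj (\<xi> $ i)) *\<^sub>C T i x)) = R (r *\<^sub>R \<xi>)"
    by (simp_all add: Rad_def R_def S_sum c del: vector_scaleR_component)
  then show ?thesis
    using trace_D[OF resolvent_clinear[OF z], of "\<lambda>h. \<Delta> (Rad (r *\<^sub>R \<xi>) (R (r *\<^sub>R \<xi>) (\<Delta> h)))"] trace_resolvent[OF z]
    by (simp add: density_def sum_distrib_left)
qed

text \<open>Each basis vector contributes at most 1 by \<open>norm_char_symbol_adj\<close>; the
  total is the dominating constant for the limit under the integral.\<close>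

lemma density_bounds: "0 \<le> r \<Longrightarrow> r < 1 \<Longrightarrow> \<xi> \<in> sphere 0 1 \<Longrightarrow> 0 \<le> density r \<xi> \<and> density r \<xi> \<le> real (card E)"
proof
  assume r: "0 \<le> r" "r < 1" and \<xi>: "\<xi> \<in> sphere 0 1"
  have z: "norm (r *\<^sub>R \<xi>) < 1" "norm (r *\<^sub>R \<xi>) = r" using sphere_radial[OF r \<xi>] by auto
  have "r\<^sup>2 \<le> 1" using r by (simp add: abs_square_le_1)
  then show "0 \<le> density r \<xi>" by (simp add: density_def sum_nonneg)
  have "(1 - r\<^sup>2) * (norm (R (r *\<^sub>R \<xi>) (\<Delta> e)))\<^sup>2 \<le> 1" if "e \<in> E" for e
    using norm_char_symbol_adj[OF z(1), of e] unfolding z(2) by (simp add: E_norm[OF that])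
  then have "density r \<xi> \<le> (\<Sum>e\<in>E. 1)" unfolding density_def by (rule sum_mono)
  then show "density r \<xi> \<le> real (card E)" by simp
qed

lemma density_continuous: "0 \<le> r \<Longrightarrow> r < 1 \<Longrightarrow> continuous_on (sphere 0 1) (density r)"
  unfolding density_def[abs_def] by (intro continuous_intros R_radial_continuous)

lemma density_limit: "AE \<xi> in sphere_measure. \<exists>l. ((\<lambda>r. complex_of_real (density r \<xi>)) \<longlongrightarrow> l) (at_left 1)"
  and density_Lim_measurable: "(\<lambda>\<xi>. Lim (at_left 1) (\<lambda>r. complex_of_real (density r \<xi>))) \<in> borel_measurable sphere_measure"
proof -
  have c: "continuous_on (sphere 0 1) (\<lambda>\<xi>. complex_of_real (density r \<xi>))" if "0 < r" "r < 1" for r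
    by (intro continuous_intros density_continuous) (use that in auto)
  note M = radial_limit_measurable[OF c]
  show "(\<lambda>\<xi>. Lim (at_left 1) (\<lambda>r. complex_of_real (density r \<xi>))) \<in> borel_measurable sphere_measure" by (rule M(2))
  show "AE \<xi> in sphere_measure. \<exists>l. ((\<lambda>r. complex_of_real (density r \<xi>)) \<longlongrightarrow> l) (at_left 1)"
  proof (rule sphere_AE_slices)
    show "{\<xi> \<in> sphere 0 1. \<exists>l. ((\<lambda>r. complex_of_real (density r \<xi>)) \<longlongrightarrow> l) (at_left 1)} \<in> sets sphere_measure"
      by (rule M(1))
    fix \<xi> :: "complex ^ 'n" assume \<xi>: "\<xi> \<in> sphere 0 1"
    have "AE \<theta> in lborel. \<forall>e\<in>E. \<theta> \<in> {-pi..pi} \<longrightarrow>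
      (\<exists>l. ((\<lambda>r. slice \<theta> \<xi> e r) \<longlongrightarrow> l) (at_left 1))"
      by (rule AE_finite_allI[OF E(1) char_symbol_slice_limit[OF \<xi>]])
    then show "AE \<theta> in lborel. \<theta> \<in> {-pi..pi} \<longrightarrow> (\<exists>l. ((\<lambda>r. complex_of_real (density r (cis (- \<theta>) *\<^sub>C \<xi>))) \<longlongrightarrow> l) (at_left 1))"
    proof eventually_elim
      case (elim \<theta>)
      show ?case
      proof
        assume "\<theta> \<in> {-pi..pi}"
        then have "\<forall>e\<in>E. \<exists>l. ((\<lambda>r. slice \<theta> \<xi> e r) \<longlongrightarrow> l) (at_left 1)" using elim by blast
        then obtain l where l: "\<And>e. e \<in> E \<Longrightarrow> ((\<lambda>r. slice \<theta> \<xi> e r) \<longlongrightarrow> l e) (at_left 1)"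
          using bchoice by meson
        have "((\<lambda>r. complex_of_real (density r (cis (- \<theta>) *\<^sub>C \<xi>))) \<longlongrightarrow> of_real (\<Sum>e\<in>E. l e)) (at_left 1)"
          unfolding density_def by (intro tendsto_of_real tendsto_sum l)
        then show "\<exists>l. ((\<lambda>r. complex_of_real (density r (cis (- \<theta>) *\<^sub>C \<xi>))) \<longlongrightarrow> l) (at_left 1)" by blast
      qed
    qed
  qed
qed

definition mean_total :: "nat \<Rightarrow> real" where "mean_total m = (\<Sum>e\<in>E. homog_mean m (\<Delta> e))"

lemma mean_total_props: "decseq mean_total" "0 \<le> mean_total m"
proof -
  show "decseq mean_total" unfolding decseq_def mean_total_def by (intro allI impI sum_mono decseqD[OF homog_mean_decseq])
  show "0 \<le> mean_total m" by (simp add: mean_total_def sum_nonneg homog_mean_nonneg)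
qed

text \<open>At fixed radius the integral is \<open>1 - r\<^sup>2\<close> times the power series of
  the means in \<open>r\<^sup>2\<close>, an Abel mean of a decreasing sequence. Dominated
  convergence along a sequence of radii identifies its limit with the integral of the limit.\<close>

lemma density_integral:
  assumes \<beta>: "mean_total \<longlonglongrightarrow> \<beta>"
  shows "(LINT \<xi>|sphere_measure. Lim (at_left 1) (\<lambda>r. complex_of_real (density r \<xi>))) = of_real \<beta>"
proof -
  obtain \<rho> :: "nat \<Rightarrow> real" where \<rho>: "\<And>j. 0 < \<rho> j" "\<And>j. \<rho> j < 1"
    and \<rho>1: "\<rho> \<longlonglongrightarrow> 1" and \<rho>l: "filterlim \<rho> (at_left 1) sequentially"
    using radial_sequence by blast
  have "(\<lambda>j. LINT \<xi>|sphere_measure. complex_of_real (density (\<rho> j) \<xi>))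
      \<longlonglongrightarrow> (LINT \<xi>|sphere_measure. Lim (at_left 1) (\<lambda>r. complex_of_real (density r \<xi>)))"
  proof (rule integral_dominated_convergence[where w = "\<lambda>_. real (card E)"])
    show "(\<lambda>\<xi>. complex_of_real (density (\<rho> j) \<xi>)) \<in> borel_measurable sphere_measure" for j
      by (intro sphere_measurable continuous_intros density_continuous) (use \<rho>[of j] in auto)
    show "integrable sphere_measure (\<lambda>_ :: complex ^ 'n. real (card E))" by (intro sphere_integrable continuous_intros)
    show "AE \<xi> in sphere_measure. norm (complex_of_real (density (\<rho> j) \<xi>)) \<le> real (card E)" for j
      using density_bounds[of "\<rho> j"] \<rho>[of j] by (intro AE_I2) (simp add: space_sphere_prob)
    show "AE \<xi> in sphere_measure. (\<lambda>j. complex_of_real (density (\<rho> j) \<xi>)) \<longlonglongrightarrow> Lim (at_left 1) (\<lambda>r. complex_of_real (density r \<xi>))"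
      using density_limit
    proof eventually_elim
      case (elim \<xi>)
      then obtain l where l: "((\<lambda>r. complex_of_real (density r \<xi>)) \<longlongrightarrow> l) (at_left 1)" by blast
      have "Lim (at_left 1) (\<lambda>r. complex_of_real (density r \<xi>)) = l" by (rule tendsto_Lim[OF _ l]) simp
      then show ?case using filterlim_compose[OF l \<rho>l] by simp
    qed
  qed (rule density_Lim_measurable)
  moreover have "(\<lambda>j. LINT \<xi>|sphere_measure. complex_of_real (density (\<rho> j) \<xi>)) \<longlonglongrightarrow> of_real \<beta>"
  proof -
    define y where "y j = (\<Sum>e\<in>E. LINT \<xi>|sphere_measure. (norm (R (\<rho> j *\<^sub>R \<xi>) (\<Delta> e)))\<^sup>2)" for j
    have s: "(\<lambda>m. ((\<rho> j)\<^sup>2) ^ m * mean_total m) sums y j" for j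
      unfolding y_def mean_total_def sum_distrib_left by (intro sums_sum R_integral) (use \<rho>[of j] in auto)
    have "(\<lambda>j. (1 - (\<rho> j)\<^sup>2) * y j) \<longlonglongrightarrow> \<beta>"
    proof (rule abel_mean_limit[OF mean_total_props \<beta> _ _ _ s])
      show "(\<lambda>j. (\<rho> j)\<^sup>2) \<longlonglongrightarrow> 1" using tendsto_power[OF \<rho>1, of 2] by simp
      show "(\<rho> j)\<^sup>2 < 1" for j using \<rho>[of j] by (simp add: abs_square_less_1)
    qed simp
    moreover have "(LINT \<xi>|sphere_measure. complex_of_real (density (\<rho> j) \<xi>)) = of_real ((1 - (\<rho> j)\<^sup>2) * y j)" for j
    proof -
      have "integrable sphere_measure (\<lambda>\<xi>. (1 - (\<rho> j)\<^sup>2) * (norm (R (\<rho> j *\<^sub>R \<xi>) (\<Delta> e)))\<^sup>2)" for e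
        by (intro sphere_integrable continuous_intros R_radial_continuous) (use \<rho>[of j] in auto)
      then show ?thesis
        unfolding integral_complex_of_real density_def y_def by (simp add: Bochner_Integration.integral_sum sum_distrib_left)
    qed
    ultimately show ?thesis by (simp only: tendsto_of_real)
  qed
  ultimately show ?thesis by (rule LIMSEQ_unique)
qed

lemma radial_eventually: "(\<And>r. 0 < r \<Longrightarrow> r < 1 \<Longrightarrow> P r) \<Longrightarrow> \<forall>\<^sub>F r::real in at_left 1. P r"
  using eventually_at_left_real[of 0 1] by (auto elim: eventually_mono)

lemma curvature_density: "curvature T = (LINT \<xi>|sphere_measure. Lim (at_left 1) (\<lambda>r. complex_of_real (density r \<xi>)))"
  unfolding curvature_def
  by (intro Bochner_Integration.integral_cong refl Lim_cong radial_eventually trace_curvature) (auto simp: space_sphere_prob)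

lemma char_symbol_density:
  "(LINT \<xi>|sphere_measure. Lim (at_left 1) (\<lambda>r::real. trace_on D (\<lambda>h. h - \<Theta> (r *\<^sub>R \<xi>) (char_symbol_adj T (r *\<^sub>R \<xi>) h))))
    = (LINT \<xi>|sphere_measure. Lim (at_left 1) (\<lambda>r. complex_of_real (density r \<xi>)))"
  by (intro Bochner_Integration.integral_cong refl Lim_cong radial_eventually trace_char_symbol) (auto simp: space_sphere_prob)

lemma char_symbol_limit:
  "AE \<xi> in sphere_measure. \<exists>l. ((\<lambda>r::real. trace_on D (\<lambda>h. h - \<Theta> (r *\<^sub>R \<xi>) (char_symbol_adj T (r *\<^sub>R \<xi>) h))) \<longlongrightarrow> l) (at_left 1)"
  using density_limit AE_space[of sphere_measure]
proof eventually_elim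
  case (elim \<xi>)
  have "\<forall>\<^sub>F r in at_left 1. trace_on D (\<lambda>h. h - \<Theta> (r *\<^sub>R \<xi>) (char_symbol_adj T (r *\<^sub>R \<xi>) h)) = of_real (density r \<xi>)"
    by (intro radial_eventually trace_char_symbol) (use elim in \<open>auto simp: space_sphere_prob\<close>)
  then show ?case using elim(1) by (simp add: tendsto_cong)
qed

end

lemma (in vector_space_pair) dim_image_inj:
  assumes f: "Vector_Spaces.linear s1 s2 f" and U: "vs1.subspace U" and inj: "inj_on f U"
  shows "vs2.dim (f ` U) = vs1.dim U"
proof -
  obtain B where B: "B \<subseteq> U" "vs1.independent B" "U \<subseteq> vs1.span B" "card B = vs1.dim U" by (rule vs1.basis_exists)
  have "inj_on f (vs1.span B)" using inj_on_subset[OF inj vs1.span_minimal[OF B(1) U]] .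
  then have "vs2.independent (f ` B)" "inj_on f B"
    using linear_independent_injective_image[OF f B(2)] inj_on_subset[OF inj B(1)] by blast+
  moreover have "f ` U \<subseteq> vs2.span (f ` B)" unfolding linear_span_image[OF f] using B(3) by blast
  ultimately show ?thesis using vs2.basis_card_eq_dim[OF image_mono[OF B(1)]] B(4) card_image[of f B] by simp
qed

section \<open>Traces and ranks on polynomials\<close>

definition arv_mono :: "'n::finite multi_index \<Rightarrow> 'e::complex_inner \<Rightarrow> ('n, 'e) arveson" where
  "arv_mono \<alpha> x = Abs_arv (\<lambda>\<beta>. if \<beta> = \<alpha> then x else 0)"

lemma coeff_arv_mono: "coeff_arv (arv_mono \<alpha> x) \<beta> = (if \<beta> = \<alpha> then x else 0)"
proof -
  have "(\<lambda>\<beta>. mweight \<beta> * (norm (if \<beta> = \<alpha> then x else 0))\<^sup>2) summable_on UNIV"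
    by (rule finite_nonzero_values_imp_summable_on) (rule finite_subset[of _ "{\<alpha>}"], auto)
  then show ?thesis unfolding arv_mono_def by (subst Abs_arv_inverse) auto
qed

lemma arv_eqI: "(\<And>\<alpha>. coeff_arv f \<alpha> = coeff_arv g \<alpha>) \<Longrightarrow> f = g"
  by (simp add: coeff_arv_inject[symmetric] fun_eq_iff)

lemma arv_mono_sum_scaleC: "arv_mono \<alpha> (\<Sum>i\<in>I. c i *\<^sub>C x i) = (\<Sum>i\<in>I. c i *\<^sub>C arv_mono \<alpha> (x i))"
  by (rule arv_eqI)
     (simp add: bounded_clinear_sum[OF coeff_arv_clinear] bounded_clinearD[OF coeff_arv_clinear] coeff_arv_mono)

lemma cinner_arv_mono:
  fixes f :: "('n::finite, 'e::complex_inner) arveson"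
  shows "cinner f (arv_mono \<alpha> x) = of_real (mweight \<alpha>) * cinner (coeff_arv f \<alpha>) x"
proof -
  have "cinner f (arv_mono \<alpha> x) = (\<Sum>\<^sub>\<infinity>\<beta>\<in>{\<alpha>}. of_real (mweight \<beta>) * cinner (coeff_arv f \<beta>) (coeff_arv (arv_mono \<alpha> x) \<beta>))"
    unfolding cinner_arveson_def by (rule infsum_cong_neutral) (auto simp: coeff_arv_mono)
  then show ?thesis by (simp add: coeff_arv_mono)
qed

lemma arv_mono_in: "csubspace D \<Longrightarrow> x \<in> D \<Longrightarrow> arv_mono \<alpha> x \<in> arv_sub D"
  by (auto simp: arv_sub_def coeff_arv_mono complex_vector.subspace_0)

lemma coeff_arv_sum_mono:
  assumes "finite A"
  shows "coeff_arv (\<Sum>\<alpha>\<in>A. arv_mono \<alpha> (x \<alpha>)) \<beta> = (if \<beta> \<in> A then x \<beta> else 0)"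
  by (simp add: bounded_clinear_sum[OF coeff_arv_clinear] coeff_arv_mono assms)

lemma orth_proj_polynomials:
  fixes f :: "('n::finite, 'e::complex_inner) arveson"
  assumes D: "csubspace D" and A: "finite A" and f: "f \<in> arv_sub D"
  shows "orth_proj {f \<in> arv_sub D. \<forall>\<alpha>. \<alpha> \<notin> A \<longrightarrow> coeff_arv f \<alpha> = 0} f = (\<Sum>\<alpha>\<in>A. arv_mono \<alpha> (coeff_arv f \<alpha>))"
proof (rule orth_proj_eq)
  let ?V = "{f \<in> arv_sub D. \<forall>\<alpha>. \<alpha> \<notin> A \<longrightarrow> coeff_arv f \<alpha> = 0}" and ?p = "\<Sum>\<alpha>\<in>A. arv_mono \<alpha> (coeff_arv f \<alpha>)"
  show "csubspace ?V" using arv_sub_subspace[OF D] unfolding complex_vector.subspace_def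
    by (auto simp: zero_arveson.rep_eq plus_arveson.rep_eq scaleC_arveson.rep_eq)
  show "?p \<in> ?V" using f A by (auto simp: arv_sub_def coeff_arv_sum_mono complex_vector.subspace_0[OF D])
  show "cinner (f - ?p) v = 0" if "v \<in> ?V" for v
    unfolding cinner_arveson_def using that by (intro infsum_0) (auto simp: coeff_arv_diff coeff_arv_sum_mono[OF A])
qed

context row_contraction
begin

text \<open>Identifies the Taylor coefficients of the Poisson kernel by pairing, which puts the
  monomials in \<open>T\<close> on the side of \<open>y\<close>. The reciprocal weights add up by
  \<open>mweight_reciprocal_sum\<close>.\<close>

lemma state_adjoint:
  "mdeg \<beta> = m \<Longrightarrow> of_real (mweight \<beta>) * cinner (state h (\<lambda>_. 0) m \<beta>) y = cinner h (op_monomial T \<beta> y)"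
proof (induction m arbitrary: \<beta> y)
  case 0
  then have "\<beta> = 0" by (simp add: mdeg_eq_0)
  then show ?case by (simp add: mweight_def mdeg_def op_monomial_zero)
next
  case (Suc m)
  let ?e = "\<lambda>i::'n. single i (Suc 0)" and ?I = "{i. lookup \<beta> i \<noteq> 0}"
  have "cinner (state h (\<lambda>_. 0) (Suc m) \<beta>) y = (\<Sum>i\<in>?I. of_real (1 / mweight (\<beta> - ?e i)) * cinner h (op_monomial T \<beta> y))"
    unfolding state.simps cinner_sum_left
  proof (rule sum.cong[OF refl])
    fix i assume i: "i \<in> ?I"
    have b: "\<beta> - ?e i + ?e i = \<beta>" and d: "mdeg (\<beta> - ?e i) = m"
      using i Suc.prems multi_index_minus_single[of \<beta> i] by simp_all
    have "cinner ((rowad (state h (\<lambda>_. 0) m (\<beta> - ?e i)) + \<Delta>s 0) $ i) y = cinner (state h (\<lambda>_. 0) m (\<beta> - ?e i)) (T i y)"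
      by (simp add: rowad_nth defect_simps cadjoint(2)[OF T_clinear])
    moreover have "of_real (mweight (\<beta> - ?e i)) * cinner (state h (\<lambda>_. 0) m (\<beta> - ?e i)) (T i y) = cinner h (op_monomial T \<beta> y)"
      using Suc.IH[OF d, of "T i y"] op_monomial_Suc[of "\<beta> - ?e i" i y] unfolding b by simp
    ultimately show "cinner ((rowad (state h (\<lambda>_. 0) m (\<beta> - ?e i)) + \<Delta>s 0) $ i) y = of_real (1 / mweight (\<beta> - ?e i)) * cinner h (op_monomial T \<beta> y)"
      using mweight_pos[of "\<beta> - ?e i"] by (simp add: field_simps)
  qed
  also have "\<dots> = of_real (\<Sum>i\<in>?I. 1 / mweight (\<beta> - ?e i)) * cinner h (op_monomial T \<beta> y)"
    by (simp add: sum_distrib_right)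
  also have "(\<Sum>i\<in>?I. 1 / mweight (\<beta> - ?e i)) = 1 / mweight \<beta>" by (rule mweight_reciprocal_sum[OF Suc.prems])
  finally show ?case using mweight_pos[of \<beta>] by simp
qed

text \<open>Through this formula traces and ranks of \<open>K K^*\<close> become statements about
  the vectors \<open>op_monomial T \<alpha> (\<Delta> x)\<close>.\<close>

lemma Kad_mono: "cadjoint K (arv_mono \<alpha> x) = op_monomial T \<alpha> (\<Delta> x)"
proof (rule cadjointI[OF K_clinear])
  fix h
  have "coeff_arv (K h) \<alpha> = \<Delta> (state h (\<lambda>_. 0) (mdeg \<alpha>) \<alpha>)"
    by (simp add: K_def coeff_W outcoeff_def row_simps zero_arveson.rep_eq)
  then show "cinner (K h) (arv_mono \<alpha> x) = cinner h (op_monomial T \<alpha> (\<Delta> x))"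
    using state_adjoint[of \<alpha> "mdeg \<alpha>" h "\<Delta> x"] by (simp add: cinner_arv_mono defect_selfadjoint)
qed

end

context finite_rank_row_contraction
begin

text \<open>The monomials with basis vectors as coefficients are orthogonal with squared norm
  \<open>mweight \<alpha>\<close>, so the operator has an explicit expansion of finite rank. Its
  diagonal is evaluated through \<open>1 - K K^*\<close>.\<close>

lemma trace_homogeneous:
  "trace_on (arv_sub D) (\<lambda>f. M (Mad (Q_hom D m f)))
    = of_real (real (card {\<alpha> :: 'n multi_index. mdeg \<alpha> = m}) * (real (card E) - mean_total m))"
proof -
  let ?A = "{\<alpha> :: 'n multi_index. mdeg \<alpha> = m}"
  let ?u = "\<lambda>p. arv_mono (fst p) (snd p) :: ('n, 'h) arveson"
  note MM = bounded_clinear_comp[OF M_clinear Mad_clinear]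
  have Q: "Q_hom D m f = (\<Sum>\<alpha>\<in>?A. arv_mono \<alpha> (coeff_arv f \<alpha>))" if "f \<in> arv_sub D" for f :: "('n, 'h) arveson"
    using orth_proj_polynomials[OF spaces(2) finite_mdeg that, of m] by (simp add: Q_hom_def)
  have "trace_on (arv_sub D) (\<lambda>f. M (Mad (Q_hom D m f)))
      = (\<Sum>p\<in>?A \<times> E. cinner (of_real (1 / mweight (fst p)) *\<^sub>C M (Mad (?u p))) (?u p))"
  proof (rule trace_on_finite_rank[OF arv_sub_closed[OF spaces(1)] arv_sub_subspace[OF spaces(2)]])
    show "?u p \<in> arv_sub D" if "p \<in> ?A \<times> E" for p using that by (auto intro!: arv_mono_in spaces E_D)
    fix f :: "('n, 'h) arveson" assume f: "f \<in> arv_sub D"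
    have "M (Mad (Q_hom D m f)) = (\<Sum>\<alpha>\<in>?A. M (Mad (arv_mono \<alpha> (\<Sum>e\<in>E. cinner (coeff_arv f \<alpha>) e *\<^sub>C e))))"
      unfolding Q[OF f] bounded_clinear_sum[OF MM]
      by (intro sum.cong refl arg_cong[where f = "\<lambda>x. M (Mad (arv_mono _ x))"] D_expand) (use f in \<open>simp add: arv_sub_def\<close>)
    also have "\<dots> = (\<Sum>\<alpha>\<in>?A. \<Sum>e\<in>E. cinner (coeff_arv f \<alpha>) e *\<^sub>C M (Mad (arv_mono \<alpha> e)))"
      by (simp add: arv_mono_sum_scaleC bounded_clinear_sum[OF MM] bounded_clinearD(2)[OF MM])
    also have "\<dots> = (\<Sum>p\<in>?A \<times> E. cinner f (?u p) *\<^sub>C of_real (1 / mweight (fst p)) *\<^sub>C M (Mad (?u p)))"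
      unfolding sum.cartesian_product
      by (intro sum.cong refl) (auto simp: cinner_arv_mono scaleC_scaleC less_imp_neq[OF mweight_pos, THEN not_sym])
    finally show "M (Mad (Q_hom D m f)) = (\<Sum>p\<in>?A \<times> E. cinner f (?u p) *\<^sub>C of_real (1 / mweight (fst p)) *\<^sub>C M (Mad (?u p)))" .
  qed
  also have "\<dots> = (\<Sum>(\<alpha>, e)\<in>?A \<times> E. of_real (1 - (norm (op_monomial T \<alpha> (\<Delta> e)))\<^sup>2 / mweight \<alpha>))"
  proof (intro sum.cong refl)
    fix p assume "p \<in> ?A \<times> E"
    then obtain \<alpha> e where p: "p = (\<alpha>, e)" "e \<in> E" by auto
    let ?m = "arv_mono \<alpha> e :: ('n, 'h) arveson"
    have "cinner (M (Mad ?m)) ?m = cinner ?m ?m - cinner (K (cadjoint K ?m)) ?m"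
      unfolding char_op_complement[OF arv_mono_in[OF spaces(2) E_D[OF p(2)]]] cinner_diff(1) ..
    also have "cinner ?m ?m = of_real (mweight \<alpha>)"
      unfolding cinner_arv_mono by (simp add: coeff_arv_mono cinner_same E_norm[OF p(2)])
    also have "cinner (K (cadjoint K ?m)) ?m = of_real ((norm (op_monomial T \<alpha> (\<Delta> e)))\<^sup>2)"
      by (simp add: cadjoint(1)[OF K_clinear] Kad_mono cinner_same)
    finally show "cinner (of_real (1 / mweight (fst p)) *\<^sub>C M (Mad (?u p))) (?u p)
        = (case p of (\<alpha>, e) \<Rightarrow> of_real (1 - (norm (op_monomial T \<alpha> (\<Delta> e)))\<^sup>2 / mweight \<alpha>))"
      using mweight_pos[of \<alpha>] by (simp add: p cinner_scaleC_left diff_divide_distrib)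
  qed
  also have "\<dots> = (\<Sum>e\<in>E. \<Sum>\<alpha>\<in>?A. of_real (1 - (norm (op_monomial T \<alpha> (\<Delta> e)))\<^sup>2 / mweight \<alpha>))"
    unfolding sum.cartesian_product[symmetric] by (rule sum.swap)
  also have "\<dots> = of_real (\<Sum>e\<in>E. real (card ?A) * (1 - homog_mean m (\<Delta> e)))"
  proof -
    have "m \<le> m + CARD('n) - 1" using zero_less_card_finite[where 'a = 'n] by linarith
    then have "card ?A \<noteq> 0" by (simp add: card_mdeg)
    then have "(\<Sum>\<alpha>\<in>?A. (norm (op_monomial T \<alpha> (\<Delta> e)))\<^sup>2 / mweight \<alpha>) = real (card ?A) * homog_mean m (\<Delta> e)" for e
      by (simp add: homog_mean_def)
    then have "(\<Sum>\<alpha>\<in>?A. 1 - (norm (op_monomial T \<alpha> (\<Delta> e)))\<^sup>2 / mweight \<alpha>) = real (card ?A) * (1 - homog_mean m (\<Delta> e))" for e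
      by (simp add: sum_subtractf right_diff_distrib)
    then show ?thesis by (simp only: of_real_sum[symmetric])
  qed
  also have "(\<Sum>e\<in>E. real (card ?A) * (1 - homog_mean m (\<Delta> e))) = real (card ?A) * (real (card E) - mean_total m)"
    by (simp add: sum_distrib_left[symmetric] sum_subtractf mean_total_def)
  finally show ?thesis .
qed

lemma Q_le_eq:
  fixes f :: "('n, 'h) arveson"
  assumes "f \<in> arv_sub D"
  shows "Q_le D m f = (\<Sum>\<alpha> | mdeg \<alpha> \<le> m. arv_mono \<alpha> (coeff_arv f \<alpha>))"
proof -
  have "(Q_le D m :: ('n, 'h) arveson \<Rightarrow> _) = orth_proj {f \<in> arv_sub D. \<forall>\<alpha>. \<alpha> \<notin> {\<alpha>. mdeg \<alpha> \<le> m} \<longrightarrow> coeff_arv f \<alpha> = 0}"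
    by (simp add: Q_le_def not_le)
  then show ?thesis by (simp only: orth_proj_polynomials[OF spaces(2) finite_mdeg_le assms])
qed

lemma Kad_polynomials:
  "(\<lambda>f. cadjoint K (Q_le D m f)) ` arv_sub D = filt (range \<Delta>) m"
proof -
  let ?A = "{\<alpha> :: 'n multi_index. mdeg \<alpha> \<le> m}"
  note Kl = cadjoint(3)[OF K_clinear]
  have KQ: "cadjoint K (Q_le D m f) = (\<Sum>\<alpha>\<in>?A. op_monomial T \<alpha> (\<Delta> (coeff_arv f \<alpha>)))" if "f \<in> arv_sub D" for f
    unfolding Q_le_eq[OF that] bounded_clinear_sum[OF Kl] Kad_mono ..
  show ?thesis
  proof
    show "(\<lambda>f. cadjoint K (Q_le D m f)) ` arv_sub D \<subseteq> filt (range \<Delta>) m"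
    proof (rule image_subsetI)
      fix f :: "('n, 'h) arveson" assume f: "f \<in> arv_sub D"
      show "cadjoint K (Q_le D m f) \<in> filt (range \<Delta>) m"
        unfolding filt_def KQ[OF f] by (intro complex_vector.span_sum complex_vector.span_base) blast
    qed
    have "csubspace ((\<lambda>f. \<Sum>\<alpha>\<in>?A. op_monomial T \<alpha> (\<Delta> (coeff_arv f \<alpha>))) ` arv_sub D)"
      by (intro subspace_image bounded_clinear_sum_op bounded_clinear_comp[OF op_monomial_clinear]
          bounded_clinear_comp[OF defect_clinear(1)] coeff_arv_clinear arv_sub_subspace spaces)
    then have sub: "csubspace ((\<lambda>f. cadjoint K (Q_le D m f)) ` arv_sub D)" by (simp add: KQ)
    show "filt (range \<Delta>) m \<subseteq> (\<lambda>f. cadjoint K (Q_le D m f)) ` arv_sub D"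
      unfolding filt_def
    proof (rule complex_vector.span_minimal[OF _ sub], rule subsetI)
      fix x assume "x \<in> {op_monomial T \<alpha> v |\<alpha> v. v \<in> range \<Delta> \<and> mdeg \<alpha> \<le> m}"
      then obtain \<alpha> h where x: "x = op_monomial T \<alpha> (\<Delta> h)" "mdeg \<alpha> \<le> m" by blast
      \<comment> \<open>\<Delta> annihilates the part of \<open>h\<close> orthogonal to the defect
        space, so the coefficient can be chosen in \<open>D\<close>.\<close>
      obtain d where d: "d \<in> D" "\<And>v. v \<in> D \<Longrightarrow> cinner (h - d) v = 0" using projection_exists[OF spaces(1,2)] by blast
      have hd: "\<Delta> h = \<Delta> d" using defect_null[OF d(2)] by (simp add: defect_simps)
      have in_: "arv_mono \<alpha> d \<in> arv_sub D" by (rule arv_mono_in[OF spaces(2) d(1)])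
      have "(\<Sum>\<beta>\<in>?A. op_monomial T \<beta> (\<Delta> (coeff_arv (arv_mono \<alpha> d) \<beta>))) = (\<Sum>\<beta>\<in>?A. if \<beta> = \<alpha> then x else 0)"
        by (rule sum.cong) (auto simp: coeff_arv_mono x hd defect_simps op_monomial_linear)
      also have "\<dots> = x" using x(2) by (simp add: finite_mdeg_le)
      finally show "x \<in> (\<lambda>f. cadjoint K (Q_le D m f)) ` arv_sub D"
        by (intro image_eqI[OF _ in_]) (simp add: KQ[OF in_])
    qed
  qed
qed

lemma Q_le_in:
  fixes f :: "('n, 'h) arveson"
  assumes "f \<in> arv_sub D"
  shows "Q_le D m f \<in> arv_sub D"
  unfolding Q_le_eq[OF assms]
  by (intro complex_vector.subspace_sum arv_sub_subspace spaces arv_mono_in) (use assms in \<open>simp add: arv_sub_def\<close>)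

text \<open>By the complement formula the image is \<open>K\<close> applied to
  \<open>filt (range \<Delta>) m\<close>, which consists of vectors \<open>y = K^* q\<close>. If
  \<open>K y = 0\<close>, then \<open>cinner y y = cinner (K y) q = 0\<close>, so \<open>K\<close>
  preserves the dimension.\<close>

lemma rank_polynomials:
  "rank_on (arv_sub D) (\<lambda>f. Q_le D m f - M (Mad (Q_le D m f))) = cdim (filt (range \<Delta>) m)"
proof -
  have "(\<lambda>f. Q_le D m f - M (Mad (Q_le D m f))) ` arv_sub D = (\<lambda>f. K (cadjoint K (Q_le D m f))) ` arv_sub D"
    by (intro image_cong refl) (simp add: char_op_complement Q_le_in)
  also have "\<dots> = K ` filt (range \<Delta>) m" unfolding Kad_polynomials[symmetric] image_image ..
  finally have *: "rank_on (arv_sub D) (\<lambda>f. Q_le D m f - M (Mad (Q_le D m f))) = cdim (K ` filt (range \<Delta>) m)"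
    by (simp add: rank_on_def)
  interpret VS: vector_space_pair "scaleC :: complex \<Rightarrow> 'h \<Rightarrow> 'h" "scaleC :: complex \<Rightarrow> ('n, 'h) arveson \<Rightarrow> ('n, 'h) arveson" ..
  have lin: "Vector_Spaces.linear scaleC scaleC K" by unfold_locales (simp_all add: bounded_clinearD[OF K_clinear])
  have null: "y = 0" if y: "y \<in> filt (range \<Delta>) m" "K y = 0" for y
  proof -
    obtain f where "y = cadjoint K (Q_le D m f)" using y(1) unfolding Kad_polynomials[symmetric] by blast
    then have "cinner y y = cinner (K y) (Q_le D m f)" by (simp add: cadjoint(1)[OF K_clinear])
    then show ?thesis using y(2) by (simp add: cinner_eq_0_iff)
  qed
  have "inj_on K (filt (range \<Delta>) m)"
  proof (rule inj_onI)
    fix x y assume xy: "x \<in> filt (range \<Delta>) m" "y \<in> filt (range \<Delta>) m" "K x = K y"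
    have "x - y = 0"
      by (rule null[OF complex_vector.subspace_diff[OF filt_subspace xy(1,2)]]) (simp add: bounded_clinearD[OF K_clinear] xy(3))
    then show "x = y" by simp
  qed
  then show ?thesis unfolding * by (rule VS.dim_image_inj[OF lin filt_subspace])
qed

lemma rank_defect: "rank_on UNIV \<Delta> = card E"
  unfolding rank_on_def E(3)[symmetric]
  by (rule complex_vector.dim_span_eq_card_independent[OF orthonormal_independent[OF E(2,1)]])

text \<open>There are asymptotically \<open>m^(n-1) / (n-1)!\<close> monomials of degree
  \<open>m\<close> in \<open>n\<close> variables, whence the factorial.\<close>

lemma trace_limit:
  assumes \<beta>: "mean_total \<longlonglongrightarrow> \<beta>"
  shows "(\<lambda>m. trace_on (arv_sub D) (\<lambda>f. M (Mad (Q_hom D m f))) / of_nat m ^ (CARD('n) - 1))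
    \<longlonglongrightarrow> of_real ((real (card E) - \<beta>) / fact (CARD('n) - 1))"
proof -
  have "(\<lambda>m. (real (card {\<alpha> :: 'n multi_index. mdeg \<alpha> = m}) / real m ^ (CARD('n) - 1)) * (real (card E) - mean_total m))
      \<longlonglongrightarrow> (1 / fact (CARD('n) - 1)) * (real (card E) - \<beta>)"
    unfolding card_mdeg using binomial_asymp[of "CARD('n) - 1"]
    by (intro tendsto_mult tendsto_diff tendsto_const \<beta>) (simp add: Suc_leI)
  from tendsto_of_real[OF this, where ?'a = complex]
  show ?thesis unfolding trace_homogeneous by simp
qed

end

text \<open>The first conjunct guarantees that \<open>Lim\<close> in the integral is a genuine limit
  for almost every \<xi>. For the same reason the trace and rank formulas assert convergence to some
  \<open>L\<close> before they use its value.\<close>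

theorem theorem4p7:
  fixes T :: "'n::finite \<Rightarrow> 'h::chilbert_space \<Rightarrow> 'h"
  assumes "commutative_row_contraction T"
    and "finite_dim (range (defect T))"
  shows
    "(AE \<xi> in sphere_prob. \<exists>l. ((\<lambda>r::real. trace_on (defect_space T)
         (\<lambda>h. h - char_symbol T (r *\<^sub>R \<xi>) (char_symbol_adj T (r *\<^sub>R \<xi>) h))) \<longlongrightarrow> l) (at_left 1)) \<and>
     curvature T = (LINT \<xi>|sphere_prob. Lim (at_left 1) (\<lambda>r::real. trace_on (defect_space T)
         (\<lambda>h. h - char_symbol T (r *\<^sub>R \<xi>) (char_symbol_adj T (r *\<^sub>R \<xi>) h)))) \<and>
     (\<exists>L. (\<lambda>m. trace_on (arv_sub (defect_space T))
              (\<lambda>f. char_op T (char_op_adj T (Q_hom (defect_space T) m f)))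
              / of_nat m ^ (CARD('n) - 1)) \<longlonglongrightarrow> L \<and>
          curvature T = of_nat (rank_on UNIV (defect T)) - fact (CARD('n) - 1) * L) \<and>
     (\<exists>L::real. (\<lambda>m. real (rank_on (arv_sub (defect_space T))
              (\<lambda>f. Q_le (defect_space T) m f
                   - char_op T (char_op_adj T (Q_le (defect_space T) m f))))
              / real m ^ CARD('n)) \<longlonglongrightarrow> L \<and>
          of_int (euler_characteristic T) = fact (CARD('n)) * L)"
proof -
  interpret row_contraction T by unfold_locales (rule assms(1))
  have sub: "csubspace (range \<Delta>)"
    by (rule subspace_image[OF defect_clinear(1)]) simp
  obtain V where V: "finite V" "range \<Delta> \<subseteq> cspan V"
    using assms(2) unfolding finite_dim_def by blast
  obtain E where E: "finite E" "orthonormal E" "cspan E = range \<Delta>"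
    using finite_dim_orthonormal[OF sub V] by blast
  interpret finite_rank_row_contraction T E by unfold_locales (fact E)+
  obtain \<beta> where \<beta>: "mean_total \<longlonglongrightarrow> \<beta>"
    using decseq_convergent[OF mean_total_props(1), of 0] mean_total_props(2) by blast
  have cur: "curvature T = of_real \<beta>" unfolding curvature_density by (rule density_integral[OF \<beta>])
  have "curvature T = of_nat (rank_on UNIV \<Delta>) - fact (CARD('n) - 1) * of_real ((real (card E) - \<beta>) / fact (CARD('n) - 1))"
    by (simp add: cur rank_defect)
  moreover have "of_int (euler_characteristic T) = fact CARD('n) * (real_of_int (euler_characteristic T) / fact CARD('n))" by simp
  ultimately show ?thesis
    using char_symbol_limit curvature_density char_symbol_density trace_limit[OF \<beta>]
      euler_characteristic_growth[OF commuting_ops_axioms assms(2)]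
    unfolding rank_polynomials by (intro conjI exI) auto
qed

end
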